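(* Let $G$ be a non-discrete compact group such that for each positive integer $n$ the set $\{\pi\in\widehat G: d_\pi=n\}$ is finite. Then the central Fourier algebra $ZA(G)$ is not amenable as a Banach algebra.
   Context: For a compact group $G$, $\widehat G=\operatorname{Irr}(G)$ is the set of equivalence classes of irreducible unitary representations of $G$, and $d_\pi$ is the dimension of $\pi$. $A(G)$ is the Fourier algebra of $G$ (with pointwise multiplication), and $ZA(G)$ is its closed subalgebra generated by (equivalently, the closed linear span in $A(G)$ of) the characters $\chi_\pi=\operatorname{Tr}\pi(\cdot)$, $\pi\in\widehat G$. A Banach algebra $A$ is amenable if every bounded derivation from $A$ into a dual Banach $A$-bimodule is inner. *)

theory Defs
  imports
    "HOL-Analysis.Analysis"
    "HOL-Algebra.Module"
    "Jordan_Normal_Form.VS_Connect"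
    "Jordan_Normal_Form.Schur_Decomposition"
begin

section \<open>Banach bimodules and amenability\<close>

text \<open>
  A normed space is a HOL-Algebra module record over the complex numbers with a norm. The
  \<open>mult\<close> field is the product when the record is a Banach algebra; it is ignored otherwise. The
  \<open>one\<close> field is never used, so algebras need not be unital.
\<close>

record 'v normed = "(complex, 'v) module" +
  vnorm :: "'v \<Rightarrow> real"

definition banach_space :: "'v normed \<Rightarrow> bool" where
  "banach_space V \<longleftrightarrow>
     Module.module (class_ring :: complex ring) V \<and>
     (\<forall>x\<in>carrier V. 0 \<le> vnorm V x \<and> (vnorm V x = 0 \<longleftrightarrow> x = \<zero>\<^bsub>V\<^esub>)) \<and>
     (\<forall>c. \<forall>x\<in>carrier V. vnorm V (c \<odot>\<^bsub>V\<^esub> x) = cmod c * vnorm V x) \<and>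
     (\<forall>x\<in>carrier V. \<forall>y\<in>carrier V. vnorm V (x \<oplus>\<^bsub>V\<^esub> y) \<le> vnorm V x + vnorm V y) \<and>
     (\<forall>s :: nat \<Rightarrow> 'v. range s \<subseteq> carrier V \<and>
        (\<forall>e>0. \<exists>N. \<forall>m\<ge>N. \<forall>n\<ge>N. vnorm V (s m \<ominus>\<^bsub>V\<^esub> s n) < e) \<longrightarrow>
        (\<exists>x\<in>carrier V. (\<lambda>n. vnorm V (s n \<ominus>\<^bsub>V\<^esub> x)) \<longlonglongrightarrow> 0))"

definition banach_bimodule ::
  "'b normed \<Rightarrow> 'x normed \<Rightarrow> ('b \<Rightarrow> 'x \<Rightarrow> 'x) \<Rightarrow> ('x \<Rightarrow> 'b \<Rightarrow> 'x) \<Rightarrow> bool" where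
  "banach_bimodule A X l r \<longleftrightarrow>
     banach_space X \<and>
     (\<forall>a\<in>carrier A. \<forall>x\<in>carrier X. l a x \<in> carrier X \<and> r x a \<in> carrier X) \<and>
     (\<forall>a\<in>carrier A. \<forall>x\<in>carrier X. \<forall>y\<in>carrier X.
        l a (x \<oplus>\<^bsub>X\<^esub> y) = l a x \<oplus>\<^bsub>X\<^esub> l a y \<and> r (x \<oplus>\<^bsub>X\<^esub> y) a = r x a \<oplus>\<^bsub>X\<^esub> r y a) \<and>
     (\<forall>a\<in>carrier A. \<forall>b\<in>carrier A. \<forall>x\<in>carrier X.
        l (a \<oplus>\<^bsub>A\<^esub> b) x = l a x \<oplus>\<^bsub>X\<^esub> l b x \<and> r x (a \<oplus>\<^bsub>A\<^esub> b) = r x a \<oplus>\<^bsub>X\<^esub> r x b) \<and>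
     (\<forall>c. \<forall>a\<in>carrier A. \<forall>x\<in>carrier X.
        l (c \<odot>\<^bsub>A\<^esub> a) x = c \<odot>\<^bsub>X\<^esub> l a x \<and> l a (c \<odot>\<^bsub>X\<^esub> x) = c \<odot>\<^bsub>X\<^esub> l a x \<and>
        r x (c \<odot>\<^bsub>A\<^esub> a) = c \<odot>\<^bsub>X\<^esub> r x a \<and> r (c \<odot>\<^bsub>X\<^esub> x) a = c \<odot>\<^bsub>X\<^esub> r x a) \<and>
     (\<forall>a\<in>carrier A. \<forall>b\<in>carrier A. \<forall>x\<in>carrier X.
        l (a \<otimes>\<^bsub>A\<^esub> b) x = l a (l b x) \<and>
        r x (a \<otimes>\<^bsub>A\<^esub> b) = r (r x a) b \<and>
        l a (r x b) = r (l a x) b) \<and>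
     (\<exists>K. \<forall>a\<in>carrier A. \<forall>x\<in>carrier X.
        vnorm X (l a x) \<le> K * vnorm A a * vnorm X x \<and>
        vnorm X (r x a) \<le> K * vnorm A a * vnorm X x)"

text \<open>Functionals on \<open>X\<close> are normalised to vanish outside \<open>carrier X\<close>, so that equality of
  functionals is equality of functions.\<close>

definition dual_space :: "'x normed \<Rightarrow> ('x \<Rightarrow> complex) normed" where
  "dual_space X =
     \<lparr> carrier = {\<phi>. (\<forall>x\<in>carrier X. \<forall>y\<in>carrier X. \<phi> (x \<oplus>\<^bsub>X\<^esub> y) = \<phi> x + \<phi> y) \<and>
                    (\<forall>c. \<forall>x\<in>carrier X. \<phi> (c \<odot>\<^bsub>X\<^esub> x) = c * \<phi> x) \<and>
                    (\<exists>K. \<forall>x\<in>carrier X. cmod (\<phi> x) \<le> K * vnorm X x) \<and>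
                    (\<forall>x. x \<notin> carrier X \<longrightarrow> \<phi> x = 0)},
       mult = undefined, one = undefined,
       zero = (\<lambda>x. 0), add = (\<lambda>\<phi> \<psi> x. \<phi> x + \<psi> x), smult = (\<lambda>c \<phi> x. c * \<phi> x),
       vnorm = (\<lambda>\<phi>. Sup {cmod (\<phi> x) | x. x \<in> carrier X \<and> vnorm X x \<le> 1}) \<rparr>"

text \<open>The dual actions \<open>(a \<cdot> \<phi>)(x) = \<phi>(x \<cdot> a)\<close> and \<open>(\<phi> \<cdot> a)(x) = \<phi>(a \<cdot> x)\<close>.\<close>

definition dual_left ::
  "'x normed \<Rightarrow> ('x \<Rightarrow> 'b \<Rightarrow> 'x) \<Rightarrow> 'b \<Rightarrow> ('x \<Rightarrow> complex) \<Rightarrow> ('x \<Rightarrow> complex)" where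
  "dual_left X r a \<phi> = (\<lambda>x. if x \<in> carrier X then \<phi> (r x a) else 0)"

definition dual_right ::
  "'x normed \<Rightarrow> ('b \<Rightarrow> 'x \<Rightarrow> 'x) \<Rightarrow> ('x \<Rightarrow> complex) \<Rightarrow> 'b \<Rightarrow> ('x \<Rightarrow> complex)" where
  "dual_right X l \<phi> a = (\<lambda>x. if x \<in> carrier X then \<phi> (l a x) else 0)"

definition bounded_derivation ::
  "'b normed \<Rightarrow> 'y normed \<Rightarrow> ('b \<Rightarrow> 'y \<Rightarrow> 'y) \<Rightarrow> ('y \<Rightarrow> 'b \<Rightarrow> 'y) \<Rightarrow> ('b \<Rightarrow> 'y) \<Rightarrow> bool" where
  "bounded_derivation A Y l r D \<longleftrightarrow>
     (\<forall>a\<in>carrier A. D a \<in> carrier Y) \<and>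
     (\<forall>a\<in>carrier A. \<forall>b\<in>carrier A. D (a \<oplus>\<^bsub>A\<^esub> b) = D a \<oplus>\<^bsub>Y\<^esub> D b) \<and>
     (\<forall>c. \<forall>a\<in>carrier A. D (c \<odot>\<^bsub>A\<^esub> a) = c \<odot>\<^bsub>Y\<^esub> D a) \<and>
     (\<exists>K. \<forall>a\<in>carrier A. vnorm Y (D a) \<le> K * vnorm A a) \<and>
     (\<forall>a\<in>carrier A. \<forall>b\<in>carrier A. D (a \<otimes>\<^bsub>A\<^esub> b) = l a (D b) \<oplus>\<^bsub>Y\<^esub> r (D a) b)"

definition inner_derivation ::
  "'b normed \<Rightarrow> 'y normed \<Rightarrow> ('b \<Rightarrow> 'y \<Rightarrow> 'y) \<Rightarrow> ('y \<Rightarrow> 'b \<Rightarrow> 'y) \<Rightarrow> ('b \<Rightarrow> 'y) \<Rightarrow> bool" where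
  "inner_derivation A Y l r D \<longleftrightarrow>
     (\<exists>y\<in>carrier Y. \<forall>a\<in>carrier A. D a = l a y \<ominus>\<^bsub>Y\<^esub> r y a)"

text \<open>
  Amenability tested on the Banach bimodules whose underlying set lies in the type \<open>'x\<close>.
\<close>

definition amenable_wrt :: "'x itself \<Rightarrow> 'b normed \<Rightarrow> bool" where
  "amenable_wrt _ A \<longleftrightarrow>
     (\<forall>(X :: 'x normed) l r D.
        banach_bimodule A X l r \<and>
        bounded_derivation A (dual_space X) (dual_left X r) (dual_right X l) D \<longrightarrow>
        inner_derivation A (dual_space X) (dual_left X r) (dual_right X l) D)"

text \<open>
  HOL cannot quantify over types inside a definition, so the bimodules range over a type large
  enough to detect amenability: for unital \<open>A\<close> it suffices to test the derivation
  \<open>a \<mapsto> a \<otimes> 1 - 1 \<otimes> a\<close> into the bidual of the kernel \<open>K\<close> of the product map on the projective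
  tensor square of \<open>A\<close> (inner iff there is a virtual diagonal). The predual \<open>K\<^sup>*\<close> embeds in the
  functions \<open>'b \<Rightarrow> 'b \<Rightarrow> complex\<close>, by \<open>\<phi> \<mapsto> (\<lambda>a b. \<phi> (a \<otimes> b - ab \<otimes> 1))\<close>, extended by \<open>0\<close>.
  In any case, failure of \<open>amenable A\<close> exhibits a bounded non-inner derivation into a dual
  bimodule, so it implies non-amenability without restriction on the universe.
\<close>

definition amenable :: "'b normed \<Rightarrow> bool" where
  "amenable A \<longleftrightarrow> amenable_wrt TYPE('b \<Rightarrow> 'b \<Rightarrow> complex) A"


section \<open>The unitary dual of a compact group\<close>

text \<open>
  Groups are types of class \<open>topological_group_add\<close>, which is written additively but not assumed
  commutative: \<open>x + y\<close>, \<open>- x\<close> and \<open>0\<close> are the product, the inverse and the identity of the group.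
  Irreducible unitary representations of compact groups are finite-dimensional, so
  they are taken to be homomorphisms into the unitary group \<open>U(n)\<close>, \<open>n > 0\<close>.
\<close>

definition unitary_mats :: "nat \<Rightarrow> complex mat set" where
  "unitary_mats n =
     {U \<in> carrier_mat n n. mat_adjoint U * U = 1\<^sub>m n \<and> U * mat_adjoint U = 1\<^sub>m n}"

definition unitary_rep :: "nat \<Rightarrow> ('a::topological_group_add \<Rightarrow> complex mat) \<Rightarrow> bool" where
  "unitary_rep n \<pi> \<longleftrightarrow>
     (\<forall>g. \<pi> g \<in> unitary_mats n) \<and>
     (\<forall>g h. \<pi> (g + h) = \<pi> g * \<pi> h) \<and>
     (\<forall>i<n. \<forall>j<n. continuous_on UNIV (\<lambda>g. \<pi> g $$ (i, j)))"

definition irreducible_rep :: "nat \<Rightarrow> ('a::topological_group_add \<Rightarrow> complex mat) \<Rightarrow> bool" where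
  "irreducible_rep n \<pi> \<longleftrightarrow>
     n > 0 \<and> unitary_rep n \<pi> \<and>
     (\<forall>W. Module.submodule W (class_ring :: complex ring) (module_vec TYPE(complex) n) \<and>
          (\<forall>g. \<forall>w\<in>W. \<pi> g *\<^sub>v w \<in> W) \<longrightarrow>
          W = {0\<^sub>v n} \<or> W = carrier_vec n)"

definition irreps :: "('a::topological_group_add \<Rightarrow> complex mat) set" where
  "irreps = {\<pi>. \<exists>n. irreducible_rep n \<pi>}"

definition unitarily_equivalent :: "('a::topological_group_add \<Rightarrow> complex mat) rel" where
  "unitarily_equivalent =
     {(\<pi>, \<sigma>). \<exists>n. irreducible_rep n \<pi> \<and> irreducible_rep n \<sigma> \<and>
                (\<exists>U\<in>unitary_mats n. \<forall>g. U * \<pi> g = \<sigma> g * U)}"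

definition unitary_dual :: "('a::topological_group_add \<Rightarrow> complex mat) set set" where
  "unitary_dual = irreps // unitarily_equivalent"

text \<open>Degree, character and the norm of Fourier coefficients do not depend on the chosen
  representative of a class.\<close>

definition class_rep :: "('a \<Rightarrow> complex mat) set \<Rightarrow> 'a \<Rightarrow> complex mat" where
  "class_rep p = (SOME \<pi>. \<pi> \<in> p)"

definition class_dim :: "('a::zero \<Rightarrow> complex mat) set \<Rightarrow> nat" where
  "class_dim p = dim_row (class_rep p 0)"

definition class_char :: "('a::zero \<Rightarrow> complex mat) set \<Rightarrow> 'a \<Rightarrow> complex" where
  "class_char p g = (\<Sum>i<class_dim p. class_rep p g $$ (i, i))"


section \<open>The Fourier algebra and its central subalgebra\<close>

text \<open>The normalised Haar integral, as the unique left-invariant positive linear functional of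
  total mass one on the continuous functions. Only its values on continuous functions matter.\<close>

definition is_haar_integral :: "(('a::topological_group_add \<Rightarrow> complex) \<Rightarrow> complex) \<Rightarrow> bool" where
  "is_haar_integral I \<longleftrightarrow>
     (\<forall>f h. continuous_on UNIV f \<and> continuous_on UNIV h \<longrightarrow> I (\<lambda>x. f x + h x) = I f + I h) \<and>
     (\<forall>c f. continuous_on UNIV f \<longrightarrow> I (\<lambda>x. c * f x) = c * I f) \<and>
     (\<forall>f. continuous_on UNIV f \<and> (\<forall>x. f x \<in> \<real>\<^sub>\<ge>\<^sub>0) \<longrightarrow> I f \<in> \<real>\<^sub>\<ge>\<^sub>0) \<and>
     I (\<lambda>x. 1) = 1 \<and>
     (\<forall>a f. continuous_on UNIV f \<longrightarrow> I (\<lambda>x. f (a + x)) = I f)"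

definition haar_integral :: "('a::topological_group_add \<Rightarrow> complex) \<Rightarrow> complex" where
  "haar_integral = (SOME I. is_haar_integral I)"

text \<open>\<open>\<F>f(\<pi>) = \<integral> f(x) \<pi>(x\<^sup>-\<^sup>1) dx\<close>, entrywise.\<close>

definition fourier_coeff ::
  "('a::topological_group_add \<Rightarrow> complex) \<Rightarrow> ('a \<Rightarrow> complex mat) \<Rightarrow> complex mat" where
  "fourier_coeff f \<pi> =
     mat (dim_row (\<pi> 0)) (dim_col (\<pi> 0)) (\<lambda>(i, j). haar_integral (\<lambda>x. f x * \<pi> (- x) $$ (i, j)))"

text \<open>The trace norm: the sum of the singular values, that is, of the square roots of the
  eigenvalues of \<open>A\<^sup>* A\<close>, with multiplicity.\<close>

definition trace_norm :: "complex mat \<Rightarrow> real" where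
  "trace_norm A =
     (let p = char_poly (mat_adjoint A * A)
      in \<Sum>l | poly p l = 0. of_nat (Polynomial.order l p) * sqrt (Re l))"

text \<open>
  The Fourier algebra of a compact group consists of the continuous functions with
  \<open>\<parallel>f\<parallel> = (\<Sum>\<pi>. d\<^sub>\<pi> \<parallel>\<F>f(\<pi>)\<parallel>\<^sub>1) < \<infinity>\<close>; this is its usual description
  by absolutely convergent Fourier series \<open>f = (\<Sum>\<pi>. d\<^sub>\<pi> Tr (\<F>f(\<pi>) \<pi>(\<cdot>)))\<close>.
\<close>

definition fourier_algebra :: "('a::topological_group_add \<Rightarrow> complex) normed" where
  "fourier_algebra =
     \<lparr> carrier = {f. continuous_on UNIV f \<and>
                    (\<lambda>p. real (class_dim p) * trace_norm (fourier_coeff f (class_rep p)))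
                      summable_on unitary_dual},
       mult = (\<lambda>f h x. f x * h x), one = (\<lambda>x. 1),
       zero = (\<lambda>x. 0), add = (\<lambda>f h x. f x + h x), smult = (\<lambda>c f x. c * f x),
       vnorm = (\<lambda>f. \<Sum>\<^sub>\<infinity>p\<in>unitary_dual.
                      real (class_dim p) * trace_norm (fourier_coeff f (class_rep p))) \<rparr>"

definition character_span :: "('a::topological_group_add \<Rightarrow> complex) set" where
  "character_span =
     {\<lambda>x. \<Sum>p\<in>F. c p * class_char p x | F c. finite F \<and> F \<subseteq> unitary_dual}"

definition central_fourier_algebra :: "('a::topological_group_add \<Rightarrow> complex) normed" where
  "central_fourier_algebra =
     fourier_algebra \<lparr> carrier :=
       {f \<in> carrier fourier_algebra.
          \<forall>e>0. \<exists>h\<in>character_span. vnorm fourier_algebra (\<lambda>x. f x - h x) < e} \<rparr>"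

end

theory Submission
  imports Defs
begin

text \<open>
  The functions in \<open>ZA(G)\<close> are the absolutely convergent series in the normalised characters
  \<open>\<psi>\<^sub>\<pi> = \<chi>\<^sub>\<pi> / d\<^sub>\<pi>\<close>, and the norm is the \<open>\<ell>\<^sup>1\<close> norm of the coefficients. The coefficient of \<open>\<psi>\<^sub>\<sigma>\<close> in
  \<open>\<psi>\<^sub>\<pi> \<psi>\<^sub>\<rho>\<close> is at most \<open>d\<^sub>\<sigma>\<^sup>2 / (d\<^sub>\<pi> d\<^sub>\<rho>)\<close>, so it vanishes at infinity in \<open>(\<pi>, \<rho>)\<close> when there are only
  finitely many classes of each degree. Therefore the kernel of the product map on the projective
  tensor square \<open>\<ell>\<^sup>1(G^ \<times> G^)\<close> is itself a dual bimodule, the predual being a space of bilinear forms that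
  vanish at infinity. If \<open>ZA(G)\<close> were amenable, the derivation \<open>a \<mapsto> 1 \<otimes> a - a \<otimes> 1\<close> into this kernel would
  be implemented by an element \<open>y\<close> of the kernel, and not merely of its bidual. As an absolutely
  convergent series, \<open>y\<close> is a continuous function on \<open>G \<times> G\<close> vanishing on the diagonal; the
  derivation identity forces \<open>y(0, h)\<close> to have modulus 1 whenever some \<open>\<psi>\<^sub>\<pi>(h) \<noteq> 1\<close>, that is, for all \<open>h \<noteq> 0\<close>, and
  this is impossible when \<open>G\<close> is not discrete.
\<close>

section \<open>The Haar integral\<close>

text \<open>The modulus 1 comes from an eigenvector. For \<phi>(b, c) = b(0) (c(h) - c(0)) the two
  module actions satisfy \<phi> . a - a . \<phi> = (a(0) - a(h)) \<phi>, while the derivation at a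
  pairs with \<phi> to a(h) - a(0); so a y that implements it must have y(\<phi>) = -1 as soon as
  some a(h) differs from a(0). The obstacle is that \<phi> does not vanish at infinity and so is not
  in the predual. It is reached through truncations, and the limit can be taken because y, a
  functional on forms that vanish at infinity, is an absolutely summable family of coordinates:
  dominated convergence holds for it. Finitely many coordinates carry almost all of y, and on these
  \<phi> is small when h is close to 0. The forms are functions of two elements of the algebra,
  which places the bimodule in the very type over which \<open>amenable\<close> quantifies. The
  degree condition enters through the coefficient bound alone. That bound and the
  submultiplicativity of the norm come from Haar integrals, without decomposing tensor products into
  irreducibles.\<close>

definition left_avg :: "'a::plus list \<Rightarrow> ('a \<Rightarrow> real) \<Rightarrow> 'a \<Rightarrow> real" where
  "left_avg xs f x = (\<Sum>a\<leftarrow>xs. f (a + x)) / length xs"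

definition right_avg :: "'a::plus list \<Rightarrow> ('a \<Rightarrow> real) \<Rightarrow> 'a \<Rightarrow> real" where
  "right_avg xs f x = (\<Sum>a\<leftarrow>xs. f (x + a)) / length xs"

text \<open>Von Neumann's notion of a mean: a constant approximated uniformly by averages of
  translates on one side. For a continuous function on a compact group it will be the value of the
  Haar integral.\<close>

definition left_mean :: "('a::plus \<Rightarrow> real) \<Rightarrow> real \<Rightarrow> bool" where
  "left_mean f c \<longleftrightarrow> (\<forall>e>0. \<exists>xs. xs \<noteq> [] \<and> (\<forall>x. \<bar>left_avg xs f x - c\<bar> \<le> e))"

definition right_mean :: "('a::plus \<Rightarrow> real) \<Rightarrow> real \<Rightarrow> bool" where
  "right_mean f c \<longleftrightarrow> (\<forall>e>0. \<exists>xs. xs \<noteq> [] \<and> (\<forall>x. \<bar>right_avg xs f x - c\<bar> \<le> e))"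

lemma sum_list_le_const:
  fixes h :: "'b \<Rightarrow> real"
  assumes "\<And>a. a \<in> set xs \<Longrightarrow> h a \<le> M"
  shows "(\<Sum>a\<leftarrow>xs. h a) \<le> real (length xs) * M"
  using assms by (induction xs) (auto simp: algebra_simps add_mono)

lemma sum_list_ge_const:
  fixes h :: "'b \<Rightarrow> real"
  assumes "\<And>a. a \<in> set xs \<Longrightarrow> M \<le> h a"
  shows "real (length xs) * M \<le> (\<Sum>a\<leftarrow>xs. h a)"
  using assms by (induction xs) (auto simp: algebra_simps add_mono)

lemma avg_mono_bounds:
  fixes h :: "'b \<Rightarrow> real"
  assumes "xs \<noteq> []" "\<And>a. a \<in> set xs \<Longrightarrow> \<bar>h a - c\<bar> \<le> e"
  shows "\<bar>(\<Sum>a\<leftarrow>xs. h a) / length xs - c\<bar> \<le> e"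
proof -
  have "(\<Sum>a\<leftarrow>xs. h a) \<le> length xs * (c + e)"
    by (rule sum_list_le_const) (use assms(2) in \<open>force simp: abs_le_iff\<close>)
  moreover have "length xs * (c - e) \<le> (\<Sum>a\<leftarrow>xs. h a)"
    by (rule sum_list_ge_const) (use assms(2) in \<open>force simp: abs_le_iff\<close>)
  moreover have "real (length xs) > 0" using assms(1) by simp
  ultimately show ?thesis
    by (simp add: abs_le_iff field_simps)
qed

text \<open>Averages are taken over lists, with multiplicity, so that iterating two of them is
  exactly an average again, over all sums a + b. Lists of translates can therefore be refined one
  after another.\<close>

lemma left_avg_comp:
  fixes f :: "'a::semigroup_add \<Rightarrow> real"
  shows "left_avg ys (left_avg xs f) x = left_avg (concat (map (\<lambda>b. map (\<lambda>a. a + b) xs) ys)) f x"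
proof -
  have "(\<Sum>a\<leftarrow>concat (map (\<lambda>b. map (\<lambda>a. a + b) xs) ys). f (a + x))
     = (\<Sum>b\<leftarrow>ys. \<Sum>a\<leftarrow>xs. f (a + (b + x)))"
    by (induction ys) (auto simp: comp_def add.assoc)
  moreover have "length (concat (map (\<lambda>b. map (\<lambda>a. a + b) xs) ys)) = length ys * length xs"
    by (induction ys) auto
  moreover have "(\<Sum>b\<leftarrow>ys. h b / r) = (\<Sum>b\<leftarrow>ys. h b) / r" for h :: "'a \<Rightarrow> real" and r
    by (induction ys) (auto simp: add_divide_distrib)
  ultimately show ?thesis
    by (simp add: left_avg_def mult.commute)
qed

lemma left_avg_right_avg:
  fixes f :: "'a::semigroup_add \<Rightarrow> real"
  shows "left_avg xs (right_avg ys f) x = right_avg ys (left_avg xs f) x"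
proof -
  have 1: "(\<Sum>a\<leftarrow>xs. \<Sum>b\<leftarrow>ys. f (a + x + b)) = (\<Sum>b\<leftarrow>ys. \<Sum>a\<leftarrow>xs. f (a + x + b))"
    by (induction xs) (auto simp: sum_list_addf)
  have 2: "(\<Sum>a\<leftarrow>zs. h a / real n) = (\<Sum>a\<leftarrow>zs. h a) / real n" for zs :: "'a list" and h n
    by (induction zs) (auto simp: add_divide_distrib)
  show ?thesis
    by (simp add: left_avg_def right_avg_def 2 add.assoc[symmetric] 1 mult.commute)
qed

text \<open>Left and right averaging commute, and an average of a function that is within e of a
  constant stays within e of it; so one double average is close to both c and d. Uniqueness of the
  mean rests on this comparison of the two sides.\<close>

lemma left_mean_right_mean:
  fixes f :: "'a::monoid_add \<Rightarrow> real"
  assumes "left_mean f c" "right_mean f d"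
  shows "c = d"
proof -
  have "\<bar>c - d\<bar> \<le> e" if e: "e > 0" for e
  proof -
    obtain xs where xs: "xs \<noteq> []" "\<And>x. \<bar>left_avg xs f x - c\<bar> \<le> e / 2"
      using assms(1) e unfolding left_mean_def by (meson half_gt_zero)
    obtain ys where ys: "ys \<noteq> []" "\<And>x. \<bar>right_avg ys f x - d\<bar> \<le> e / 2"
      using assms(2) e unfolding right_mean_def by (meson half_gt_zero)
    have "\<bar>left_avg xs (right_avg ys f) 0 - d\<bar> \<le> e / 2"
      unfolding left_avg_def by (rule avg_mono_bounds) (use xs ys in auto)
    moreover have "\<bar>right_avg ys (left_avg xs f) 0 - c\<bar> \<le> e / 2"
      unfolding right_avg_def by (rule avg_mono_bounds) (use xs ys in auto)
    ultimately show ?thesis unfolding left_avg_right_avg by linarith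
  qed
  then show ?thesis
    using field_le_epsilon[of "\<bar>c - d\<bar>" 0] by simp
qed

section \<open>Means of continuous functions on a compact group\<close>

locale compact_group =
  fixes group_type :: "'a::topological_group_add itself"
  assumes compact_UNIV: "compact (UNIV :: 'a set)"
begin

text \<open>Compactness in x, applied to the continuous map (v, x) -> f (x + v), gives one
  neighbourhood for all base points. The perturbation v stands on the right, so that it passes
  through left averages.\<close>

lemma uniform_continuity:
  fixes f :: "'a \<Rightarrow> 'b::metric_space"
  assumes f: "continuous_on UNIV f" and e: "e > 0"
  obtains V where "open V" "0 \<in> V" "\<And>x v. v \<in> V \<Longrightarrow> dist (f (x + v)) (f x) \<le> e"
proof -
  have "continuous_on (UNIV \<times> UNIV) (\<lambda>(v, x). f (x + v))"
    unfolding case_prod_beta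
    by (intro continuous_on_compose2[OF f] continuous_intros) auto
  then obtain V where "0 \<in> V" "open V"
    "\<forall>v\<in>V \<inter> UNIV. \<forall>x\<in>UNIV. dist ((\<lambda>(v, x). f (x + v)) (v, x)) ((\<lambda>(v, x). f (x + v)) (0, x)) \<le> e"
    by (rule continuous_on_prod_compactE[OF _ compact_UNIV UNIV_I e])
  with that show ?thesis by auto
qed

lemma finite_translates_cover:
  assumes V: "open (V :: 'a set)" "0 \<in> V"
  obtains cs where "cs \<noteq> []" "\<And>x. \<exists>c\<in>set cs. - c + x \<in> V"
proof -
  have op: "open ((\<lambda>x. - c + x) -` V)" for c
    using V(1) by (intro open_vimage continuous_intros)
  have cov: "UNIV \<subseteq> (\<Union>c\<in>UNIV. (\<lambda>x. - c + x) -` V)"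
    using V(2) by (auto intro!: exI)
  obtain C where C: "C \<subseteq> UNIV" "finite C" "UNIV \<subseteq> (\<Union>c\<in>C. (\<lambda>x. - c + x) -` V)"
    by (rule compactE_image[OF compact_UNIV op cov])
  obtain cs where cs: "set cs = C" using finite_list[OF C(2)] by blast
  show ?thesis
  proof
    show "cs \<noteq> []" using cs C(3) by auto
    show "\<exists>c\<in>set cs. - c + x \<in> V" for x using C(3) cs by blast
  qed
qed

lemma continuous_bounded:
  fixes f :: "'a \<Rightarrow> 'b::real_normed_vector"
  assumes "continuous_on UNIV f"
  obtains B where "B > 0" "\<And>x. norm (f x) \<le> B"
proof -
  have "bounded (range f)"
    using compact_continuous_image[OF assms compact_UNIV] compact_imp_bounded by blast
  then show ?thesis using that by (meson bounded_pos rangeI)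
qed

text \<open>Minimising the maximum of the left averages: they share a common modulus of continuity, so an
  average that is small somewhere can be averaged once more, over a number of translates that does
  not depend on it, to lower the maximum by a fixed amount.\<close>

lemma left_mean_exists:
  fixes f :: "'a \<Rightarrow> real"
  assumes f: "continuous_on UNIV f"
  shows "\<exists>c. left_mean f c"
proof -
  define T where "T = {M. \<exists>xs. xs \<noteq> [] \<and> (\<forall>x. left_avg xs f x \<le> M)}"
  define s where "s = Inf T"
  obtain B where B: "\<And>x. \<bar>f x\<bar> \<le> B" using continuous_bounded[OF f] by auto
  have avgB: "\<bar>left_avg xs f x - 0\<bar> \<le> B" if "xs \<noteq> []" for xs x
    unfolding left_avg_def by (rule avg_mono_bounds) (use that B in auto)
  have "B \<in> T" unfolding T_def using avgB[of "[0]"] by (force simp: abs_le_iff)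
  then have Tne: "T \<noteq> {}" by auto
  have Tbd: "bdd_below T"
  proof (rule bdd_belowI)
    fix M assume "M \<in> T"
    then obtain xs where "xs \<noteq> []" "left_avg xs f 0 \<le> M" by (auto simp: T_def)
    with avgB[of xs 0] show "- B \<le> M" by linarith
  qed
  have sle: "s \<le> M" if "xs \<noteq> []" "\<And>x. left_avg xs f x \<le> M" for M xs
    unfolding s_def by (rule cInf_lower[OF _ Tbd]) (use that in \<open>auto simp: T_def\<close>)
  have "left_mean f s"
    unfolding left_mean_def
  proof (intro allI impI)
    fix e :: real assume e: "e > 0"
    define d where "d = e / 2"
    have d: "d > 0" using e by (simp add: d_def)
    obtain V where V: "open V" "0 \<in> V" "\<And>x v. v \<in> V \<Longrightarrow> dist (f (x + v)) (f x) \<le> d"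
      using uniform_continuity[OF f d] by blast
    obtain cs where cs: "cs \<noteq> []" "\<And>x. \<exists>c\<in>set cs. - c + x \<in> V"
      using finite_translates_cover[OF V(1,2)] by blast
    \<comment> \<open>The number of translates depends on f and d only and is fixed before the
      nearly optimal list \<open>xs\<close> is chosen; this makes the gain d / (2 N) a fixed
      amount.\<close>
    define N where "N = real (length cs)"
    have N: "N \<ge> 1" using cs(1) by (cases cs) (auto simp: N_def)
    have "s < s + d / (2 * N)" using d N by simp
    then obtain M where M: "M \<in> T" "M < s + d / (2 * N)"
      unfolding s_def using Tne by (metis cInf_lessD)
    then obtain xs where xs: "xs \<noteq> []" "\<And>x. left_avg xs f x \<le> M" by (auto simp: T_def)
    have low: "s - e \<le> left_avg xs f x0" for x0
    proof (rule ccontr)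
      assume "\<not> ?thesis"
      then have x0: "left_avg xs f x0 < s - e" by simp
      have near: "left_avg xs f (x0 + v) \<le> s - d" if "v \<in> V" for v
      proof -
        have "(\<Sum>a\<leftarrow>xs. f (a + (x0 + v))) \<le> (\<Sum>a\<leftarrow>xs. f (a + x0) + d)"
        proof (rule sum_list_mono)
          fix a
          have "\<bar>f (a + x0 + v) - f (a + x0)\<bar> \<le> d"
            using V(3)[OF that, of "a + x0"] by (simp add: dist_real_def)
          then show "f (a + (x0 + v)) \<le> f (a + x0) + d"
            unfolding add.assoc[symmetric] by linarith
        qed
        also have "\<dots> = (\<Sum>a\<leftarrow>xs. f (a + x0)) + length xs * d"
          by (simp add: sum_list_addf sum_list_triv)
        finally have "left_avg xs f (x0 + v) \<le> left_avg xs f x0 + d"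
          using xs(1) by (simp add: left_avg_def field_simps)
        with x0 show ?thesis by (simp add: d_def field_simps)
      qed
      \<comment> \<open>These translates carry the dip at x0 to every point x: when - c + x lies in
        V, the term of index c is evaluated at x0 + v with v in V.\<close>
      define ys where "ys = map (\<lambda>c. x0 + - c) cs"
      have len: "length ys = length cs" by (simp add: ys_def)
      have "left_avg ys (left_avg xs f) x \<le> s - d / (2 * N)" for x
      proof -
        obtain c where c: "c \<in> set cs" "- c + x \<in> V" using cs(2) by blast
        let ?h = "\<lambda>a. left_avg xs f (x0 + - a + x)"
        obtain us vs where split: "cs = us @ c # vs" using c(1) by (meson split_list)
        have "?h c \<le> s - d" using near[OF c(2)] by (simp only: add.assoc)
        moreover have "(\<Sum>a\<leftarrow>us. ?h a) \<le> length us * M" "(\<Sum>a\<leftarrow>vs. ?h a) \<le> length vs * M"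
          by (rule sum_list_le_const; rule xs(2))+
        ultimately have "(\<Sum>a\<leftarrow>cs. ?h a) \<le> (N - 1) * M + (s - d)"
          by (simp add: split N_def algebra_simps)
        \<comment> \<open>One term is at most s - d and each of the other N - 1 exceeds s by less
          than d / (2 N), so the total is below N s - d / 2. The new average then has a maximum
          below the infimum s.\<close>
        also have "\<dots> \<le> (N - 1) * (s + d / (2 * N)) + (s - d)"
          using M(2) N by (intro add_right_mono mult_left_mono) auto
        also have "\<dots> \<le> N * (s - d / (2 * N))"
          using N d by (simp add: field_simps)
        finally have "(\<Sum>a\<leftarrow>cs. ?h a) / N \<le> s - d / (2 * N)"
          using N by (simp add: pos_divide_le_eq mult.commute)
        then show ?thesis
          by (subst left_avg_def) (simp add: len ys_def comp_def N_def)
      qed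
      then have "s \<le> s - d / (2 * N)"
        unfolding left_avg_comp
        by (rule sle[rotated]) (use xs(1) cs(1) in \<open>auto simp: ys_def\<close>)
      then show False using d N by (simp add: field_simps)
    qed
    have "d / (2 * N) \<le> e" using N d e by (simp add: field_simps d_def mult_le_cancel_left1)
    then have "left_avg xs f x \<le> s + e" for x using M(2) xs(2)[of x] by linarith
    then show "\<exists>xs. xs \<noteq> [] \<and> (\<forall>x. \<bar>left_avg xs f x - s\<bar> \<le> e)"
      using low xs(1) by (intro exI[of _ xs]) (auto simp: abs_le_iff algebra_simps)
  qed
  then show ?thesis ..
qed

text \<open>Inversion turns left averages of x -> f (- x) into right averages of f.\<close>

lemma right_mean_exists:
  fixes f :: "'a \<Rightarrow> real"
  assumes f: "continuous_on UNIV f"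
  shows "\<exists>c. right_mean f c"
proof -
  have "continuous_on UNIV (\<lambda>x. f (- x))"
    by (intro continuous_on_compose2[OF f] continuous_intros) auto
  then obtain c where c: "left_mean (\<lambda>x. f (- x)) c" using left_mean_exists by blast
  have "right_avg (map uminus xs) f x = left_avg xs (\<lambda>x. f (- x)) (- x)" for xs x
    by (simp add: right_avg_def left_avg_def comp_def minus_add)
  with c have "right_mean f c"
    unfolding left_mean_def right_mean_def by (metis list.map_disc_iff)
  then show ?thesis ..
qed

lemma left_mean_unique:
  fixes f :: "'a \<Rightarrow> real"
  assumes "continuous_on UNIV f" "left_mean f c" "left_mean f d"
  shows "c = d"
  using right_mean_exists[OF assms(1)] assms left_mean_right_mean by metis

text \<open>The average has some mean d; composing lists shows that d is also a mean of f, and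
  uniqueness gives d = c. Additivity can therefore treat two functions in turn.\<close>

lemma left_mean_left_avg:
  fixes f :: "'a \<Rightarrow> real"
  assumes f: "continuous_on UNIV f" and c: "left_mean f c" and xs: "xs \<noteq> []"
  shows "left_mean (left_avg xs f) c"
proof -
  have "continuous_on UNIV (left_avg xs f)"
  proof -
    have "continuous_on UNIV (\<lambda>x. \<Sum>a\<leftarrow>xs. f (a + x))"
      by (induction xs) (auto intro!: continuous_intros continuous_on_compose2[OF f])
    then show ?thesis unfolding left_avg_def[abs_def] by (auto intro!: continuous_intros simp: xs)
  qed
  then obtain d where d: "left_mean (left_avg xs f) d" using left_mean_exists by blast
  have "left_mean f d"
    unfolding left_mean_def
  proof (intro allI impI)
    fix e :: real assume "e > 0"
    then obtain ys where ys: "ys \<noteq> []" "\<And>x. \<bar>left_avg ys (left_avg xs f) x - d\<bar> \<le> e"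
      using d unfolding left_mean_def by blast
    then show "\<exists>xs. xs \<noteq> [] \<and> (\<forall>x. \<bar>left_avg xs f x - d\<bar> \<le> e)"
      unfolding left_avg_comp using xs by (intro exI[of _ "concat (map (\<lambda>b. map (\<lambda>a. a + b) xs) ys)"]) auto
  qed
  with d left_mean_unique[OF f c] show ?thesis by simp
qed

text \<open>The list \<open>xs\<close> flattens f, a second list \<open>ys\<close> flattens the
  average of h over \<open>xs\<close>, and averaging over \<open>ys\<close> keeps f flat. The
  combined list serves both functions.\<close>

lemma left_mean_add:
  fixes f h :: "'a \<Rightarrow> real"
  assumes f: "continuous_on UNIV f" "left_mean f c" and h: "continuous_on UNIV h" "left_mean h d"
  shows "left_mean (\<lambda>x. f x + h x) (c + d)"
  unfolding left_mean_def
proof (intro allI impI)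
  fix e :: real assume e: "e > 0"
  obtain xs where xs: "xs \<noteq> []" "\<And>x. \<bar>left_avg xs f x - c\<bar> \<le> e / 2"
    using f(2) e unfolding left_mean_def by (meson half_gt_zero)
  obtain ys where ys: "ys \<noteq> []" "\<And>x. \<bar>left_avg ys (left_avg xs h) x - d\<bar> \<le> e / 2"
    using left_mean_left_avg[OF h xs(1)] e unfolding left_mean_def by (meson half_gt_zero)
  let ?zs = "concat (map (\<lambda>b. map (\<lambda>a. a + b) xs) ys)"
  have add: "left_avg zs (\<lambda>x. f x + h x) x = left_avg zs f x + left_avg zs h x" for zs x
    by (simp add: left_avg_def sum_list_addf add_divide_distrib)
  have "\<bar>left_avg ys (left_avg xs f) x - c\<bar> \<le> e / 2" for x
    by (subst left_avg_def, rule avg_mono_bounds) (use xs ys in auto)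
  then have "\<bar>left_avg ?zs (\<lambda>x. f x + h x) x - (c + d)\<bar> \<le> e" for x
    unfolding add left_avg_comp[symmetric] using ys(2)[of x] by (smt (verit) field_sum_of_halves)
  then show "\<exists>xs. xs \<noteq> [] \<and> (\<forall>x. \<bar>left_avg xs (\<lambda>x. f x + h x) x - (c + d)\<bar> \<le> e)"
    using xs(1) ys(1) by (intro exI[of _ ?zs]) auto
qed

lemma left_mean_scale:
  fixes f :: "'a \<Rightarrow> real"
  assumes "left_mean f c"
  shows "left_mean (\<lambda>x. r * f x) (r * c)"
  unfolding left_mean_def
proof (intro allI impI)
  fix e :: real assume e: "e > 0"
  have pos: "\<bar>r\<bar> + 1 > 0" by simp
  then obtain xs where xs: "xs \<noteq> []" "\<And>x. \<bar>left_avg xs f x - c\<bar> \<le> e / (\<bar>r\<bar> + 1)"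
    using assms e unfolding left_mean_def by (meson divide_pos_pos)
  have "left_avg xs (\<lambda>x. r * f x) x = r * left_avg xs f x" for x
    by (simp add: left_avg_def sum_list_const_mult)
  then have "\<bar>left_avg xs (\<lambda>x. r * f x) x - r * c\<bar> = \<bar>r\<bar> * \<bar>left_avg xs f x - c\<bar>" for x
    by (simp add: abs_mult[symmetric] algebra_simps)
  moreover have "\<bar>r\<bar> * \<bar>left_avg xs f x - c\<bar> \<le> e" for x
  proof -
    have "\<bar>r\<bar> * \<bar>left_avg xs f x - c\<bar> \<le> (\<bar>r\<bar> + 1) * (e / (\<bar>r\<bar> + 1))"
      using xs(2)[of x] by (intro mult_mono) auto
    then show ?thesis using pos by simp
  qed
  ultimately show "\<exists>xs. xs \<noteq> [] \<and> (\<forall>x. \<bar>left_avg xs (\<lambda>x. r * f x) x - r * c\<bar> \<le> e)"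
    using xs(1) by auto
qed

lemma left_mean_translate:
  fixes f :: "'a \<Rightarrow> real"
  assumes "left_mean f c"
  shows "left_mean (\<lambda>x. f (a + x)) c"
proof -
  have "left_avg (map (\<lambda>b. - a + b) xs) (\<lambda>x. f (a + x)) x = left_avg xs f x" for xs x
    by (simp add: left_avg_def comp_def add.assoc)
  with assms show ?thesis unfolding left_mean_def by (metis list.map_disc_iff)
qed

lemma left_mean_nonneg:
  fixes f :: "'a \<Rightarrow> real"
  assumes "left_mean f c" "\<And>x. f x \<ge> 0"
  shows "c \<ge> 0"
proof (rule field_le_epsilon)
  fix e :: real assume "e > 0"
  then obtain xs where xs: "\<bar>left_avg xs f 0 - c\<bar> \<le> e"
    using assms unfolding left_mean_def by blast
  moreover have "left_avg xs f 0 \<ge> 0"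
    unfolding left_avg_def using assms(2) by (auto intro!: divide_nonneg_nonneg sum_list_nonneg)
  ultimately show "0 \<le> c + e" by linarith
qed

theorem haar_integral_exists: "\<exists>I :: ('a \<Rightarrow> complex) \<Rightarrow> complex. is_haar_integral I"
proof -
  define m where "m f = (SOME c. left_mean f c)" for f :: "'a \<Rightarrow> real"
  have m: "left_mean f (m f)" if "continuous_on UNIV f" for f :: "'a \<Rightarrow> real"
    unfolding m_def using left_mean_exists[OF that] by (rule someI_ex)
  have mI: "m f = c" if "continuous_on UNIV f" "left_mean f c" for f c
    using left_mean_unique m that by blast
  define I where "I f = Complex (m (\<lambda>x. Re (f x))) (m (\<lambda>x. Im (f x)))" for f
  \<comment> \<open>Two-term combinations are needed because a complex factor mixes the real and
    imaginary parts on which I is built.\<close>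
  have scale: "m (\<lambda>x. r * f x + t * h x) = r * m f + t * m h"
    if "continuous_on UNIV f" "continuous_on UNIV h" for f h r t
    by (rule mI) (use that in \<open>auto intro!: continuous_intros left_mean_add left_mean_scale m\<close>)
  have add: "m (\<lambda>x. f x + h x) = m f + m h"
    if "continuous_on UNIV f" "continuous_on UNIV h" for f h
    using scale[OF that, of 1 1] by simp
  have const: "left_mean (\<lambda>x :: 'a. r) r" for r :: real
    unfolding left_mean_def left_avg_def by (intro allI impI exI[of _ "[0]"]) auto
  have "is_haar_integral I"
    unfolding is_haar_integral_def
  proof (intro conjI allI impI)
    fix f h :: "'a \<Rightarrow> complex"
    assume "continuous_on UNIV f \<and> continuous_on UNIV h"
    then show "I (\<lambda>x. f x + h x) = I f + I h"
      by (simp add: I_def add continuous_intros complex_eq_iff)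
  next
    fix f :: "'a \<Rightarrow> complex" and c
    assume f: "continuous_on UNIV f"
    have "m (\<lambda>x. Re c * Re (f x) + (- Im c) * Im (f x)) = Re c * m (\<lambda>x. Re (f x)) + (- Im c) * m (\<lambda>x. Im (f x))"
      "m (\<lambda>x. Re c * Im (f x) + Im c * Re (f x)) = Re c * m (\<lambda>x. Im (f x)) + Im c * m (\<lambda>x. Re (f x))"
      by (rule scale; intro continuous_intros f)+
    then show "I (\<lambda>x. c * f x) = c * I f"
      by (simp add: I_def complex_eq_iff)
  next
    fix f :: "'a \<Rightarrow> complex"
    assume f: "continuous_on UNIV f \<and> (\<forall>x. f x \<in> \<real>\<^sub>\<ge>\<^sub>0)"
    then have "m (\<lambda>x. Re (f x)) \<ge> 0"
      by (intro left_mean_nonneg[OF m]) (auto intro!: continuous_intros simp: complex_nonneg_Reals_iff)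
    moreover have "m (\<lambda>x. Im (f x)) = 0"
      using f mI[OF _ const[of 0]] by (simp add: complex_nonneg_Reals_iff)
    ultimately show "I f \<in> \<real>\<^sub>\<ge>\<^sub>0" by (simp add: I_def complex_nonneg_Reals_iff)
  next
    show "I (\<lambda>x. 1) = 1" using mI[OF _ const] by (simp add: I_def complex_eq_iff)
  next
    fix a and f :: "'a \<Rightarrow> complex"
    assume f: "continuous_on UNIV f"
    have "m (\<lambda>x. g (a + x)) = m g" if g: "continuous_on UNIV g" for g :: "'a \<Rightarrow> real"
      by (rule mI[OF _ left_mean_translate[OF m[OF g]]])
        (intro continuous_on_compose2[OF g] continuous_intros; simp)
    from this[of "\<lambda>x. Re (f x)"] this[of "\<lambda>x. Im (f x)"] show "I (\<lambda>x. f (a + x)) = I f"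
      using f by (simp add: I_def continuous_intros)
  qed
  then show ?thesis by (intro exI[of _ I])
qed

end

section \<open>Integration against an arbitrary invariant functional\<close>

lemma left_translate_continuous:
  fixes f :: "'a::topological_group_add \<Rightarrow> 'b::topological_space"
  assumes "continuous_on UNIV f" shows "continuous_on UNIV (\<lambda>x. f (a + x))"
  by (intro continuous_on_compose2[OF assms] continuous_intros) auto

lemma right_translate_continuous:
  fixes f :: "'a::topological_group_add \<Rightarrow> 'b::topological_space"
  assumes "continuous_on UNIV f" shows "continuous_on UNIV (\<lambda>x. f (x + a))"
  by (intro continuous_on_compose2[OF assms] continuous_intros) auto

lemma uminus_continuous:
  fixes f :: "'a::topological_group_add \<Rightarrow> 'b::topological_space"
  assumes "continuous_on UNIV f" shows "continuous_on UNIV (\<lambda>x. f (- x))"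
  by (intro continuous_on_compose2[OF assms] continuous_intros) auto

text \<open>Uniqueness of the Haar integral will be applied on the product group, in order to obtain
  Fubini's theorem.\<close>

instance prod :: (topological_group_add, topological_group_add) topological_group_add
proof
  fix a b :: "'a \<times> 'b"
  have 1: "((\<lambda>x. fst (fst x) + fst (snd x)) \<longlongrightarrow> fst a + fst b) (nhds a \<times>\<^sub>F nhds b)"
    and 2: "((\<lambda>x. snd (fst x) + snd (snd x)) \<longlongrightarrow> snd a + snd b) (nhds a \<times>\<^sub>F nhds b)"
    by (intro tendsto_add tendsto_fst tendsto_snd filterlim_fst filterlim_snd)+
  show "LIM x (nhds a \<times>\<^sub>F nhds b). fst x + snd x :> nhds (a + b)"
    using tendsto_Pair[OF 1 2] by (simp add: plus_prod_def)
  have "((\<lambda>x. (- fst x, - snd x)) \<longlongrightarrow> (- fst a, - snd a)) (nhds a)"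
    by (intro tendsto_Pair tendsto_minus tendsto_fst tendsto_snd filterlim_ident)
  moreover have "(\<lambda>x :: 'a \<times> 'b. (- fst x, - snd x)) = uminus" by (simp add: fun_eq_iff uminus_prod_def)
  ultimately show "(uminus \<longlongrightarrow> - a) (nhds a)" by (simp add: uminus_prod_def)
qed

context
  fixes I :: "('a::topological_group_add \<Rightarrow> complex) \<Rightarrow> complex"
  assumes haar: "is_haar_integral I"
begin

lemma haar_functional_add:
  "continuous_on UNIV f \<Longrightarrow> continuous_on UNIV h \<Longrightarrow> I (\<lambda>x. f x + h x) = I f + I h"
  using haar unfolding is_haar_integral_def by simp

lemma haar_functional_cmult: "continuous_on UNIV f \<Longrightarrow> I (\<lambda>x. c * f x) = c * I f"
  using haar unfolding is_haar_integral_def by simp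

lemma haar_functional_const: "I (\<lambda>x. c) = c"
proof -
  have "I (\<lambda>x. c * (\<lambda>x. 1) x) = c * I (\<lambda>x. 1)" by (rule haar_functional_cmult) simp
  then show ?thesis using haar unfolding is_haar_integral_def by simp
qed

lemma haar_functional_translate: "continuous_on UNIV f \<Longrightarrow> I (\<lambda>x. f (a + x)) = I f"
  using haar unfolding is_haar_integral_def by simp

lemma haar_functional_sum:
  "(\<And>i. i \<in> F \<Longrightarrow> continuous_on UNIV (f i)) \<Longrightarrow> I (\<lambda>x. \<Sum>i\<in>F. f i x) = (\<Sum>i\<in>F. I (f i))"
  by (induction F rule: infinite_finite_induct)
    (auto simp: haar_functional_const haar_functional_add continuous_on_sum)

lemma haar_functional_nonneg:
  assumes "continuous_on UNIV f" "\<And>x. f x \<ge> 0"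
  shows "I (\<lambda>x. of_real (f x)) = of_real (Re (I (\<lambda>x. of_real (f x))))" "0 \<le> Re (I (\<lambda>x. of_real (f x)))"
proof -
  have "I (\<lambda>x. of_real (f x)) \<in> \<real>\<^sub>\<ge>\<^sub>0"
    using haar assms unfolding is_haar_integral_def
    by (auto intro!: continuous_intros)
  then show "I (\<lambda>x. of_real (f x)) = of_real (Re (I (\<lambda>x. of_real (f x))))"
    "0 \<le> Re (I (\<lambda>x. of_real (f x)))"
    by (auto simp: complex_nonneg_Reals_iff complex_eq_iff)
qed

text \<open>Positivity gives real values on nonnegative functions; adding a bound B of |f| reduces
  to that case.\<close>

lemma haar_functional_of_real:
  assumes c: "compact (UNIV :: 'a set)" and f: "continuous_on UNIV f"
  shows "I (\<lambda>x. of_real (f x)) = of_real (Re (I (\<lambda>x. of_real (f x))))"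
proof -
  interpret compact_group "TYPE('a)" by unfold_locales (rule c)
  obtain B where B: "\<And>x. norm (f x) \<le> B" using continuous_bounded[OF f] by blast
  have "f x + B \<ge> 0" for x using B[of x] by (simp add: abs_le_iff)
  then have *: "I (\<lambda>x. of_real (f x + B)) = of_real (Re (I (\<lambda>x. of_real (f x + B))))"
    by (intro haar_functional_nonneg continuous_intros f)
  have "I (\<lambda>x. of_real (f x + B)) = I (\<lambda>x. of_real (f x)) + of_real B"
    using haar_functional_add[of "\<lambda>x. of_real (f x)" "\<lambda>x. of_real B"] f
    by (simp add: haar_functional_const continuous_intros)
  with * show ?thesis by (auto simp: complex_eq_iff)
qed

lemma haar_functional_Re:
  assumes c: "compact (UNIV :: 'a set)" and f: "continuous_on UNIV f"
  shows "I (\<lambda>x. of_real (Re (f x))) = of_real (Re (I f))"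
    and "I (\<lambda>x. of_real (Im (f x))) = of_real (Im (I f))"
proof -
  have "I (\<lambda>x. of_real (Re (f x)) + \<i> * of_real (Im (f x)))
      = I (\<lambda>x. of_real (Re (f x))) + \<i> * I (\<lambda>x. of_real (Im (f x)))"
    by (subst haar_functional_add, (intro continuous_intros f)+, subst haar_functional_cmult)
      (auto intro!: continuous_intros f)
  then have "I f = I (\<lambda>x. of_real (Re (f x))) + \<i> * I (\<lambda>x. of_real (Im (f x)))"
    by (simp add: complex_eq[symmetric])
  moreover have "I (\<lambda>x. of_real (Re (f x))) = of_real (Re (I (\<lambda>x. of_real (Re (f x)))))"
    "I (\<lambda>x. of_real (Im (f x))) = of_real (Re (I (\<lambda>x. of_real (Im (f x)))))"
    by (rule haar_functional_of_real[OF c]; intro continuous_intros f)+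
  ultimately show "I (\<lambda>x. of_real (Re (f x))) = of_real (Re (I f))"
    and "I (\<lambda>x. of_real (Im (f x))) = of_real (Im (I f))"
    by (auto simp: complex_eq_iff)
qed

text \<open>The number u rotates I f onto the positive axis, and positivity is applied to the
  nonnegative function g - Re (u f).\<close>

lemma haar_functional_norm_le:
  assumes c: "compact (UNIV :: 'a set)" and f: "continuous_on UNIV f" and g: "continuous_on UNIV g"
    and le: "\<And>x. cmod (f x) \<le> g x"
  shows "cmod (I f) \<le> Re (I (\<lambda>x. of_real (g x)))"
proof (cases "I f = 0")
  case True
  have "0 \<le> g x" for x using le[of x] norm_ge_zero order_trans by blast
  with True show ?thesis using haar_functional_nonneg(2)[OF g] by simp
next
  case False
  define u where "u = cnj (I f) / cmod (I f)"
  have u: "cmod u = 1" "u * I f = cmod (I f)"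
    using False by (simp_all add: u_def norm_divide complex_norm_square[symmetric] power2_eq_square
        mult.commute[of "cnj _"])
  have nn: "0 \<le> g x - Re (u * f x)" for x
    using le[of x] complex_Re_le_cmod[of "u * f x"] u(1) by (simp add: norm_mult)
  have uf: "continuous_on UNIV (\<lambda>x. u * f x)" by (intro continuous_intros f)
  have "0 \<le> Re (I (\<lambda>x. of_real (g x - Re (u * f x))))"
    by (intro haar_functional_nonneg(2) nn continuous_intros f g)
  also have "I (\<lambda>x. of_real (g x - Re (u * f x)))
      = I (\<lambda>x. of_real (g x) + (-1) * of_real (Re (u * f x)))"
    by (rule arg_cong[of _ _ I]) (simp only: fun_eq_iff of_real_diff, simp)
  also have "\<dots> = I (\<lambda>x. of_real (g x)) + (-1) * I (\<lambda>x. of_real (Re (u * f x)))"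
    by (subst haar_functional_add, (intro continuous_intros f g)+, subst haar_functional_cmult)
      (auto intro!: continuous_intros f)
  also have "I (\<lambda>x. of_real (Re (u * f x))) = of_real (Re (I (\<lambda>x. u * f x)))"
    by (rule haar_functional_Re(1)[OF c uf])
  also have "I (\<lambda>x. u * f x) = cmod (I f)" using u(2) by (simp add: haar_functional_cmult f)
  finally show ?thesis by simp
qed

end

text \<open>By invariance I takes the same value on f and on each of its left averages, and some of
  these are uniformly close to the constant m. Hence the mean determines the integral, and every
  invariant functional agrees with it.\<close>

lemma haar_functional_left_mean:
  fixes f :: "'a::topological_group_add \<Rightarrow> real"
  assumes c: "compact (UNIV :: 'a set)" and I: "is_haar_integral I" 
    and f: "continuous_on UNIV f" and m: "left_mean f m"
  shows "I (\<lambda>x. of_real (f x)) = of_real m"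
proof -
  let ?J = "I (\<lambda>x. of_real (f x))"
  have "cmod (?J - of_real m) \<le> e" if e: "e > 0" for e
  proof -
    obtain xs where xs: "xs \<noteq> []" "\<And>x. \<bar>left_avg xs f x - m\<bar> \<le> e"
      using m e unfolding left_mean_def by blast
    define F :: "'a \<Rightarrow> complex" where "F = (\<lambda>x. of_real (left_avg xs f x))"
    have ca: "continuous_on UNIV (\<lambda>x. complex_of_real (f (a + x)))" for a
      by (intro continuous_intros left_translate_continuous f)
    have "continuous_on UNIV (\<lambda>x. \<Sum>a\<leftarrow>ys. complex_of_real (f (a + x)))
        \<and> I (\<lambda>x. \<Sum>a\<leftarrow>ys. of_real (f (a + x))) = of_nat (length ys) * ?J" for ys
    proof (induction ys)
      case Nil
      then show ?case using haar_functional_const[OF I, of 0] by simp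
    next
      case (Cons a ys)
      have "I (\<lambda>x. of_real (f (a + x))) = ?J"
        by (rule haar_functional_translate[OF I, of "\<lambda>x. of_real (f x)"]) (intro continuous_intros f)
      with Cons ca show ?case
        by (auto simp: haar_functional_add[OF I] algebra_simps intro!: continuous_intros)
    qed
    note S = conjunct1[OF this] conjunct2[OF this]
    have F: "F = (\<lambda>x. inverse (of_nat (length xs)) * (\<Sum>a\<leftarrow>xs. of_real (f (a + x))))"
    proof -
      have "(\<Sum>a\<leftarrow>ys. complex_of_real (f (a + x))) = of_real (\<Sum>a\<leftarrow>ys. f (a + x))" for ys x
        by (induction ys) auto
      then show ?thesis
        unfolding F_def left_avg_def by (auto simp: field_simps)
    qed
    have IF: "I F = ?J"
      unfolding F using xs(1) by (subst haar_functional_cmult[OF I]) (auto simp: S)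
    have cF: "continuous_on UNIV F" unfolding F by (intro continuous_intros S)
    have "I (\<lambda>x. F x + - of_real m) = ?J + - of_real m"
      using cF by (subst haar_functional_add[OF I]) (auto simp: IF haar_functional_const[OF I])
    moreover have "cmod (I (\<lambda>x. F x + - of_real m)) \<le> Re (I (\<lambda>x. of_real e))"
    proof (rule haar_functional_norm_le[OF I c])
      fix x
      have "F x + - of_real m = of_real (left_avg xs f x - m)" by (simp add: F_def)
      then show "cmod (F x + - of_real m) \<le> e" using xs(2)[of x] by (metis norm_of_real)
    qed (intro continuous_intros cF)+
    ultimately show ?thesis by (simp add: haar_functional_const[OF I])
  qed
  then have "cmod (?J - of_real m) \<le> 0" using field_le_epsilon[of "cmod (?J - of_real m)" 0] by simp
  then show ?thesis by simp
qed

lemma haar_functional_unique: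
  fixes f :: "'a::topological_group_add \<Rightarrow> complex"
  assumes c: "compact (UNIV :: 'a set)" and I: "is_haar_integral I" and J: "is_haar_integral J"
    and f: "continuous_on UNIV f"
  shows "I f = J f"
proof -
  interpret compact_group "TYPE('a)" by unfold_locales (rule c)
  have *: "I (\<lambda>x. of_real (g x)) = J (\<lambda>x. of_real (g x))" if g: "continuous_on UNIV g" for g :: "'a \<Rightarrow> real"
    using left_mean_exists[OF g] haar_functional_left_mean[OF c I g] haar_functional_left_mean[OF c J g]
    by metis
  have "complex_of_real (Re (I f)) = of_real (Re (J f))" "complex_of_real (Im (I f)) = of_real (Im (J f))"
    using *[of "\<lambda>x. Re (f x)"] *[of "\<lambda>x. Im (f x)"] f
    by (simp_all add: haar_functional_Re[OF I c f, symmetric] haar_functional_Re[OF J c f, symmetric]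
        continuous_intros)
  then show ?thesis by (simp add: complex_eq_iff)
qed

context compact_group
begin

lemma is_haar: "is_haar_integral (haar_integral :: ('a \<Rightarrow> complex) \<Rightarrow> complex)"
  unfolding haar_integral_def by (rule someI_ex[OF haar_integral_exists])

lemmas haar_add = haar_functional_add[OF is_haar]
lemmas haar_cmult = haar_functional_cmult[OF is_haar]
lemmas haar_const = haar_functional_const[OF is_haar]
lemmas haar_translate = haar_functional_translate[OF is_haar]
lemmas haar_sum = haar_functional_sum[OF is_haar]
lemmas haar_nonneg = haar_functional_nonneg[OF is_haar]
lemmas haar_Re = haar_functional_Re[OF is_haar compact_UNIV]
lemmas haar_norm_le = haar_functional_norm_le[OF is_haar compact_UNIV]

lemma haar_unique:
  fixes f :: "'a \<Rightarrow> complex"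
  shows "is_haar_integral I \<Longrightarrow> continuous_on UNIV f \<Longrightarrow> I f = haar_integral f"
  using haar_functional_unique[OF compact_UNIV _ is_haar] by blast

lemma haar_nonneg_Reals:
  fixes f :: "'a \<Rightarrow> complex"
  shows "continuous_on UNIV f \<Longrightarrow> (\<And>x. f x \<in> \<real>\<^sub>\<ge>\<^sub>0) \<Longrightarrow> haar_integral f \<in> \<real>\<^sub>\<ge>\<^sub>0"
  using is_haar unfolding is_haar_integral_def by blast

lemma haar_multc:
  fixes f :: "'a \<Rightarrow> complex"
  shows "continuous_on UNIV f \<Longrightarrow> haar_integral (\<lambda>x. f x * c) = haar_integral f * c"
  using haar_cmult[of f c] by (simp add: mult.commute)

lemma haar_diff:
  fixes f g :: "'a \<Rightarrow> complex"
  assumes "continuous_on UNIV f" "continuous_on UNIV g"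
  shows "haar_integral (\<lambda>x. f x - g x) = haar_integral f - haar_integral g"
  using haar_add[of f "\<lambda>x. (-1) * g x"] haar_cmult[of g "-1"] assms
  by (simp add: continuous_intros)

lemma haar_cnj:
  fixes f :: "'a \<Rightarrow> complex"
  assumes f: "continuous_on UNIV f"
  shows "haar_integral (\<lambda>x. cnj (f x)) = cnj (haar_integral f)"
proof -
  have c: "continuous_on UNIV (\<lambda>x. cnj (f x))" by (intro continuous_intros f)
  have "complex_of_real (Re (haar_integral (\<lambda>x. cnj (f x)))) = of_real (Re (haar_integral f))"
    using haar_Re(1)[OF c] haar_Re(1)[OF f] by simp
  moreover have "of_real (Im (haar_integral (\<lambda>x. cnj (f x)))) = haar_integral (\<lambda>x. (-1) * of_real (Im (f x)))"
    using haar_Re(2)[OF c] by simp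
  moreover have "haar_integral (\<lambda>x. (-1) * of_real (Im (f x))) = - complex_of_real (Im (haar_integral f))"
    using haar_Re(2)[OF f] f by (subst haar_cmult) (auto intro!: continuous_intros)
  ultimately show ?thesis by (simp add: complex_eq_iff)
qed

lemma haar_bound:
  fixes f :: "'a \<Rightarrow> complex"
  assumes "continuous_on UNIV f" "\<And>x. cmod (f x) \<le> M"
  shows "cmod (haar_integral f) \<le> M"
  using haar_norm_le[OF assms(1) continuous_on_const[of UNIV M] assms(2)] by (simp add: haar_const)

text \<open>Integrating a right translate is again a normalised positive left-invariant functional,
  so uniqueness applies: compact groups are unimodular. Inversion is handled in the same way below,
  with right invariance as input.\<close>

lemma haar_translate_right:
  fixes f :: "'a \<Rightarrow> complex"
  assumes f: "continuous_on UNIV f"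
  shows "haar_integral (\<lambda>x. f (x + a)) = haar_integral f"
proof -
  have "is_haar_integral (\<lambda>f :: 'a \<Rightarrow> complex. haar_integral (\<lambda>x. f (x + a)))"
    unfolding is_haar_integral_def
    using haar_translate[OF right_translate_continuous[of _ a]]
    by (auto simp: haar_add haar_cmult haar_const right_translate_continuous add.assoc
      intro!: haar_nonneg_Reals)
  from haar_unique[OF this f] show ?thesis by simp
qed

lemma haar_uminus:
  fixes f :: "'a \<Rightarrow> complex"
  assumes f: "continuous_on UNIV f"
  shows "haar_integral (\<lambda>x. f (- x)) = haar_integral f"
proof -
  have tr: "haar_integral (\<lambda>x. g (a + - x)) = haar_integral (\<lambda>x. g (- x))"
    if "continuous_on UNIV g" for g :: "'a \<Rightarrow> complex" and a
    using haar_translate_right[OF uminus_continuous[OF that], of "- a"] by (simp add: minus_add)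
  have "is_haar_integral (\<lambda>f :: 'a \<Rightarrow> complex. haar_integral (\<lambda>x. f (- x)))"
    unfolding is_haar_integral_def using tr
    by (auto simp: haar_add haar_cmult haar_const uminus_continuous intro!: haar_nonneg_Reals)
  from haar_unique[OF this f] show ?thesis by simp
qed

text \<open>Finitely many translates of f add up to at least f x0 / 2 everywhere, because the set
  where f exceeds f x0 / 2 is open and its translates cover the group. All these translates have the
  same integral.\<close>

lemma haar_pos:
  fixes f :: "'a \<Rightarrow> real"
  assumes f: "continuous_on UNIV f" and nn: "\<And>x. f x \<ge> 0" and x0: "f x0 > 0"
  shows "Re (haar_integral (\<lambda>x. of_real (f x))) > 0"
proof -
  define V where "V = {v. f (x0 + v) > f x0 / 2}"
  have "open V" unfolding V_def
    by (intro open_Collect_less continuous_intros left_translate_continuous f)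
  moreover have "0 \<in> V" using x0 by (simp add: V_def)
  ultimately obtain cs where cs: "cs \<noteq> []" "\<And>x. \<exists>c\<in>set cs. - c + x \<in> V"
    using finite_translates_cover by blast
  let ?h = "\<lambda>c x. f (x0 + - c + x)"
  have ch: "continuous_on UNIV (\<lambda>x. f (x0 - c + x))" for c by (intro left_translate_continuous f)
  have ge: "f x0 / 2 \<le> (\<Sum>c\<in>set cs. ?h c x)" for x
  proof -
    obtain c where c: "c \<in> set cs" "- c + x \<in> V" using cs by blast
    have "f x0 / 2 \<le> ?h c x" using c(2) by (simp add: V_def add.assoc[symmetric])
    also have "\<dots> \<le> (\<Sum>c\<in>set cs. ?h c x)" using c(1) nn by (intro member_le_sum) (auto simp del: add_uminus_conv_diff)
    finally show ?thesis .
  qed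
  have "f x0 / 2 = cmod (haar_integral (\<lambda>x::'a. of_real (f x0 / 2)))" using x0 by (simp add: haar_const)
  also have "\<dots> \<le> Re (haar_integral (\<lambda>x. of_real (\<Sum>c\<in>set cs. ?h c x)))"
    by (rule haar_norm_le) (use ge x0 in \<open>auto intro!: continuous_intros ch\<close>)
  also have "\<dots> = Re (\<Sum>c\<in>set cs. haar_integral (\<lambda>x. of_real (?h c x)))"
    by (simp only: of_real_sum, subst haar_sum) (auto intro!: continuous_intros ch)
  also have "\<dots> = Re (\<Sum>c\<in>set cs. haar_integral (\<lambda>x. of_real (f x)))"
    by (subst haar_translate[of "\<lambda>x. of_real (f x)"]) (auto intro!: continuous_intros f)
  finally have "0 < card (set cs) * Re (haar_integral (\<lambda>x. of_real (f x)))" using x0 by simp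
  then show ?thesis by (simp add: zero_less_mult_iff)
qed

text \<open>Compactness of the integration variable gives a neighbourhood of y on which F z and F y
  differ by at most e / 2 uniformly.\<close>

lemma haar_param_continuous:
  fixes F :: "'b::topological_space \<Rightarrow> 'a \<Rightarrow> complex"
  assumes F: "continuous_on UNIV (\<lambda>(y, x). F y x)"
  shows "continuous_on UNIV (\<lambda>y. haar_integral (F y))"
proof -
  have Fy: "continuous_on UNIV (F y)" for y
    using continuous_on_compose2[OF F, of UNIV "\<lambda>x. (y, x)"]
    by (simp add: continuous_on_Pair continuous_on_const continuous_on_id)
  show ?thesis
    unfolding continuous_on_def
  proof (intro ballI tendstoI)
    fix y :: 'b and e :: real assume e: "e > 0"
    have F': "continuous_on (UNIV \<times> UNIV) (\<lambda>(y, x). F y x)" using F by simp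
    have e2: "e / 2 > 0" using e by simp
    obtain X0 where X0: "y \<in> X0" "open X0"
      "\<forall>x\<in>X0 \<inter> UNIV. \<forall>t\<in>UNIV. dist (case (x, t) of (y, x) \<Rightarrow> F y x) (case (y, t) of (y, x) \<Rightarrow> F y x) \<le> e / 2"
      by (rule continuous_on_prod_compactE[OF F' compact_UNIV UNIV_I[of y] e2])
    have "dist (haar_integral (F z)) (haar_integral (F y)) < e" if z: "z \<in> X0" for z
    proof -
      have "cmod (haar_integral (\<lambda>x. F z x - F y x)) \<le> e / 2"
        using X0(3) z by (intro haar_bound continuous_intros Fy) (auto simp: dist_norm)
      then show ?thesis using e by (simp add: haar_diff Fy dist_norm)
    qed
    then show "\<forall>\<^sub>F z in at y within UNIV. dist (haar_integral (F z)) (haar_integral (F y)) < e"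
      using X0(1,2) by (auto simp: eventually_at_topological)
  qed
qed

text \<open>Both iterated integrals are normalised positive left-invariant functionals on the
  product group, and uniqueness there identifies them.\<close>

lemma haar_fubini:
  fixes F :: "'a \<Rightarrow> 'a \<Rightarrow> complex"
  assumes F: "continuous_on UNIV (\<lambda>(x, y). F x y)"
  shows "haar_integral (\<lambda>x. haar_integral (\<lambda>y. F x y)) = haar_integral (\<lambda>y. haar_integral (\<lambda>x. F x y))"
proof -
  let ?I = "\<lambda>F :: 'a \<times> 'a \<Rightarrow> complex. haar_integral (\<lambda>x. haar_integral (\<lambda>y. F (x, y)))"
  let ?J = "\<lambda>F :: 'a \<times> 'a \<Rightarrow> complex. haar_integral (\<lambda>y. haar_integral (\<lambda>x. F (x, y)))"
  have c1: "continuous_on UNIV (\<lambda>y. f (x, y))" and c2: "continuous_on UNIV (\<lambda>x. f (x, y))"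
    if f: "continuous_on UNIV f" for f :: "'a \<times> 'a \<Rightarrow> complex" and x y
    by (intro continuous_on_compose2[OF f] continuous_intros; simp)+
  have c3: "continuous_on UNIV (\<lambda>x. haar_integral (\<lambda>y. f (x, y)))"
    if f: "continuous_on UNIV f" for f :: "'a \<times> 'a \<Rightarrow> complex"
    by (rule haar_param_continuous) (simp add: f)
  have swap: "continuous_on UNIV (\<lambda>(x, y). f (y, x))"
    if f: "continuous_on UNIV f" for f :: "'a \<times> 'a \<Rightarrow> complex"
    unfolding case_prod_beta by (intro continuous_on_compose2[OF f] continuous_intros; simp)
  have c4: "continuous_on UNIV (\<lambda>y. haar_integral (\<lambda>x. f (x, y)))"
    if f: "continuous_on UNIV f" for f :: "'a \<times> 'a \<Rightarrow> complex"
    by (rule haar_param_continuous) (rule swap[OF f])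
  have I: "is_haar_integral ?I"
    unfolding is_haar_integral_def
  proof (intro conjI allI impI)
    fix a :: "'a \<times> 'a" and f :: "'a \<times> 'a \<Rightarrow> complex" assume f: "continuous_on UNIV f"
    have "haar_integral (\<lambda>y. f (fst a + x, snd a + y)) = haar_integral (\<lambda>y. f (fst a + x, y))" for x
      by (rule haar_translate[OF c1[OF f]])
    then show "?I (\<lambda>x. f (a + x)) = ?I f"
      by (simp add: plus_prod_def haar_translate[OF c3[OF f]])
  qed (auto simp: haar_add haar_cmult haar_const c1 c3 intro!: haar_nonneg_Reals)
  have J: "is_haar_integral ?J"
    unfolding is_haar_integral_def
  proof (intro conjI allI impI)
    fix a :: "'a \<times> 'a" and f :: "'a \<times> 'a \<Rightarrow> complex" assume f: "continuous_on UNIV f"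
    have "haar_integral (\<lambda>x. f (fst a + x, snd a + y)) = haar_integral (\<lambda>x. f (x, snd a + y))" for y
      by (rule haar_translate[OF c2[OF f]])
    then show "?J (\<lambda>x. f (a + x)) = ?J f"
      by (simp add: plus_prod_def haar_translate[OF c4[OF f]])
  qed (auto simp: haar_add haar_cmult haar_const c2 c4 intro!: haar_nonneg_Reals)
  have "compact (UNIV :: ('a \<times> 'a) set)"
    using compact_Times[OF compact_UNIV compact_UNIV] by simp
  from haar_functional_unique[OF this I J F] show ?thesis by simp
qed

end

text \<open>An elementary form of the spectral radius argument. By log-convexity the ratios
  \<open>r n\<close> increase; together with the bound along doublings this gives
  \<open>r m ^ n \<le> a n\<close> for all m and n. So the ratios converge to some s with
  \<open>s ^ n \<le> a n\<close>, and the quotients \<open>a n / s ^ n\<close> decrease. In the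
  application a n is the squared norm of the n-th convolution power of a Hermitian function.\<close>

lemma log_convex_growth:
  fixes a :: "nat \<Rightarrow> real"
  assumes pos: "\<And>n. n \<ge> 1 \<Longrightarrow> a n > 0"
    and lc: "\<And>n. n \<ge> 1 \<Longrightarrow> (a (n + 1))\<^sup>2 \<le> a n * a (n + 2)"
    and sub: "\<And>n. n \<ge> 1 \<Longrightarrow> a (2 * n) \<le> (a n)\<^sup>2"
  obtains s where "s > 0" "\<And>n. n \<ge> 1 \<Longrightarrow> s ^ n \<le> a n" "convergent (\<lambda>n. a n / s ^ n)"
proof -
  define r where "r n = a (n + 1) / a n" for n
  have rpos: "r n > 0" if "n \<ge> 1" for n using pos[of n] pos[of "n + 1"] that by (simp add: r_def)
  have step: "r n \<le> r (Suc n)" if "n \<ge> 1" for n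
    using lc[OF that] pos[of n] pos[of "n + 1"] that
    by (simp add: r_def frac_le_eq field_simps power2_eq_square)
  have mono: "r m \<le> r n" if "1 \<le> m" "m \<le> n" for m n
    using that(2,1) by (induction rule: dec_induct) (auto intro: order_trans[OF _ step])
  have grow: "a n * r n ^ k \<le> a (n + k)" if n: "n \<ge> 1" for n k
  proof (induction k)
    case (Suc k)
    have "a n * r n ^ Suc k = (a n * r n ^ k) * r n" by simp
    also have "\<dots> \<le> a (n + k) * r (n + k)"
      using Suc n rpos[OF n] pos[of "n + k"] by (intro mult_mono mono) auto
    also have "\<dots> = a (n + Suc k)" using pos[of "n + k"] n by (simp add: r_def)
    finally show ?case .
  qed simp
  have rn: "r n ^ n \<le> a n" if n: "n \<ge> 1" for n
  proof -
    have "a n * r n ^ n \<le> a n * a n"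
      using grow[OF n, of n] sub[OF n] by (simp add: mult_2 power2_eq_square)
    then show ?thesis using pos[OF n] by simp
  qed
  have pow: "a (2 ^ j * n) \<le> a n ^ (2 ^ j)" if n: "n \<ge> 1" for n j
  proof (induction j)
    case (Suc j)
    have "a (2 ^ Suc j * n) \<le> (a (2 ^ j * n))\<^sup>2"
      using sub[of "2 ^ j * n"] n by (simp add: mult.assoc)
    also have "\<dots> \<le> (a n ^ (2 ^ j))\<^sup>2"
      using Suc pos[of "2 ^ j * n"] n by (intro power_mono) auto
    finally show ?case by (simp add: power_mult[symmetric] mult.commute)
  qed simp
  have rpow: "r m ^ n \<le> a n" if m: "m \<ge> 1" and n: "n \<ge> 1" for m n
  proof -
    \<comment> \<open>This index is at least m and is reached from n by doublings, so both sides
      become powers with exponent 2 ^ m and the root can be taken.\<close>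
    let ?k = "2 ^ m * n"
    have "m \<le> ?k" using n less_exp[of m] by (metis le_trans less_imp_le mult_le_mono2 mult.right_neutral)
    then have "r m ^ n \<le> r ?k ^ n" using m rpos[OF m] by (intro power_mono mono) auto
    also have "r ?k ^ n \<le> a n"
    proof -
      have "(r ?k ^ n) ^ (2 ^ m) \<le> a ?k"
        using rn[of ?k] n by (simp add: power_mult[symmetric] mult.commute)
      also have "\<dots> \<le> a n ^ (2 ^ m)" by (rule pow[OF n])
      finally have "(r ?k ^ n) ^ (2 ^ m) \<le> a n ^ (2 ^ m)" .
      moreover have "0 \<le> r ?k ^ n" using rpos[of ?k] n by simp
      ultimately show ?thesis using pos[OF n] by (subst (asm) power_mono_iff) auto
    qed
    finally show ?thesis .
  qed
  have inc: "incseq (\<lambda>n. r (Suc n))" by (rule incseq_SucI) (use step in auto)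
  obtain s where s: "(\<lambda>n. r (Suc n)) \<longlonglongrightarrow> s" "\<And>n. r (Suc n) \<le> s"
    using incseq_convergent[OF inc, of "a 1"] rpow[of "Suc _" 1] by auto
  have spos: "s > 0" using s(2)[of 0] rpos[of "Suc 0"] by simp
  have sle: "s ^ n \<le> a n" if n: "n \<ge> 1" for n
    by (rule LIMSEQ_le_const2[OF tendsto_power[OF s(1)]]) (use rpow n in auto)
  have dec: "decseq (\<lambda>n. a (Suc n) / s ^ Suc n)"
  proof (rule decseq_SucI)
    fix n
    have "a (Suc (Suc n)) \<le> a (Suc n) * s"
      using s(2)[of n] pos[of "Suc n"] by (simp add: r_def field_simps)
    then show "a (Suc (Suc n)) / s ^ Suc (Suc n) \<le> a (Suc n) / s ^ Suc n"
      using spos by (simp add: field_simps)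
  qed
  have nn: "0 \<le> a (Suc n) / s ^ Suc n" for n
    using pos[of "Suc n"] spos by (simp add: less_imp_le)
  obtain L where L: "(\<lambda>n. a (Suc n) / s ^ Suc n) \<longlonglongrightarrow> L"
    using decseq_convergent[OF dec, of 0] nn by blast
  have "convergent (\<lambda>n. a n / s ^ n)"
    using LIMSEQ_imp_Suc[of "\<lambda>n. a n / s ^ n", OF L] by (rule convergentI)
  with spos sle show ?thesis by (rule that)
qed

section \<open>Convolution\<close>

definition ip :: "('a::topological_group_add \<Rightarrow> complex) \<Rightarrow> ('a \<Rightarrow> complex) \<Rightarrow> complex" where
  "ip f g = haar_integral (\<lambda>x. f x * cnj (g x))"

definition sqnorm :: "('a::topological_group_add \<Rightarrow> complex) \<Rightarrow> real" where
  "sqnorm f = Re (haar_integral (\<lambda>x. of_real ((cmod (f x))\<^sup>2)))"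

definition conv :: "('a::topological_group_add \<Rightarrow> complex) \<Rightarrow> ('a \<Rightarrow> complex) \<Rightarrow> 'a \<Rightarrow> complex" where
  "conv u v x = haar_integral (\<lambda>y. u y * v (- y + x))"

text \<open>The involution of the group algebra. A function fixed by it gives a self-adjoint
  convolution operator, and \<open>conv u (star v) 0\<close> is the inner product of u and
  v.\<close>

definition star :: "('a::topological_group_add \<Rightarrow> complex) \<Rightarrow> 'a \<Rightarrow> complex" where
  "star f x = cnj (f (- x))"

lemma mult_cnj_self: "z * cnj z = of_real ((cmod z)\<^sup>2)" "cnj z * z = of_real ((cmod z)\<^sup>2)"
  by (simp_all only: complex_norm_square mult.commute)

lemma star_continuous: "continuous_on UNIV f \<Longrightarrow> continuous_on UNIV (star f)"
  unfolding star_def[abs_def] by (intro continuous_intros uminus_continuous)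

context compact_group
begin

lemma ip_self:
  fixes f :: "'a \<Rightarrow> complex"
  assumes "continuous_on UNIV f"
  shows "ip f f = of_real (sqnorm f)"
proof -
  have "haar_integral (\<lambda>x. of_real ((cmod (f x))\<^sup>2)) = of_real (sqnorm f)"
    unfolding sqnorm_def by (rule haar_nonneg(1)) (auto intro!: continuous_intros assms)
  then show ?thesis by (simp add: ip_def mult_cnj_self)
qed

lemma sqnorm_nonneg: "continuous_on UNIV f \<Longrightarrow> 0 \<le> sqnorm (f :: 'a \<Rightarrow> complex)"
  unfolding sqnorm_def by (rule haar_nonneg(2)) (auto intro!: continuous_intros)

lemma sqnorm_pos:
  fixes f :: "'a \<Rightarrow> complex"
  assumes "continuous_on UNIV f" "f x \<noteq> 0"
  shows "0 < sqnorm f"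
  unfolding sqnorm_def by (rule haar_pos[of _ x]) (use assms in \<open>auto intro!: continuous_intros\<close>)

lemma sqnorm_bound:
  fixes f :: "'a \<Rightarrow> complex"
  assumes "continuous_on UNIV f" "\<And>x. cmod (f x) \<le> M"
  shows "sqnorm f \<le> M\<^sup>2"
proof -
  have "cmod (haar_integral (\<lambda>x. of_real ((cmod (f x))\<^sup>2))) \<le> M\<^sup>2"
    by (rule haar_bound) (use assms in \<open>auto intro!: continuous_intros power_mono simp: norm_power\<close>)
  then show ?thesis unfolding sqnorm_def using complex_Re_le_cmod order_trans by blast
qed

lemma ip_diff_left:
  fixes f g h :: "'a \<Rightarrow> complex"
  assumes "continuous_on UNIV f" "continuous_on UNIV g" "continuous_on UNIV h"
  shows "ip (\<lambda>x. f x - g x) h = ip f h - ip g h"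
  unfolding ip_def using assms
  by (simp add: left_diff_distrib haar_diff continuous_intros)

lemma ip_diff_right:
  fixes f g h :: "'a \<Rightarrow> complex"
  assumes "continuous_on UNIV f" "continuous_on UNIV g" "continuous_on UNIV h"
  shows "ip h (\<lambda>x. f x - g x) = ip h f - ip h g"
  unfolding ip_def using assms
  by (simp add: right_diff_distrib haar_diff continuous_intros)

lemma ip_cmult_left:
  fixes f g :: "'a \<Rightarrow> complex"
  assumes "continuous_on UNIV f" "continuous_on UNIV g"
  shows "ip (\<lambda>x. c * f x) g = c * ip f g"
  unfolding ip_def using assms haar_cmult[of "\<lambda>x. f x * cnj (g x)" c]
  by (simp add: mult.assoc continuous_intros)

lemma ip_cnj:
  fixes f g :: "'a \<Rightarrow> complex"
  assumes "continuous_on UNIV f" "continuous_on UNIV g"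
  shows "cnj (ip f g) = ip g f"
  unfolding ip_def using assms
  by (simp add: haar_cnj[symmetric] continuous_intros mult.commute)

lemma ip_cmult_right:
  fixes f g :: "'a \<Rightarrow> complex"
  assumes "continuous_on UNIV f" "continuous_on UNIV g"
  shows "ip f (\<lambda>x. c * g x) = cnj c * ip f g"
  unfolding ip_def using assms haar_cmult[of "\<lambda>x. f x * cnj (g x)" "cnj c"]
  by (simp add: mult_ac continuous_intros)

lemma ip_sum_left:
  fixes f :: "'i \<Rightarrow> 'a \<Rightarrow> complex"
  assumes "\<And>i. i \<in> F \<Longrightarrow> continuous_on UNIV (f i)" "continuous_on UNIV g"
  shows "ip (\<lambda>x. \<Sum>i\<in>F. f i x) g = (\<Sum>i\<in>F. ip (f i) g)"
  unfolding ip_def using assms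
  by (simp add: sum_distrib_right haar_sum continuous_intros)

lemma ip_sum_right:
  fixes f :: "'i \<Rightarrow> 'a \<Rightarrow> complex"
  assumes "\<And>i. i \<in> F \<Longrightarrow> continuous_on UNIV (f i)" "continuous_on UNIV g"
  shows "ip g (\<lambda>x. \<Sum>i\<in>F. f i x) = (\<Sum>i\<in>F. ip g (f i))"
  unfolding ip_def using assms
  by (simp add: sum_distrib_left haar_sum continuous_intros)

lemma sqnorm_diff_cmult:
  fixes f g :: "'a \<Rightarrow> complex"
  assumes f: "continuous_on UNIV f" and g: "continuous_on UNIV g"
  shows "sqnorm (\<lambda>x. a * f x - b * g x)
    = (cmod a)\<^sup>2 * sqnorm f - 2 * Re (a * cnj b * ip f g) + (cmod b)\<^sup>2 * sqnorm g"
proof -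
  have af: "continuous_on UNIV (\<lambda>x. a * f x)" and bg: "continuous_on UNIV (\<lambda>x. b * g x)"
    by (intro continuous_intros f g)+
  have "of_real (sqnorm (\<lambda>x. a * f x - b * g x)) = ip (\<lambda>x. a * f x - b * g x) (\<lambda>x. a * f x - b * g x)"
    by (rule ip_self[symmetric]) (intro continuous_intros f g)
  also have "\<dots> = a * cnj a * ip f f - a * cnj b * ip f g - (b * cnj a * cnj (ip f g) - b * cnj b * ip g g)"
    using f g af bg
    by (simp add: ip_diff_left ip_diff_right ip_cmult_left ip_cmult_right ip_cnj continuous_intros algebra_simps)
  finally have *: "complex_of_real (sqnorm (\<lambda>x. a * f x - b * g x)) =
      of_real ((cmod a)\<^sup>2 * sqnorm f) - (a * cnj b * ip f g + cnj (a * cnj b * ip f g)) + of_real ((cmod b)\<^sup>2 * sqnorm g)"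
    by (simp add: ip_self f g mult_cnj_self mult_ac)
  show ?thesis
    using arg_cong[OF *, of Re] by (simp add: algebra_simps)
qed

lemma cauchy_schwarz:
  fixes f g :: "'a \<Rightarrow> complex"
  assumes f: "continuous_on UNIV f" and g: "continuous_on UNIV g"
  shows "(cmod (ip f g))\<^sup>2 \<le> sqnorm f * sqnorm g"
proof (cases "sqnorm g = 0")
  case True
  then have "g x = 0" for x using sqnorm_pos[OF g, of x] by fastforce
  then have "ip f g = 0" by (simp add: ip_def haar_const)
  with True show ?thesis by simp
next
  case False
  then have pos: "sqnorm g > 0" using sqnorm_nonneg[OF g] by simp
  let ?z = "ip f g"
  have "0 \<le> sqnorm (\<lambda>x. of_real (sqnorm g) * f x - ?z * g x)"
    by (intro sqnorm_nonneg continuous_intros f g)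
  also have "\<dots> = (sqnorm g)\<^sup>2 * sqnorm f - 2 * Re (of_real (sqnorm g) * cnj ?z * ?z) + (cmod ?z)\<^sup>2 * sqnorm g"
    by (subst sqnorm_diff_cmult[OF f g]) (simp add: sqnorm_nonneg[OF g])
  also have "of_real (sqnorm g) * cnj ?z * ?z = of_real (sqnorm g * (cmod ?z)\<^sup>2)"
    by (simp add: mult.assoc mult_cnj_self)
  finally have "0 \<le> sqnorm g * (sqnorm g * sqnorm f - (cmod ?z)\<^sup>2)"
    by (simp add: algebra_simps power2_eq_square)
  then show ?thesis using pos by (simp add: zero_le_mult_iff mult.commute)
qed

lemma conv_integrand_continuous:
  fixes u v :: "'a \<Rightarrow> complex"
  assumes "continuous_on UNIV u" "continuous_on UNIV v"
  shows "continuous_on UNIV (\<lambda>y. u y * v (- y + x))"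
  by (intro continuous_intros continuous_on_compose2[OF assms(2)] assms(1)) auto

lemma conv_continuous:
  fixes u v :: "'a \<Rightarrow> complex"
  assumes "continuous_on UNIV u" "continuous_on UNIV v"
  shows "continuous_on UNIV (conv u v)"
  unfolding conv_def[abs_def]
  by (rule haar_param_continuous)
    (auto simp: case_prod_beta intro!: continuous_intros continuous_on_compose2[OF assms(1)] continuous_on_compose2[OF assms(2)])

lemma conv_translate:
  fixes u v :: "'a \<Rightarrow> complex"
  assumes "continuous_on UNIV u" "continuous_on UNIV v"
  shows "conv u v x = haar_integral (\<lambda>y. u (x + y) * v (- y))"
  unfolding conv_def
  using haar_translate[OF conv_integrand_continuous[OF assms, of x], of x]
  by (simp add: minus_add add.assoc)

lemma conv_swap:
  fixes u v :: "'a \<Rightarrow> complex"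
  assumes "continuous_on UNIV u" "continuous_on UNIV v"
  shows "conv u v x = haar_integral (\<lambda>y. u (x - y) * v y)"
proof -
  have "continuous_on UNIV (\<lambda>y. u (x - y) * v y)"
    by (intro continuous_intros continuous_on_compose2[OF assms(1)] assms(2))
      (auto intro!: continuous_intros continuous_on_op_minus)
  from haar_uminus[OF this] show ?thesis by (simp add: conv_translate assms)
qed

lemma conv_eq_ip:
  fixes u v :: "'a \<Rightarrow> complex"
  assumes "continuous_on UNIV u" "continuous_on UNIV v"
  shows "conv u v x = ip u (\<lambda>y. cnj (v (- y + x)))"
  by (simp add: conv_def ip_def)

lemma sqnorm_reflect:
  fixes v :: "'a \<Rightarrow> complex"
  assumes v: "continuous_on UNIV v"
  shows "sqnorm (\<lambda>y. cnj (v (- y + x))) = sqnorm v"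
proof -
  have c: "continuous_on UNIV (\<lambda>y. complex_of_real ((cmod (v y))\<^sup>2))" by (intro continuous_intros v)
  show ?thesis
    unfolding sqnorm_def
    using haar_translate_right[OF c, of x] haar_uminus[OF right_translate_continuous[OF c, of x]]
    by simp
qed

text \<open>Cauchy-Schwarz at each point, since a reflected translate of v has the norm of v.
  Convolution thus turns convergence in mean square into uniform convergence; this is the
  compactness behind the existence of eigenfunctions.\<close>

lemma conv_bound:
  fixes u v :: "'a \<Rightarrow> complex"
  assumes u: "continuous_on UNIV u" and v: "continuous_on UNIV v"
  shows "(cmod (conv u v x))\<^sup>2 \<le> sqnorm u * sqnorm v"
proof -
  have "continuous_on UNIV (\<lambda>y. cnj (v (- y + x)))"
    by (intro continuous_intros continuous_on_compose2[OF v]) auto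
  from cauchy_schwarz[OF u this] show ?thesis
    by (simp add: conv_eq_ip assms sqnorm_reflect)
qed

lemma conv_assoc:
  fixes u v w :: "'a \<Rightarrow> complex"
  assumes u: "continuous_on UNIV u" and v: "continuous_on UNIV v" and w: "continuous_on UNIV w"
  shows "conv (conv u v) w = conv u (conv v w)"
proof
  fix x
  have "conv (conv u v) w x = haar_integral (\<lambda>y. haar_integral (\<lambda>z. u z * v (- z + y) * w (- y + x)))"
    unfolding conv_def by (simp add: haar_multc conv_integrand_continuous u v)
  also have "\<dots> = haar_integral (\<lambda>z. haar_integral (\<lambda>y. u z * v (- z + y) * w (- y + x)))"
    by (rule haar_fubini)
      (auto simp: case_prod_beta intro!: continuous_intros continuous_on_compose2[OF u]
        continuous_on_compose2[OF v] continuous_on_compose2[OF w])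
  also have "\<dots> = haar_integral (\<lambda>z. u z * conv v w (- z + x))"
  proof (rule arg_cong[of _ _ haar_integral], rule ext)
    fix z
    have "haar_integral (\<lambda>y. u z * v (- z + y) * w (- y + x)) = haar_integral (\<lambda>y. u z * (v (- z + y) * w (- y + x)))"
      by (simp add: mult.assoc)
    also have "\<dots> = u z * haar_integral (\<lambda>y. v (- z + y) * w (- y + x))"
      by (rule haar_cmult)
        (auto intro!: continuous_intros continuous_on_compose2[OF v] continuous_on_compose2[OF w])
    also have "haar_integral (\<lambda>y. v (- z + y) * w (- y + x)) = conv v w (- z + x)"
      unfolding conv_def
      using haar_translate[OF conv_integrand_continuous[OF v w, of "- z + x"], of "- z"]
      by (simp add: minus_add add.assoc)
    finally show "haar_integral (\<lambda>y. u z * v (- z + y) * w (- y + x)) = u z * conv v w (- z + x)" .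
  qed
  finally show "conv (conv u v) w x = conv u (conv v w) x" by (simp add: conv_def)
qed

lemma conv_cmult_right:
  fixes u v :: "'a \<Rightarrow> complex"
  assumes "continuous_on UNIV u" "continuous_on UNIV v"
  shows "conv u (\<lambda>x. c * v x) = (\<lambda>x. c * conv u v x)"
  unfolding conv_def[abs_def]
  using haar_cmult[OF conv_integrand_continuous[OF assms]] by (simp add: mult.left_commute)

lemma conv_diff_right:
  fixes u v w :: "'a \<Rightarrow> complex"
  assumes "continuous_on UNIV u" "continuous_on UNIV v" "continuous_on UNIV w"
  shows "conv u (\<lambda>x. v x - w x) = (\<lambda>x. conv u v x - conv u w x)"
  unfolding conv_def[abs_def]
  using haar_diff[OF conv_integrand_continuous[OF assms(1,2)] conv_integrand_continuous[OF assms(1,3)]]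
  by (simp add: right_diff_distrib)

lemma star_conv:
  fixes u v :: "'a \<Rightarrow> complex"
  assumes "continuous_on UNIV u" "continuous_on UNIV v"
  shows "star (conv u v) = conv (star v) (star u)"
proof
  fix x
  have "star (conv u v) x = haar_integral (\<lambda>y. cnj (u (- x + y) * v (- y)))"
    unfolding star_def conv_translate[OF assms]
    by (rule haar_cnj[symmetric])
      (auto intro!: continuous_intros continuous_on_compose2[OF assms(1)] continuous_on_compose2[OF assms(2)])
  then show "star (conv u v) x = conv (star v) (star u) x"
    by (simp add: conv_def star_def minus_add mult.commute)
qed

lemma conv_star_zero:
  fixes u v :: "'a \<Rightarrow> complex"
  shows "conv u (star v) 0 = ip u v"
  by (simp add: conv_def star_def ip_def)

end

section \<open>An eigenfunction of a Hermitian convolution operator by power iteration\<close>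

context compact_group
begin

text \<open>With T the self-adjoint operator of convolution by g, the function \<open>p n\<close> is
  T^n g. Scaled by powers of the growth rate s of the squared norms, the even convolution powers of
  g converge in mean square, because the squared norm of a difference is expressed by the convergent
  numbers \<open>b\<close>. One more convolution makes the convergence uniform; the limit P
  satisfies T (T P) = s P, and Re (P 0) is at least s, so P does not vanish.\<close>

lemma positive_eigenfunction:
  fixes g :: "'a \<Rightarrow> complex"
  assumes g: "continuous_on UNIV g" and herm: "star g = g" and g0: "g x0 \<noteq> 0"
  obtains s :: real and P where "s > 0" "continuous_on UNIV P" "P 0 \<noteq> 0"
    "conv (conv g g) P = (\<lambda>x. of_real s * P x)"
proof -
  define p where "p n = ((conv g) ^^ n) g" for n
  have p0: "p 0 = g" and pS: "p (Suc n) = conv g (p n)" for n by (simp_all add: p_def)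
  have c: "continuous_on UNIV (p n)" for n
    by (induction n) (simp_all add: p0 pS g conv_continuous)
  have pp: "conv (p m) (p n) = p (m + n + 1)" for m n
    by (induction m) (simp_all add: p0 pS g c conv_assoc)
  have st: "star (p n) = p n" for n
  proof (induction n)
    case (Suc n)
    then show ?case using pp[of n 0] by (simp add: pS p0 star_conv g c herm)
  qed (simp add: p0 herm)
  \<comment> \<open>All \<open>p n\<close> are Hermitian, so their inner products depend on the sum
    of the indices only, and are squared norms when that sum is even.\<close>
  have ipp: "ip (p m) (p n) = p (m + n + 1) 0" for m n
    using conv_star_zero[of "p m" "p n"] by (simp add: st pp)
  have sq: "of_real (sqnorm (p k)) = p (2 * k + 1) 0" for k
    using ipp[of k k] by (simp add: ip_self c mult_2)
  have ipk: "ip (p m) (p n) = of_real (sqnorm (p k))" if "m + n = 2 * k" for m n k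
    unfolding sq ipp using that by simp
  have lc: "(sqnorm (p (n + 1)))\<^sup>2 \<le> sqnorm (p n) * sqnorm (p (n + 2))" for n
  proof -
    have "ip (p n) (p (n + 2)) = of_real (sqnorm (p (n + 1)))" by (rule ipk) simp
    then show ?thesis using cauchy_schwarz[OF c c, of n "n + 2"] by (metis norm_of_real power2_abs)
  qed
  \<comment> \<open>Log-convexity carries positivity from m and m + 1 to m + 2. The start n = 1 is
    separate: the value of \<open>p 1\<close> at 0 is the squared norm of g.\<close>
  have pos: "sqnorm (p n) > 0" for n
  proof (induction n rule: nat_less_induct)
    case (1 n)
    consider "n = 0" | "n = 1" | m where "n = m + 2"
      by (metis add_2_eq_Suc' not0_implies_Suc One_nat_def)
    then show ?case
    proof cases
      case 1
      then show ?thesis using sqnorm_pos[OF g g0] by (simp add: p0)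
    next
      case 2
      have "p 1 0 \<noteq> 0" using sq[of 0] sqnorm_pos[OF g g0] by (auto simp: p0)
      then show ?thesis using sqnorm_pos[OF c, of 1 0] 2 by simp
    next
      case 3
      have "0 < (sqnorm (p (m + 1)))\<^sup>2" using "1" 3 by (simp add: order_less_imp_not_eq2)
      also have "\<dots> \<le> sqnorm (p m) * sqnorm (p (m + 2))" by (rule lc)
      finally show ?thesis using "1"[rule_format, of m] 3 by (simp add: zero_less_mult_iff)
    qed
  qed
  \<comment> \<open>The shift makes a n belong to the n-fold convolution power of g, so that a (2 n)
    <= (a n)^2 holds without an offset.\<close>
  define a where "a n = sqnorm (p (n - 1))" for n
  obtain s where s: "s > 0" "\<And>n. n \<ge> 1 \<Longrightarrow> s ^ n \<le> a n" "convergent (\<lambda>n. a n / s ^ n)"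
  proof (rule log_convex_growth[of a])
    fix n :: nat assume n: "n \<ge> 1"
    show "a n > 0" by (simp add: a_def pos)
    show "(a (n + 1))\<^sup>2 \<le> a n * a (n + 2)" using lc[of "n - 1"] n by (simp add: a_def)
    have "cmod (p (2 * n - 1) x) \<le> a n" for x
    proof -
      have "n - 1 + (n - 1) + 1 = 2 * n - 1" using n by simp
      then have "p (2 * n - 1) = conv (p (n - 1)) (p (n - 1))" by (simp only: pp)
      then have "(cmod (p (2 * n - 1) x))\<^sup>2 \<le> (a n)\<^sup>2"
        using conv_bound[OF c c, of "n - 1" "n - 1" x] by (simp add: a_def power2_eq_square)
      then show ?thesis by (rule power2_le_imp_le) (simp add: a_def pos less_imp_le)
    qed
    then show "a (2 * n) \<le> (a n)\<^sup>2" unfolding a_def[of "2 * n"] by (intro sqnorm_bound c)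
  qed blast
  define b where "b n = a n / s ^ n" for n
  obtain L where L: "b \<longlonglongrightarrow> L" using s(3) by (auto simp: b_def[abs_def] convergent_def)
  define t where "t n = complex_of_real (1 / s ^ (n + 1))" for n
  define u where "u n x = t n * p (2 * n + 1) x" for n x
  have cu: "continuous_on UNIV (u n)" for n unfolding u_def[abs_def] by (intro continuous_intros c)
  \<comment> \<open>Three terms of one convergent sequence with coefficients 1, -2, 1, which add up
    to 0: hence \<open>u\<close> is Cauchy in mean square.\<close>
  have sqd: "sqnorm (\<lambda>x. u m x - u n x) = b (2 * m + 2) - 2 * b (m + n + 2) + b (2 * n + 2)" for m n
  proof -
    have "ip (p (2 * m + 1)) (p (2 * n + 1)) = of_real (a (m + n + 2))"
      by (subst ipk[of _ _ "m + n + 1"]) (auto simp: a_def)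
    then have "t m * cnj (t n) * ip (p (2 * m + 1)) (p (2 * n + 1)) = of_real (b (m + n + 2))"
      by (simp add: t_def b_def power_add power2_eq_square)
    moreover have "(cmod (t k))\<^sup>2 * sqnorm (p (2 * k + 1)) = b (2 * k + 2)" for k
    proof -
      have "cmod (t k) = 1 / s ^ (k + 1)" unfolding t_def using s(1) by (simp add: norm_divide norm_mult norm_power)
      moreover have "s ^ (2 * k + 2) = (s ^ (k + 1))\<^sup>2" using power_mult[of s "k + 1" 2] by (simp add: mult.commute)
      ultimately show ?thesis by (simp add: b_def a_def power_divide)
    qed
    ultimately show ?thesis
      unfolding u_def sqnorm_diff_cmult[OF c c] by simp
  qed
  \<comment> \<open>The estimate for \<open>u\<close> is in mean square only; a further convolution
    with \<open>p 1\<close> makes the sequence uniformly Cauchy.\<close>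
  define H where "H n = conv (p 1) (u n)" for n
  have H_eq: "H n x = t n * p (2 * n + 3) x" for n x
    unfolding H_def u_def using c by (simp add: conv_cmult_right pp numeral_3_eq_3)
  have cH: "continuous_on UNIV (H n)" for n unfolding H_def by (intro conv_continuous c cu)
  have Hd: "(cmod (H m x - H n x))\<^sup>2 \<le> sqnorm (p 1) * sqnorm (\<lambda>x. u m x - u n x)" for m n x
  proof -
    have "conv (p 1) (\<lambda>x. u m x - u n x) x = H m x - H n x"
      by (simp add: H_def conv_diff_right c cu)
    with conv_bound[OF c[of 1], of "\<lambda>x. u m x - u n x" x] show ?thesis
      by (simp add: continuous_intros cu)
  qed
  have "\<exists>N. \<forall>m n x. N \<le> m \<and> N \<le> n \<and> True \<longrightarrow> dist (H m x) (H n x) < e" if e: "e > 0" for e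
  proof -
    define d where "d = e\<^sup>2 / (4 * sqnorm (p 1))"
    have d: "d > 0" using e pos[of 1] by (simp add: d_def)
    obtain N where N: "\<And>n. n \<ge> N \<Longrightarrow> \<bar>b n - L\<bar> < d"
      using LIMSEQ_D[OF L d] by auto
    have "dist (H m x) (H n x) < e" if "N \<le> m" "N \<le> n" for m n x
    proof -
      have "sqnorm (\<lambda>x. u m x - u n x) < 4 * d"
        using N[of "2 * m + 2"] N[of "m + n + 2"] N[of "2 * n + 2"] that by (simp add: sqd)
      then have "sqnorm (p 1) * sqnorm (\<lambda>x. u m x - u n x) < sqnorm (p 1) * (4 * d)"
        using pos[of 1] by simp
      also have "\<dots> = e\<^sup>2" using pos[of 1] by (simp add: d_def)
      finally have "(cmod (H m x - H n x))\<^sup>2 < e\<^sup>2" using Hd order_le_less_trans by blast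
      then show ?thesis using e by (simp add: dist_norm power2_less_imp_less)
    qed
    then show ?thesis by blast
  qed
  then obtain P where P: "\<forall>e>0. \<exists>N. \<forall>n x. N \<le> n \<and> True \<longrightarrow> dist (H n x) (P x) < e"
    using uniformly_convergent_eq_cauchy[of "\<lambda>_. True" H] by metis
  have ul: "uniform_limit UNIV H P sequentially"
    unfolding uniform_limit_iff eventually_sequentially using P by (metis UNIV_I)
  have cP: "continuous_on UNIV P"
    by (rule uniform_limit_theorem[OF _ ul]) (auto simp: cH)
  have Hlim: "(\<lambda>n. H n x) \<longlonglongrightarrow> P x" for x
    using tendsto_uniform_limitI[OF ul] by blast
  \<comment> \<open>The inequality \<open>s ^ n \<le> a n\<close> becomes a lower bound at the
    identity that survives the limit and keeps P from vanishing.\<close>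
  have "s \<le> Re (H n 0)" for n
  proof -
    have "p (2 * n + 3) 0 = of_real (a (n + 2))"
      using sq[of "n + 1"] by (simp add: a_def numeral_3_eq_3)
    then have "Re (H n 0) = a (n + 2) / s ^ (n + 1)" by (simp add: H_eq t_def)
    moreover have "s * s ^ (n + 1) \<le> a (n + 2)" using s(2)[of "n + 2"] by (simp add: power_add)
    ultimately show ?thesis using s(1) by (simp add: pos_le_divide_eq)
  qed
  then have "s \<le> Re (P 0)"
    by (intro LIMSEQ_le_const[OF tendsto_Re[OF Hlim]]) auto
  then have P0: "P 0 \<noteq> 0" using s(1) by auto
  have step: "conv (p 1) (H n) x = of_real s * H (Suc n) x" for n x
  proof -
    have "H n = (\<lambda>x. t n * p (2 * n + 3) x)" using H_eq by blast
    then have "conv (p 1) (H n) x = t n * p (2 * n + 5) x"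
      by (simp add: conv_cmult_right c pp add.commute)
    then show ?thesis using s(1) by (simp add: H_eq t_def field_simps)
  qed
  have "conv (p 1) P x = of_real s * P x" for x
  proof (rule LIMSEQ_unique)
    show "(\<lambda>n. conv (p 1) (H n) x) \<longlonglongrightarrow> of_real s * P x"
      unfolding step by (intro tendsto_intros LIMSEQ_Suc Hlim)
    show "(\<lambda>n. conv (p 1) (H n) x) \<longlonglongrightarrow> conv (p 1) P x"
    proof (rule LIMSEQ_I)
      fix e :: real assume e: "e > 0"
      define d where "d = e / (2 * sqrt (sqnorm (p 1)))"
      have d: "d > 0" using e pos[of 1] by (simp add: d_def)
      obtain N where N: "\<And>n x. N \<le> n \<Longrightarrow> dist (H n x) (P x) < d" using P d by meson
      have "cmod (conv (p 1) (H n) x - conv (p 1) P x) < e" if n: "N \<le> n" for n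
      proof -
        have "(cmod (conv (p 1) (H n) x - conv (p 1) P x))\<^sup>2 \<le> sqnorm (p 1) * sqnorm (\<lambda>x. H n x - P x)"
          using conv_bound[OF c[of 1], of "\<lambda>x. H n x - P x" x]
          by (simp add: conv_diff_right c cH cP continuous_intros)
        also have "\<dots> \<le> sqnorm (p 1) * d\<^sup>2"
        proof (rule mult_left_mono[OF sqnorm_bound])
          show "cmod (H n x - P x) \<le> d" for x using N[OF n, of x] by (simp add: dist_norm)
        qed (use pos[of 1] in \<open>auto intro!: continuous_intros cH cP\<close>)
        also have "\<dots> < e\<^sup>2" using pos[of 1] e by (simp add: d_def power_divide power_mult_distrib)
        finally show ?thesis using e by (simp add: power2_less_imp_less)
      qed
      then show "\<exists>N. \<forall>n\<ge>N. cmod (conv (p 1) (H n) x - conv (p 1) P x) < e" by blast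
    qed
  qed
  then have "conv (conv g g) P = (\<lambda>x. of_real s * P x)" by (simp add: pS p0 fun_eq_iff)
  with s(1) cP P0 show ?thesis by (rule that)
qed

end

section \<open>Matrix representations\<close>

lemma mat_mult_index:
  assumes "A \<in> carrier_mat n m" "B \<in> carrier_mat m k" "i < n" "j < k"
  shows "(A * B) $$ (i, j) = (\<Sum>l<m. A $$ (i, l) * B $$ (l, j))"
  using assms by (auto simp: scalar_prod_def atLeast0LessThan intro!: sum.cong)

lemma mat_vec_index:
  assumes "A \<in> carrier_mat n m" "v \<in> carrier_vec m" "i < n"
  shows "(A *\<^sub>v v) $ i = (\<Sum>l<m. A $$ (i, l) * v $ l)"
  using assms by (auto simp: scalar_prod_def atLeast0LessThan intro!: sum.cong)

lemma mat_adjoint_carrier: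
  "A \<in> carrier_mat n m \<Longrightarrow> mat_adjoint A \<in> carrier_mat m n"
  by (auto simp: mat_adjoint_def)

lemma mat_adjoint_index:
  fixes A :: "complex mat"
  assumes "A \<in> carrier_mat n m" "i < m" "j < n"
  shows "mat_adjoint A $$ (i, j) = cnj (A $$ (j, i))"
  using assms by (auto simp: mat_adjoint_def mat_of_rows_def conjugate_complex_def)

text \<open>Orthonormal columns suffice, since a left inverse of a square matrix is also a right
  inverse.\<close>

lemma unitary_matsI:
  assumes A: "A \<in> carrier_mat n n"
    and ort: "\<And>i j. i < n \<Longrightarrow> j < n \<Longrightarrow> (\<Sum>l<n. cnj (A $$ (l, i)) * A $$ (l, j)) = (if i = j then 1 else 0)"
  shows "A \<in> unitary_mats n"
proof -
  note B = mat_adjoint_carrier[OF A]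
  have "mat_adjoint A * A = 1\<^sub>m n"
  proof (rule eq_matI)
    show "(mat_adjoint A * A) $$ (i, j) = 1\<^sub>m n $$ (i, j)" if "i < dim_row (1\<^sub>m n)" "j < dim_col (1\<^sub>m n)" for i j
    proof -
      have ij: "i < n" "j < n" using that by auto
      then have "(mat_adjoint A * A) $$ (i, j) = (\<Sum>l<n. cnj (A $$ (l, i)) * A $$ (l, j))"
        by (simp add: mat_mult_index[OF B A] mat_adjoint_index[OF A])
      then show ?thesis using ort[OF ij] ij by simp
    qed
  qed (use A B in auto)
  moreover have "A * mat_adjoint A = 1\<^sub>m n"
    using mat_mult_left_right_inverse[OF B A] calculation by simp
  ultimately show ?thesis using A by (simp add: unitary_mats_def)
qed

lemma submodule_vecI:
  assumes W: "W \<subseteq> carrier_vec n" "0\<^sub>v n \<in> W"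
    and add: "\<And>v w. v \<in> W \<Longrightarrow> w \<in> W \<Longrightarrow> v + w \<in> W"
    and smult: "\<And>c v. v \<in> W \<Longrightarrow> c \<cdot>\<^sub>v v \<in> W"
  shows "Module.submodule W (class_ring :: complex ring) (module_vec TYPE(complex) n)"
proof -
  interpret vec_space "TYPE(complex)" n .
  have "\<ominus>\<^bsub>V\<^esub> v = (-1) \<cdot>\<^sub>v v" if "v \<in> W" for v
  proof (rule abelian_group.minus_equality)
    show "(-1) \<cdot>\<^sub>v v \<oplus>\<^bsub>V\<^esub> v = \<zero>\<^bsub>V\<^esub>"
      using W(1) that by (auto simp: module_vec_simps intro!: eq_vecI)
  qed (use W(1) that in \<open>auto simp: module_vec_simps abelian_group_axioms\<close>)
  then show ?thesis
    by (intro submoduleI) (use assms in \<open>auto simp: module_vec_simps\<close>)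
qed

lemma submodule_vecD:
  assumes "Module.submodule W (class_ring :: complex ring) (module_vec TYPE(complex) n)"
  shows "W \<subseteq> carrier_vec n" "0\<^sub>v n \<in> W" "\<And>v w. v \<in> W \<Longrightarrow> w \<in> W \<Longrightarrow> v + w \<in> W"
    "\<And>c v. v \<in> W \<Longrightarrow> c \<cdot>\<^sub>v v \<in> W"
proof -
  interpret Module.submodule W "class_ring :: complex ring" "module_vec TYPE(complex) n" by (rule assms)
  show "W \<subseteq> carrier_vec n" using subset by (simp add: module_vec_simps)
  show "0\<^sub>v n \<in> W" using one_closed by (simp add: module_vec_simps)
  show "\<And>v w. v \<in> W \<Longrightarrow> w \<in> W \<Longrightarrow> v + w \<in> W" using m_closed by (simp add: module_vec_simps)
  show "\<And>c v. v \<in> W \<Longrightarrow> c \<cdot>\<^sub>v v \<in> W" using smult_closed by (simp add: module_vec_simps class_ring_simps)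
qed

lemma unitary_rep_carrier: "unitary_rep n \<pi> \<Longrightarrow> \<pi> g \<in> carrier_mat n n"
  by (simp add: unitary_rep_def unitary_mats_def)

lemma unitary_rep_dim [simp]:
  "unitary_rep n \<pi> \<Longrightarrow> dim_row (\<pi> g) = n" "unitary_rep n \<pi> \<Longrightarrow> dim_col (\<pi> g) = n"
  using unitary_rep_carrier by blast+

lemma unitary_rep_continuous:
  "unitary_rep n \<pi> \<Longrightarrow> i < n \<Longrightarrow> j < n \<Longrightarrow> continuous_on UNIV (\<lambda>g. \<pi> g $$ (i, j))"
  by (simp add: unitary_rep_def)

lemma unitary_rep_add:
  assumes "unitary_rep n \<pi>" "i < n" "j < n"
  shows "\<pi> (g + h) $$ (i, j) = (\<Sum>l<n. \<pi> g $$ (i, l) * \<pi> h $$ (l, j))"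
  using assms mat_mult_index[OF unitary_rep_carrier unitary_rep_carrier, OF assms(1,1,2,3)]
  by (simp add: unitary_rep_def)

lemma unitary_rep_zero:
  assumes \<pi>: "unitary_rep n \<pi>"
  shows "\<pi> 0 = 1\<^sub>m n"
proof -
  note c = unitary_rep_carrier[OF \<pi>, of 0]
  have u: "mat_adjoint (\<pi> 0) * \<pi> 0 = 1\<^sub>m n" and h: "\<pi> 0 * \<pi> 0 = \<pi> 0"
    using \<pi> unfolding unitary_rep_def unitary_mats_def by (blast, metis add_0)
  have "\<pi> 0 = mat_adjoint (\<pi> 0) * \<pi> 0 * \<pi> 0" using u c by simp
  also have "\<dots> = mat_adjoint (\<pi> 0) * (\<pi> 0 * \<pi> 0)"
    using c by (intro assoc_mult_mat[OF mat_adjoint_carrier]) auto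
  finally show ?thesis using u h by simp
qed

lemma unitary_rep_minus:
  assumes \<pi>: "unitary_rep n \<pi>" and ij: "i < n" "j < n"
  shows "\<pi> (- g) $$ (i, j) = cnj (\<pi> g $$ (j, i))"
proof -
  note c = unitary_rep_carrier[OF \<pi>]
  have u: "\<pi> g * mat_adjoint (\<pi> g) = 1\<^sub>m n" and h: "\<pi> (- g) * \<pi> g = 1\<^sub>m n"
    using \<pi> unfolding unitary_rep_def unitary_mats_def
    by (blast, metis \<pi> unitary_rep_zero add.left_inverse)
  have "\<pi> (- g) = \<pi> (- g) * (\<pi> g * mat_adjoint (\<pi> g))" using c[of "- g"] by (simp add: u)
  also have "\<dots> = \<pi> (- g) * \<pi> g * mat_adjoint (\<pi> g)"
    by (rule assoc_mult_mat[symmetric, OF c c mat_adjoint_carrier[OF c]])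
  also have "\<dots> = mat_adjoint (\<pi> g)" using left_mult_one_mat[OF mat_adjoint_carrier[OF c]] by (simp add: h)
  finally show ?thesis using mat_adjoint_index[OF c ij] by simp
qed

section \<open>Orthonormal systems of continuous functions\<close>

definition orthonormal :: "nat \<Rightarrow> (nat \<Rightarrow> 'a::topological_group_add \<Rightarrow> complex) \<Rightarrow> bool" where
  "orthonormal n u \<longleftrightarrow> (\<forall>i<n. continuous_on UNIV (u i)) \<and>
     (\<forall>i<n. \<forall>j<n. ip (u i) (u j) = (if i = j then 1 else 0))"

definition function_subspace :: "('a::topological_space \<Rightarrow> complex) set \<Rightarrow> bool" where
  "function_subspace V \<longleftrightarrow> (\<forall>f\<in>V. continuous_on UNIV f) \<and> (\<lambda>x. 0) \<in> V \<and>
     (\<forall>f\<in>V. \<forall>h\<in>V. (\<lambda>x. f x + h x) \<in> V) \<and> (\<forall>c. \<forall>f\<in>V. (\<lambda>x. c * f x) \<in> V)"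

definition span_of :: "nat \<Rightarrow> (nat \<Rightarrow> 'a \<Rightarrow> complex) \<Rightarrow> ('a \<Rightarrow> complex) set" where
  "span_of n u = {\<lambda>x. \<Sum>i<n. c i * u i x | c. True}"

lemma span_ofI: "f = (\<lambda>x. \<Sum>i<n. c i * u i x) \<Longrightarrow> f \<in> span_of n u"
  by (auto simp: span_of_def)

lemma function_subspace_sum:
  assumes "function_subspace V" "\<And>i. i \<in> F \<Longrightarrow> f i \<in> V"
  shows "(\<lambda>x. \<Sum>i\<in>F. c i * f i x) \<in> V"
  using assms by (induction F rule: infinite_finite_induct) (auto simp: function_subspace_def)

context compact_group
begin

lemma orthonormal_coeff:
  fixes u :: "nat \<Rightarrow> 'a \<Rightarrow> complex"
  assumes "orthonormal n u" "j < n"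
  shows "ip (\<lambda>x. \<Sum>i<n. c i * u i x) (u j) = c j"
proof -
  have "ip (\<lambda>x. \<Sum>i<n. c i * u i x) (u j) = (\<Sum>i<n. c i * ip (u i) (u j))"
    using assms by (subst ip_sum_left) (auto simp: orthonormal_def ip_cmult_left intro!: continuous_intros)
  also have "\<dots> = (\<Sum>i<n. if i = j then c i else 0)"
    using assms by (intro sum.cong) (auto simp: orthonormal_def)
  finally show ?thesis using assms(2) by simp
qed

lemma orthonormal_sqnorm:
  fixes u :: "nat \<Rightarrow> 'a \<Rightarrow> complex"
  assumes "orthonormal n u" "j < n"
  shows "sqnorm (u j) = 1"
proof -
  have "continuous_on UNIV (u j)" "ip (u j) (u j) = 1" using assms by (simp_all add: orthonormal_def)
  then show ?thesis by (metis ip_self of_real_eq_1_iff)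
qed

lemma bessel_identity:
  fixes u :: "nat \<Rightarrow> 'a \<Rightarrow> complex"
  assumes u: "orthonormal n u" and f: "continuous_on UNIV f"
  defines "r \<equiv> \<lambda>x. f x - (\<Sum>i<n. ip f (u i) * u i x)"
  shows "sqnorm r = sqnorm f - (\<Sum>i<n. (cmod (ip f (u i)))\<^sup>2)" 
    and "\<And>j. j < n \<Longrightarrow> ip r (u j) = 0" and "continuous_on UNIV r"
proof -
  have cu: "continuous_on UNIV (u i)" if "i < n" for i using u that by (simp add: orthonormal_def)
  let ?S = "\<lambda>x. \<Sum>i<n. ip f (u i) * u i x"
  have cS: "continuous_on UNIV ?S" by (intro continuous_intros cu) auto
  show cr: "continuous_on UNIV r" unfolding r_def by (intro continuous_intros f cS)
  show r0: "ip r (u j) = 0" if "j < n" for j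
    unfolding r_def by (subst ip_diff_left[OF f cS cu[OF that]]) (simp add: orthonormal_coeff[OF u that])
  have "ip r ?S = 0"
    using cr cu r0 by (subst ip_sum_right) (auto simp: ip_cmult_right intro!: continuous_intros)
  then have "ip r r = ip r f"
    using ip_diff_right[OF f cS cr, folded r_def] by simp
  also have "\<dots> = ip f f - ip ?S f" unfolding r_def by (rule ip_diff_left[OF f cS f])
  also have "ip ?S f = (\<Sum>i<n. ip f (u i) * ip (u i) f)"
    using f cu by (subst ip_sum_left) (auto simp: ip_cmult_left intro!: continuous_intros)
  also have "\<dots> = (\<Sum>i<n. of_real ((cmod (ip f (u i)))\<^sup>2))"
  proof (intro sum.cong refl)
    fix i assume "i \<in> {..<n}"
    then have "ip (u i) f = cnj (ip f (u i))" by (simp add: ip_cnj f cu)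
    then show "ip f (u i) * ip (u i) f = of_real ((cmod (ip f (u i)))\<^sup>2)" by (simp only: mult_cnj_self)
  qed
  finally have "complex_of_real (sqnorm r) = of_real (sqnorm f - (\<Sum>i<n. (cmod (ip f (u i)))\<^sup>2))"
    by (simp add: ip_self f cr)
  then show "sqnorm r = sqnorm f - (\<Sum>i<n. (cmod (ip f (u i)))\<^sup>2)" using of_real_eq_iff by blast
qed

lemma bessel:
  fixes u :: "nat \<Rightarrow> 'a \<Rightarrow> complex"
  assumes u: "orthonormal n u" and f: "continuous_on UNIV f"
  shows "(\<Sum>i<n. (cmod (ip f (u i)))\<^sup>2) \<le> sqnorm f"
  using sqnorm_nonneg[OF bessel_identity(3)[OF u f]] by (simp add: bessel_identity(1)[OF u f])

text \<open>A nonzero remainder of the expansion of f could be normalised and would extend the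
  system.\<close>

lemma maximal_orthonormal_spans:
  fixes u :: "nat \<Rightarrow> 'a \<Rightarrow> complex"
  assumes V: "function_subspace V" and u: "orthonormal n u" "\<And>i. i < n \<Longrightarrow> u i \<in> V"
    and max: "\<And>v. orthonormal (Suc n) v \<Longrightarrow> (\<And>i. i < Suc n \<Longrightarrow> v i \<in> V) \<Longrightarrow> False"
    and f: "f \<in> V"
  shows "f = (\<lambda>x. \<Sum>i<n. ip f (u i) * u i x)"
proof (rule ccontr)
  assume neq: "\<not> ?thesis"
  have cf: "continuous_on UNIV f" using V f by (simp add: function_subspace_def)
  define r where "r x = f x - (\<Sum>i<n. ip f (u i) * u i x)" for x
  note r = bessel_identity[OF u(1) cf, folded r_def]
  have r0: "ip r (u j) = 0" if "j < n" for j using r(2)[OF that] by (simp add: r_def[abs_def])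
  have r0': "ip (u j) r = 0" if "j < n" for j
    using r0[OF that] ip_cnj[OF r(3), of "u j"] u(1) that by (simp add: orthonormal_def)
  obtain x where "r x \<noteq> 0" using neq by (auto simp: r_def fun_eq_iff)
  then have pos: "sqnorm r > 0" using sqnorm_pos[OF r(3)] by blast
  have rV: "r \<in> V"
  proof -
    have "(\<lambda>x. 1 * f x + (-1) * (\<Sum>i<n. ip f (u i) * u i x)) \<in> V"
      using V f function_subspace_sum[OF V, of "{..<n}" u "\<lambda>i. ip f (u i)"] u(2)
      unfolding function_subspace_def by (simp only: lessThan_iff)
    then show ?thesis by (simp add: r_def[abs_def])
  qed
  define c where "c = complex_of_real (1 / sqrt (sqnorm r))"
  have "cnj c * c * of_real (sqnorm r) = of_real ((1 / sqrt (sqnorm r))\<^sup>2 * sqnorm r)"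
    unfolding c_def complex_cnj_complex_of_real by (simp only: power2_eq_square of_real_mult)
  also have "\<dots> = 1" using pos by (simp add: power_divide del: of_real_power of_real_mult)
  finally have cc: "cnj c * (c * of_real (sqnorm r)) = 1" by (simp only: mult.assoc)
  define v where "v i = (if i < n then u i else (\<lambda>x. c * r x))" for i
  have "orthonormal (Suc n) v"
    using u(1) r(3) pos cc r0 r0'
    by (auto simp: orthonormal_def v_def less_Suc_eq ip_cmult_left ip_cmult_right ip_self
      continuous_intros mult.assoc)
  moreover have "v i \<in> V" if "i < Suc n" for i
    using u(2) V rV by (auto simp: v_def function_subspace_def)
  ultimately show False by (rule max)
qed

text \<open>A bound on the size of orthonormal systems stands for finite dimension: a system of
  greatest size exists, and it spans. The nonzero function f rules out size 0.\<close>

lemma orthonormal_spanning_exists: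
  fixes V :: "('a \<Rightarrow> complex) set"
  assumes V: "function_subspace V"
    and bound: "\<And>n u. orthonormal n u \<Longrightarrow> (\<And>i. i < n \<Longrightarrow> u i \<in> V) \<Longrightarrow> n \<le> N"
    and f: "f \<in> V" "f x \<noteq> 0"
  shows "\<exists>n u. n > 0 \<and> orthonormal n u \<and> (\<forall>i<n. u i \<in> V) \<and> V \<subseteq> span_of n u"
proof -
  let ?P = "\<lambda>n. \<exists>u. orthonormal n u \<and> (\<forall>i<n. u i \<in> V)"
  define n where "n = (GREATEST n. ?P n)"
  have P0: "?P 0" by (simp add: orthonormal_def)
  have bd: "\<And>n. ?P n \<Longrightarrow> n \<le> N" using bound by blast
  have "?P n" unfolding n_def by (rule GreatestI_nat[where P = ?P, OF P0 bd])
  then obtain u where u: "orthonormal n u" "\<And>i. i < n \<Longrightarrow> u i \<in> V" by blast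
  have mx: "?P m \<Longrightarrow> m \<le> n" for m unfolding n_def by (rule Greatest_le_nat[where P = ?P, OF _ bd])
  have no: False if "orthonormal (Suc n) v" "\<And>i. i < Suc n \<Longrightarrow> v i \<in> V" for v
  proof -
    have "Suc n \<le> n" by (rule mx) (rule exI[of _ v], simp add: that)
    then show False by simp
  qed
  have span: "h = (\<lambda>x. \<Sum>i<n. ip h (u i) * u i x)" if "h \<in> V" for h
    by (rule maximal_orthonormal_spans[OF V u no that])
  have "n > 0"
  proof (rule ccontr)
    assume "\<not> n > 0"
    then have "f = (\<lambda>x. 0)" using span[OF f(1)] by simp
    then show False using f(2) by simp
  qed
  moreover have "V \<subseteq> span_of n u"
  proof
    fix h assume "h \<in> V"
    from span[OF this] show "h \<in> span_of n u" by (rule span_ofI)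
  qed
  ultimately show ?thesis using u by (intro exI[of _ n] exI[of _ u] conjI allI impI)
qed

lemma function_subspace_span:
  fixes u :: "nat \<Rightarrow> 'a \<Rightarrow> complex"
  assumes "orthonormal n u"
  shows "function_subspace (span_of n u)"
  unfolding function_subspace_def
proof (intro conjI ballI allI)
  fix f assume "f \<in> span_of n u"
  then show "continuous_on UNIV f"
    using assms by (auto simp: span_of_def orthonormal_def intro!: continuous_intros)
next
  show "(\<lambda>x. 0) \<in> span_of n u" by (auto simp: span_of_def intro!: exI[of _ "\<lambda>_. 0"])
next
  fix f h assume "f \<in> span_of n u" "h \<in> span_of n u"
  then obtain c d where "f = (\<lambda>x. \<Sum>i<n. c i * u i x)" "h = (\<lambda>x. \<Sum>i<n. d i * u i x)"
    by (auto simp: span_of_def)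
  then show "(\<lambda>x. f x + h x) \<in> span_of n u"
    by (auto simp: span_of_def sum.distrib distrib_right intro!: exI[of _ "\<lambda>i. c i + d i"])
next
  fix k f assume "f \<in> span_of n u"
  then obtain c where "f = (\<lambda>x. \<Sum>i<n. c i * u i x)" by (auto simp: span_of_def)
  then show "(\<lambda>x. k * f x) \<in> span_of n u"
    by (auto simp: span_of_def sum_distrib_left mult.assoc intro!: exI[of _ "\<lambda>i. k * c i"])
qed

text \<open>Double counting of the squared inner products of u i and v j. Summed over i they give 1
  for each v j, which lies in the span; summed over j they give at most 1 for each u i, by
  Bessel.\<close>

lemma orthonormal_in_span_card:
  fixes u v :: "nat \<Rightarrow> 'a \<Rightarrow> complex"
  assumes u: "orthonormal n u" and v: "orthonormal m v" "\<And>i. i < m \<Longrightarrow> v i \<in> span_of n u"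
  shows "m \<le> n"
proof -
  have cu: "continuous_on UNIV (u i)" if "i < n" for i using u that by (simp add: orthonormal_def)
  have cv: "continuous_on UNIV (v i)" if "i < m" for i using v(1) that by (simp add: orthonormal_def)
  note sqv = orthonormal_sqnorm[OF v(1)]
  note squ = orthonormal_sqnorm[OF u]
  have pars: "(\<Sum>i<n. (cmod (ip (v j) (u i)))\<^sup>2) = 1" if j: "j < m" for j
  proof -
    have "\<exists>c. v j = (\<lambda>x. \<Sum>i<n. c i * u i x)"
      using v(2)[OF j] by (simp add: span_of_def)
    then obtain c where c: "v j = (\<lambda>x. \<Sum>i<n. c i * u i x)" ..
    have "ip (v j) (u i) = c i" if "i < n" for i unfolding c by (rule orthonormal_coeff[OF u that])
    then have "(\<Sum>i<n. ip (v j) (u i) * u i x) = v j x" for x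
      unfolding fun_cong[OF c, of x] by (intro sum.cong) auto
    then have "(\<lambda>x. v j x - (\<Sum>i<n. ip (v j) (u i) * u i x)) = (\<lambda>x. 0)" by (simp only: diff_self)
    then show ?thesis
      using bessel_identity(1)[OF u cv[OF j]] sqv[OF j] by (simp add: sqnorm_def haar_const)
  qed
  have "real m = (\<Sum>j<m. \<Sum>i<n. (cmod (ip (v j) (u i)))\<^sup>2)" using pars by simp
  also have "\<dots> = (\<Sum>i<n. \<Sum>j<m. (cmod (ip (u i) (v j)))\<^sup>2)"
  proof (subst sum.swap, intro sum.cong refl)
    fix i j assume "i \<in> {..<n}" "j \<in> {..<m}"
    then have "ip (u i) (v j) = cnj (ip (v j) (u i))" by (simp add: ip_cnj cu cv)
    then show "(cmod (ip (v j) (u i)))\<^sup>2 = (cmod (ip (u i) (v j)))\<^sup>2" by simp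
  qed
  also have "\<dots> \<le> (\<Sum>i<n. sqnorm (u i))" by (intro sum_mono bessel v(1)) (auto intro: cu)
  also have "\<dots> = real n" using squ by simp
  finally show ?thesis by simp
qed

end

section \<open>The Peter-Weyl theorem\<close>

context compact_group
begin

definition right_invariant :: "('a \<Rightarrow> complex) set \<Rightarrow> bool" where
  "right_invariant V \<longleftrightarrow> (\<forall>f\<in>V. \<forall>g. (\<lambda>x. f (x + g)) \<in> V)"

text \<open>The right regular representation on the span of \<open>u\<close>, as a matrix in the
  orthonormal basis \<open>u\<close>. It deserves this name when the span is right
  invariant.\<close>

definition translation_rep :: "nat \<Rightarrow> (nat \<Rightarrow> 'a \<Rightarrow> complex) \<Rightarrow> 'a \<Rightarrow> complex mat" where
  "translation_rep n u g = mat n n (\<lambda>(i, j). ip (\<lambda>x. u j (x + g)) (u i))"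

lemma ip_lincomb_left:
  fixes u :: "'i \<Rightarrow> 'a \<Rightarrow> complex"
  assumes "\<And>i. i \<in> F \<Longrightarrow> continuous_on UNIV (u i)" "continuous_on UNIV g"
  shows "ip (\<lambda>x. \<Sum>i\<in>F. c i * u i x) g = (\<Sum>i\<in>F. c i * ip (u i) g)"
proof -
  have "ip (\<lambda>x. \<Sum>i\<in>F. c i * u i x) g = (\<Sum>i\<in>F. ip (\<lambda>x. c i * u i x) g)"
    by (rule ip_sum_left) (intro continuous_intros assms; assumption)+
  also have "\<dots> = (\<Sum>i\<in>F. c i * ip (u i) g)"
    by (intro sum.cong refl ip_cmult_left assms)
  finally show ?thesis .
qed

lemma span_of_self: "i < n \<Longrightarrow> u i \<in> span_of n u"
proof -
  assume i: "i < n"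
  have "u i = (\<lambda>x. \<Sum>l<n. (if l = i then 1 else 0) * u l x)"
  proof
    fix x
    have "(\<Sum>l<n. (if l = i then 1 else 0) * u l x) = (\<Sum>l<n. if l = i then u l x else 0)"
      by (intro sum.cong) auto
    then show "u i x = (\<Sum>l<n. (if l = i then 1 else 0) * u l x)" using i by simp
  qed
  then show ?thesis by (rule span_ofI)
qed

lemma span_of_expand:
  fixes u :: "nat \<Rightarrow> 'a \<Rightarrow> complex"
  assumes u: "orthonormal n u" and f: "f \<in> span_of n u"
  shows "f x = (\<Sum>i<n. ip f (u i) * u i x)"
proof -
  have "\<exists>c. f = (\<lambda>x. \<Sum>i<n. c i * u i x)" using f by (simp add: span_of_def)
  then obtain c where c: "f = (\<lambda>x. \<Sum>i<n. c i * u i x)" ..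
  have "ip f (u i) = c i" if "i < n" for i unfolding c by (rule orthonormal_coeff[OF u that])
  then show ?thesis unfolding fun_cong[OF c, of x] by (intro sum.cong) auto
qed

context
  fixes n and u :: "nat \<Rightarrow> 'a \<Rightarrow> complex"
  assumes u: "orthonormal n u" and inv: "right_invariant (span_of n u)"
begin

private lemma cu: "i < n \<Longrightarrow> continuous_on UNIV (u i)"
  using u by (simp add: orthonormal_def)

lemma translation_rep_expand:
  assumes "j < n"
  shows "u j (x + g) = (\<Sum>i<n. translation_rep n u g $$ (i, j) * u i x)"
proof -
  have "(\<lambda>x. u j (x + g)) \<in> span_of n u"
    using inv span_of_self[OF assms, of u] by (simp add: right_invariant_def)
  from span_of_expand[OF u this, of x] show ?thesis
    using assms by (simp add: translation_rep_def)
qed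

text \<open>Right invariance of the Haar integral makes translation an isometry, and invariance of
  the span makes the expansion of each translated basis function exact.\<close>

lemma translation_rep_unitary: "unitary_rep n (translation_rep n u)"
  unfolding unitary_rep_def
proof (intro conjI allI impI)
  let ?\<pi> = "translation_rep n u"
  have carr: "?\<pi> g \<in> carrier_mat n n" for g by (simp add: translation_rep_def)
  have ipt: "ip (\<lambda>x. u j (x + g)) (\<lambda>x. u k (x + g)) = (if j = k then 1 else 0)" if "j < n" "k < n" for j k g
  proof -
    have "continuous_on UNIV (\<lambda>x. u j x * cnj (u k x))" by (intro continuous_intros cu that)
    from haar_translate_right[OF this, of g] show ?thesis
      using u that by (simp add: ip_def orthonormal_def)
  qed
  show "?\<pi> g \<in> unitary_mats n" for g
  proof (rule unitary_matsI[OF carr])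
    fix i j assume ij: "i < n" "j < n"
    have "(if j = i then 1 else 0) = ip (\<lambda>x. \<Sum>l<n. ?\<pi> g $$ (l, j) * u l x) (\<lambda>x. u i (x + g))"
      unfolding ipt[OF ij(2,1), of g, symmetric] by (simp add: translation_rep_expand ij)
    also have "\<dots> = (\<Sum>l<n. ?\<pi> g $$ (l, j) * ip (u l) (\<lambda>x. u i (x + g)))"
      using ij by (intro ip_lincomb_left) (auto intro!: cu right_translate_continuous)
    also have "\<dots> = (\<Sum>l<n. cnj (?\<pi> g $$ (l, i)) * ?\<pi> g $$ (l, j))"
    proof (intro sum.cong refl)
      fix l assume "l \<in> {..<n}"
      then have "ip (u l) (\<lambda>x. u i (x + g)) = cnj (?\<pi> g $$ (l, i))"
        using ij by (simp add: translation_rep_def ip_cnj cu right_translate_continuous)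
      then show "?\<pi> g $$ (l, j) * ip (u l) (\<lambda>x. u i (x + g)) = cnj (?\<pi> g $$ (l, i)) * ?\<pi> g $$ (l, j)"
        by simp
    qed
    finally show "(\<Sum>l<n. cnj (?\<pi> g $$ (l, i)) * ?\<pi> g $$ (l, j)) = (if i = j then 1 else 0)"
      by (auto split: if_splits)
  qed
  show "?\<pi> (g + h) = ?\<pi> g * ?\<pi> h" for g h
  proof (rule eq_matI)
    fix i j assume "i < dim_row (?\<pi> g * ?\<pi> h)" "j < dim_col (?\<pi> g * ?\<pi> h)"
    then have ij: "i < n" "j < n" using carr[of g] carr[of h] by auto
    have "?\<pi> (g + h) $$ (i, j) = ip (\<lambda>x. u j (x + g + h)) (u i)"
      using ij by (simp add: translation_rep_def add.assoc)
    also have "\<dots> = ip (\<lambda>x. \<Sum>l<n. ?\<pi> h $$ (l, j) * u l (x + g)) (u i)"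
      by (simp add: translation_rep_expand ij)
    also have "\<dots> = (\<Sum>l<n. ?\<pi> h $$ (l, j) * ip (\<lambda>x. u l (x + g)) (u i))"
      using ij by (intro ip_lincomb_left) (auto intro!: cu right_translate_continuous)
    also have "\<dots> = (\<Sum>l<n. ?\<pi> g $$ (i, l) * ?\<pi> h $$ (l, j))"
      using ij by (intro sum.cong) (auto simp: translation_rep_def)
    finally show "?\<pi> (g + h) $$ (i, j) = (?\<pi> g * ?\<pi> h) $$ (i, j)"
      by (simp add: mat_mult_index[OF carr carr ij])
  qed (simp_all add: translation_rep_def)
  show "continuous_on UNIV (\<lambda>g. ?\<pi> g $$ (i, j))" if "i < n" "j < n" for i j
  proof -
    have "continuous_on UNIV (\<lambda>g. haar_integral (\<lambda>x. u j (x + g) * cnj (u i x)))"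
      by (rule haar_param_continuous)
        (auto simp: case_prod_beta intro!: continuous_intros continuous_on_compose2[OF cu] that)
    then show ?thesis using that by (simp add: translation_rep_def ip_def)
  qed
qed

text \<open>A nonzero invariant space W of coordinate vectors corresponds to a right-invariant space
  V of functions inside the span. By minimality an orthonormal basis of V has at least n members, so
  it spans the whole of \<open>span_of n u\<close>; hence every u i lies in V and every unit vector
  in W.\<close>

lemma translation_rep_irreducible:
  assumes n: "n > 0"
    and minimal: "\<And>m v. m > 0 \<Longrightarrow> orthonormal m v \<Longrightarrow> (\<And>i. i < m \<Longrightarrow> v i \<in> span_of n u) \<Longrightarrow>
      right_invariant (span_of m v) \<Longrightarrow> n \<le> m"
  shows "irreducible_rep n (translation_rep n u)"
  unfolding irreducible_rep_def
proof (intro conjI n translation_rep_unitary allI impI, elim conjE)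
  let ?\<pi> = "translation_rep n u"
  fix W
  assume W: "Module.submodule W (class_ring :: complex ring) (module_vec TYPE(complex) n)"
    and Winv: "\<forall>g. \<forall>w\<in>W. ?\<pi> g *\<^sub>v w \<in> W"
  note W = submodule_vecD[OF W]
  show "W = {0\<^sub>v n} \<or> W = carrier_vec n"
  proof (cases "W = {0\<^sub>v n}")
    case False
    define F where "F w = (\<lambda>x. \<Sum>i<n. (w $ i) * u i x)" for w
    define V where "V = F ` W"
    have VS: "V \<subseteq> span_of n u" by (auto simp: V_def F_def span_of_def)
    have Vsub: "function_subspace V"
      unfolding function_subspace_def
    proof (intro conjI ballI allI)
      fix f assume "f \<in> V"
      then show "continuous_on UNIV f" using VS function_subspace_span[OF u] by (auto simp: function_subspace_def)
    next
      have "F (0\<^sub>v n) = (\<lambda>x. 0)" by (simp add: F_def)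
      then show "(\<lambda>x. 0) \<in> V" using W(2) by (auto simp: V_def image_iff intro!: bexI[of _ "0\<^sub>v n"])
    next
      fix f h assume "f \<in> V" "h \<in> V"
      then obtain v w where vw: "v \<in> W" "w \<in> W" "f = F v" "h = F w" by (auto simp: V_def)
      have "(\<lambda>x. f x + h x) = F (v + w)"
        using vw W(1) by (auto simp: F_def fun_eq_iff sum.distrib[symmetric] distrib_right[symmetric] intro!: sum.cong)
      then show "(\<lambda>x. f x + h x) \<in> V" using W(3) vw by (simp add: V_def)
    next
      fix c f assume "f \<in> V"
      then obtain v where v: "v \<in> W" "f = F v" by (auto simp: V_def)
      have "(\<lambda>x. c * f x) = F (c \<cdot>\<^sub>v v)"
        using v W(1) by (auto simp: F_def fun_eq_iff sum_distrib_left mult.assoc intro!: sum.cong)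
      then show "(\<lambda>x. c * f x) \<in> V" using W(4) v by (simp add: V_def)
    qed
    have Vinv: "(\<lambda>x. f (x + g)) \<in> V" if f: "f \<in> V" for f g
    proof -
      obtain w where w: "w \<in> W" "f = F w" using f by (auto simp: V_def)
      have wc: "w \<in> carrier_vec n" using w W(1) by auto
      have "f (x + g) = F (?\<pi> g *\<^sub>v w) x" for x
      proof -
        have "f (x + g) = (\<Sum>j<n. \<Sum>i<n. ?\<pi> g $$ (i, j) * w $ j * u i x)"
          unfolding w(2) F_def
          by (intro sum.cong refl) (simp add: translation_rep_expand sum_distrib_left mult_ac)
        also have "\<dots> = F (?\<pi> g *\<^sub>v w) x"
          unfolding F_def
          by (subst sum.swap, intro sum.cong refl)
            (simp add: mat_vec_index[OF unitary_rep_carrier[OF translation_rep_unitary] wc] sum_distrib_right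
              del: index_mult_mat_vec)
        finally show ?thesis .
      qed
      then show ?thesis using Winv w(1) by (auto simp: V_def fun_eq_iff)
    qed
    obtain w where w: "w \<in> W" "w \<noteq> 0\<^sub>v n" using False W(2) by blast
    then have wc: "w \<in> carrier_vec n" using W(1) by auto
    then obtain i where i: "i < n" "w $ i \<noteq> 0" using w(2) by (metis carrier_vecD eq_vecI index_zero_vec)
    have "ip (F w) (u i) = w $ i" unfolding F_def by (rule orthonormal_coeff[OF u i(1)])
    then have "F w \<noteq> (\<lambda>x. 0)" using i(2) by (auto simp: ip_def haar_const)
    then obtain x where x: "F w x \<noteq> 0" by blast
    have bound: "k \<le> n" if "orthonormal k v" "\<And>i. i < k \<Longrightarrow> v i \<in> V" for k v
      by (rule orthonormal_in_span_card[OF u that(1)]) (use that(2) VS in blast)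
    have "F w \<in> V" using w by (simp add: V_def)
    have "\<exists>m v. m > 0 \<and> orthonormal m v \<and> (\<forall>i<m. v i \<in> V) \<and> V \<subseteq> span_of m v"
      by (rule orthonormal_spanning_exists[OF Vsub _ \<open>F w \<in> V\<close> x]) (rule bound)
    then obtain m v where "m > 0 \<and> orthonormal m v \<and> (\<forall>i<m. v i \<in> V) \<and> V \<subseteq> span_of m v"
      by (elim exE)
    then have v: "m > 0" "orthonormal m v" "\<And>i. i < m \<Longrightarrow> v i \<in> V" "V \<subseteq> span_of m v"
      by simp_all
    have spanV: "span_of m v \<subseteq> V"
      using function_subspace_sum[OF Vsub, of "{..<m}" v] v(3) by (auto simp: span_of_def)
    have "right_invariant (span_of m v)"
      using spanV v(4) Vinv unfolding right_invariant_def by blast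
    then have nm: "n \<le> m" using minimal[OF v(1,2)] v(3) VS by blast
    \<comment> \<open>An orthonormal system in the span has at most n members, and n <= m, so v
      cannot be extended within the span.\<close>
    have nomore: False if "orthonormal (Suc m) z" "\<And>i. i < Suc m \<Longrightarrow> z i \<in> span_of n u" for z
      using orthonormal_in_span_card[OF u that] nm by simp
    have vS: "v i \<in> span_of n u" if "i < m" for i using v(3)[OF that] VS by blast
    have "u i \<in> V" if i: "i < n" for i
    proof -
      have "u i = (\<lambda>x. \<Sum>l<m. ip (u i) (v l) * v l x)"
        by (rule maximal_orthonormal_spans[OF function_subspace_span[OF u] v(2) vS nomore span_of_self[OF i]])
      also have "\<dots> \<in> V" using function_subspace_sum[OF Vsub, of "{..<m}" v] v(3) by simp
      finally show ?thesis .
    qed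
    then have units: "unit_vec n i \<in> W" if i: "i < n" for i
    proof -
      obtain w where w: "w \<in> W" "u i = F w" using \<open>\<And>i. i < n \<Longrightarrow> u i \<in> V\<close>[OF i] by (auto simp: V_def)
      have "w $ k = (if i = k then 1 else 0)" if k: "k < n" for k
      proof -
        have "ip (F w) (u k) = w $ k" unfolding F_def by (rule orthonormal_coeff[OF u k])
        then show ?thesis unfolding w(2)[symmetric] using u i k by (simp add: orthonormal_def)
      qed
      then have "w = unit_vec n i" using w(1) W(1) i by (intro eq_vecI) (auto simp: unit_vec_def)
      then show ?thesis using w(1) by simp
    qed
    have "x \<in> W" if x: "x \<in> carrier_vec n" for x
    proof -
      have "Matrix.vec n (\<lambda>i. if i < k then x $ i else 0) \<in> W" if "k \<le> n" for k
        using that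
      proof (induction k)
        case 0
        have "Matrix.vec n (\<lambda>i. if i < 0 then x $ i else 0) = 0\<^sub>v n" by auto
        then show ?case using W(2) by simp
      next
        case (Suc k)
        have "Matrix.vec n (\<lambda>i. if i < Suc k then x $ i else 0)
          = Matrix.vec n (\<lambda>i. if i < k then x $ i else 0) + (x $ k) \<cdot>\<^sub>v unit_vec n k"
          using Suc by (intro eq_vecI) (auto simp: less_Suc_eq)
        then show ?case using Suc W(3,4) units by simp
      qed
      from this[of n] have "Matrix.vec n (\<lambda>i. if i < n then x $ i else 0) \<in> W" by simp
      moreover have "Matrix.vec n (\<lambda>i. if i < n then x $ i else 0) = x" using x by auto
      ultimately show ?thesis by simp
    qed
    then show ?thesis using W(1) by blast
  qed simp
qed

end

section \<open>Eigenspaces of convolution operators\<close>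

definition eigenspace :: "('a \<Rightarrow> complex) \<Rightarrow> real \<Rightarrow> ('a \<Rightarrow> complex) set" where
  "eigenspace k s = {u. continuous_on UNIV u \<and> conv k u = (\<lambda>x. of_real s * u x)}"

lemma eigenspace_subspace:
  assumes k: "continuous_on UNIV k"
  shows "function_subspace (eigenspace k s)"
proof -
  have add: "conv k (\<lambda>x. f x + h x) = (\<lambda>x. conv k f x + conv k h x)"
    if "continuous_on UNIV f" "continuous_on UNIV h" for f h
    unfolding conv_def[abs_def]
    using haar_add[OF conv_integrand_continuous[OF k that(1)] conv_integrand_continuous[OF k that(2)]]
    by (simp add: distrib_left)
  have zero: "conv k (\<lambda>x. 0) = (\<lambda>x. 0)" by (simp add: conv_def[abs_def] haar_const)
  show ?thesis
    unfolding function_subspace_def eigenspace_def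
    using conv_cmult_right[OF k] zero
    by (auto simp: add distrib_left mult.left_commute intro!: continuous_intros)
qed

text \<open>Convolution by k on the left commutes with right translations.\<close>

lemma eigenspace_right_invariant:
  shows "right_invariant (eigenspace k s)"
  unfolding right_invariant_def eigenspace_def
  by (auto simp: right_translate_continuous conv_def fun_eq_iff add.assoc)

text \<open>The Hilbert-Schmidt argument. Up to conjugation, s times the value of u i at x is the
  inner product of u i with a reflected translate of k; so Bessel bounds, at each x, the sum of the
  s^2 |u i x|^2 by the squared norm of k. Integration over the group turns the sum into n.\<close>

lemma eigenspace_orthonormal_bound:
  assumes k: "continuous_on UNIV k" and s: "s > 0"
    and u: "orthonormal n u" "\<And>i. i < n \<Longrightarrow> u i \<in> eigenspace k s"
  shows "real n \<le> sqnorm k / s\<^sup>2"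
proof -
  have cu: "continuous_on UNIV (u i)" if "i < n" for i using u(1) that by (simp add: orthonormal_def)
  have le: "(\<Sum>i<n. (cmod (u i x))\<^sup>2) \<le> sqnorm k / s\<^sup>2" for x
  proof -
    let ?h = "\<lambda>y. cnj (k (x - y))"
    have ch: "continuous_on UNIV ?h"
      by (intro continuous_intros continuous_on_compose2[OF k] continuous_on_op_minus) auto
    have c2: "continuous_on UNIV (\<lambda>y. complex_of_real ((cmod (k y))\<^sup>2))" by (intro continuous_intros k)
    have sq: "sqnorm ?h = sqnorm k"
      using haar_translate[OF c2, of x] haar_uminus[OF left_translate_continuous[OF c2, of x]]
      by (simp add: sqnorm_def)
    have "s\<^sup>2 * (\<Sum>i<n. (cmod (u i x))\<^sup>2) = (\<Sum>i<n. (cmod (ip ?h (u i)))\<^sup>2)"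
      unfolding sum_distrib_left
    proof (intro sum.cong refl)
      fix i assume "i \<in> {..<n}"
      then have i: "i < n" by simp
      have "of_real s * u i x = conv k (u i) x" using u(2)[OF i] by (simp add: eigenspace_def)
      also have "\<dots> = ip (u i) ?h" by (simp add: conv_swap k cu i ip_def mult.commute)
      also have "\<dots> = cnj (ip ?h (u i))" by (simp add: ip_cnj ch cu i)
      finally have "cmod (of_real s * u i x) = cmod (ip ?h (u i))" by simp
      then show "s\<^sup>2 * (cmod (u i x))\<^sup>2 = (cmod (ip ?h (u i)))\<^sup>2"
        using s by (metis abs_of_pos norm_mult norm_of_real power_mult_distrib)
    qed
    also have "\<dots> \<le> sqnorm k" using bessel[OF u(1) ch] sq by simp
    finally show ?thesis using s by (simp add: pos_le_divide_eq mult.commute)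
  qed
  have "real n = (\<Sum>i<n. sqnorm (u i))" by (simp add: orthonormal_sqnorm[OF u(1)])
  also have "\<dots> = Re (haar_integral (\<lambda>x. \<Sum>i<n. of_real ((cmod (u i x))\<^sup>2)))"
    unfolding sqnorm_def by (subst haar_sum) (auto intro!: continuous_intros cu)
  also have "\<dots> \<le> cmod (haar_integral (\<lambda>x. \<Sum>i<n. of_real ((cmod (u i x))\<^sup>2)))" by (rule complex_Re_le_cmod)
  also have "\<dots> \<le> sqnorm k / s\<^sup>2"
  proof (rule haar_bound)
    fix x
    have "cmod (\<Sum>i<n. of_real ((cmod (u i x))\<^sup>2)) = \<bar>\<Sum>i<n. (cmod (u i x))\<^sup>2\<bar>"
      unfolding of_real_sum[symmetric] by (rule norm_of_real)
    then show "cmod (\<Sum>i<n. of_real ((cmod (u i x))\<^sup>2)) \<le> sqnorm k / s\<^sup>2"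
      using le[of x] by (simp add: sum_nonneg)
  qed (intro continuous_intros cu; simp)
  finally show ?thesis .
qed

text \<open>Functions whose Fourier coefficient along \<pi> vanishes form a left ideal for
  convolution: translating f by y multiplies its coefficient matrix on the right by \<pi> (-
  y).\<close>

lemma conv_coeff_zero:
  fixes f w :: "'a \<Rightarrow> complex"
  assumes \<pi>: "unitary_rep n \<pi>" and f: "continuous_on UNIV f" and w: "continuous_on UNIV w"
    and zero: "\<And>i j. i < n \<Longrightarrow> j < n \<Longrightarrow> haar_integral (\<lambda>x. f x * \<pi> (- x) $$ (i, j)) = 0"
    and ij: "i < n" "j < n"
  shows "haar_integral (\<lambda>x. conv w f x * \<pi> (- x) $$ (i, j)) = 0"
proof -
  note c = unitary_rep_continuous[OF \<pi>]
  have cm: "continuous_on UNIV (\<lambda>x. \<pi> (- x) $$ (k, l))" if "k < n" "l < n" for k l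
    by (rule uminus_continuous[OF c[OF that]])
  have inner: "haar_integral (\<lambda>x. f (- y + x) * \<pi> (- x) $$ (i, j)) = 0" for y
  proof -
    have "continuous_on UNIV (\<lambda>x. f x * \<pi> (- (y + x)) $$ (i, j))"
      by (intro continuous_intros f left_translate_continuous[OF cm] ij)
    from haar_translate[OF this, of "- y"]
    have "haar_integral (\<lambda>x. f (- y + x) * \<pi> (- x) $$ (i, j)) = haar_integral (\<lambda>x. f x * \<pi> (- (y + x)) $$ (i, j))"
      by (simp add: add.assoc[symmetric])
    also have "\<dots> = haar_integral (\<lambda>x. \<Sum>l<n. (f x * \<pi> (- x) $$ (i, l)) * \<pi> (- y) $$ (l, j))"
      unfolding minus_add unitary_rep_add[OF \<pi> ij] by (simp add: sum_distrib_left mult.assoc unitary_rep_add[OF \<pi> ij]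
          flip: diff_conv_add_uminus add_uminus_conv_diff)
    also have "\<dots> = 0"
    proof (subst haar_sum)
      show "(\<Sum>l<n. haar_integral (\<lambda>x. f x * \<pi> (- x) $$ (i, l) * \<pi> (- y) $$ (l, j))) = 0"
      proof (intro sum.neutral ballI)
        fix l assume "l \<in> {..<n}"
        then have "haar_integral (\<lambda>x. f x * \<pi> (- x) $$ (i, l)) = 0" "continuous_on UNIV (\<lambda>x. f x * \<pi> (- x) $$ (i, l))"
          using ij by (auto intro!: zero continuous_intros f cm)
        then show "haar_integral (\<lambda>x. f x * \<pi> (- x) $$ (i, l) * \<pi> (- y) $$ (l, j)) = 0"
          by (simp add: haar_multc)
      qed
    qed (use ij in \<open>auto intro!: continuous_intros f cm\<close>)
    finally show ?thesis .
  qed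
  have "haar_integral (\<lambda>x. conv w f x * \<pi> (- x) $$ (i, j))
      = haar_integral (\<lambda>x. haar_integral (\<lambda>y. w y * f (- y + x) * \<pi> (- x) $$ (i, j)))"
    by (simp add: conv_def haar_multc conv_integrand_continuous w f)
  also have "\<dots> = haar_integral (\<lambda>y. haar_integral (\<lambda>x. w y * f (- y + x) * \<pi> (- x) $$ (i, j)))"
    by (rule haar_fubini) (auto simp: case_prod_beta intro!: continuous_intros continuous_on_compose2[OF f]
        continuous_on_compose2[OF w] continuous_on_compose2[OF c] ij)
  also have "\<dots> = haar_integral (\<lambda>y. w y * haar_integral (\<lambda>x. f (- y + x) * \<pi> (- x) $$ (i, j)))"
    unfolding mult.assoc
    by (subst haar_cmult) (auto intro!: continuous_intros left_translate_continuous f cm ij)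
  finally show ?thesis by (simp add: inner haar_const)
qed

text \<open>Suppose f is nonzero. The convolution g of \<open>star f\<close> with f is Hermitian
  with g 0 > 0, so k = \<open>conv g g\<close> has a nonzero eigenspace for some s > 0, of finite
  dimension. A right-invariant subspace of least dimension in it carries an irreducible
  representation. The Fourier coefficients of k along this representation vanish with those of f,
  yet they compute convolution by k on the subspace; so s kills it, which is a
  contradiction.\<close>

theorem peter_weyl:
  fixes f :: "'a \<Rightarrow> complex"
  assumes f: "continuous_on UNIV f"
    and zero: "\<And>n \<pi> i j. irreducible_rep n \<pi> \<Longrightarrow> i < n \<Longrightarrow> j < n \<Longrightarrow>
      haar_integral (\<lambda>x. f x * \<pi> (- x) $$ (i, j)) = 0"
  shows "f = (\<lambda>x. 0)"
proof (rule ccontr)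
  assume "f \<noteq> (\<lambda>x. 0)"
  then obtain x0 where x0: "f x0 \<noteq> 0" by blast
  note sf = star_continuous[OF f]
  have star2: "star (star f) = f" by (simp add: star_def fun_eq_iff)
  define g where "g = conv (star f) f"
  have g: "continuous_on UNIV g" unfolding g_def by (rule conv_continuous[OF sf f])
  have herm: "star g = g" by (simp add: g_def star_conv sf f star2)
  have "g 0 = of_real (sqnorm (star f))"
    using conv_star_zero[of "star f" "star f"] by (simp add: star2 g_def ip_self sf)
  moreover have "sqnorm (star f) > 0" by (rule sqnorm_pos[OF sf, of "- x0"]) (simp add: star_def x0)
  ultimately have g0: "g 0 \<noteq> 0" by simp
  define k where "k = conv g g"
  have k: "continuous_on UNIV k" unfolding k_def by (rule conv_continuous[OF g g])
  \<comment> \<open>With f as the right factor, k belongs to the left ideal to which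
    \<open>conv_coeff_zero\<close> applies.\<close>
  have k_eq: "k = conv (conv g (star f)) f"
    unfolding k_def by (subst (2) g_def) (simp add: conv_assoc g sf f)
  obtain s P where s: "s > 0" and P: "continuous_on UNIV P" "P 0 \<noteq> 0" "conv k P = (\<lambda>x. of_real s * P x)"
    using positive_eigenfunction[OF g herm g0] unfolding k_def by metis
  let ?E = "eigenspace k s"
  have PE: "P \<in> ?E" using P by (simp add: eigenspace_def)
  have bound: "n \<le> nat \<lceil>sqnorm k / s\<^sup>2\<rceil>" if "orthonormal n u" "\<And>i. i < n \<Longrightarrow> u i \<in> ?E" for n u
    using eigenspace_orthonormal_bound[OF k s that] by linarith
  let ?Q = "\<lambda>n. n > 0 \<and> (\<exists>u. orthonormal n u \<and> (\<forall>i<n. u i \<in> ?E) \<and> right_invariant (span_of n u))"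
  have "\<exists>n u. n > 0 \<and> orthonormal n u \<and> (\<forall>i<n. u i \<in> ?E) \<and> ?E \<subseteq> span_of n u"
    by (rule orthonormal_spanning_exists[OF eigenspace_subspace[OF k] _ PE P(2)]) (rule bound)
  then obtain n0 u0 where "n0 > 0 \<and> orthonormal n0 u0 \<and> (\<forall>i<n0. u0 i \<in> ?E) \<and> ?E \<subseteq> span_of n0 u0"
    by (elim exE)
  then have u0: "n0 > 0" "orthonormal n0 u0" "\<And>i. i < n0 \<Longrightarrow> u0 i \<in> ?E" "?E \<subseteq> span_of n0 u0"
    by simp_all
  have sE: "span_of n u \<subseteq> ?E" if "\<And>i. i < n \<Longrightarrow> u i \<in> ?E" for n u
    using function_subspace_sum[OF eigenspace_subspace[OF k], of "{..<n}" u] that by (auto simp: span_of_def)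
  have "span_of n0 u0 \<subseteq> ?E" by (rule sE) (rule u0(3))
  with u0(4) have "span_of n0 u0 = ?E" by (rule equalityI[rotated])
  then have "right_invariant (span_of n0 u0)" using eigenspace_right_invariant by simp
  then have Q0: "?Q n0" by (intro conjI exI[of _ u0] allI impI u0(1,2,3))
  define n where "n = (LEAST n. ?Q n)"
  have "?Q n" unfolding n_def by (rule LeastI[where P = ?Q, OF Q0])
  then have n: "n > 0"
    and "\<exists>u. orthonormal n u \<and> (\<forall>i<n. u i \<in> ?E) \<and> right_invariant (span_of n u)"
    by simp_all
  then obtain u where "orthonormal n u \<and> (\<forall>i<n. u i \<in> ?E) \<and> right_invariant (span_of n u)"
    by (elim exE)
  then have u: "orthonormal n u" "\<And>i. i < n \<Longrightarrow> u i \<in> ?E" "right_invariant (span_of n u)"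
    by simp_all
  have minimal: "n \<le> m" if "m > 0" "orthonormal m v" "\<And>i. i < m \<Longrightarrow> v i \<in> span_of n u"
    "right_invariant (span_of m v)" for m v
  proof -
    have "span_of n u \<subseteq> ?E" by (rule sE) (rule u(2))
    then have "\<forall>i<m. v i \<in> ?E" using that(3) by blast
    then have "?Q m" by (intro conjI exI[of _ v] that(1,2,4))
    then show ?thesis unfolding n_def by (rule Least_le)
  qed
  let ?\<pi> = "translation_rep n u"
  note irr = translation_rep_irreducible[OF u(1,3) n minimal]
  note rep = translation_rep_unitary[OF u(1,3)]
  have kz: "haar_integral (\<lambda>x. k x * ?\<pi> (- x) $$ (i, l)) = 0" if "i < n" "l < n" for i l
    unfolding k_eq by (rule conv_coeff_zero[OF rep f conv_continuous[OF g sf] zero[OF irr] that])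
  have ck: "continuous_on UNIV (\<lambda>y. k y * ?\<pi> (- y) $$ (i, l))" if "i < n" "l < n" for i l
    by (intro continuous_intros k uminus_continuous[OF unitary_rep_continuous[OF rep that]])
  have "u 0 x = 0" for x
  proof -
    \<comment> \<open>The point - y + x is regarded as a translation of 0, so that the dependence on
      y is carried by matrix coefficients at - y and the functions enter through the constants u i
      0.\<close>
    have e: "u 0 (- y + x) = (\<Sum>i<n. \<Sum>l<n. ?\<pi> (- y) $$ (i, l) * (?\<pi> x $$ (l, 0) * u i 0))" for y
      using translation_rep_expand[OF u(1,3) n, of 0 "- y + x"]
      by (simp add: unitary_rep_add[OF rep _ n] sum_distrib_right mult.assoc)
    have "of_real s * u 0 x = conv k (u 0) x" using u(2)[OF n] by (simp add: eigenspace_def)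
    also have "\<dots> = haar_integral (\<lambda>y. \<Sum>i<n. \<Sum>l<n. (k y * ?\<pi> (- y) $$ (i, l)) * (?\<pi> x $$ (l, 0) * u i 0))"
      unfolding conv_def e by (simp add: sum_distrib_left mult.assoc)
    also have "\<dots> = (\<Sum>i<n. haar_integral (\<lambda>y. \<Sum>l<n. (k y * ?\<pi> (- y) $$ (i, l)) * (?\<pi> x $$ (l, 0) * u i 0)))"
      by (rule haar_sum) (auto intro!: continuous_intros ck)
    also have "\<dots> = (\<Sum>i<n. \<Sum>l<n. haar_integral (\<lambda>y. (k y * ?\<pi> (- y) $$ (i, l)) * (?\<pi> x $$ (l, 0) * u i 0)))"
      by (intro sum.cong refl haar_sum) (auto intro!: continuous_intros ck)
    also have "\<dots> = (\<Sum>i<n. \<Sum>l<n. haar_integral (\<lambda>y. k y * ?\<pi> (- y) $$ (i, l)) * (?\<pi> x $$ (l, 0) * u i 0))"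
      by (intro sum.cong refl haar_multc) (auto intro!: ck)
    also have "\<dots> = 0" using kz by simp
    finally show ?thesis using s by simp
  qed
  then have "u 0 = (\<lambda>x. 0)" by blast
  then show False using orthonormal_sqnorm[OF u(1) n] by (simp add: sqnorm_def haar_const)
qed

end

section \<open>The trace norm\<close>

lemma order_prod_linear_factors:
  fixes es :: "complex list"
  shows "(\<Prod>a\<leftarrow>es. [:- a, 1:]) \<noteq> 0"
    and "poly (\<Prod>a\<leftarrow>es. [:- a, 1:]) l = 0 \<longleftrightarrow> l \<in> set es"
    and "Polynomial.order l (\<Prod>a\<leftarrow>es. [:- a, 1:]) = count_list es l"
proof -
  show nz: "(\<Prod>a\<leftarrow>es. [:- a, 1:]) \<noteq> 0" for es :: "complex list"
    by (induction es) (simp_all del: mult_pCons_left)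
  show "poly (\<Prod>a\<leftarrow>es. [:- a, 1:]) l = 0 \<longleftrightarrow> l \<in> set es" by (induction es) auto
  have lin: "Polynomial.order l [:- a, 1:] = (if a = l then 1 else 0)" for a
    using order_power_n_n[of l 1] by (auto intro: order_0I)
  show "Polynomial.order l (\<Prod>a\<leftarrow>es. [:- a, 1:]) = count_list es l"
  proof (induction es)
    case (Cons a es)
    have "[:- a, 1:] * (\<Prod>a\<leftarrow>es. [:- a, 1:]) \<noteq> 0" using nz[of "a # es"] by simp
    from order_mult[OF this, of l] show ?case using Cons lin[of a] by simp
  qed simp
qed

lemma sum_count_list:
  fixes g :: "'b \<Rightarrow> real"
  assumes "finite S" "set es \<subseteq> S"
  shows "(\<Sum>l\<in>S. of_nat (count_list es l) * g l) = (\<Sum>a\<leftarrow>es. g a)"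
  using assms(2)
proof (induction es)
  case (Cons a es)
  have "(\<Sum>l\<in>S. of_nat (count_list (a # es) l) * g l)
      = (\<Sum>l\<in>S. of_nat (count_list es l) * g l + (if l = a then g l else 0))"
    by (intro sum.cong) (auto simp: algebra_simps)
  then show ?case using Cons assms(1) by (simp add: sum.distrib)
qed simp

lemma trace_norm_eq:
  assumes "char_poly (mat_adjoint A * A) = (\<Prod>a\<leftarrow>es. [:- a, 1:])"
  shows "trace_norm A = (\<Sum>a\<leftarrow>es. sqrt (Re a))"
  using sum_count_list[of "set es" es "\<lambda>l. sqrt (Re l)"]
  by (simp add: trace_norm_def assms order_prod_linear_factors)

lemma trace_mult_commute:
  fixes A B :: "complex mat"
  assumes A: "A \<in> carrier_mat n n" and B: "B \<in> carrier_mat n n"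
  shows "(\<Sum>i<n. (A * B) $$ (i, i)) = (\<Sum>i<n. (B * A) $$ (i, i))"
  using A B by (simp add: mat_mult_index[OF A B] mat_mult_index[OF B A] del: index_mult_mat)
    (subst sum.swap, simp add: mult.commute)

text \<open>The trace is invariant under similarity, and the Schur form has the eigenvalues on its
  diagonal.\<close>

lemma trace_eq_sum_eigenvalues:
  fixes M :: "complex mat"
  assumes M: "M \<in> carrier_mat n n" and cp: "char_poly M = (\<Prod>a\<leftarrow>es. [:- a, 1:])"
  shows "(\<Sum>i<n. M $$ (i, i)) = sum_list es"
proof -
  obtain C P Q where CPQ: "schur_decomposition M es = (C, P, Q)" by (cases "schur_decomposition M es")
  from schur_decomposition[OF M cp CPQ]
  have sim: "similar_mat_wit M C P Q" and diag: "diag_mat C = es" by auto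
  note w = similar_mat_witD2[OF M sim]
  have "(\<Sum>i<n. M $$ (i, i)) = (\<Sum>i<n. (P * (C * Q)) $$ (i, i))"
    using w(3) assoc_mult_mat[OF w(6,5,7)] by simp
  also have "\<dots> = (\<Sum>i<n. ((C * Q) * P) $$ (i, i))"
    using w by (intro trace_mult_commute) auto
  also have "(C * Q) * P = C" using assoc_mult_mat[OF w(5,7,6)] w by simp
  also have "(\<Sum>i<n. C $$ (i, i)) = sum_list (diag_mat C)"
    using w(5) by (simp add: diag_mat_def sum_list_sum_nth atLeast0LessThan)
  finally show ?thesis by (simp add: diag)
qed

text \<open>For an eigenvector v, the number l |v|^2 equals |A v|^2.\<close>

lemma gram_eigenvalue_nonneg:
  fixes A :: "complex mat"
  assumes A: "A \<in> carrier_mat n n" and l: "poly (char_poly (mat_adjoint A * A)) l = 0"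
  shows "l = of_real (Re l)" "Re l \<ge> 0"
proof -
  let ?M = "mat_adjoint A * A"
  note A' = mat_adjoint_carrier[OF A]
  have M: "?M \<in> carrier_mat n n" using A A' by auto
  obtain v where v: "v \<in> carrier_vec n" "v \<noteq> 0\<^sub>v n" "?M *\<^sub>v v = l \<cdot>\<^sub>v v"
    using l M unfolding eigenvalue_root_char_poly[OF M, symmetric] eigenvalue_def eigenvector_def by auto
  define q where "q = (\<Sum>i<n. (cmod (vec_index v i))\<^sup>2)"
  define r where "r = (\<Sum>k<n. (cmod (vec_index (A *\<^sub>v v) k))\<^sup>2)"
  obtain i where i: "i < n" "vec_index v i \<noteq> 0" using v(1,2) by (metis carrier_vecD eq_vecI index_zero_vec)
  have qpos: "q > 0" unfolding q_def by (rule sum_pos2[of _ i]) (use i in auto)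
  have rnn: "r \<ge> 0" unfolding r_def by (rule sum_nonneg) simp
  have Av: "A *\<^sub>v v \<in> carrier_vec n" using A v(1) by auto
  have "l * of_real q = (\<Sum>i<n. cnj (vec_index v i) * vec_index (l \<cdot>\<^sub>v v) i)"
    unfolding q_def of_real_sum sum_distrib_left
    using v(1) by (intro sum.cong) (auto simp: mult_cnj_self[symmetric] mult_ac simp del: of_real_power)
  also have "l \<cdot>\<^sub>v v = mat_adjoint A *\<^sub>v (A *\<^sub>v v)"
    unfolding v(3)[symmetric] by (rule assoc_mult_mat_vec[OF A' A v(1)])
  also have "(\<Sum>i<n. cnj (vec_index v i) * vec_index (mat_adjoint A *\<^sub>v (A *\<^sub>v v)) i)
      = (\<Sum>i<n. \<Sum>k<n. cnj (A $$ (k, i) * vec_index v i) * vec_index (A *\<^sub>v v) k)"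
    by (intro sum.cong refl)
      (simp add: mat_vec_index[OF A' Av] mat_adjoint_index[OF A] sum_distrib_left mult_ac del: index_mult_mat_vec)
  also have "\<dots> = (\<Sum>k<n. cnj (vec_index (A *\<^sub>v v) k) * vec_index (A *\<^sub>v v) k)"
    by (subst sum.swap, intro sum.cong refl)
      (simp add: mat_vec_index[OF A v(1)] sum_distrib_right del: index_mult_mat_vec)
  also have "\<dots> = of_real r" unfolding r_def of_real_sum by (simp only: mult_cnj_self)
  finally have "l * of_real q = of_real r" .
  then have leq: "l = of_real (r / q)" using qpos by (simp add: field_simps)
  then show "l = of_real (Re l)" by simp
  show "Re l \<ge> 0" unfolding leq using qpos rnn by simp
qed

lemma sum_list_sq_le:
  fixes h :: "'b \<Rightarrow> real"
  assumes "\<And>a. a \<in> set xs \<Longrightarrow> h a \<ge> 0"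
  shows "(\<Sum>a\<leftarrow>xs. (h a)\<^sup>2) \<le> (\<Sum>a\<leftarrow>xs. h a)\<^sup>2" "0 \<le> (\<Sum>a\<leftarrow>xs. h a)"
  using assms
proof (induction xs)
  case (Cons a xs)
  { case 2 then show ?case using Cons by simp }
  { case 1
    then have "0 \<le> h a * (\<Sum>a\<leftarrow>xs. h a)" using Cons(2) by simp
    moreover have "(\<Sum>a\<leftarrow>xs. (h a)\<^sup>2) \<le> (\<Sum>a\<leftarrow>xs. h a)\<^sup>2" using Cons 1 by simp
    ultimately show ?case by (simp add: power2_sum mult.assoc) }
qed simp_all

text \<open>The trace of the Gram matrix is the sum of the squared singular values, and the sum of
  squares of nonnegative numbers is at most the square of their sum.\<close>

lemma frobenius_le_trace_norm:
  fixes A :: "complex mat"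
  assumes A: "A \<in> carrier_mat n n"
  shows "(\<Sum>i<n. \<Sum>j<n. (cmod (A $$ (i, j)))\<^sup>2) \<le> (trace_norm A)\<^sup>2" "0 \<le> trace_norm A"
proof -
  let ?M = "mat_adjoint A * A"
  note A' = mat_adjoint_carrier[OF A]
  have M: "?M \<in> carrier_mat n n" using A A' by auto
  obtain es where es: "char_poly ?M = (\<Prod>a\<leftarrow>es. [:- a, 1:])" using char_poly_factorized[OF M] by blast
  have pos: "a = of_real (Re a)" "Re a \<ge> 0" if "a \<in> set es" for a
    using gram_eigenvalue_nonneg[OF A, of a] that by (auto simp: es order_prod_linear_factors)
  have "(\<Sum>i<n. ?M $$ (i, i)) = of_real (\<Sum>i<n. \<Sum>k<n. (cmod (A $$ (k, i)))\<^sup>2)"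
    unfolding of_real_sum
    by (intro sum.cong refl)
      (simp add: mat_mult_index[OF A' A] mat_adjoint_index[OF A] mult_cnj_self del: index_mult_mat)
  then have "of_real (\<Sum>i<n. \<Sum>k<n. (cmod (A $$ (k, i)))\<^sup>2) = sum_list es"
    using trace_eq_sum_eigenvalues[OF M es] by simp
  then have "(\<Sum>i<n. \<Sum>k<n. (cmod (A $$ (k, i)))\<^sup>2) = Re (sum_list es)" by (metis Re_complex_of_real)
  also have "\<dots> = (\<Sum>a\<leftarrow>es. Re a)" by (induction es) auto
  also have "\<dots> = (\<Sum>a\<leftarrow>es. (sqrt (Re a))\<^sup>2)" using pos by (intro arg_cong[of _ _ sum_list] map_cong) auto
  also have "\<dots> \<le> (trace_norm A)\<^sup>2"
    unfolding trace_norm_eq[OF es] by (rule sum_list_sq_le) (use pos in auto)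
  finally show "(\<Sum>i<n. \<Sum>j<n. (cmod (A $$ (i, j)))\<^sup>2) \<le> (trace_norm A)\<^sup>2" by (subst sum.swap)
  show "0 \<le> trace_norm A" unfolding trace_norm_eq[OF es] by (rule sum_list_sq_le) (use pos in auto)
qed

text \<open>Used to turn smallness in the norm of the Fourier algebra into smallness of every entry
  of every Fourier coefficient.\<close>

lemma entry_le_trace_norm:
  fixes A :: "complex mat"
  assumes A: "A \<in> carrier_mat n n" and ij: "i < n" "j < n"
  shows "cmod (A $$ (i, j)) \<le> trace_norm A"
proof -
  have "(cmod (A $$ (i, j)))\<^sup>2 \<le> (\<Sum>j<n. (cmod (A $$ (i, j)))\<^sup>2)"
    using ij by (intro member_le_sum[of j "{..<n}" "\<lambda>j. (cmod (A $$ (i, j)))\<^sup>2"]) auto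
  also have "\<dots> \<le> (\<Sum>i<n. \<Sum>j<n. (cmod (A $$ (i, j)))\<^sup>2)"
    using ij by (intro member_le_sum[of i "{..<n}" "\<lambda>i. \<Sum>j<n. (cmod (A $$ (i, j)))\<^sup>2"]) (auto intro: sum_nonneg)
  also have "\<dots> \<le> (trace_norm A)\<^sup>2" by (rule frobenius_le_trace_norm[OF A])
  finally show ?thesis using frobenius_le_trace_norm(2)[OF A] by (rule power2_le_imp_le)
qed

text \<open>Fourier coefficients of class functions are scalar matrices, so this is the value that
  enters the norm of ZA(G).\<close>

lemma trace_norm_scalar:
  "trace_norm (c \<cdot>\<^sub>m 1\<^sub>m n) = real n * cmod c"
proof -
  let ?A = "c \<cdot>\<^sub>m 1\<^sub>m n :: complex mat" and ?M = "of_real ((cmod c)\<^sup>2) \<cdot>\<^sub>m 1\<^sub>m n :: complex mat"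
  have A: "?A \<in> carrier_mat n n" by simp
  note A' = mat_adjoint_carrier[OF A]
  have eq: "mat_adjoint ?A * ?A = ?M"
  proof (rule eq_matI)
    fix i j assume "i < dim_row ?M" "j < dim_col ?M"
    then have ij: "i < n" "j < n" by auto
    have "(mat_adjoint ?A * ?A) $$ (i, j) = (\<Sum>l<n. (if l = i then cnj c * c * (if l = j then 1 else 0) else 0))"
      unfolding mat_mult_index[OF A' A ij] using ij
      by (intro sum.cong refl) (auto simp: mat_adjoint_index[OF A])
    also have "\<dots> = ?M $$ (i, j)" using ij by (auto simp: mult_cnj_self)
    finally show "(mat_adjoint ?A * ?A) $$ (i, j) = ?M $$ (i, j)" .
  qed (use A A' in auto)
  have M: "?M \<in> carrier_mat n n" by simp
  have ut: "upper_triangular ?M" by (auto simp: upper_triangular_def)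
  have "char_poly (mat_adjoint ?A * ?A) = (\<Prod>a\<leftarrow>replicate n (of_real ((cmod c)\<^sup>2)). [:- a, 1:])"
  proof -
    have "diag_mat ?M = replicate n (of_real ((cmod c)\<^sup>2))"
      unfolding diag_mat_def by (intro nth_equalityI) auto
    with char_poly_upper_triangular[OF M ut] show ?thesis unfolding eq by simp
  qed
  from trace_norm_eq[OF this] show ?thesis by (simp add: sum_list_replicate)
qed

section \<open>Schur's lemma and the orthogonality relations\<close>

text \<open>An eigenspace of T is a nonzero subspace invariant under \<pi>, hence the whole
  space.\<close>

lemma schur_commutant:
  assumes irr: "irreducible_rep n \<pi>" and T: "T \<in> carrier_mat n n"
    and comm: "\<And>g. \<pi> g * T = T * \<pi> g"
  obtains c where "T = c \<cdot>\<^sub>m 1\<^sub>m n"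
proof -
  have n: "n > 0" and rep: "unitary_rep n \<pi>" using irr by (auto simp: irreducible_rep_def)
  note P = unitary_rep_carrier[OF rep]
  obtain es where es: "char_poly T = (\<Prod>a\<leftarrow>es. [:- a, 1:])" "length es = n"
    using char_poly_factorized[OF T] by blast
  obtain c es' where "es = c # es'" using es(2) n by (cases es) auto
  then have "poly (char_poly T) c = 0" by (simp add: es(1))
  then obtain v where v: "v \<in> carrier_vec n" "v \<noteq> 0\<^sub>v n" "T *\<^sub>v v = c \<cdot>\<^sub>v v"
    using T unfolding eigenvalue_root_char_poly[OF T, symmetric] eigenvalue_def eigenvector_def by auto
  define W where "W = {w \<in> carrier_vec n. T *\<^sub>v w = c \<cdot>\<^sub>v w}"
  have "Module.submodule W (class_ring :: complex ring) (module_vec TYPE(complex) n)"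
  proof (rule submodule_vecI)
    show "0\<^sub>v n \<in> W" using T by (auto simp: W_def scalar_prod_def)
    show "x + y \<in> W" if "x \<in> W" "y \<in> W" for x y
      using that mult_add_distrib_mat_vec[OF T, of x y] smult_add_distrib_vec[of x n y c] by (auto simp: W_def)
    show "k \<cdot>\<^sub>v x \<in> W" if "x \<in> W" for k x
      using that T by (simp add: W_def mult_mat_vec smult_smult_assoc mult.commute)
  qed (auto simp: W_def)
  moreover have "\<pi> g *\<^sub>v w \<in> W" if "w \<in> W" for g w
  proof -
    have w: "w \<in> carrier_vec n" "T *\<^sub>v w = c \<cdot>\<^sub>v w" using that by (auto simp: W_def)
    have "T *\<^sub>v (\<pi> g *\<^sub>v w) = (T * \<pi> g) *\<^sub>v w" using assoc_mult_mat_vec[OF T P w(1)] by simp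
    also have "\<dots> = \<pi> g *\<^sub>v (T *\<^sub>v w)" unfolding comm[symmetric] by (rule assoc_mult_mat_vec[OF P T w(1)])
    also have "\<dots> = c \<cdot>\<^sub>v (\<pi> g *\<^sub>v w)" unfolding w(2) by (rule mult_mat_vec[OF P w(1)])
    finally show ?thesis using P[of g] w(1) by (auto simp: W_def)
  qed
  moreover have "W \<noteq> {0\<^sub>v n}" using v by (auto simp: W_def)
  ultimately have W: "W = carrier_vec n" using irr unfolding irreducible_rep_def by blast
  have "T = c \<cdot>\<^sub>m 1\<^sub>m n"
  proof (rule eq_matI)
    fix i j assume "i < dim_row (c \<cdot>\<^sub>m 1\<^sub>m n)" "j < dim_col (c \<cdot>\<^sub>m 1\<^sub>m n)"
    then have ij: "i < n" "j < n" by auto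
    have "unit_vec n j \<in> W" by (simp add: W)
    then have "vec_index (T *\<^sub>v unit_vec n j) i = vec_index (c \<cdot>\<^sub>v unit_vec n j) i" by (simp add: W_def)
    moreover have "vec_index (T *\<^sub>v unit_vec n j) i = T $$ (i, j)"
    proof -
      have "vec_index (T *\<^sub>v unit_vec n j) i = (\<Sum>l<n. if l = j then T $$ (i, l) else 0)"
        unfolding mat_vec_index[OF T unit_vec_carrier ij(1)] using ij by (intro sum.cong) auto
      then show ?thesis using ij by simp
    qed
    ultimately show "T $$ (i, j) = (c \<cdot>\<^sub>m 1\<^sub>m n) $$ (i, j)" using ij by (simp add: unit_vec_def)
  qed (use T in auto)
  then show ?thesis by (rule that)
qed

lemma mat_adjoint_mult:
  fixes A B :: "complex mat"
  assumes A: "A \<in> carrier_mat n m" and B: "B \<in> carrier_mat m k"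
  shows "mat_adjoint (A * B) = mat_adjoint B * mat_adjoint A"
proof (rule eq_matI)
  have AB: "A * B \<in> carrier_mat n k" using A B by simp
  note A' = mat_adjoint_carrier[OF A] and B' = mat_adjoint_carrier[OF B] and AB' = mat_adjoint_carrier[OF AB]
  show "dim_row (mat_adjoint (A * B)) = dim_row (mat_adjoint B * mat_adjoint A)"
    "dim_col (mat_adjoint (A * B)) = dim_col (mat_adjoint B * mat_adjoint A)"
    using A' B' AB' by auto
  fix i j assume "i < dim_row (mat_adjoint B * mat_adjoint A)" "j < dim_col (mat_adjoint B * mat_adjoint A)"
  then have ij: "i < k" "j < n" using A' B' by auto
  show "mat_adjoint (A * B) $$ (i, j) = (mat_adjoint B * mat_adjoint A) $$ (i, j)"
    unfolding mat_adjoint_index[OF AB ij] mat_mult_index[OF A B ij(2,1)] mat_mult_index[OF B' A' ij]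
    using ij by (simp add: mat_adjoint_index[OF A] mat_adjoint_index[OF B] mult.commute)
qed

lemma mat_adjoint_adjoint:
  fixes A :: "complex mat"
  assumes A: "A \<in> carrier_mat n m"
  shows "mat_adjoint (mat_adjoint A) = A"
  using mat_adjoint_carrier[OF A] mat_adjoint_carrier[OF mat_adjoint_carrier[OF A]] A
  by (intro eq_matI) (auto simp: mat_adjoint_index[OF mat_adjoint_carrier[OF A]] mat_adjoint_index[OF A])

lemma unitary_rep_adjoint:
  assumes "unitary_rep n \<pi>"
  shows "mat_adjoint (\<pi> g) = \<pi> (- g)"
proof (rule eq_matI)
  note P = unitary_rep_carrier[OF assms]
  show "dim_row (mat_adjoint (\<pi> g)) = dim_row (\<pi> (- g))" "dim_col (mat_adjoint (\<pi> g)) = dim_col (\<pi> (- g))"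
    using P[of "- g"] mat_adjoint_carrier[OF P[of g]] by auto
  fix i j assume "i < dim_row (\<pi> (- g))" "j < dim_col (\<pi> (- g))"
  then have ij: "i < n" "j < n" using P[of "- g"] by auto
  show "mat_adjoint (\<pi> g) $$ (i, j) = \<pi> (- g) $$ (i, j)"
    by (simp add: mat_adjoint_index[OF P ij] unitary_rep_minus[OF assms ij])
qed

lemma intertwiner_adjoint:
  assumes \<pi>: "unitary_rep n \<pi>" and \<sigma>: "unitary_rep m \<sigma>" and T: "T \<in> carrier_mat n m"
    and int: "\<And>g. \<pi> g * T = T * \<sigma> g"
  shows "\<sigma> g * mat_adjoint T = mat_adjoint T * \<pi> g"
proof -
  have "mat_adjoint (\<pi> (- g) * T) = mat_adjoint (T * \<sigma> (- g))" by (simp add: int)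
  then show ?thesis
    using mat_adjoint_mult[OF unitary_rep_carrier[OF \<pi>] T] mat_adjoint_mult[OF T unitary_rep_carrier[OF \<sigma>]]
    by (simp add: unitary_rep_adjoint[OF \<pi>] unitary_rep_adjoint[OF \<sigma>])
qed

text \<open>The products of T with its adjoint, in both orders, commute with a representation and
  are scalars a and b. Bracketing T T^* T in two ways gives a = b, a nonzero column of T makes it
  positive, and comparing traces gives n = m. The rescaled adjoint of T is then a unitary
  intertwiner.\<close>

lemma schur_intertwiner:
  assumes \<pi>: "irreducible_rep n \<pi>" and \<sigma>: "irreducible_rep m \<sigma>" and T: "T \<in> carrier_mat n m"
    and int: "\<And>g. \<pi> g * T = T * \<sigma> g" and ne: "i0 < n" "j0 < m" "T $$ (i0, j0) \<noteq> 0"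
  shows "(\<pi>, \<sigma>) \<in> unitarily_equivalent"
proof -
  have n: "n > 0" and rp: "unitary_rep n \<pi>" using \<pi> by (auto simp: irreducible_rep_def)
  have m: "m > 0" and rs: "unitary_rep m \<sigma>" using \<sigma> by (auto simp: irreducible_rep_def)
  note P = unitary_rep_carrier[OF rp] and S = unitary_rep_carrier[OF rs]
  let ?T = "mat_adjoint T"
  have T': "?T \<in> carrier_mat m n" by (rule mat_adjoint_carrier[OF T])
  note int' = intertwiner_adjoint[OF rp rs T int]
  have "\<sigma> g * (?T * T) = ?T * T * \<sigma> g" for g
    using assoc_mult_mat[OF S T' T, of g] assoc_mult_mat[OF T' P T, of g] assoc_mult_mat[OF T' T S, of g] int int'
    by metis
  then obtain a where a: "?T * T = a \<cdot>\<^sub>m 1\<^sub>m m" using schur_commutant[OF \<sigma>, of "?T * T"] T T' by (metis mult_carrier_mat)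
  have "\<pi> g * (T * ?T) = T * ?T * \<pi> g" for g
    using assoc_mult_mat[OF P T T', of g] assoc_mult_mat[OF T S T', of g] assoc_mult_mat[OF T T' P, of g] int int'
    by metis
  then obtain b where b: "T * ?T = b \<cdot>\<^sub>m 1\<^sub>m n" using schur_commutant[OF \<pi>, of "T * ?T"] T T' by (metis mult_carrier_mat)
  have "a \<cdot>\<^sub>m T = T * (?T * T)" using mult_smult_distrib[OF T one_carrier_mat, of a] T by (simp add: a)
  also have "\<dots> = T * ?T * T" by (rule assoc_mult_mat[OF T T' T, symmetric])
  also have "\<dots> = b \<cdot>\<^sub>m T" using mult_smult_assoc_mat[OF one_carrier_mat T, of b] T by (simp add: b)
  finally have "(a \<cdot>\<^sub>m T) $$ (i0, j0) = (b \<cdot>\<^sub>m T) $$ (i0, j0)" by simp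
  then have ab: "a = b" using T ne by simp
  define r where "r = (\<Sum>i<n. (cmod (T $$ (i, j0)))\<^sup>2)"
  have rpos: "r > 0" unfolding r_def by (rule sum_pos2[of _ i0]) (use ne in auto)
  have "(?T * T) $$ (j0, j0) = of_real r"
    unfolding mat_mult_index[OF T' T ne(2,2)] r_def of_real_sum
    by (intro sum.cong refl) (simp add: mat_adjoint_index[OF T] ne mult_cnj_self)
  then have ar: "a = of_real r" using ne by (simp add: a)
  have tr: "(\<Sum>j<m. (?T * T) $$ (j, j)) = (\<Sum>i<n. (T * ?T) $$ (i, i))"
    by (simp add: mat_mult_index[OF T' T] mat_mult_index[OF T T'] del: index_mult_mat)
      (subst sum.swap, simp add: mult.commute)
  have "of_nat m * a = of_nat n * b" using tr by (simp add: a b)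
  moreover have "b \<noteq> 0" using ab ar rpos by auto
  ultimately have mn: "m = n" using ab by simp
  \<comment> \<open>The adjoint is taken because equivalence asks for an intertwiner from \<pi> to
    \<sigma>, and T goes from \<sigma> to \<pi>.\<close>
  define U where "U = of_real (1 / sqrt r) \<cdot>\<^sub>m ?T"
  have U: "U \<in> carrier_mat n n" using T' by (simp add: U_def mn)
  have s: "complex_of_real (1 / sqrt r) * of_real (1 / sqrt r) * of_real r = 1"
    unfolding of_real_mult[symmetric] using rpos by simp
  have "U \<in> unitary_mats n"
  proof (rule unitary_matsI[OF U])
    fix i j assume ij: "i < n" "j < n"
    have "(\<Sum>l<n. cnj (U $$ (l, i)) * U $$ (l, j)) = (\<Sum>l<n. of_real (1 / sqrt r) * of_real (1 / sqrt r) * (T $$ (i, l) * ?T $$ (l, j)))"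
      using ij T T' mn by (intro sum.cong refl) (simp add: U_def mat_adjoint_index[OF T])
    also have "\<dots> = of_real (1 / sqrt r) * of_real (1 / sqrt r) * (T * ?T) $$ (i, j)"
      using mat_mult_index[OF T T' ij] mn by (simp add: sum_distrib_left)
    also have "\<dots> = (if i = j then 1 else 0)" using ij s by (simp add: b ab[symmetric] ar)
    finally show "(\<Sum>l<n. cnj (U $$ (l, i)) * U $$ (l, j)) = (if i = j then 1 else 0)" .
  qed
  moreover have "U * \<pi> g = \<sigma> g * U" for g
    using int'[of g] P[of g] S[of g] T' mn by (simp add: U_def mult_smult_distrib mult_smult_assoc_mat)
  ultimately show ?thesis unfolding unitarily_equivalent_def using \<pi> \<sigma> mn by blast
qed

lemma unitarily_equivalent_refl:
  assumes "irreducible_rep n \<pi>"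
  shows "(\<pi>, \<pi>) \<in> unitarily_equivalent"
proof -
  have "1\<^sub>m n \<in> unitary_mats n" by (rule unitary_matsI) (auto simp: if_distrib cong: if_cong)
  moreover have c: "\<pi> g \<in> carrier_mat n n" for g
    using assms unitary_rep_carrier by (auto simp: irreducible_rep_def)
  moreover have "1\<^sub>m n * \<pi> g = \<pi> g * 1\<^sub>m n" for g using c[of g] by simp
  ultimately show ?thesis unfolding unitarily_equivalent_def using assms by blast
qed

lemma unitary_mats_adjoint: "U \<in> unitary_mats n \<Longrightarrow> mat_adjoint U \<in> unitary_mats n"
  by (auto simp: unitary_mats_def mat_adjoint_carrier mat_adjoint_adjoint)

lemma unitary_mats_mult:
  assumes U: "U \<in> unitary_mats n" and V: "V \<in> unitary_mats n"
  shows "U * V \<in> unitary_mats n"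
proof -
  have c: "U \<in> carrier_mat n n" "V \<in> carrier_mat n n" "mat_adjoint U \<in> carrier_mat n n" "mat_adjoint V \<in> carrier_mat n n"
    using U V by (auto simp: unitary_mats_def mat_adjoint_carrier)
  have UV: "U * V \<in> carrier_mat n n" using c by simp
  have "mat_adjoint (U * V) * (U * V) = mat_adjoint V * (mat_adjoint U * U) * V"
    using c by (simp add: mat_adjoint_mult[OF c(1,2)] assoc_mult_mat[of _ n n _ n _ n])
  also have "\<dots> = 1\<^sub>m n" using U V c by (simp add: unitary_mats_def)
  finally have "mat_adjoint (U * V) * (U * V) = 1\<^sub>m n" .
  moreover from this have "U * V * mat_adjoint (U * V) = 1\<^sub>m n"
    by (rule mat_mult_left_right_inverse[OF mat_adjoint_carrier[OF UV] UV])
  ultimately show ?thesis using UV by (simp add: unitary_mats_def)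
qed

lemma unitary_intertwine_cancel:
  assumes U: "U \<in> unitary_mats n" and A: "A \<in> carrier_mat n n" and B: "B \<in> carrier_mat n n"
    and eq: "U * A = B * U"
  shows "A = mat_adjoint U * B * U" "mat_adjoint U * B = A * mat_adjoint U"
proof -
  have c: "U \<in> carrier_mat n n" "mat_adjoint U \<in> carrier_mat n n"
    using U by (auto simp: unitary_mats_def mat_adjoint_carrier)
  have "A = mat_adjoint U * U * A" using U A by (simp add: unitary_mats_def)
  also have "\<dots> = mat_adjoint U * (U * A)" by (rule assoc_mult_mat[OF c(2,1) A])
  finally show 1: "A = mat_adjoint U * B * U" using assoc_mult_mat[OF c(2) B c(1)] eq by simp
  have "A * mat_adjoint U = mat_adjoint U * B * (U * mat_adjoint U)"
    using assoc_mult_mat[of "mat_adjoint U * B" n n U n "mat_adjoint U" n] c B 1 by simp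
  also have "\<dots> = mat_adjoint U * B" using U c B by (simp add: unitary_mats_def)
  finally show "mat_adjoint U * B = A * mat_adjoint U" ..
qed

lemma equiv_unitarily_equivalent: "equiv irreps (unitarily_equivalent :: ('a::topological_group_add \<Rightarrow> complex mat) rel)"
proof (rule equivI)
  show "unitarily_equivalent \<subseteq> irreps \<times> (irreps :: ('a \<Rightarrow> complex mat) set)"
    by (auto simp: unitarily_equivalent_def irreps_def)
  show "refl_on irreps (unitarily_equivalent :: ('a \<Rightarrow> complex mat) rel)"
    by (auto simp: refl_on_def irreps_def intro: unitarily_equivalent_refl)
  show "sym (unitarily_equivalent :: ('a \<Rightarrow> complex mat) rel)"
  proof (rule symI)
    fix \<pi> \<sigma> :: "'a \<Rightarrow> complex mat" assume "(\<pi>, \<sigma>) \<in> unitarily_equivalent"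
    then obtain n U where U: "irreducible_rep n \<pi>" "irreducible_rep n \<sigma>" "U \<in> unitary_mats n" "\<And>g. U * \<pi> g = \<sigma> g * U"
      by (auto simp: unitarily_equivalent_def)
    have "mat_adjoint U * \<sigma> g = \<pi> g * mat_adjoint U" for g
      by (rule unitary_intertwine_cancel(2)[OF U(3) _ _ U(4)])
        (use U unitary_rep_carrier in \<open>auto simp: irreducible_rep_def\<close>)
    then show "(\<sigma>, \<pi>) \<in> unitarily_equivalent"
      unfolding unitarily_equivalent_def using U unitary_mats_adjoint by blast
  qed
  show "trans (unitarily_equivalent :: ('a \<Rightarrow> complex mat) rel)"
  proof (rule transI)
    fix \<pi> \<sigma> \<rho> :: "'a \<Rightarrow> complex mat"
    assume "(\<pi>, \<sigma>) \<in> unitarily_equivalent" "(\<sigma>, \<rho>) \<in> unitarily_equivalent"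
    then obtain n U m V where U: "irreducible_rep n \<pi>" "irreducible_rep n \<sigma>" "U \<in> unitary_mats n" "\<And>g. U * \<pi> g = \<sigma> g * U"
      and V: "irreducible_rep m \<sigma>" "irreducible_rep m \<rho>" "V \<in> unitary_mats m" "\<And>g. V * \<sigma> g = \<rho> g * V"
      by (auto simp: unitarily_equivalent_def)
    have c: "\<pi> g \<in> carrier_mat n n" "\<sigma> g \<in> carrier_mat n n" "\<rho> g \<in> carrier_mat m m" "\<sigma> g \<in> carrier_mat m m" for g
      using U V unitary_rep_carrier by (auto simp: irreducible_rep_def)
    then have mn: "m = n" by (metis carrier_matD(1))
    have UV: "U \<in> carrier_mat n n" "V \<in> carrier_mat n n" using U V mn by (auto simp: unitary_mats_def)
    have "V * U * \<pi> g = \<rho> g * (V * U)" for g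
      using assoc_mult_mat[OF UV(2,1) c(1), of g] assoc_mult_mat[OF UV(2) c(2) UV(1), of g]
        assoc_mult_mat[OF c(3)[unfolded mn] UV(2,1), of g] U(4)[of g] V(4)[of g] by simp
    then show "(\<pi>, \<rho>) \<in> unitarily_equivalent"
      unfolding unitarily_equivalent_def using U V mn unitary_mats_mult by blast
  qed
qed

section \<open>Orthogonality of matrix coefficients\<close>

context compact_group
begin

text \<open>For fixed j and k, as a matrix in (i, l), this is the integral of \<pi> (x) E \<sigma>
  (- x), with E the matrix unit at (j, k).\<close>

definition matrix_coeff_integral :: "('a \<Rightarrow> complex mat) \<Rightarrow> ('a \<Rightarrow> complex mat) \<Rightarrow> nat \<Rightarrow> nat \<Rightarrow> nat \<Rightarrow> nat \<Rightarrow> complex" where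
  "matrix_coeff_integral \<pi> \<sigma> i j k l = haar_integral (\<lambda>x. \<pi> x $$ (i, j) * \<sigma> (- x) $$ (k, l))"

text \<open>The average of a matrix unit over the group is an intertwiner, because \<pi> g is
  absorbed under the integral by a translation.\<close>

lemma coeff_integral_intertwines:
  fixes \<pi> \<sigma> :: "'a \<Rightarrow> complex mat"
  assumes rp: "unitary_rep n \<pi>" and rs: "unitary_rep m \<sigma>" and jk: "j < n" "k < m"
  defines "T \<equiv> mat n m (\<lambda>(i, l). matrix_coeff_integral \<pi> \<sigma> i j k l)"
  shows "\<pi> g * T = T * \<sigma> g"
proof (rule eq_matI)
  note P = unitary_rep_carrier[OF rp] and S = unitary_rep_carrier[OF rs]
  have T: "T \<in> carrier_mat n m" by (simp add: T_def)
  show "dim_row (\<pi> g * T) = dim_row (T * \<sigma> g)" "dim_col (\<pi> g * T) = dim_col (T * \<sigma> g)"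
    using P[of g] S[of g] T by auto
  fix i l assume "i < dim_row (T * \<sigma> g)" "l < dim_col (T * \<sigma> g)"
  then have il: "i < n" "l < m" using T S[of g] by auto
  have cP: "continuous_on UNIV (\<lambda>x. \<pi> x $$ (a, b))" if "a < n" "b < n" for a b
    by (rule unitary_rep_continuous[OF rp that])
  have cS: "continuous_on UNIV (\<lambda>x. \<sigma> (- x) $$ (a, b))" if "a < m" "b < m" for a b
    by (rule uminus_continuous[OF unitary_rep_continuous[OF rs that]])
  have "(\<pi> g * T) $$ (i, l) = (\<Sum>p<n. \<pi> g $$ (i, p) * haar_integral (\<lambda>x. \<pi> x $$ (p, j) * \<sigma> (- x) $$ (k, l)))"
    unfolding mat_mult_index[OF P T il] using il by (simp add: T_def matrix_coeff_integral_def)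
  also have "\<dots> = (\<Sum>p<n. haar_integral (\<lambda>x. \<pi> g $$ (i, p) * (\<pi> x $$ (p, j) * \<sigma> (- x) $$ (k, l))))"
    using il jk by (intro sum.cong refl haar_cmult[symmetric]) (auto intro!: continuous_intros cP cS)
  also have "\<dots> = haar_integral (\<lambda>x. \<Sum>p<n. \<pi> g $$ (i, p) * (\<pi> x $$ (p, j) * \<sigma> (- x) $$ (k, l)))"
    using il jk by (intro haar_sum[symmetric]) (auto intro!: continuous_intros cP cS)
  also have "\<dots> = haar_integral (\<lambda>x. \<pi> (g + x) $$ (i, j) * \<sigma> (- x) $$ (k, l))"
    unfolding unitary_rep_add[OF rp il(1) jk(1)] by (simp add: sum_distrib_right mult.assoc)
  also have "\<dots> = haar_integral (\<lambda>x. \<pi> x $$ (i, j) * \<sigma> (- x + g) $$ (k, l))"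
  proof -
    have "continuous_on UNIV (\<lambda>x. \<pi> x $$ (i, j) * \<sigma> (- x + g) $$ (k, l))"
      by (intro continuous_intros cP il jk continuous_on_compose2[OF unitary_rep_continuous[OF rs jk(2) il(2)]]) auto
    from haar_translate[OF this, of g] show ?thesis by (simp add: minus_add add.assoc)
  qed
  also have "\<dots> = haar_integral (\<lambda>x. \<Sum>q<m. \<pi> x $$ (i, j) * \<sigma> (- x) $$ (k, q) * \<sigma> g $$ (q, l))"
    unfolding unitary_rep_add[OF rs jk(2) il(2)] by (simp add: sum_distrib_left mult.assoc)
  also have "\<dots> = (\<Sum>q<m. haar_integral (\<lambda>x. \<pi> x $$ (i, j) * \<sigma> (- x) $$ (k, q) * \<sigma> g $$ (q, l)))"
    using il jk by (intro haar_sum) (auto intro!: continuous_intros cP cS)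
  also have "\<dots> = (\<Sum>q<m. haar_integral (\<lambda>x. \<pi> x $$ (i, j) * \<sigma> (- x) $$ (k, q)) * \<sigma> g $$ (q, l))"
    using il jk by (intro sum.cong refl haar_multc) (auto intro!: continuous_intros cP cS)
  also have "\<dots> = (T * \<sigma> g) $$ (i, l)"
    unfolding mat_mult_index[OF T S il] using il by (simp add: T_def matrix_coeff_integral_def)
  finally show "(\<pi> g * T) $$ (i, l) = (T * \<sigma> g) $$ (i, l)" .
qed

lemma schur_orthogonality_inequivalent:
  fixes \<pi> \<sigma> :: "'a \<Rightarrow> complex mat"
  assumes \<pi>: "irreducible_rep n \<pi>" and \<sigma>: "irreducible_rep m \<sigma>" and ne: "(\<pi>, \<sigma>) \<notin> unitarily_equivalent"
    and ijkl: "i < n" "j < n" "k < m" "l < m"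
  shows "haar_integral (\<lambda>x. \<pi> x $$ (i, j) * \<sigma> (- x) $$ (k, l)) = 0"
proof -
  have rp: "unitary_rep n \<pi>" and rs: "unitary_rep m \<sigma>" using \<pi> \<sigma> by (auto simp: irreducible_rep_def)
  let ?T = "mat n m (\<lambda>(i, l). matrix_coeff_integral \<pi> \<sigma> i j k l)"
  have "?T $$ (i, l) = 0"
    using schur_intertwiner[OF \<pi> \<sigma> _ coeff_integral_intertwines[OF rp rs ijkl(2,3)] ijkl(1,4)] ne by auto
  then show ?thesis using ijkl by (simp add: matrix_coeff_integral_def)
qed

text \<open>The averaged matrix unit is a scalar c by Schur. Its trace n c is the integral of the
  (k, j) entry of \<pi> (- x + x), the identity matrix.\<close>

lemma schur_orthogonality:
  fixes \<pi> :: "'a \<Rightarrow> complex mat"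
  assumes \<pi>: "irreducible_rep n \<pi>" and ijkl: "i < n" "j < n" "k < n" "l < n"
  shows "haar_integral (\<lambda>x. \<pi> x $$ (i, j) * \<pi> (- x) $$ (k, l)) = (if i = l \<and> j = k then 1 / of_nat n else 0)"
proof -
  have n: "n > 0" and rp: "unitary_rep n \<pi>" using \<pi> by (auto simp: irreducible_rep_def)
  let ?T = "mat n n (\<lambda>(i, l). matrix_coeff_integral \<pi> \<pi> i j k l)"
  have "?T \<in> carrier_mat n n" by simp
  then obtain c where c: "?T = c \<cdot>\<^sub>m 1\<^sub>m n"
    by (rule schur_commutant[OF \<pi> _ coeff_integral_intertwines[OF rp rp ijkl(2,3)]])
  have cP: "continuous_on UNIV (\<lambda>x. \<pi> x $$ (a, b))" if "a < n" "b < n" for a b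
    by (rule unitary_rep_continuous[OF rp that])
  have cS: "continuous_on UNIV (\<lambda>x. \<pi> (- x) $$ (a, b))" if "a < n" "b < n" for a b
    by (rule uminus_continuous[OF cP[OF that]])
  have "of_nat n * c = (\<Sum>i<n. ?T $$ (i, i))" by (simp add: c)
  also have "\<dots> = (\<Sum>i<n. haar_integral (\<lambda>x. \<pi> (- x) $$ (k, i) * \<pi> x $$ (i, j)))"
    by (intro sum.cong) (auto simp: matrix_coeff_integral_def mult.commute)
  also have "\<dots> = haar_integral (\<lambda>x. \<Sum>i<n. \<pi> (- x) $$ (k, i) * \<pi> x $$ (i, j))"
    using ijkl by (intro haar_sum[symmetric]) (auto intro!: continuous_intros cP cS)
  also have "\<dots> = haar_integral (\<lambda>x::'a. if j = k then 1 else 0)"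
    unfolding unitary_rep_add[OF rp ijkl(3,2), symmetric] using ijkl by (simp add: unitary_rep_zero[OF rp])
  finally have "c = (if j = k then 1 / of_nat n else 0)" using n by (simp add: haar_const field_simps split: if_splits)
  moreover have "matrix_coeff_integral \<pi> \<pi> i j k l = ?T $$ (i, l)" using ijkl by simp
  ultimately show ?thesis unfolding c using ijkl by (simp add: matrix_coeff_integral_def)
qed

end

section \<open>Characters\<close>

lemma class_rep_in:
  assumes p: "p \<in> (unitary_dual :: ('a::topological_group_add \<Rightarrow> complex mat) set set)"
  shows "class_rep p \<in> p"
proof -
  have "p \<noteq> {}" using in_quotient_imp_non_empty[OF equiv_unitarily_equivalent] p by (simp add: unitary_dual_def)
  then show ?thesis unfolding class_rep_def by (simp add: some_in_eq)
qed

lemma class_rep_irreducible: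
  assumes p: "p \<in> (unitary_dual :: ('a::topological_group_add \<Rightarrow> complex mat) set set)"
  shows "irreducible_rep (class_dim p) (class_rep p)"
proof -
  have "class_rep p \<in> irreps"
    using class_rep_in[OF p] in_quotient_imp_subset[OF equiv_unitarily_equivalent] p
    by (auto simp: unitary_dual_def)
  then obtain n where n: "irreducible_rep n (class_rep p)" by (auto simp: irreps_def)
  then have "class_dim p = n" by (simp add: class_dim_def irreducible_rep_def)
  with n show ?thesis by simp
qed

lemma class_rep_unitary:
  "p \<in> (unitary_dual :: ('a::topological_group_add \<Rightarrow> complex mat) set set) \<Longrightarrow> unitary_rep (class_dim p) (class_rep p)"
  using class_rep_irreducible by (auto simp: irreducible_rep_def)

lemma class_dim_pos:
  "p \<in> (unitary_dual :: ('a::topological_group_add \<Rightarrow> complex mat) set set) \<Longrightarrow> class_dim p > 0"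
  using class_rep_irreducible by (auto simp: irreducible_rep_def)

lemma class_rep_inequivalent:
  assumes "p \<in> (unitary_dual :: ('a::topological_group_add \<Rightarrow> complex mat) set set)" "q \<in> unitary_dual" "p \<noteq> q"
  shows "(class_rep p, class_rep q) \<notin> unitarily_equivalent"
  using quotient_eqI[OF equiv_unitarily_equivalent, of p q "class_rep p" "class_rep q"] assms class_rep_in
  by (auto simp: unitary_dual_def)

lemma equivalent_class_rep:
  fixes \<pi> :: "'a::topological_group_add \<Rightarrow> complex mat"
  assumes \<pi>: "irreducible_rep n \<pi>"
  obtains p where "p \<in> unitary_dual" "(\<pi>, class_rep p) \<in> unitarily_equivalent"
proof -
  have i: "\<pi> \<in> irreps" using \<pi> by (auto simp: irreps_def)
  define p where "p = unitarily_equivalent `` {\<pi>}"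
  have p: "p \<in> unitary_dual" unfolding unitary_dual_def p_def using i by (rule quotientI)
  have "(\<pi>, class_rep p) \<in> unitarily_equivalent" using class_rep_in[OF p] by (simp add: p_def)
  with p show ?thesis by (rule that)
qed

text \<open>The coefficient with respect to the normalised character: a character has integral
  square 1 and is the degree times its normalisation, hence the factor in front.\<close>

definition char_coeff :: "('a::topological_group_add \<Rightarrow> complex mat) set \<Rightarrow> ('a \<Rightarrow> complex) \<Rightarrow> complex" where
  "char_coeff p f = of_nat (class_dim p) * haar_integral (\<lambda>x. f x * class_char p (- x))"

definition norm_char :: "('a::topological_group_add \<Rightarrow> complex mat) set \<Rightarrow> 'a \<Rightarrow> complex" where
  "norm_char p x = class_char p x / of_nat (class_dim p)"

definition class_function :: "('a::topological_group_add \<Rightarrow> complex) \<Rightarrow> bool" where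
  "class_function f \<longleftrightarrow> continuous_on UNIV f \<and> (\<forall>a x. f (a + x) = f (x + a))"

lemma unitary_rep_col_norm:
  assumes \<pi>: "unitary_rep n \<pi>" and i: "i < n"
  shows "(\<Sum>l<n. (cmod (\<pi> x $$ (l, i)))\<^sup>2) = 1"
proof -
  have "complex_of_real (\<Sum>l<n. (cmod (\<pi> x $$ (l, i)))\<^sup>2) = (\<Sum>l<n. \<pi> (- x) $$ (i, l) * \<pi> x $$ (l, i))"
    unfolding of_real_sum by (intro sum.cong refl) (simp add: unitary_rep_minus[OF \<pi> i] mult_cnj_self)
  also have "\<dots> = \<pi> (- x + x) $$ (i, i)" by (rule unitary_rep_add[OF \<pi> i i, symmetric])
  also have "\<dots> = 1" using i by (simp add: unitary_rep_zero[OF \<pi>])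
  finally show ?thesis by (simp only: of_real_eq_1_iff)
qed

lemma unitary_rep_entry_le:
  assumes \<pi>: "unitary_rep n \<pi>" and ij: "i < n" "j < n"
  shows "cmod (\<pi> x $$ (i, j)) \<le> 1"
proof -
  have "(cmod (\<pi> x $$ (i, j)))\<^sup>2 \<le> (\<Sum>l<n. (cmod (\<pi> x $$ (l, j)))\<^sup>2)"
    using ij by (intro member_le_sum[of i "{..<n}" "\<lambda>l. (cmod (\<pi> x $$ (l, j)))\<^sup>2"]) auto
  then have "(cmod (\<pi> x $$ (i, j)))\<^sup>2 \<le> 1\<^sup>2" by (simp add: unitary_rep_col_norm[OF \<pi> ij(2)])
  then show ?thesis by (rule power2_le_imp_le) simp
qed

context
  fixes p :: "('a::topological_group_add \<Rightarrow> complex mat) set"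
  assumes p: "p \<in> unitary_dual"
begin

lemma class_char_continuous: "continuous_on UNIV (class_char p)"
  unfolding class_char_def[abs_def]
  by (intro continuous_intros unitary_rep_continuous[OF class_rep_unitary[OF p]]) auto

lemma class_char_minus: "class_char p (- x) = cnj (class_char p x)"
  unfolding class_char_def cnj_sum
  by (intro sum.cong refl) (simp add: unitary_rep_minus[OF class_rep_unitary[OF p]])

lemma class_char_zero: "class_char p 0 = of_nat (class_dim p)"
  by (simp add: class_char_def unitary_rep_zero[OF class_rep_unitary[OF p]])

lemma class_char_commute: "class_char p (a + x) = class_char p (x + a)"
proof -
  have "class_char p (b + y) = (\<Sum>i<class_dim p. \<Sum>l<class_dim p. class_rep p b $$ (i, l) * class_rep p y $$ (l, i))" for b y
    unfolding class_char_def
    by (intro sum.cong refl) (simp add: unitary_rep_add[OF class_rep_unitary[OF p]])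
  then show ?thesis by (simp add: mult.commute) (rule sum.swap)
qed

lemma class_char_le: "cmod (class_char p x) \<le> class_dim p"
proof -
  have "cmod (class_char p x) \<le> (\<Sum>i<class_dim p. 1)"
    unfolding class_char_def
    by (intro order_trans[OF norm_sum] sum_mono) (simp add: unitary_rep_entry_le[OF class_rep_unitary[OF p]])
  then show ?thesis by simp
qed

lemma norm_char_continuous: "continuous_on UNIV (norm_char p)"
  unfolding norm_char_def[abs_def] using class_dim_pos[OF p]
  by (intro continuous_intros class_char_continuous) auto

lemma norm_char_zero: "norm_char p 0 = 1"
  using class_dim_pos[OF p] by (simp add: norm_char_def class_char_zero)

lemma norm_char_le: "cmod (norm_char p x) \<le> 1"
  using class_dim_pos[OF p] class_char_le[of x] by (simp add: norm_char_def norm_divide)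

lemma norm_char_class_function: "class_function (norm_char p)"
  unfolding class_function_def
  using norm_char_continuous class_char_commute by (auto simp: norm_char_def)

end

section \<open>Orthogonality of characters and Fourier coefficients of class functions\<close>

context compact_group
begin

lemma char_entry_orthogonality:
  fixes p q :: "('a \<Rightarrow> complex mat) set"
  assumes p: "p \<in> unitary_dual" and q: "q \<in> unitary_dual" and kl: "k < class_dim q" "l < class_dim q"
  shows "haar_integral (\<lambda>x. class_char p x * class_rep q (- x) $$ (k, l)) =
    (if p = q \<and> k = l then 1 / of_nat (class_dim p) else 0)"
proof -
  have "haar_integral (\<lambda>x. class_char p x * class_rep q (- x) $$ (k, l))
    = haar_integral (\<lambda>x. \<Sum>i<class_dim p. class_rep p x $$ (i, i) * class_rep q (- x) $$ (k, l))"
    by (simp add: class_char_def sum_distrib_right)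
  also have "\<dots> = (\<Sum>i<class_dim p. haar_integral (\<lambda>x. class_rep p x $$ (i, i) * class_rep q (- x) $$ (k, l)))"
    using kl by (intro haar_sum continuous_intros unitary_rep_continuous[OF class_rep_unitary[OF p]]
        uminus_continuous[OF unitary_rep_continuous[OF class_rep_unitary[OF q]]]) auto
  also have "\<dots> = (if p = q \<and> k = l then 1 / of_nat (class_dim p) else 0)"
  proof (cases "p = q")
    case True
    have "(\<Sum>i<class_dim p. haar_integral (\<lambda>x. class_rep p x $$ (i, i) * class_rep q (- x) $$ (k, l)))
      = (\<Sum>i<class_dim p. if i = l then (if k = l then 1 / of_nat (class_dim p) else 0) else 0)"
      using kl True by (intro sum.cong refl) (auto simp: schur_orthogonality[OF class_rep_irreducible[OF q]])
    then show ?thesis using True kl by simp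
  next
    case False
    then show ?thesis
      using schur_orthogonality_inequivalent[OF class_rep_irreducible[OF p] class_rep_irreducible[OF q]
          class_rep_inequivalent[OF p q False]] kl by simp
  qed
  finally show ?thesis .
qed

lemma char_orthogonality:
  fixes p q :: "('a \<Rightarrow> complex mat) set"
  assumes p: "p \<in> unitary_dual" and q: "q \<in> unitary_dual"
  shows "haar_integral (\<lambda>x. class_char p x * class_char q (- x)) = (if p = q then 1 else 0)"
proof -
  have "haar_integral (\<lambda>x. class_char p x * class_char q (- x))
    = haar_integral (\<lambda>x. \<Sum>k<class_dim q. class_char p x * class_rep q (- x) $$ (k, k))"
    by (simp add: class_char_def[of q] sum_distrib_left)
  also have "\<dots> = (\<Sum>k<class_dim q. haar_integral (\<lambda>x. class_char p x * class_rep q (- x) $$ (k, k)))"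
    by (intro haar_sum continuous_intros class_char_continuous[OF p]
        uminus_continuous[OF unitary_rep_continuous[OF class_rep_unitary[OF q]]]) auto
  also have "\<dots> = (if p = q then 1 else 0)"
    using class_dim_pos[OF p] class_dim_pos[OF q] by (auto simp: char_entry_orthogonality[OF p q])
  finally show ?thesis .
qed

lemma char_coeff_integrand_continuous:
  fixes p :: "('a \<Rightarrow> complex mat) set"
  assumes "p \<in> unitary_dual" "continuous_on UNIV f"
  shows "continuous_on UNIV (\<lambda>x. f x * class_char p (- x))"
  by (intro continuous_intros assms uminus_continuous class_char_continuous)

lemma char_coeff_norm_char:
  fixes p q :: "('a \<Rightarrow> complex mat) set"
  assumes p: "p \<in> unitary_dual" and q: "q \<in> unitary_dual"
  shows "char_coeff q (norm_char p) = (if p = q then 1 else 0)"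
proof -
  have "haar_integral (\<lambda>x. norm_char p x * class_char q (- x))
      = haar_integral (\<lambda>x. class_char p x * class_char q (- x)) * (1 / of_nat (class_dim p))"
    by (subst haar_multc[OF char_coeff_integrand_continuous[OF q class_char_continuous[OF p]], symmetric])
      (simp add: norm_char_def)
  then show ?thesis
    using class_dim_pos[OF p] class_dim_pos[OF q] by (auto simp: char_coeff_def char_orthogonality p q)
qed

lemma char_coeff_add:
  fixes f g :: "'a \<Rightarrow> complex"
  assumes "p \<in> unitary_dual" "continuous_on UNIV f" "continuous_on UNIV g"
  shows "char_coeff p (\<lambda>x. f x + g x) = char_coeff p f + char_coeff p g"
  using haar_add[OF char_coeff_integrand_continuous[OF assms(1,2)] char_coeff_integrand_continuous[OF assms(1,3)]]
  by (simp add: char_coeff_def algebra_simps)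

lemma char_coeff_cmult:
  fixes f :: "'a \<Rightarrow> complex"
  assumes "p \<in> unitary_dual" "continuous_on UNIV f"
  shows "char_coeff p (\<lambda>x. c * f x) = c * char_coeff p f"
  using haar_cmult[OF char_coeff_integrand_continuous[OF assms], of c]
  by (simp add: char_coeff_def mult.left_commute mult.assoc)

lemma char_coeff_diff:
  fixes f g :: "'a \<Rightarrow> complex"
  assumes "p \<in> unitary_dual" "continuous_on UNIV f" "continuous_on UNIV g"
  shows "char_coeff p (\<lambda>x. f x - g x) = char_coeff p f - char_coeff p g"
  using haar_diff[OF char_coeff_integrand_continuous[OF assms(1,2)] char_coeff_integrand_continuous[OF assms(1,3)]]
  by (simp add: char_coeff_def left_diff_distrib right_diff_distrib)

lemma char_coeff_sum:
  fixes f :: "'i \<Rightarrow> 'a \<Rightarrow> complex"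
  assumes "p \<in> unitary_dual" "\<And>i. i \<in> F \<Longrightarrow> continuous_on UNIV (f i)"
  shows "char_coeff p (\<lambda>x. \<Sum>i\<in>F. f i x) = (\<Sum>i\<in>F. char_coeff p (f i))"
  using haar_sum[of F "\<lambda>i x. f i x * class_char p (- x)"] char_coeff_integrand_continuous[OF assms(1)] assms(2)
  by (simp add: char_coeff_def sum_distrib_right sum_distrib_left)

lemma char_coeff_bound:
  fixes f :: "'a \<Rightarrow> complex" and M :: real
  assumes p: "p \<in> unitary_dual" and f: "continuous_on UNIV f" and M: "\<And>x. cmod (f x) \<le> M"
  shows "cmod (char_coeff p f) \<le> (class_dim p)\<^sup>2 * M"
proof -
  have M0: "0 \<le> M" using M norm_ge_zero order_trans by blast
  have "cmod (haar_integral (\<lambda>x. f x * class_char p (- x))) \<le> M * class_dim p"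
    by (rule haar_bound[OF char_coeff_integrand_continuous[OF p f]])
      (auto simp: norm_mult intro!: mult_mono M class_char_le[OF p] M0)
  then have "class_dim p * cmod (haar_integral (\<lambda>x. f x * class_char p (- x))) \<le> class_dim p * (M * class_dim p)"
    by (intro mult_left_mono) auto
  then show ?thesis by (simp add: char_coeff_def norm_mult power2_eq_square mult_ac)
qed

lemma char_coeff_lincomb:
  fixes F :: "('a \<Rightarrow> complex mat) set set"
  assumes p: "p \<in> unitary_dual" and F: "F \<subseteq> unitary_dual" "finite F"
  shows "char_coeff p (\<lambda>x. \<Sum>q\<in>F. c q * norm_char q x) = (if p \<in> F then c p else 0)"
proof -
  have cn: "continuous_on UNIV (norm_char q)" if "q \<in> F" for q using norm_char_continuous that F by blast
  have "char_coeff p (\<lambda>x. \<Sum>q\<in>F. c q * norm_char q x) = (\<Sum>q\<in>F. char_coeff p (\<lambda>x. c q * norm_char q x))"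
    by (rule char_coeff_sum[OF p]) (intro continuous_intros cn)
  also have "\<dots> = (\<Sum>q\<in>F. if q = p then c q else 0)"
    using F cn by (intro sum.cong refl) (auto simp: char_coeff_cmult p char_coeff_norm_char subset_iff)
  finally show ?thesis using F(2) by (simp add: sum.delta')
qed

lemma fourier_coeff_index:
  fixes f :: "'a \<Rightarrow> complex"
  assumes p: "p \<in> unitary_dual"
  shows "fourier_coeff f (class_rep p) \<in> carrier_mat (class_dim p) (class_dim p)"
    "i < class_dim p \<Longrightarrow> j < class_dim p \<Longrightarrow>
      fourier_coeff f (class_rep p) $$ (i, j) = haar_integral (\<lambda>x. f x * class_rep p (- x) $$ (i, j))"
  using class_rep_unitary[OF p] by (simp_all add: fourier_coeff_def)

lemma fourier_integrand_continuous:
  fixes p :: "('a \<Rightarrow> complex mat) set"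
  assumes "p \<in> unitary_dual" "continuous_on UNIV f" "i < class_dim p" "j < class_dim p"
  shows "continuous_on UNIV (\<lambda>x. f x * class_rep p (- x) $$ (i, j))"
  by (intro continuous_intros assms uminus_continuous[OF unitary_rep_continuous[OF class_rep_unitary]])

lemma fourier_coeff_trace:
  fixes f :: "'a \<Rightarrow> complex"
  assumes p: "p \<in> unitary_dual" and f: "continuous_on UNIV f"
  shows "char_coeff p f = of_nat (class_dim p) * (\<Sum>i<class_dim p. fourier_coeff f (class_rep p) $$ (i, i))"
proof -
  have "haar_integral (\<lambda>x. f x * class_char p (- x)) = haar_integral (\<lambda>x. \<Sum>i<class_dim p. f x * class_rep p (- x) $$ (i, i))"
    by (simp add: class_char_def sum_distrib_left)
  also have "\<dots> = (\<Sum>i<class_dim p. haar_integral (\<lambda>x. f x * class_rep p (- x) $$ (i, i)))"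
    by (rule haar_sum) (auto intro: fourier_integrand_continuous p f)
  finally show ?thesis by (simp add: char_coeff_def fourier_coeff_index[OF p])
qed

text \<open>Substituting y = a + x - a, which uses left and right invariance of the integral,
  conjugates the Fourier coefficient by the representation.\<close>

lemma fourier_coeff_conjugate:
  fixes f :: "'a \<Rightarrow> complex"
  assumes p: "p \<in> unitary_dual" and f: "continuous_on UNIV f" and ij: "i < class_dim p" "j < class_dim p"
  shows "fourier_coeff (\<lambda>x. f (a + x + - a)) (class_rep p) $$ (i, j)
    = (\<Sum>k<class_dim p. \<Sum>l<class_dim p.
        class_rep p (- a) $$ (i, k) * fourier_coeff f (class_rep p) $$ (k, l) * class_rep p a $$ (l, j))"
proof -
  let ?d = "class_dim p" and ?R = "class_rep p"
  note rep = class_rep_unitary[OF p]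
  have cR: "continuous_on UNIV (\<lambda>x. ?R (- x) $$ (k, l))" if "k < ?d" "l < ?d" for k l
    by (rule uminus_continuous[OF unitary_rep_continuous[OF rep that]])
  have expand: "?R (- a + - y + a) $$ (i, j) = (\<Sum>k<?d. \<Sum>l<?d. ?R (- a) $$ (i, k) * ?R (- y) $$ (k, l) * ?R a $$ (l, j))" for y
  proof -
    have "?R (- a + - y + a) $$ (i, j) = (\<Sum>l<?d. (\<Sum>k<?d. ?R (- a) $$ (i, k) * ?R (- y) $$ (k, l)) * ?R a $$ (l, j))"
      unfolding unitary_rep_add[OF rep ij]
      by (intro sum.cong refl) (simp add: unitary_rep_add[OF rep ij(1)] del: add_uminus_conv_diff)
    also have "\<dots> = (\<Sum>k<?d. \<Sum>l<?d. ?R (- a) $$ (i, k) * ?R (- y) $$ (k, l) * ?R a $$ (l, j))"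
      unfolding sum_distrib_right by (rule sum.swap)
    finally show ?thesis .
  qed
  define h where "h y = f y * ?R (- a + - y + a) $$ (i, j)" for y
  have h: "continuous_on UNIV h"
    unfolding h_def by (intro continuous_intros f continuous_on_compose2[OF unitary_rep_continuous[OF rep ij]]) auto
  have "haar_integral (\<lambda>x. f (a + x + - a) * ?R (- x) $$ (i, j)) = haar_integral (\<lambda>x. h (a + x + - a))"
  proof -
    have "- a + - (a + x + - a) + a = - x" for x
      by (simp only: minus_add minus_minus add.assoc left_minus add_0_right minus_add_cancel)
    then show ?thesis by (simp only: h_def)
  qed
  also have "\<dots> = haar_integral h"
    using haar_translate[OF right_translate_continuous[OF h, of "- a"], of a] haar_translate_right[OF h, of "- a"]
    by simp
  also have "\<dots> = haar_integral (\<lambda>y. \<Sum>k<?d. \<Sum>l<?d. ?R (- a) $$ (i, k) * (f y * ?R (- y) $$ (k, l)) * ?R a $$ (l, j))"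
    unfolding h_def expand by (simp add: sum_distrib_left mult_ac)
  also have "\<dots> = (\<Sum>k<?d. haar_integral (\<lambda>y. \<Sum>l<?d. ?R (- a) $$ (i, k) * (f y * ?R (- y) $$ (k, l)) * ?R a $$ (l, j)))"
    by (rule haar_sum) (auto intro!: continuous_intros f cR)
  also have "\<dots> = (\<Sum>k<?d. \<Sum>l<?d. haar_integral (\<lambda>y. ?R (- a) $$ (i, k) * (f y * ?R (- y) $$ (k, l)) * ?R a $$ (l, j)))"
    by (intro sum.cong refl haar_sum) (auto intro!: continuous_intros f cR)
  also have "\<dots> = (\<Sum>k<?d. \<Sum>l<?d. ?R (- a) $$ (i, k) * haar_integral (\<lambda>y. f y * ?R (- y) $$ (k, l)) * ?R a $$ (l, j))"
  proof (intro sum.cong refl)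
    fix k l assume kl: "k \<in> {..<?d}" "l \<in> {..<?d}"
    then have "continuous_on UNIV (\<lambda>y. f y * ?R (- y) $$ (k, l))" by (auto intro!: continuous_intros f cR)
    then show "haar_integral (\<lambda>y. ?R (- a) $$ (i, k) * (f y * ?R (- y) $$ (k, l)) * ?R a $$ (l, j))
      = ?R (- a) $$ (i, k) * haar_integral (\<lambda>y. f y * ?R (- y) $$ (k, l)) * ?R a $$ (l, j)"
      by (subst haar_multc) (auto intro!: continuous_intros simp: haar_cmult)
  qed
  finally show ?thesis using ij by (simp add: fourier_coeff_index[OF p])
qed

text \<open>A class function is unchanged by conjugation, so its Fourier coefficient commutes with
  the representation and is scalar by Schur. The trace identifies the scalar: one factor of the
  degree comes from \<open>char_coeff\<close>, the other from the trace of the identity.\<close>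

lemma fourier_coeff_scalar:
  fixes f :: "'a \<Rightarrow> complex"
  assumes p: "p \<in> unitary_dual" and f: "class_function f"
  shows "fourier_coeff f (class_rep p) = (char_coeff p f / (of_nat (class_dim p))\<^sup>2) \<cdot>\<^sub>m 1\<^sub>m (class_dim p)"
proof -
  let ?d = "class_dim p" and ?R = "class_rep p" and ?F = "fourier_coeff f (class_rep p)"
  note rep = class_rep_unitary[OF p] and d = class_dim_pos[OF p]
  have cf: "continuous_on UNIV f" and cen: "f (a + x) = f (x + a)" for a x using f by (auto simp: class_function_def)
  note F = fourier_coeff_index(1)[OF p, of f] and R = unitary_rep_carrier[OF rep]
  have conj: "f (a + x + - a) = f x" for a x
    using cen[of "a + x" "- a"] by (simp add: add.assoc[symmetric])
  have "?R a * ?F = ?F * ?R a" for a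
  proof -
    have "?F = ?R (- a) * (?F * ?R a)"
    proof (rule eq_matI)
      fix i j assume "i < dim_row (?R (- a) * (?F * ?R a))" "j < dim_col (?R (- a) * (?F * ?R a))"
      then have ij: "i < ?d" "j < ?d" using R[of a] R[of "- a"] by auto
      have "?F $$ (i, j) = fourier_coeff (\<lambda>x. f (a + x + - a)) ?R $$ (i, j)" unfolding conj ..
      also have "\<dots> = (?R (- a) * (?F * ?R a)) $$ (i, j)"
        unfolding fourier_coeff_conjugate[OF p cf ij] mat_mult_index[OF R mult_carrier_mat[OF F R] ij]
        using ij by (intro sum.cong refl)
          (simp add: mat_mult_index[OF F R] sum_distrib_left mult.assoc del: index_mult_mat)
      finally show "?F $$ (i, j) = (?R (- a) * (?F * ?R a)) $$ (i, j)" .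
    qed (use F R[of a] R[of "- a"] in auto)
    then have "?R a * ?F = ?R a * (?R (- a) * (?F * ?R a))" by simp
    also have "\<dots> = ?R a * ?R (- a) * (?F * ?R a)"
      by (rule assoc_mult_mat[symmetric, OF R R mult_carrier_mat[OF F R]])
    also have "?R a * ?R (- a) = 1\<^sub>m ?d"
      using rep unitary_rep_zero[OF rep] unfolding unitary_rep_def by (metis add.right_inverse)
    also have "1\<^sub>m ?d * (?F * ?R a) = ?F * ?R a" by (rule left_mult_one_mat[OF mult_carrier_mat[OF F R]])
    finally show ?thesis .
  qed
  then obtain c where c: "?F = c \<cdot>\<^sub>m 1\<^sub>m ?d" using schur_commutant[OF class_rep_irreducible[OF p] F] by metis
  have "char_coeff p f = of_nat ?d * (of_nat ?d * c)" by (simp add: fourier_coeff_trace[OF p cf] c)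
  then have "c = char_coeff p f / (of_nat ?d)\<^sup>2" using d by (simp add: power2_eq_square)
  then show ?thesis using c by simp
qed

text \<open>The entries of any irreducible representation are fixed linear combinations of the
  entries of the equivalent chosen one, so it suffices to test one representative of each
  class.\<close>

lemma peter_weyl_dual:
  fixes f :: "'a \<Rightarrow> complex"
  assumes f: "continuous_on UNIV f"
    and zero: "\<And>p i j. p \<in> unitary_dual \<Longrightarrow> i < class_dim p \<Longrightarrow> j < class_dim p \<Longrightarrow>
      fourier_coeff f (class_rep p) $$ (i, j) = 0"
  shows "f = (\<lambda>x. 0)"
proof (rule peter_weyl[OF f])
  fix n and \<pi> :: "'a \<Rightarrow> complex mat" and i j
  assume \<pi>: "irreducible_rep n \<pi>" and ij: "i < n" "j < n"
  obtain p where p: "p \<in> unitary_dual" and eq: "(\<pi>, class_rep p) \<in> unitarily_equivalent"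
    by (rule equivalent_class_rep[OF \<pi>])
  let ?R = "class_rep p"
  obtain m U where m: "irreducible_rep m \<pi>" "irreducible_rep m ?R" and U: "U \<in> unitary_mats m" "\<And>g. U * \<pi> g = ?R g * U"
    using eq by (auto simp: unitarily_equivalent_def)
  have mn: "m = n" using m(1) \<pi> unitary_rep_dim(1) by (metis irreducible_rep_def)
  have dn: "class_dim p = n" using m(2) mn by (simp add: class_dim_def irreducible_rep_def)
  have P: "\<pi> g \<in> carrier_mat n n" and R: "?R g \<in> carrier_mat n n" for g
    using m mn unitary_rep_carrier by (auto simp: irreducible_rep_def)
  have Uc: "U \<in> carrier_mat n n" and U': "mat_adjoint U \<in> carrier_mat n n"
    using U(1) mn by (auto simp: unitary_mats_def mat_adjoint_carrier)
  have "\<pi> g $$ (i, j) = (\<Sum>l<n. \<Sum>k<n. mat_adjoint U $$ (i, k) * ?R g $$ (k, l) * U $$ (l, j))" for g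
  proof -
    have "\<pi> g = mat_adjoint U * ?R g * U"
      by (rule unitary_intertwine_cancel(1)[OF U(1)[unfolded mn] P R U(2)])
    then have "\<pi> g $$ (i, j) = (\<Sum>l<n. (mat_adjoint U * ?R g) $$ (i, l) * U $$ (l, j))"
      using mat_mult_index[OF mult_carrier_mat[OF U' R] Uc ij] by simp
    then show ?thesis using ij by (simp add: mat_mult_index[OF U' R] sum_distrib_right del: index_mult_mat)
  qed
  then have "haar_integral (\<lambda>x. f x * \<pi> (- x) $$ (i, j)) =
      haar_integral (\<lambda>x. \<Sum>l<n. \<Sum>k<n. (mat_adjoint U $$ (i, k) * U $$ (l, j)) * (f x * ?R (- x) $$ (k, l)))"
    by (simp add: sum_distrib_left mult_ac)
  also have "\<dots> = (\<Sum>l<n. haar_integral (\<lambda>x. \<Sum>k<n. (mat_adjoint U $$ (i, k) * U $$ (l, j)) * (f x * ?R (- x) $$ (k, l))))"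
    by (rule haar_sum) (auto simp: dn intro!: continuous_on_sum continuous_on_mult continuous_on_const fourier_integrand_continuous[OF p f, unfolded dn])
  also have "\<dots> = (\<Sum>l<n. \<Sum>k<n. haar_integral (\<lambda>x. (mat_adjoint U $$ (i, k) * U $$ (l, j)) * (f x * ?R (- x) $$ (k, l))))"
    by (intro sum.cong refl haar_sum) (auto intro!: continuous_on_mult continuous_on_const fourier_integrand_continuous[OF p f, unfolded dn])
  also have "\<dots> = 0"
  proof (intro sum.neutral ballI)
    fix l k assume lk: "l \<in> {..<n}" "k \<in> {..<n}"
    then have "haar_integral (\<lambda>x. f x * ?R (- x) $$ (k, l)) = 0"
      using zero[OF p, of k l] by (simp add: fourier_coeff_index[OF p] dn)
    moreover have "continuous_on UNIV (\<lambda>x. f x * ?R (- x) $$ (k, l))"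
      using lk by (intro fourier_integrand_continuous[OF p f, unfolded dn]) auto
    ultimately show "haar_integral (\<lambda>x. (mat_adjoint U $$ (i, k) * U $$ (l, j)) * (f x * ?R (- x) $$ (k, l))) = 0"
      by (subst haar_cmult) auto
  qed
  finally show "haar_integral (\<lambda>x. f x * \<pi> (- x) $$ (i, j)) = 0" .
qed

lemma class_function_char_coeff_eq:
  fixes f g :: "'a \<Rightarrow> complex"
  assumes f: "class_function f" and g: "class_function g"
    and eq: "\<And>p. p \<in> unitary_dual \<Longrightarrow> char_coeff p f = char_coeff p g"
  shows "f = g"
proof -
  have cf: "continuous_on UNIV f" and cg: "continuous_on UNIV g" using f g by (auto simp: class_function_def)
  have h: "class_function (\<lambda>x. f x - g x)"
    using f g by (auto simp: class_function_def intro!: continuous_intros)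
  have "(\<lambda>x. f x - g x) = (\<lambda>x. 0)"
  proof (rule peter_weyl_dual)
    show "continuous_on UNIV (\<lambda>x. f x - g x)" by (intro continuous_intros cf cg)
    fix p :: "('a \<Rightarrow> complex mat) set" and i j assume p: "p \<in> unitary_dual" and ij: "i < class_dim p" "j < class_dim p"
    have "char_coeff p (\<lambda>x. f x - g x) = 0" using eq[OF p] by (simp add: char_coeff_diff p cf cg)
    then show "fourier_coeff (\<lambda>x. f x - g x) (class_rep p) $$ (i, j) = 0"
      using ij by (simp add: fourier_coeff_scalar[OF p h])
  qed
  then show ?thesis by (simp add: fun_eq_iff)
qed

end

section \<open>The central Fourier algebra as an algebra of absolutely convergent character series\<close>

lemma summable_tail:
  fixes M :: "'b \<Rightarrow> real"
  assumes sum: "M summable_on K" and nn: "\<And>p. p \<in> K \<Longrightarrow> 0 \<le> M p" and e: "e > 0"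
  obtains P where "finite P" "P \<subseteq> K" "\<And>Q. finite Q \<Longrightarrow> P \<subseteq> Q \<Longrightarrow> Q \<subseteq> K \<Longrightarrow> infsum M (K - Q) < e"
proof -
  have "\<forall>\<^sub>F Q in finite_subsets_at_top K. dist (sum M Q) (infsum M K) < e"
    using infsum_tendsto[OF sum] e by (rule tendstoD)
  then obtain P where P: "finite P" "P \<subseteq> K"
    "\<And>Q. finite Q \<Longrightarrow> P \<subseteq> Q \<Longrightarrow> Q \<subseteq> K \<Longrightarrow> dist (sum M Q) (infsum M K) < e"
    unfolding eventually_finite_subsets_at_top by metis
  have "infsum M (K - Q) < e" if Q: "finite Q" "P \<subseteq> Q" "Q \<subseteq> K" for Q
  proof -
    have "infsum M K = infsum M (Q \<union> (K - Q))" using Q by (simp add: Un_absorb1)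
    also have "\<dots> = infsum M Q + infsum M (K - Q)"
      using Q summable_on_subset_banach[OF sum] by (intro infsum_Un_disjoint) auto
    finally have "infsum M K = sum M Q + infsum M (K - Q)" using Q by simp
    moreover have "infsum M (K - Q) \<ge> 0" using nn by (intro infsum_nonneg) auto
    ultimately show ?thesis using P(3)[OF Q] by (simp add: dist_real_def)
  qed
  with P(1,2) show ?thesis by (rule that)
qed

section \<open>Identification of the carrier and the norm\<close>

context compact_group
begin

text \<open>The intrinsic description of ZA(G). It is shown below to agree with the carrier, which
  is defined by approximation from the span of the characters.\<close>

definition char_abs_summable :: "('a \<Rightarrow> complex) \<Rightarrow> bool" where
  "char_abs_summable f \<longleftrightarrow> class_function f \<and> (\<lambda>p. cmod (char_coeff p f)) summable_on unitary_dual"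

definition char_norm :: "('a \<Rightarrow> complex) \<Rightarrow> real" where
  "char_norm f = (\<Sum>\<^sub>\<infinity>p\<in>unitary_dual. cmod (char_coeff p f))"

definition char_partial_sum :: "('a \<Rightarrow> complex mat) set set \<Rightarrow> ('a \<Rightarrow> complex) \<Rightarrow> 'a \<Rightarrow> complex" where
  "char_partial_sum P f x = (\<Sum>p\<in>P. char_coeff p f * norm_char p x)"

lemma char_abs_summable_continuous: "char_abs_summable f \<Longrightarrow> continuous_on UNIV f"
  by (simp add: char_abs_summable_def class_function_def)

lemma char_norm_nonneg: "0 \<le> char_norm f"
  unfolding char_norm_def by (rule infsum_nonneg) simp

lemma class_function_lincomb:
  assumes "P \<subseteq> unitary_dual"
  shows "class_function (\<lambda>x. \<Sum>p\<in>P. c p * norm_char p (x :: 'a))"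
proof -
  have cf: "class_function (norm_char p)" if "p \<in> P" for p
    using norm_char_class_function assms that by blast
  show ?thesis
    unfolding class_function_def
  proof (intro conjI allI)
    show "continuous_on UNIV (\<lambda>x. \<Sum>p\<in>P. c p * norm_char p x)"
      using cf by (intro continuous_intros) (auto simp: class_function_def)
    show "(\<Sum>p\<in>P. c p * norm_char p (a + x)) = (\<Sum>p\<in>P. c p * norm_char p (x + a))" for a x
      using cf by (intro sum.cong refl) (auto simp: class_function_def)
  qed
qed

lemma class_function_diff:
  "class_function f \<Longrightarrow> class_function g \<Longrightarrow> class_function (\<lambda>x. f x - g x)"
  by (auto simp: class_function_def intro!: continuous_intros)

lemma char_coeff_minus_lincomb:
  fixes f :: "'a \<Rightarrow> complex"
  assumes f: "continuous_on UNIV f" and P: "finite P" "P \<subseteq> unitary_dual" and p: "p \<in> unitary_dual"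
  shows "char_coeff p (\<lambda>x. f x - (\<Sum>q\<in>P. c q * norm_char q x)) = char_coeff p f - (if p \<in> P then c p else 0)"
  using class_function_lincomb[OF P(2)] f
  by (simp add: char_coeff_diff p class_function_def char_coeff_lincomb P)

lemma char_norm_minus_partial_sum:
  assumes f: "char_abs_summable f" and P: "finite P" "P \<subseteq> unitary_dual"
  shows "char_abs_summable (\<lambda>x. f x - char_partial_sum P f x)"
    and "char_norm (\<lambda>x. f x - char_partial_sum P f x) = infsum (\<lambda>p. cmod (char_coeff p f)) (unitary_dual - P)"
proof -
  have cf: "class_function f" and sm: "(\<lambda>p. cmod (char_coeff p f)) summable_on unitary_dual"
    using f by (auto simp: char_abs_summable_def)
  have c: "char_coeff p (\<lambda>x. f x - char_partial_sum P f x) = (if p \<in> P then 0 else char_coeff p f)" if "p \<in> unitary_dual" for p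
    using char_coeff_minus_lincomb[OF char_abs_summable_continuous[OF f] P that, of "\<lambda>q. char_coeff q f"]
    by (simp add: char_partial_sum_def)
  have "(\<lambda>p. cmod (char_coeff p f)) summable_on (unitary_dual - P)"
    using sm by (rule summable_on_subset_banach) auto
  then have "(\<lambda>p. cmod (char_coeff p (\<lambda>x. f x - char_partial_sum P f x))) summable_on unitary_dual"
    by (rule summable_on_cong_neutral[THEN iffD1, rotated -1]) (auto simp: c)
  moreover have "class_function (\<lambda>x. f x - char_partial_sum P f x)"
    unfolding char_partial_sum_def by (intro class_function_diff cf class_function_lincomb P)
  ultimately show "char_abs_summable (\<lambda>x. f x - char_partial_sum P f x)" by (simp add: char_abs_summable_def)
  show "char_norm (\<lambda>x. f x - char_partial_sum P f x) = infsum (\<lambda>p. cmod (char_coeff p f)) (unitary_dual - P)"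
    unfolding char_norm_def by (rule infsum_cong_neutral) (auto simp: c)
qed

lemma char_partial_sum_dense:
  assumes f: "char_abs_summable f" and e: "e > 0"
  obtains P where "finite P" "P \<subseteq> unitary_dual"
    "\<And>Q. finite Q \<Longrightarrow> P \<subseteq> Q \<Longrightarrow> Q \<subseteq> unitary_dual \<Longrightarrow> char_norm (\<lambda>x. f x - char_partial_sum Q f x) < e"
proof -
  have sm: "(\<lambda>p. cmod (char_coeff p f)) summable_on unitary_dual"
    using f by (auto simp: char_abs_summable_def)
  obtain P where P: "finite P" "P \<subseteq> unitary_dual"
    "\<And>Q. finite Q \<Longrightarrow> P \<subseteq> Q \<Longrightarrow> Q \<subseteq> unitary_dual \<Longrightarrow> infsum (\<lambda>p. cmod (char_coeff p f)) (unitary_dual - Q) < e"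
    using summable_tail[OF sm _ e] by (metis norm_ge_zero)
  with that show ?thesis by (simp add: char_norm_minus_partial_sum[OF f])
qed

lemma fourier_term_class_function:
  assumes p: "p \<in> unitary_dual" and f: "class_function f"
  shows "real (class_dim p) * trace_norm (fourier_coeff f (class_rep p)) = cmod (char_coeff p (f :: 'a \<Rightarrow> complex))"
  using class_dim_pos[OF p]
  by (simp add: fourier_coeff_scalar[OF p f] trace_norm_scalar norm_divide norm_mult power2_eq_square)

lemma vnorm_class_function:
  assumes "class_function f"
  shows "vnorm fourier_algebra f = char_norm (f :: 'a \<Rightarrow> complex)"
  unfolding fourier_algebra_def char_norm_def
  by (simp, rule infsum_cong) (simp add: fourier_term_class_function assms)

lemma char_span_eq:
  assumes "finite F" "F \<subseteq> unitary_dual"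
  shows "(\<lambda>x :: 'a. \<Sum>p\<in>F. c p * class_char p x) = (\<lambda>x. \<Sum>p\<in>F. c p * of_nat (class_dim p) * norm_char p x)"
    (is "?l = ?r")
proof
  fix x
  have "class_dim p > 0" if "p \<in> F" for p using class_dim_pos assms that by blast
  then show "?l x = ?r x" by (intro sum.cong refl) (simp add: norm_char_def less_imp_neq[symmetric])
qed

text \<open>Partial sums of the character series lie in the span of the characters, and the norm of
  the remainder is a tail of a summable family.\<close>

lemma char_abs_summable_in_carrier:
  assumes f: "char_abs_summable f"
  shows "f \<in> carrier (central_fourier_algebra :: ('a \<Rightarrow> complex) normed)"
proof -
  have cf: "class_function f" and sm: "(\<lambda>p. cmod (char_coeff p f)) summable_on unitary_dual"
    using f by (auto simp: char_abs_summable_def)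
  have "(\<lambda>p. real (class_dim p) * trace_norm (fourier_coeff f (class_rep p))) summable_on unitary_dual
     \<longleftrightarrow> (\<lambda>p. cmod (char_coeff p f)) summable_on unitary_dual"
    by (rule summable_on_cong) (simp add: fourier_term_class_function cf)
  then have fA: "f \<in> carrier fourier_algebra"
    using sm cf by (simp add: fourier_algebra_def class_function_def)
  have "\<exists>h\<in>character_span. vnorm fourier_algebra (\<lambda>x. f x - h x) < e" if e: "e > 0" for e
  proof -
    obtain P where P: "finite P" "P \<subseteq> unitary_dual"
      "\<And>Q. finite Q \<Longrightarrow> P \<subseteq> Q \<Longrightarrow> Q \<subseteq> unitary_dual \<Longrightarrow> char_norm (\<lambda>x. f x - char_partial_sum Q f x) < e"
      using char_partial_sum_dense[OF f e] by blast
    let ?h = "char_partial_sum P f"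
    have "?h = (\<lambda>x. \<Sum>p\<in>P. (char_coeff p f / of_nat (class_dim p)) * class_char p x)"
      by (simp add: char_partial_sum_def[abs_def] norm_char_def)
    then have "?h \<in> character_span"
      unfolding character_span_def using P
      by (intro CollectI exI[of _ P] exI[of _ "\<lambda>p. char_coeff p f / of_nat (class_dim p)"] conjI)
    moreover have "vnorm fourier_algebra (\<lambda>x. f x - ?h x) < e"
      using char_norm_minus_partial_sum(1)[OF f P(1,2)] P(3)[of P] P(1,2)
      by (simp add: vnorm_class_function char_abs_summable_def)
    ultimately show ?thesis by blast
  qed
  with fA show ?thesis by (simp add: central_fourier_algebra_def)
qed

text \<open>The norm dominates all entries of all Fourier coefficients, so approximation by
  combinations of characters forces every coefficient of f to be scalar. Scalar coefficients are
  unchanged by conjugation; by Peter-Weyl f is then a class function, and for such functions the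
  series in the definition of the Fourier algebra is the series of the |char_coeff|.\<close>

lemma carrier_char_abs_summable:
  assumes f: "f \<in> carrier (central_fourier_algebra :: ('a \<Rightarrow> complex) normed)"
  shows "char_abs_summable f"
proof -
  have cf: "continuous_on UNIV f"
    and sm: "(\<lambda>p. real (class_dim p) * trace_norm (fourier_coeff f (class_rep p))) summable_on unitary_dual"
    and app: "\<And>e. e > 0 \<Longrightarrow> \<exists>h\<in>character_span. vnorm fourier_algebra (\<lambda>x. f x - h x) < e"
    using f by (auto simp: central_fourier_algebra_def fourier_algebra_def)
  have near: "\<exists>c. \<forall>i<class_dim q. \<forall>j<class_dim q.
      cmod (fourier_coeff f (class_rep q) $$ (i, j) - (if i = j then c else 0)) \<le> e"
    if q: "q \<in> unitary_dual" and e: "e > 0" for q e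
  proof -
    obtain h where h: "h \<in> character_span" "vnorm fourier_algebra (\<lambda>x. f x - h x) < e" using app[OF e] by blast
    then obtain F c0 where F: "finite F" "F \<subseteq> unitary_dual" "h = (\<lambda>x. \<Sum>p\<in>F. c0 p * class_char p x)"
      by (auto simp: character_span_def)
    define c where "c p = c0 p * of_nat (class_dim p)" for p
    have h_eq: "h = (\<lambda>x. \<Sum>p\<in>F. c p * norm_char p x)" unfolding F(3) c_def by (rule char_span_eq[OF F(1,2)])
    have hc: "class_function h" unfolding h_eq by (rule class_function_lincomb[OF F(2)])
    then have hcont: "continuous_on UNIV h" by (simp add: class_function_def)
    have diff: "fourier_coeff (\<lambda>x. f x - h x) (class_rep p) $$ (i, j)
        = fourier_coeff f (class_rep p) $$ (i, j) - (if i = j then char_coeff p h / (of_nat (class_dim p))\<^sup>2 else 0)"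
      if p: "p \<in> unitary_dual" and ij: "i < class_dim p" "j < class_dim p" for p i j
    proof -
      have "fourier_coeff (\<lambda>x. f x - h x) (class_rep p) $$ (i, j)
          = fourier_coeff f (class_rep p) $$ (i, j) - fourier_coeff h (class_rep p) $$ (i, j)"
        using haar_diff[OF fourier_integrand_continuous[OF p cf ij] fourier_integrand_continuous[OF p hcont ij]] ij
        by (simp add: fourier_coeff_index[OF p] left_diff_distrib)
      then show ?thesis using ij by (simp add: fourier_coeff_scalar[OF p hc])
    qed
    let ?t = "\<lambda>g p. real (class_dim p) * trace_norm (fourier_coeff g (class_rep p))"
    have tnn: "0 \<le> ?t g p" if "p \<in> unitary_dual" for g and p :: "('a \<Rightarrow> complex mat) set"
      using frobenius_le_trace_norm(2)[OF fourier_coeff_index(1)[OF that]] by simp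
    have same: "?t (\<lambda>x. f x - h x) p = ?t f p" if p: "p \<in> unitary_dual - F" for p
    proof -
      have "char_coeff p h = 0" using p F(1,2) unfolding h_eq by (subst char_coeff_lincomb) auto
      then have "fourier_coeff (\<lambda>x. f x - h x) (class_rep p) = fourier_coeff f (class_rep p)"
        using p carrier_matD[OF fourier_coeff_index(1)[of p]] by (intro eq_matI) (auto simp: diff)
      then show ?thesis by simp
    qed
    \<comment> \<open>The norm is an infinite sum, with default value 0 on families that are not
      summable. So summability for f - h has to be known before a single term is compared with the
      norm; outside the finite set F the terms agree with those of f.\<close>
    have "?t f summable_on (unitary_dual - F)" by (rule summable_on_subset_banach[OF sm]) auto
    then have "?t (\<lambda>x. f x - h x) summable_on (unitary_dual - F)"
      by (rule summable_on_cong[THEN iffD1, rotated]) (simp add: same)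
    then have "?t (\<lambda>x. f x - h x) summable_on (unitary_dual - F) \<union> F"
      using F(1) by (intro summable_on_Un_disjoint) auto
    then have sd: "?t (\<lambda>x. f x - h x) summable_on unitary_dual" using F(2) by (simp add: Un_absorb2)
    have "?t (\<lambda>x. f x - h x) q \<le> vnorm fourier_algebra (\<lambda>x. f x - h x)"
      using finite_sum_le_infsum[OF sd, of "{q}"] q tnn by (simp add: fourier_algebra_def)
    then have te: "?t (\<lambda>x. f x - h x) q < e" using h(2) by simp
    have d: "class_dim q \<ge> 1" using class_dim_pos[OF q] by simp
    have tn: "trace_norm (fourier_coeff (\<lambda>x. f x - h x) (class_rep q)) \<le> e"
    proof -
      have "trace_norm (fourier_coeff (\<lambda>x. f x - h x) (class_rep q)) \<le> ?t (\<lambda>x. f x - h x) q"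
        using d frobenius_le_trace_norm(2)[OF fourier_coeff_index(1)[OF q, of "\<lambda>x. f x - h x"]]
        by (simp add: mult_le_cancel_right1)
      then show ?thesis using te by simp
    qed
    show ?thesis
    proof (intro exI[of _ "char_coeff q h / (of_nat (class_dim q))\<^sup>2"] allI impI)
      fix i j assume ij: "i < class_dim q" "j < class_dim q"
      show "cmod (fourier_coeff f (class_rep q) $$ (i, j) - (if i = j then char_coeff q h / (of_nat (class_dim q))\<^sup>2 else 0)) \<le> e"
        unfolding diff[OF q ij, symmetric]
        using entry_le_trace_norm[OF fourier_coeff_index(1)[OF q] ij] tn order_trans by blast
    qed
  qed
  \<comment> \<open>The approximating scalar depends on e; comparing it with the entry at (0, 0),
    which exists because the degree is positive, removes it when e tends to 0.\<close>
  have scalar: "fourier_coeff f (class_rep q) $$ (i, j) = (if i = j then fourier_coeff f (class_rep q) $$ (0, 0) else 0)"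
    if q: "q \<in> unitary_dual" and ij: "i < class_dim q" "j < class_dim q" for q i j
  proof -
    let ?F = "\<lambda>i j. fourier_coeff f (class_rep q) $$ (i, j)"
    have "cmod (?F i j - (if i = j then ?F 0 0 else 0)) \<le> 2 * e" if e: "e > 0" for e
    proof -
      obtain c where c: "\<And>i j. i < class_dim q \<Longrightarrow> j < class_dim q \<Longrightarrow> cmod (?F i j - (if i = j then c else 0)) \<le> e"
        using near[OF q e] by blast
      have "cmod (?F 0 0 - c) \<le> e" using c[of 0 0] class_dim_pos[OF q] by simp
      then show ?thesis using c[OF ij] e norm_triangle_ineq4[of "?F i j - c" "?F 0 0 - c"] by (auto split: if_splits)
    qed
    then have "cmod (?F i j - (if i = j then ?F 0 0 else 0)) \<le> 0 + e" if "e > 0" for e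
      using that by (metis add_0 half_gt_zero mult.commute nonzero_divide_eq_eq zero_neq_numeral)
    then have "cmod (?F i j - (if i = j then ?F 0 0 else 0)) \<le> 0" by (rule field_le_epsilon)
    then show ?thesis by simp
  qed
  have conj: "f (a + x + - a) = f x" for a x
  proof -
    have ca: "continuous_on UNIV (\<lambda>x. f (a + x + - a))"
      by (intro left_translate_continuous[of "\<lambda>y. f (y + - a)"] right_translate_continuous cf)
    have "(\<lambda>x. f (a + x + - a) - f x) = (\<lambda>x. 0)"
    proof (rule peter_weyl_dual)
      show "continuous_on UNIV (\<lambda>x. f (a + x + - a) - f x)" by (intro continuous_intros ca cf)
      fix p :: "('a \<Rightarrow> complex mat) set" and i j
      assume p: "p \<in> unitary_dual" and ij: "i < class_dim p" "j < class_dim p"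
      let ?d = "class_dim p" and ?R = "class_rep p"
      obtain c where c: "\<And>i j. i < ?d \<Longrightarrow> j < ?d \<Longrightarrow> fourier_coeff f ?R $$ (i, j) = (if i = j then c else 0)"
        using scalar[OF p] by blast
      have "fourier_coeff (\<lambda>x. f (a + x + - a)) ?R $$ (i, j)
          = (\<Sum>k<?d. \<Sum>l<?d. if k = l then c * (?R (- a) $$ (i, k) * ?R a $$ (k, j)) else 0)"
        unfolding fourier_coeff_conjugate[OF p cf ij]
        by (intro sum.cong refl) (auto simp: c)
      also have "\<dots> = c * (\<Sum>k<?d. ?R (- a) $$ (i, k) * ?R a $$ (k, j))"
        by (simp add: sum_distrib_left)
      also have "\<dots> = c * ?R (- a + a) $$ (i, j)"
        unfolding unitary_rep_add[OF class_rep_unitary[OF p] ij] ..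
      also have "\<dots> = fourier_coeff f ?R $$ (i, j)"
        using ij by (simp add: unitary_rep_zero[OF class_rep_unitary[OF p]] c)
      finally have "fourier_coeff (\<lambda>x. f (a + x + - a)) ?R $$ (i, j) = fourier_coeff f ?R $$ (i, j)" .
      then show "fourier_coeff (\<lambda>x. f (a + x + - a) - f x) ?R $$ (i, j) = 0"
        using haar_diff[OF fourier_integrand_continuous[OF p ca ij] fourier_integrand_continuous[OF p cf ij]] ij
        by (simp add: fourier_coeff_index[OF p] left_diff_distrib)
    qed
    from fun_cong[OF this, of x] show ?thesis by simp
  qed
  have "f (a + x) = f (x + a)" for a x using conj[of a "x + a"] by (simp add: add.assoc[symmetric])
  then have cl: "class_function f" using cf by (simp add: class_function_def)
  have "(\<lambda>p. cmod (char_coeff p f)) summable_on unitary_dual"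
    using sm by (rule summable_on_cong[THEN iffD1, rotated]) (simp add: fourier_term_class_function cl)
  with cl show ?thesis by (simp add: char_abs_summable_def)
qed

lemma char_coeff_uniform_limit:
  fixes F :: "'b \<Rightarrow> 'a \<Rightarrow> complex"
  assumes ul: "uniform_limit UNIV F g B" and F: "\<And>P. continuous_on UNIV (F P)" and g: "continuous_on UNIV g"
    and q: "q \<in> unitary_dual"
  shows "((\<lambda>P. char_coeff q (F P)) \<longlongrightarrow> char_coeff q g) B"
proof (rule tendstoI)
  fix e :: real assume e: "e > 0"
  let ?D = "(real (class_dim q))\<^sup>2"
  have D: "?D > 0" using class_dim_pos[OF q] by simp
  define d where "d = e / (2 * ?D)"
  have "d > 0" using e D by (simp add: d_def)
  then have "\<forall>\<^sub>F P in B. \<forall>x\<in>UNIV. dist (F P x) (g x) < d" using ul by (simp add: uniform_limit_iff)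
  then show "\<forall>\<^sub>F P in B. dist (char_coeff q (F P)) (char_coeff q g) < e"
  proof eventually_elim
    case (elim P)
    have "cmod (char_coeff q (\<lambda>x. F P x - g x)) \<le> ?D * d"
      using elim by (intro char_coeff_bound[OF q, THEN order_trans]) (auto intro!: continuous_intros F g simp: dist_norm less_imp_le)
    also have "\<dots> < e" using D e by (simp add: d_def)
    finally show ?case by (simp add: char_coeff_diff q F g dist_norm)
  qed
qed

lemma char_partial_sum_continuous:
  "continuous_on UNIV (\<lambda>x. char_partial_sum (P \<inter> unitary_dual) f x)"
  using class_function_lincomb[of "P \<inter> unitary_dual" "\<lambda>p. char_coeff p f"]
  by (simp add: char_partial_sum_def class_function_def)

text \<open>Normalised characters are bounded by 1, so the series converges uniformly by the M-test.
  Its sum is a class function with the same coefficients as f, and class functions are determined by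
  their coefficients.\<close>

lemma char_series:
  assumes f: "char_abs_summable f"
  shows "uniform_limit UNIV (\<lambda>P. char_partial_sum P f) f (finite_subsets_at_top unitary_dual)"
    and "f x = (\<Sum>\<^sub>\<infinity>p\<in>unitary_dual. char_coeff p f * norm_char p x)"
    and "cmod (f x) \<le> char_norm f"
proof -
  have cl: "class_function f" and sm: "(\<lambda>p. cmod (char_coeff p f)) summable_on unitary_dual"
    using f by (auto simp: char_abs_summable_def)
  let ?K = "unitary_dual :: ('a \<Rightarrow> complex mat) set set"
  let ?B = "finite_subsets_at_top ?K"
  define g where "g x = (\<Sum>\<^sub>\<infinity>p\<in>?K. char_coeff p f * norm_char p x)" for x
  have le: "cmod (char_coeff p f * norm_char p x) \<le> cmod (char_coeff p f)" if "p \<in> ?K" for p x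
    using mult_left_mono[OF norm_char_le[OF that, of x], of "cmod (char_coeff p f)"] by (simp add: norm_mult)
  have ul: "uniform_limit UNIV (\<lambda>P. char_partial_sum P f) g ?B"
    unfolding char_partial_sum_def[abs_def] g_def[abs_def]
    by (rule Weierstrass_m_test_general[OF le sm])
  have ev: "\<forall>\<^sub>F P in ?B. \<forall>x\<in>UNIV. char_partial_sum P f x = char_partial_sum (P \<inter> ?K) f x"
    unfolding eventually_finite_subsets_at_top
    by (intro exI[of _ "{}"]) (auto simp: Int_absorb2)
  \<comment> \<open>Intersecting with the dual makes every partial sum continuous, not just those of
    eventually all index sets.\<close>
  have ul': "uniform_limit UNIV (\<lambda>P. char_partial_sum (P \<inter> ?K) f) g ?B"
    using ul by (rule uniform_limit_cong[THEN iffD1, OF ev, rotated]) simp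
  have cg: "continuous_on UNIV g"
    by (rule uniform_limit_theorem[OF _ ul']) (auto intro!: always_eventually char_partial_sum_continuous)
  have clg: "class_function g"
    unfolding class_function_def
  proof (intro conjI cg allI)
    show "g (a + x) = g (x + a)" for a x
      unfolding g_def
      by (rule infsum_cong) (use norm_char_class_function in \<open>auto simp: class_function_def\<close>)
  qed
  have "char_coeff q f = char_coeff q g" if q: "q \<in> ?K" for q
  proof (rule tendsto_unique)
    show "((\<lambda>P. char_coeff q (char_partial_sum (P \<inter> ?K) f)) \<longlongrightarrow> char_coeff q g) ?B"
      by (rule char_coeff_uniform_limit[OF ul' _ cg q]) (rule char_partial_sum_continuous)
    have "\<forall>\<^sub>F P in ?B. char_coeff q (char_partial_sum (P \<inter> ?K) f) = char_coeff q f"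
      unfolding eventually_finite_subsets_at_top
    proof (intro exI[of _ "{q}"] conjI allI impI)
      fix P assume "finite P \<and> {q} \<subseteq> P \<and> P \<subseteq> ?K"
      then show "char_coeff q (char_partial_sum (P \<inter> ?K) f) = char_coeff q f"
        unfolding char_partial_sum_def by (subst char_coeff_lincomb[OF q]) auto
    qed (use q in auto)
    then show "((\<lambda>P. char_coeff q (char_partial_sum (P \<inter> ?K) f)) \<longlongrightarrow> char_coeff q f) ?B"
      by (rule tendsto_eventually)
  qed simp
  then have fg: "f = g" by (rule class_function_char_coeff_eq[OF cl clg])
  show "uniform_limit UNIV (\<lambda>P. char_partial_sum P f) f ?B" using ul fg by simp
  show s: "f x = (\<Sum>\<^sub>\<infinity>p\<in>?K. char_coeff p f * norm_char p x)" for x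
    by (subst fg) (simp only: g_def)
  have asum: "(\<lambda>p. norm (char_coeff p f * norm_char p x)) summable_on ?K"
    by (rule summable_on_comparison_test[OF sm]) (auto intro: le)
  have "cmod (f x) \<le> (\<Sum>\<^sub>\<infinity>p\<in>?K. norm (char_coeff p f * norm_char p x))"
    unfolding s[of x] by (rule norm_infsum_bound[OF asum])
  also have "\<dots> \<le> char_norm f"
    unfolding char_norm_def by (rule infsum_mono[OF asum sm le])
  finally show "cmod (f x) \<le> char_norm f" .
qed

end

section \<open>Products of characters and submultiplicativity of the norm\<close>

context compact_group
begin

lemma conv_class_char:
  fixes p q :: "('a \<Rightarrow> complex mat) set"
  assumes p: "p \<in> unitary_dual" and q: "q \<in> unitary_dual"
  shows "conv (class_char p) (class_char q) x = (if p = q then class_char p x / of_nat (class_dim p) else 0)"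
proof -
  let ?d = "class_dim q" and ?R = "class_rep q"
  note rep = class_rep_unitary[OF q]
  note cont = fourier_integrand_continuous[OF q class_char_continuous[OF p]]
  have "class_char q (- y + x) = (\<Sum>i<?d. \<Sum>l<?d. ?R (- y) $$ (i, l) * ?R x $$ (l, i))" for y
    unfolding class_char_def by (intro sum.cong refl) (simp add: unitary_rep_add[OF rep])
  then have "conv (class_char p) (class_char q) x
      = haar_integral (\<lambda>y. \<Sum>i<?d. \<Sum>l<?d. class_char p y * ?R (- y) $$ (i, l) * ?R x $$ (l, i))"
    by (simp add: conv_def sum_distrib_left mult.assoc)
  also have "\<dots> = (\<Sum>i<?d. haar_integral (\<lambda>y. \<Sum>l<?d. class_char p y * ?R (- y) $$ (i, l) * ?R x $$ (l, i)))"
    by (rule haar_sum) (auto intro!: continuous_on_sum continuous_on_mult[OF cont continuous_on_const])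
  also have "\<dots> = (\<Sum>i<?d. \<Sum>l<?d. haar_integral (\<lambda>y. class_char p y * ?R (- y) $$ (i, l) * ?R x $$ (l, i)))"
    by (intro sum.cong refl haar_sum) (auto intro!: continuous_on_mult[OF cont continuous_on_const])
  also have "\<dots> = (\<Sum>i<?d. \<Sum>l<?d. if i = l then (if p = q then ?R x $$ (i, i) / of_nat (class_dim p) else 0) else 0)"
    by (intro sum.cong refl, subst haar_multc[OF cont]) (auto simp: char_entry_orthogonality[OF p q])
  also have "\<dots> = (if p = q then class_char p x / of_nat (class_dim p) else 0)"
    by (auto simp: class_char_def sum_divide_distrib)
  finally show ?thesis .
qed

text \<open>The central idempotent of the convolution algebra that belongs to the isotypic
  components of the classes in R.\<close>

definition dual_projection :: "('a \<Rightarrow> complex mat) set set \<Rightarrow> 'a \<Rightarrow> complex" where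
  "dual_projection R x = (\<Sum>p\<in>R. of_nat (class_dim p) * class_char p x)"

context
  fixes R :: "('a \<Rightarrow> complex mat) set set"
  assumes R: "finite R" "R \<subseteq> unitary_dual"
begin

private lemma RD: "p \<in> R \<Longrightarrow> p \<in> unitary_dual" using R by blast

lemma dual_projection_continuous: "continuous_on UNIV (dual_projection R)"
  unfolding dual_projection_def[abs_def]
  by (intro continuous_intros class_char_continuous RD)

lemma dual_projection_minus: "dual_projection R (- x) = cnj (dual_projection R x)"
  unfolding dual_projection_def cnj_sum
  by (intro sum.cong refl) (simp add: class_char_minus RD)

lemma dual_projection_commute: "dual_projection R (a + x) = dual_projection R (x + a)"
  unfolding dual_projection_def
  by (intro sum.cong refl) (simp add: class_char_commute[OF RD, of _ a x])

lemma dual_projection_conv: "conv (dual_projection R) (dual_projection R) = dual_projection R"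
proof
  fix x
  let ?d = "\<lambda>p. complex_of_nat (class_dim p)"
  have cc: "continuous_on UNIV (\<lambda>y. class_char p y * class_char q (- y + x))" if "p \<in> R" "q \<in> R" for p q
    by (intro conv_integrand_continuous class_char_continuous RD that)
  have "conv (dual_projection R) (dual_projection R) x
      = haar_integral (\<lambda>y. \<Sum>p\<in>R. \<Sum>q\<in>R. ?d p * ?d q * (class_char p y * class_char q (- y + x)))"
    unfolding conv_def dual_projection_def sum_product by (simp add: mult_ac)
  also have "\<dots> = (\<Sum>p\<in>R. haar_integral (\<lambda>y. \<Sum>q\<in>R. ?d p * ?d q * (class_char p y * class_char q (- y + x))))"
    by (rule haar_sum) (intro continuous_on_sum continuous_on_mult[OF continuous_on_const cc])
  also have "\<dots> = (\<Sum>p\<in>R. \<Sum>q\<in>R. haar_integral (\<lambda>y. ?d p * ?d q * (class_char p y * class_char q (- y + x))))"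
    by (intro sum.cong refl haar_sum) (intro continuous_on_mult[OF continuous_on_const cc])
  also have "\<dots> = (\<Sum>p\<in>R. \<Sum>q\<in>R. ?d p * ?d q * conv (class_char p) (class_char q) x)"
    unfolding conv_def by (intro sum.cong refl haar_cmult cc)
  also have "\<dots> = (\<Sum>p\<in>R. \<Sum>q\<in>R. if p = q then ?d p * class_char p x else 0)"
    using class_dim_pos[OF RD] by (intro sum.cong refl) (auto simp: conv_class_char[OF RD RD])
  also have "\<dots> = dual_projection R x" using R(1) by (simp add: dual_projection_def)
  finally show "conv (dual_projection R) (dual_projection R) x = dual_projection R x" .
qed

lemma sum_char_coeff:
  fixes f :: "'a \<Rightarrow> complex"
  assumes f: "continuous_on UNIV f"
  shows "(\<Sum>p\<in>R. char_coeff p f) = haar_integral (\<lambda>x. f x * dual_projection R (- x))"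
proof -
  have "haar_integral (\<lambda>x. f x * dual_projection R (- x))
      = haar_integral (\<lambda>x. \<Sum>p\<in>R. of_nat (class_dim p) * (f x * class_char p (- x)))"
    by (simp add: dual_projection_def sum_distrib_left mult.left_commute)
  also have "\<dots> = (\<Sum>p\<in>R. haar_integral (\<lambda>x. of_nat (class_dim p) * (f x * class_char p (- x))))"
    by (rule haar_sum) (intro continuous_on_mult[OF continuous_on_const] char_coeff_integrand_continuous RD f)
  also have "\<dots> = (\<Sum>p\<in>R. char_coeff p f)"
    unfolding char_coeff_def by (intro sum.cong refl haar_cmult char_coeff_integrand_continuous RD f)
  finally show ?thesis ..
qed

text \<open>The matrix \<open>\<integral> t(x) e(-x) dx\<close>, where \<open>e\<close> is the self-adjoint central idempotent \<open>\<Sum>p\<in>R. d\<^sub>p \<chi>\<^sub>p\<close>,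
  is an orthogonal projection, so its diagonal entries lie in \<open>[0, 1]\<close>.\<close>

lemma projection_diagonal:
  fixes t :: "'i \<Rightarrow> 'i \<Rightarrow> 'a \<Rightarrow> complex"
  assumes I: "finite I"
    and cont: "\<And>a b. a \<in> I \<Longrightarrow> b \<in> I \<Longrightarrow> continuous_on UNIV (t a b)"
    and add: "\<And>a c x y. a \<in> I \<Longrightarrow> c \<in> I \<Longrightarrow> t a c (x + y) = (\<Sum>b\<in>I. t a b x * t b c y)"
    and minus: "\<And>a b x. a \<in> I \<Longrightarrow> b \<in> I \<Longrightarrow> t a b (- x) = cnj (t b a x)"
    and a: "a \<in> I"
  defines "z \<equiv> haar_integral (\<lambda>x. t a a x * dual_projection R (- x))"
  shows "z = of_real (Re z)" "0 \<le> Re z" "Re z \<le> 1"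
proof -
  let ?e = "dual_projection R"
  note ce = dual_projection_continuous
  define Q where "Q a b = haar_integral (\<lambda>x. t a b x * ?e (- x))" for a b
  have cQ: "continuous_on UNIV (\<lambda>x. t a b x * ?e (- x))" if "a \<in> I" "b \<in> I" for a b
    by (intro continuous_intros cont that uminus_continuous ce)
  have herm: "Q b a = cnj (Q a b)" if "a \<in> I" "b \<in> I" for a b
  proof -
    have "cnj (Q a b) = haar_integral (\<lambda>x. cnj (t a b x * ?e (- x)))"
      unfolding Q_def by (rule haar_cnj[symmetric, OF cQ[OF that]])
    also have "\<dots> = haar_integral (\<lambda>x. t b a (- x) * ?e (- (- x)))"
      by (simp add: minus[OF that(2,1)] dual_projection_minus)
    also have "\<dots> = Q b a" unfolding Q_def by (rule haar_uminus[OF cQ[OF that(2,1)]])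
    finally show ?thesis ..
  qed
  \<comment> \<open>The substitution z = x + y collects the product of two entries into one entry of
    t at z, and the x-integral that remains is the convolution of the idempotent with
    itself.\<close>
  have idem: "(\<Sum>b\<in>I. Q a b * Q b c) = Q a c" if c: "c \<in> I" for c
  proof -
    have ct: "continuous_on UNIV (\<lambda>x. t b c' (- x))" if "b \<in> I" "c' \<in> I" for b c'
      by (intro uminus_continuous cont that)
    have "(\<Sum>b\<in>I. Q a b * Q b c)
        = (\<Sum>b\<in>I. haar_integral (\<lambda>x. haar_integral (\<lambda>y. t a b x * ?e (- x) * (t b c y * ?e (- y)))))"
    proof (rule sum.cong[OF refl])
      fix b assume b: "b \<in> I"
      have "haar_integral (\<lambda>y. t a b x * ?e (- x) * (t b c y * ?e (- y))) = t a b x * ?e (- x) * Q b c" for x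
        unfolding Q_def by (rule haar_cmult[OF cQ[OF b c]])
      then show "Q a b * Q b c = haar_integral (\<lambda>x. haar_integral (\<lambda>y. t a b x * ?e (- x) * (t b c y * ?e (- y))))"
        by (simp add: haar_multc[OF cQ[OF a b]] Q_def)
    qed
    also have "\<dots> = haar_integral (\<lambda>x. \<Sum>b\<in>I. haar_integral (\<lambda>y. t a b x * ?e (- x) * (t b c y * ?e (- y))))"
    proof (rule haar_sum[symmetric])
      fix b assume b: "b \<in> I"
      show "continuous_on UNIV (\<lambda>x. haar_integral (\<lambda>y. t a b x * ?e (- x) * (t b c y * ?e (- y))))"
        by (subst haar_cmult[OF cQ[OF b c]]) (intro continuous_intros cQ a b)
    qed
    also have "\<dots> = haar_integral (\<lambda>x. haar_integral (\<lambda>z. t a c z * ?e (- x) * ?e (- z + x)))"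
    proof (rule arg_cong[of _ _ haar_integral], rule ext)
      fix x
      have cz: "continuous_on UNIV (\<lambda>z. t a c z * ?e (- x) * ?e (- z + x))"
        by (intro continuous_intros cont a c continuous_on_compose2[OF ce]) auto
      have "(\<Sum>b\<in>I. haar_integral (\<lambda>y. t a b x * ?e (- x) * (t b c y * ?e (- y))))
          = haar_integral (\<lambda>y. \<Sum>b\<in>I. t a b x * ?e (- x) * (t b c y * ?e (- y)))"
        by (rule haar_sum[symmetric]) (intro continuous_on_mult[OF continuous_on_const] cQ c)
      also have "\<dots> = haar_integral (\<lambda>y. t a c (x + y) * ?e (- x) * ?e (- y))"
        unfolding add[OF a c] by (simp add: sum_distrib_left sum_distrib_right mult_ac)
      also have "\<dots> = haar_integral (\<lambda>y. t a c (x + y) * ?e (- x) * ?e (- (x + y) + x))"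
        by (simp add: minus_add add.assoc)
      also have "\<dots> = haar_integral (\<lambda>z. t a c z * ?e (- x) * ?e (- z + x))"
        by (rule haar_translate[OF cz])
      finally show "(\<Sum>b\<in>I. haar_integral (\<lambda>y. t a b x * ?e (- x) * (t b c y * ?e (- y))))
          = haar_integral (\<lambda>z. t a c z * ?e (- x) * ?e (- z + x))" .
    qed
    also have "\<dots> = haar_integral (\<lambda>z. haar_integral (\<lambda>x. t a c z * ?e (- x) * ?e (- z + x)))"
      by (rule haar_fubini) (auto simp: case_prod_beta intro!: continuous_intros
          continuous_on_compose2[OF ce] continuous_on_compose2[OF cont[OF a c]])
    also have "\<dots> = haar_integral (\<lambda>z. t a c z * ?e (- z))"
    proof (rule arg_cong[of _ _ haar_integral], rule ext)
      fix z
      have c1: "continuous_on UNIV (\<lambda>x. ?e x * ?e (- x + - z))"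
        by (rule conv_integrand_continuous[OF ce ce])
      have "haar_integral (\<lambda>x. ?e (- x) * ?e (- z + x)) = haar_integral (\<lambda>x. ?e (- x) * ?e (- (- x) + - z))"
        by (simp add: dual_projection_commute[of "- z"] del: add_uminus_conv_diff)
      also have "\<dots> = conv ?e ?e (- z)" unfolding conv_def by (rule haar_uminus[OF c1])
      finally have *: "haar_integral (\<lambda>x. ?e (- x) * ?e (- z + x)) = ?e (- z)" by (simp add: dual_projection_conv)
      have c2: "continuous_on UNIV (\<lambda>x. ?e (- x) * ?e (- z + x))"
        by (intro continuous_intros uminus_continuous left_translate_continuous ce)
      show "haar_integral (\<lambda>x. t a c z * ?e (- x) * ?e (- z + x)) = t a c z * ?e (- z)"
        using haar_cmult[OF c2, of "t a c z"] * by (simp add: mult.assoc)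
    qed
    finally show ?thesis by (simp add: Q_def)
  qed
  \<comment> \<open>Since Q is Hermitian and idempotent, the diagonal entry is the squared norm of
    its row, and in particular r^2 <= r.\<close>
  define r where "r = (\<Sum>b\<in>I. (cmod (Q a b))\<^sup>2)"
  have "Q a a = (\<Sum>b\<in>I. Q a b * Q b a)" by (rule idem[OF a, symmetric])
  also have "\<dots> = of_real r" unfolding r_def of_real_sum
    by (intro sum.cong refl) (simp add: herm[OF a] mult_cnj_self)
  finally have Qr: "Q a a = of_real r" .
  have r0: "0 \<le> r" unfolding r_def by (rule sum_nonneg) simp
  have "(cmod (Q a a))\<^sup>2 \<le> r"
    unfolding r_def using a I by (intro member_le_sum[of a I "\<lambda>b. (cmod (Q a b))\<^sup>2"]) auto
  then have "r * r \<le> r * 1" by (simp add: Qr power2_eq_square)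
  then have "r \<le> 1" using r0 by (cases "r = 0") (auto simp: mult_le_cancel_left_pos)
  moreover have "z = of_real r" using Qr by (simp add: Q_def z_def)
  ultimately show "z = of_real (Re z)" "0 \<le> Re z" "Re z \<le> 1" using r0 by simp_all
qed

text \<open>The product of the two characters is the trace of the tensor product representation
  \<open>t\<close>, and the sum over R is the trace of the projection attached to R: a sum of
  diagonal entries in [0, 1], one for each dimension.\<close>

lemma sum_char_coeff_product:
  assumes p: "p \<in> unitary_dual" and q: "q \<in> unitary_dual"
  obtains r :: real where "(\<Sum>s\<in>R. char_coeff s (\<lambda>x. class_char p x * class_char q x)) = of_real r"
    "0 \<le> r" "r \<le> real (class_dim p) * real (class_dim q)"
proof -
  let ?I = "{..<class_dim p} \<times> {..<class_dim q}"
  note rp = class_rep_unitary[OF p] and rq = class_rep_unitary[OF q]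
  define t where "t a b x = class_rep p x $$ (fst a, fst b) * class_rep q x $$ (snd a, snd b)" for a b x
  have ct: "continuous_on UNIV (t a b)" if "a \<in> ?I" "b \<in> ?I" for a b
    unfolding t_def[abs_def] using that
    by (intro continuous_intros unitary_rep_continuous[OF rp] unitary_rep_continuous[OF rq]) auto
  have add: "t a c (x + y) = (\<Sum>b\<in>?I. t a b x * t b c y)" if "a \<in> ?I" "c \<in> ?I" for a c x y
    using that by (auto simp: t_def unitary_rep_add[OF rp] unitary_rep_add[OF rq] sum_product
        sum.cartesian_product mult_ac intro!: sum.cong)
  have mi: "t a b (- x) = cnj (t b a x)" if "a \<in> ?I" "b \<in> ?I" for a b x
    using that by (auto simp: t_def unitary_rep_minus[OF rp] unitary_rep_minus[OF rq])
  define r where "r a = Re (haar_integral (\<lambda>x. t a a x * dual_projection R (- x)))" for a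
  have r: "haar_integral (\<lambda>x. t a a x * dual_projection R (- x)) = of_real (r a)" "0 \<le> r a" "r a \<le> 1"
    if "a \<in> ?I" for a
    unfolding r_def
    by (rule projection_diagonal[of ?I t a, OF _ ct add mi that]; simp)+
  have e: "class_char p x * class_char q x = (\<Sum>a\<in>?I. t a a x)" for x
    by (auto simp: class_char_def sum_product sum.cartesian_product t_def intro!: sum.cong)
  have "(\<Sum>s\<in>R. char_coeff s (\<lambda>x. class_char p x * class_char q x))
      = haar_integral (\<lambda>x. class_char p x * class_char q x * dual_projection R (- x))"
    by (rule sum_char_coeff) (intro continuous_intros class_char_continuous p q)
  also have "\<dots> = haar_integral (\<lambda>x. \<Sum>a\<in>?I. t a a x * dual_projection R (- x))"
    by (simp only: e sum_distrib_right)
  also have "\<dots> = (\<Sum>a\<in>?I. haar_integral (\<lambda>x. t a a x * dual_projection R (- x)))"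
    by (rule haar_sum) (intro continuous_intros ct uminus_continuous dual_projection_continuous)
  also have "\<dots> = of_real (\<Sum>a\<in>?I. r a)" unfolding of_real_sum by (intro sum.cong refl r(1))
  finally have 1: "(\<Sum>s\<in>R. char_coeff s (\<lambda>x. class_char p x * class_char q x)) = of_real (\<Sum>a\<in>?I. r a)" .
  have 2: "0 \<le> (\<Sum>a\<in>?I. r a)" by (intro sum_nonneg r(2))
  have "(\<Sum>a\<in>?I. r a) \<le> (\<Sum>a\<in>?I. 1)" by (intro sum_mono r(3))
  then have 3: "(\<Sum>a\<in>?I. r a) \<le> real (class_dim p) * real (class_dim q)" by (simp add: card_cartesian_product)
  from 1 2 3 show ?thesis by (rule that)
qed

end

lemma char_coeff_norm_product:
  assumes p: "p \<in> unitary_dual" and q: "q \<in> unitary_dual" and s: "s \<in> unitary_dual"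
  shows "char_coeff s (\<lambda>x :: 'a. norm_char p x * norm_char q x)
    = char_coeff s (\<lambda>x. class_char p x * class_char q x) / (of_nat (class_dim p) * of_nat (class_dim q))"
proof -
  have "char_coeff s (\<lambda>x. inverse (of_nat (class_dim p) * of_nat (class_dim q)) * (class_char p x * class_char q x))
    = inverse (of_nat (class_dim p) * of_nat (class_dim q)) * char_coeff s (\<lambda>x. class_char p x * class_char q x)"
    by (rule char_coeff_cmult[OF s]) (intro continuous_intros class_char_continuous p q)
  then show ?thesis by (simp add: norm_char_def field_simps)
qed

text \<open>Taking singletons for R shows that the coefficients are nonnegative, so the sum of their
  absolute values is the sum itself, bounded by the dimension of the tensor product. Hence products
  of normalised characters have norm at most 1.\<close>

lemma sum_char_coeff_norm_product_le:
  assumes p: "p \<in> unitary_dual" and q: "q \<in> unitary_dual" and R: "finite R" "R \<subseteq> unitary_dual"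
  shows "(\<Sum>s\<in>R. cmod (char_coeff s (\<lambda>x :: 'a. norm_char p x * norm_char q x))) \<le> 1"
proof -
  let ?w = "\<lambda>s. char_coeff s (\<lambda>x :: 'a. class_char p x * class_char q x)"
  let ?D = "real (class_dim p) * real (class_dim q)"
  have D: "?D > 0" using class_dim_pos[OF p] class_dim_pos[OF q] by simp
  have w: "?w s = of_real (cmod (?w s))" if "s \<in> R" for s
  proof -
    have s: "finite {s}" "{s} \<subseteq> unitary_dual" using that R by auto
    obtain r where "?w s = of_real r" "0 \<le> r" by (rule sum_char_coeff_product[OF s p q]) simp
    then show ?thesis by simp
  qed
  obtain r where r: "(\<Sum>s\<in>R. ?w s) = of_real r" "r \<le> ?D" by (rule sum_char_coeff_product[OF R p q])
  have "complex_of_real (\<Sum>s\<in>R. cmod (?w s)) = of_real r"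
    unfolding r(1)[symmetric] of_real_sum by (intro sum.cong refl) (rule w[symmetric])
  then have "(\<Sum>s\<in>R. cmod (?w s)) \<le> ?D" using r(2) of_real_eq_iff by metis
  moreover have "(\<Sum>s\<in>R. cmod (char_coeff s (\<lambda>x :: 'a. norm_char p x * norm_char q x))) = (\<Sum>s\<in>R. cmod (?w s)) / ?D"
    unfolding sum_divide_distrib using R
    by (intro sum.cong refl) (auto simp: char_coeff_norm_product[OF p q] norm_divide norm_mult)
  ultimately show ?thesis using D by (simp add: divide_le_eq)
qed

text \<open>The character of s is estimated by its degree, the other two by 2 u v <= u^2 + v^2,
  where both squares have integral 1. The degree of s appears squared because
  \<open>char_coeff\<close> contributes one factor.\<close>

lemma char_coeff_norm_product_le:
  assumes p: "p \<in> unitary_dual" and q: "q \<in> unitary_dual" and s: "s \<in> unitary_dual"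
  shows "cmod (char_coeff s (\<lambda>x :: 'a. norm_char p x * norm_char q x))
    \<le> (real (class_dim s))\<^sup>2 / (real (class_dim p) * real (class_dim q))"
proof -
  let ?ds = "real (class_dim s)" and ?D = "real (class_dim p) * real (class_dim q)"
  have sq: "haar_integral (\<lambda>x. of_real ((cmod (class_char r x))\<^sup>2)) = 1" if r: "r \<in> unitary_dual" for r :: "('a \<Rightarrow> complex mat) set"
    using char_orthogonality[OF r r] by (simp add: class_char_minus[OF r] mult_cnj_self)
  have cs: "continuous_on UNIV (\<lambda>x. complex_of_real ((cmod (class_char r x))\<^sup>2))" if "r \<in> unitary_dual" for r :: "('a \<Rightarrow> complex mat) set"
    by (intro continuous_intros class_char_continuous that)
  define G where "G x = ?ds / 2 * (cmod (class_char p x))\<^sup>2 + ?ds / 2 * (cmod (class_char q x))\<^sup>2" for x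
  have cG: "continuous_on UNIV G" unfolding G_def[abs_def] by (intro continuous_intros class_char_continuous p q)
  have "haar_integral (\<lambda>x. of_real (G x)) = of_real (?ds / 2) * haar_integral (\<lambda>x. of_real ((cmod (class_char p x))\<^sup>2))
      + of_real (?ds / 2) * haar_integral (\<lambda>x. of_real ((cmod (class_char q x))\<^sup>2))"
    unfolding G_def of_real_add of_real_mult[of "?ds / 2"]
    by (simp only: haar_add[OF continuous_on_mult[OF continuous_on_const cs[OF p]] continuous_on_mult[OF continuous_on_const cs[OF q]]]
        haar_cmult[OF cs[OF p]] haar_cmult[OF cs[OF q]])
  then have IG: "haar_integral (\<lambda>x. of_real (G x)) = of_real ?ds" by (simp add: sq p q del: of_real_power)
  have "cmod (haar_integral (\<lambda>x. class_char p x * class_char q x * class_char s (- x))) \<le> Re (haar_integral (\<lambda>x. of_real (G x)))"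
  proof (rule haar_norm_le[OF _ cG])
    show "continuous_on UNIV (\<lambda>x. class_char p x * class_char q x * class_char s (- x))"
      by (intro continuous_intros class_char_continuous p q s uminus_continuous)
    fix x
    let ?u = "cmod (class_char p x)" and ?v = "cmod (class_char q x)"
    have "0 \<le> (?u - ?v)\<^sup>2" by simp
    then have "?u * ?v \<le> (?u\<^sup>2 + ?v\<^sup>2) / 2" by (simp add: power2_diff)
    then have "?u * ?v * cmod (class_char s (- x)) \<le> (?u\<^sup>2 + ?v\<^sup>2) / 2 * ?ds"
      using class_char_le[OF s, of "- x"] by (intro mult_mono) auto
    then show "cmod (class_char p x * class_char q x * class_char s (- x)) \<le> G x"
      by (simp add: norm_mult G_def field_simps)
  qed
  then have "cmod (char_coeff s (\<lambda>x. class_char p x * class_char q x)) \<le> ?ds\<^sup>2"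
    by (simp add: IG char_coeff_def norm_mult power2_eq_square mult_left_mono)
  then show ?thesis
    by (simp add: char_coeff_norm_product[OF p q s] norm_divide norm_mult divide_right_mono)
qed

text \<open>For partial sums one expands bilinearly and uses that products of normalised characters
  have norm at most 1. The estimate passes to f and g for each finite R separately, since
  coefficients are continuous under uniform convergence.\<close>

lemma char_abs_summable_mult:
  assumes f: "char_abs_summable f" and g: "char_abs_summable g"
  shows "char_abs_summable (\<lambda>x. f x * g x)" "char_norm (\<lambda>x. f x * g x) \<le> char_norm f * char_norm g"
proof -
  let ?K = "unitary_dual :: ('a \<Rightarrow> complex mat) set set"
  let ?B = "finite_subsets_at_top ?K"
  let ?S = "\<lambda>f P. char_partial_sum (P \<inter> ?K) f"
  note cf = char_abs_summable_continuous[OF f] and cg = char_abs_summable_continuous[OF g]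
  have ev: "\<forall>\<^sub>F P in ?B. \<forall>x\<in>UNIV. char_partial_sum P h x = ?S h P x" for h
    unfolding eventually_finite_subsets_at_top
    by (intro exI[of _ "{}"]) (auto simp: Int_absorb2)
  have ulS: "uniform_limit UNIV (?S h) h ?B" if "char_abs_summable h" for h
    using char_series(1)[OF that] by (rule uniform_limit_cong[THEN iffD1, OF ev, rotated]) simp
  have bd: "bounded (range h)" if "char_abs_summable h" for h
    using char_series(3)[OF that] by (auto intro: boundedI)
  have ul: "uniform_limit UNIV (\<lambda>P x. ?S f P x * ?S g P x) (\<lambda>x. f x * g x) ?B"
    by (rule uniform_lim_mult[OF ulS[OF f] ulS[OF g] bd[OF f] bd[OF g]])
  have cl: "class_function (\<lambda>x. f x * g x)"
    using f g by (auto simp: char_abs_summable_def class_function_def intro!: continuous_intros)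
  have fin: "(\<Sum>s\<in>R. cmod (char_coeff s (\<lambda>x. f x * g x))) \<le> char_norm f * char_norm g"
    if R: "finite R" "R \<subseteq> ?K" for R
  proof (rule tendsto_upperbound)
    show "((\<lambda>P. \<Sum>s\<in>R. cmod (char_coeff s (\<lambda>x. ?S f P x * ?S g P x))) \<longlongrightarrow>
        (\<Sum>s\<in>R. cmod (char_coeff s (\<lambda>x. f x * g x)))) ?B"
      using R by (intro tendsto_intros char_coeff_uniform_limit[OF ul])
        (auto intro!: continuous_intros char_partial_sum_continuous cf cg)
    show "\<forall>\<^sub>F P in ?B. (\<Sum>s\<in>R. cmod (char_coeff s (\<lambda>x. ?S f P x * ?S g P x))) \<le> char_norm f * char_norm g"
      unfolding eventually_finite_subsets_at_top
    proof (intro exI[of _ "{}"] conjI allI impI)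
      fix P assume P: "finite P \<and> {} \<subseteq> P \<and> P \<subseteq> ?K"
      then have PK: "P \<inter> ?K = P" by blast
      have coeff: "char_coeff s (\<lambda>x. ?S f P x * ?S g P x)
          = (\<Sum>p\<in>P. \<Sum>q\<in>P. char_coeff p f * char_coeff q g * char_coeff s (\<lambda>x. norm_char p x * norm_char q x))"
        if s: "s \<in> ?K" for s
      proof -
        have cn: "continuous_on UNIV (norm_char p)" if "p \<in> P" for p using norm_char_continuous P that by blast
        have "(\<lambda>x. ?S f P x * ?S g P x)
            = (\<lambda>x. \<Sum>p\<in>P. \<Sum>q\<in>P. char_coeff p f * char_coeff q g * (norm_char p x * norm_char q x))"
          unfolding PK char_partial_sum_def sum_product by (simp add: mult_ac)
        then have "char_coeff s (\<lambda>x. ?S f P x * ?S g P x) =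
            char_coeff s (\<lambda>x. \<Sum>p\<in>P. \<Sum>q\<in>P. char_coeff p f * char_coeff q g * (norm_char p x * norm_char q x))" by simp
        also have "\<dots> = (\<Sum>p\<in>P. char_coeff s (\<lambda>x. \<Sum>q\<in>P. char_coeff p f * char_coeff q g * (norm_char p x * norm_char q x)))"
          by (rule char_coeff_sum[OF s]) (intro continuous_intros cn)
        also have "\<dots> = (\<Sum>p\<in>P. \<Sum>q\<in>P. char_coeff s (\<lambda>x. char_coeff p f * char_coeff q g * (norm_char p x * norm_char q x)))"
          by (intro sum.cong refl char_coeff_sum[OF s]) (intro continuous_intros cn)
        also have "\<dots> = (\<Sum>p\<in>P. \<Sum>q\<in>P. char_coeff p f * char_coeff q g * char_coeff s (\<lambda>x. norm_char p x * norm_char q x))"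
          by (intro sum.cong refl char_coeff_cmult[OF s]) (intro continuous_intros cn)
        finally show ?thesis .
      qed
      have "(\<Sum>s\<in>R. cmod (char_coeff s (\<lambda>x. ?S f P x * ?S g P x)))
          \<le> (\<Sum>s\<in>R. \<Sum>p\<in>P. \<Sum>q\<in>P. cmod (char_coeff p f) * cmod (char_coeff q g) * cmod (char_coeff s (\<lambda>x. norm_char p x * norm_char q x)))"
      proof (rule sum_mono)
        fix s assume "s \<in> R"
        then show "cmod (char_coeff s (\<lambda>x. ?S f P x * ?S g P x)) \<le>
          (\<Sum>p\<in>P. \<Sum>q\<in>P. cmod (char_coeff p f) * cmod (char_coeff q g) * cmod (char_coeff s (\<lambda>x. norm_char p x * norm_char q x)))"
          using R(2) by (subst coeff) (auto simp flip: norm_mult intro!: order_trans[OF norm_sum] sum_mono)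
      qed
      also have "\<dots> = (\<Sum>p\<in>P. \<Sum>s\<in>R. \<Sum>q\<in>P. cmod (char_coeff p f) * cmod (char_coeff q g) * cmod (char_coeff s (\<lambda>x. norm_char p x * norm_char q x)))"
        by (rule sum.swap)
      also have "\<dots> = (\<Sum>p\<in>P. \<Sum>q\<in>P. cmod (char_coeff p f) * cmod (char_coeff q g) * (\<Sum>s\<in>R. cmod (char_coeff s (\<lambda>x. norm_char p x * norm_char q x))))"
        unfolding sum_distrib_left by (intro sum.cong refl sum.swap)
      also have "\<dots> \<le> (\<Sum>p\<in>P. \<Sum>q\<in>P. cmod (char_coeff p f) * cmod (char_coeff q g) * 1)"
        using P R by (intro sum_mono mult_left_mono sum_char_coeff_norm_product_le) auto
      also have "\<dots> = (\<Sum>p\<in>P. cmod (char_coeff p f)) * (\<Sum>q\<in>P. cmod (char_coeff q g))"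
        by (simp add: sum_product)
      also have "\<dots> \<le> char_norm f * char_norm g"
        using P f g unfolding char_norm_def char_abs_summable_def
        by (intro mult_mono finite_sum_le_infsum) (auto intro: sum_nonneg infsum_nonneg)
      finally show "(\<Sum>s\<in>R. cmod (char_coeff s (\<lambda>x. ?S f P x * ?S g P x))) \<le> char_norm f * char_norm g" .
    qed auto
  qed simp
  have sm: "(\<lambda>s. cmod (char_coeff s (\<lambda>x. f x * g x))) summable_on ?K"
    by (rule nonneg_bdd_above_summable_on) (auto intro!: bdd_aboveI2[where M = "char_norm f * char_norm g"] fin)
  then show "char_abs_summable (\<lambda>x. f x * g x)" using cl by (simp add: char_abs_summable_def)
  show "char_norm (\<lambda>x. f x * g x) \<le> char_norm f * char_norm g"
    unfolding char_norm_def by (rule infsum_le_finite_sums[OF sm]) (use fin in \<open>simp add: char_norm_def\<close>)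
qed

end

section \<open>The trivial class and separation of points\<close>

lemma trivial_class_exists:
  obtains p where "p \<in> unitary_dual" "norm_char p = (\<lambda>x :: 'a::topological_group_add. 1)"
proof -
  define \<pi> :: "'a \<Rightarrow> complex mat" where "\<pi> = (\<lambda>g. 1\<^sub>m 1)"
  have U: "1\<^sub>m 1 \<in> unitary_mats 1" by (rule unitary_matsI) auto
  have rep: "unitary_rep 1 \<pi>" using U by (simp add: unitary_rep_def \<pi>_def)
  have "irreducible_rep 1 \<pi>"
    unfolding irreducible_rep_def
  proof (intro conjI allI impI rep)
    fix W assume "Module.submodule W (class_ring :: complex ring) (module_vec TYPE(complex) 1) \<and> (\<forall>g. \<forall>w\<in>W. \<pi> g *\<^sub>v w \<in> W)"
    then have "Module.submodule W (class_ring :: complex ring) (module_vec TYPE(complex) 1)" ..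
    note W = submodule_vecD[OF this]
    show "W = {0\<^sub>v 1} \<or> W = carrier_vec 1"
    proof (cases "W = {0\<^sub>v 1}")
      case False
      then obtain w where w: "w \<in> W" "w \<noteq> 0\<^sub>v 1" using W(2) by blast
      have wc: "w \<in> carrier_vec 1" using w(1) W(1) by blast
      then have w0: "w $ 0 \<noteq> 0" using w(2) by (auto simp: vec_eq_iff)
      have "v \<in> W" if v: "v \<in> carrier_vec 1" for v
      proof -
        have "v = (v $ 0 / w $ 0) \<cdot>\<^sub>v w" using v wc w0 by (intro eq_vecI) auto
        then show ?thesis using W(4)[OF w(1)] by metis
      qed
      then show ?thesis using W(1) by blast
    qed simp
  qed simp
  then obtain p where p: "p \<in> unitary_dual" and eq: "(\<pi>, class_rep p) \<in> unitarily_equivalent"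
    by (rule equivalent_class_rep)
  let ?R = "class_rep p"
  obtain n U where n: "irreducible_rep n \<pi>" "irreducible_rep n ?R" and U: "U \<in> unitary_mats n" "\<And>g. U * \<pi> g = ?R g * U"
    using eq by (auto simp: unitarily_equivalent_def)
  have "n = 1" using n(1) unitary_rep_dim(1)[of n \<pi> 0] by (simp add: irreducible_rep_def \<pi>_def)
  then have c: "U \<in> carrier_mat 1 1" "mat_adjoint U \<in> carrier_mat 1 1" "U * mat_adjoint U = 1\<^sub>m 1"
    and Rc: "?R g \<in> carrier_mat 1 1" for g
    using U(1) n(2) by (auto simp: unitary_mats_def mat_adjoint_carrier irreducible_rep_def intro: unitary_rep_carrier)
  have R: "?R g = 1\<^sub>m 1" for g
  proof -
    have "?R g = ?R g * (U * mat_adjoint U)" using Rc[of g] c by simp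
    also have "\<dots> = ?R g * U * mat_adjoint U" by (rule assoc_mult_mat[OF Rc c(1,2), symmetric])
    also have "?R g * U = U" using U(2)[of g, symmetric] c by (simp add: \<pi>_def)
    finally show ?thesis using c by simp
  qed
  have "norm_char p = (\<lambda>x. 1)" by (simp add: fun_eq_iff norm_char_def class_char_def class_dim_def R)
  with p show ?thesis by (rule that)
qed

text \<open>A mean of numbers of modulus at most 1 equals 1 only if each of them is 1; the diagonal
  then exhausts the norm of every column.\<close>

lemma norm_char_eq_one:
  fixes p :: "('a::topological_group_add \<Rightarrow> complex mat) set"
  assumes p: "p \<in> unitary_dual" and h: "norm_char p h = 1"
  shows "class_rep p h = 1\<^sub>m (class_dim p)"
proof (rule eq_matI)
  let ?R = "class_rep p h" and ?d = "class_dim p"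
  note rep = class_rep_unitary[OF p]
  have "class_char p h = of_nat ?d" using h class_dim_pos[OF p] by (simp add: norm_char_def divide_simps)
  then have "(\<Sum>i<?d. Re (?R $$ (i, i))) = real ?d" by (simp add: class_char_def flip: Re_sum)
  then have "(\<Sum>i<?d. 1 - Re (?R $$ (i, i))) = 0" by (simp add: sum_subtractf)
  moreover have le: "Re (?R $$ (i, i)) \<le> 1" if "i < ?d" for i
    using complex_Re_le_cmod[of "?R $$ (i, i)"] unitary_rep_entry_le[OF rep that that, of h] by linarith
  ultimately have re: "Re (?R $$ (i, i)) = 1" if "i < ?d" for i
    using that by (subst (asm) sum_nonneg_eq_0_iff) auto
  have off: "cmod (?R $$ (i, j)) = 0" if ij: "i < ?d" "j < ?d" "i \<noteq> j" for i j
  proof -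
    have "(\<Sum>l\<in>{i, j}. (cmod (?R $$ (l, j)))\<^sup>2) \<le> (\<Sum>l<?d. (cmod (?R $$ (l, j)))\<^sup>2)"
      using ij by (intro sum_mono2) auto
    then have "(cmod (?R $$ (i, j)))\<^sup>2 + (cmod (?R $$ (j, j)))\<^sup>2 \<le> 1"
      using ij unitary_rep_col_norm[OF rep ij(2), of h] by simp
    moreover have "1 \<le> cmod (?R $$ (j, j))" using complex_Re_le_cmod[of "?R $$ (j, j)"] re[OF ij(2)] by simp
    then have "1 \<le> (cmod (?R $$ (j, j)))\<^sup>2" by simp
    ultimately have "(cmod (?R $$ (i, j)))\<^sup>2 \<le> 0" by linarith
    then show ?thesis by simp
  qed
  have diag: "?R $$ (i, i) = 1" if i: "i < ?d" for i
  proof -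
    have "(cmod (?R $$ (i, i)))\<^sup>2 \<le> 1\<^sup>2" using unitary_rep_entry_le[OF rep i i] by (intro power_mono) auto
    then have "(Im (?R $$ (i, i)))\<^sup>2 \<le> 0" by (simp add: cmod_power2 re[OF i])
    then show ?thesis using re[OF i] by (simp add: complex_eq_iff)
  qed
  show "?R $$ (i, j) = 1\<^sub>m ?d $$ (i, j)" if "i < dim_row (1\<^sub>m ?d)" "j < dim_col (1\<^sub>m ?d)" for i j
    using that off[of i j] diag by auto
qed (use class_rep_unitary[OF p] in auto)

lemma unitary_rep_cancel:
  assumes \<pi>: "unitary_rep n \<pi>" and h: "\<pi> h = 1\<^sub>m n" and ij: "i < n" "j < n"
  shows "\<pi> (- (h + x)) $$ (i, j) = \<pi> (- x) $$ (i, j)"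
proof -
  have "\<pi> (- x) $$ (i, j) = \<pi> (- (h + x) + h) $$ (i, j)" by (simp add: minus_add add.assoc)
  also have "\<pi> (- (h + x) + h) = \<pi> (- (h + x)) * \<pi> h" using \<pi> by (simp only: unitary_rep_def)
  also have "\<dots> = \<pi> (- (h + x))" using unitary_rep_carrier[OF \<pi>, of "- (h + x)"] by (simp add: h)
  finally show ?thesis by simp
qed

context compact_group
begin

text \<open>Such an h acts as the identity in every irreducible representation, so f and its
  translate by h have the same Fourier coefficients and coincide by Peter-Weyl.\<close>

lemma characters_separate:
  fixes f :: "'a \<Rightarrow> complex" and h :: 'a
  assumes h: "\<And>p. p \<in> unitary_dual \<Longrightarrow> norm_char p h = 1" and f: "continuous_on UNIV f"
  shows "f h = f 0"
proof -
  have fh: "continuous_on UNIV (\<lambda>x. f (h + x))" by (rule left_translate_continuous[OF f])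
  have "(\<lambda>x. f (h + x) - f x) = (\<lambda>x. 0)"
  proof (rule peter_weyl_dual)
    show "continuous_on UNIV (\<lambda>x. f (h + x) - f x)" by (intro continuous_intros f fh)
    fix p :: "('a \<Rightarrow> complex mat) set" and i j assume p: "p \<in> unitary_dual" and ij: "i < class_dim p" "j < class_dim p"
    let ?k = "\<lambda>x. f x * class_rep p (- x) $$ (i, j)"
    note cancel = unitary_rep_cancel[OF class_rep_unitary[OF p] norm_char_eq_one[OF p h[OF p]] ij]
    have k: "continuous_on UNIV ?k" by (rule fourier_integrand_continuous[OF p f ij])
    have "haar_integral (\<lambda>x. (f (h + x) - f x) * class_rep p (- x) $$ (i, j)) = haar_integral (\<lambda>x. ?k (h + x) - ?k x)"
      by (simp only: cancel left_diff_distrib)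
    also have "\<dots> = haar_integral (\<lambda>x. ?k (h + x)) - haar_integral ?k"
      by (rule haar_diff[OF left_translate_continuous[OF k] k])
    also have "\<dots> = 0" by (simp only: haar_translate[OF k] diff_self)
    finally show "fourier_coeff (\<lambda>x. f (h + x) - f x) (class_rep p) $$ (i, j) = 0"
      using ij by (simp add: fourier_coeff_index[OF p])
  qed
  from fun_cong[OF this, of 0] show ?thesis by simp
qed

text \<open>A coefficient of size at least e bounds the product of the two degrees by the squared
  degree of s over e. This is where finiteness of the number of classes of each degree
  enters.\<close>

lemma product_coeff_finite:
  assumes fin: "\<forall>n>0. finite {p \<in> (unitary_dual :: ('a \<Rightarrow> complex mat) set set). class_dim p = n}"
    and s: "s \<in> (unitary_dual :: ('a \<Rightarrow> complex mat) set set)" and e: "e > 0"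
  shows "finite {z \<in> unitary_dual \<times> unitary_dual. e \<le> cmod (char_coeff s (\<lambda>x :: 'a. norm_char (fst z) x * norm_char (snd z) x))}"
    (is "finite ?S")
proof -
  define N where "N = nat \<lfloor>(real (class_dim s))\<^sup>2 / e\<rfloor>"
  let ?D = "{p \<in> (unitary_dual :: ('a \<Rightarrow> complex mat) set set). class_dim p \<le> N}"
  have "?D \<subseteq> (\<Union>n\<in>{1..N}. {p \<in> unitary_dual. class_dim p = n})"
  proof
    fix p :: "('a \<Rightarrow> complex mat) set" assume "p \<in> ?D"
    then have "p \<in> unitary_dual" "class_dim p \<in> {1..N}" using class_dim_pos[of p] by auto
    then show "p \<in> (\<Union>n\<in>{1..N}. {p \<in> unitary_dual. class_dim p = n})" by blast
  qed
  moreover have "finite (\<Union>n\<in>{1..N}. {p \<in> (unitary_dual :: ('a \<Rightarrow> complex mat) set set). class_dim p = n})"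
    using fin by (intro finite_UN_I) auto
  ultimately have D: "finite ?D" by (rule finite_subset)
  have "?S \<subseteq> ?D \<times> ?D"
  proof
    fix z assume "z \<in> ?S"
    then have z: "fst z \<in> unitary_dual" "snd z \<in> unitary_dual"
      "e \<le> cmod (char_coeff s (\<lambda>x :: 'a. norm_char (fst z) x * norm_char (snd z) x))" by auto
    let ?p = "class_dim (fst z)" and ?q = "class_dim (snd z)"
    have pos: "?p > 0" "?q > 0" using class_dim_pos z by auto
    have "e \<le> (real (class_dim s))\<^sup>2 / (real ?p * real ?q)"
      using z(3) char_coeff_norm_product_le[OF z(1,2) s] by linarith
    then have "real (?p * ?q) \<le> (real (class_dim s))\<^sup>2 / e" using pos e by (simp add: field_simps)
    then have "?p * ?q \<le> N" unfolding N_def by (simp add: le_nat_floor)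
    moreover have "?p \<le> ?p * ?q" "?q \<le> ?p * ?q" using pos by auto
    ultimately have "?p \<le> N \<and> ?q \<le> N" by linarith
    then show "z \<in> ?D \<times> ?D" using z by (simp add: mem_Times_iff)
  qed
  then show ?thesis by (rule finite_subset) (use D in simp)
qed

lemma char_abs_summable_add:
  assumes f: "char_abs_summable f" and g: "char_abs_summable g"
  shows "char_abs_summable (\<lambda>x. f x + g x)"
proof -
  have "(\<lambda>p. cmod (char_coeff p (\<lambda>x. f x + g x))) summable_on unitary_dual"
  proof (rule summable_on_comparison_test)
    show "(\<lambda>p. cmod (char_coeff p f) + cmod (char_coeff p g)) summable_on unitary_dual"
      using f g by (intro summable_on_add) (auto simp: char_abs_summable_def)
    fix p :: "('a \<Rightarrow> complex mat) set" assume "p \<in> unitary_dual"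
    then show "cmod (char_coeff p (\<lambda>x. f x + g x)) \<le> cmod (char_coeff p f) + cmod (char_coeff p g)"
      by (simp add: char_coeff_add char_abs_summable_continuous f g norm_triangle_ineq)
  qed simp
  then show ?thesis using f g by (auto simp: char_abs_summable_def class_function_def intro!: continuous_intros)
qed

lemma char_abs_summable_cmult:
  assumes f: "char_abs_summable f"
  shows "char_abs_summable (\<lambda>x. c * f x)"
proof -
  have "(\<lambda>p. cmod c * cmod (char_coeff p f)) summable_on unitary_dual"
    using f by (intro summable_on_cmult_right) (auto simp: char_abs_summable_def)
  then have "(\<lambda>p. cmod (char_coeff p (\<lambda>x. c * f x))) summable_on unitary_dual"
    by (rule summable_on_cong[THEN iffD1, rotated])
      (simp add: char_coeff_cmult char_abs_summable_continuous f norm_mult)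
  then show ?thesis using f by (auto simp: char_abs_summable_def class_function_def intro!: continuous_intros)
qed

lemma norm_char_abs_summable:
  assumes p: "p \<in> unitary_dual"
  shows "char_abs_summable (norm_char (p :: ('a \<Rightarrow> complex mat) set))" "char_norm (norm_char p) = 1"
proof -
  have z: "cmod (char_coeff q (norm_char p)) = (if q = p then 1 else 0)" if "q \<in> unitary_dual" for q
    using that p by (simp add: char_coeff_norm_char)
  have "(\<lambda>q. cmod (char_coeff q (norm_char p))) summable_on {p}" by simp
  then have "(\<lambda>q. cmod (char_coeff q (norm_char p))) summable_on unitary_dual"
    by (rule summable_on_cong_neutral[THEN iffD1, rotated -1]) (use p z in auto)
  then show "char_abs_summable (norm_char p)" by (simp add: char_abs_summable_def norm_char_class_function p)
  have "char_norm (norm_char p) = (\<Sum>\<^sub>\<infinity>q\<in>{p}. cmod (char_coeff q (norm_char p)))"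
    unfolding char_norm_def by (rule infsum_cong_neutral) (use p z in auto)
  then show "char_norm (norm_char p) = 1" by (simp add: z p)
qed

lemma sum_char_coeff_le_norm:
  assumes f: "char_abs_summable f" and Q: "finite Q" "Q \<subseteq> unitary_dual"
  shows "(\<Sum>p\<in>Q. cmod (char_coeff p f)) \<le> char_norm f"
  unfolding char_norm_def using f Q by (intro finite_sum_le_infsum) (auto simp: char_abs_summable_def)

lemma char_partial_sum_tendsto:
  assumes f: "char_abs_summable f"
  shows "((\<lambda>Q. char_norm (\<lambda>x. f x - char_partial_sum Q f x)) \<longlongrightarrow> 0) (finite_subsets_at_top unitary_dual)"
proof (rule tendstoI)
  fix e :: real assume "e > 0"
  then obtain P where P: "finite P" "P \<subseteq> unitary_dual"
    "\<And>Q. finite Q \<Longrightarrow> P \<subseteq> Q \<Longrightarrow> Q \<subseteq> unitary_dual \<Longrightarrow> char_norm (\<lambda>x. f x - char_partial_sum Q f x) < e"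
    by (rule char_partial_sum_dense[OF f]) blast
  have "dist (char_norm (\<lambda>x. f x - char_partial_sum Q f x)) 0 < e" if "finite Q" "P \<subseteq> Q" "Q \<subseteq> unitary_dual" for Q
    using P(3)[OF that] by (simp add: char_norm_nonneg)
  then show "\<forall>\<^sub>F Q in finite_subsets_at_top unitary_dual. dist (char_norm (\<lambda>x. f x - char_partial_sum Q f x)) 0 < e"
    unfolding eventually_finite_subsets_at_top using P(1,2) by blast
qed

end

lemma Hausdorff_space_t2: "Hausdorff_space (euclidean :: 'a::t2_space topology)"
  unfolding Hausdorff_space_def disjnt_def
proof (intro allI impI)
  fix x y :: 'a assume "x \<in> topspace euclidean \<and> y \<in> topspace euclidean \<and> x \<noteq> y"
  then have "x \<noteq> y" by simp
  from hausdorff[OF this] show "\<exists>U V. openin euclidean U \<and> openin euclidean V \<and> x \<in> U \<and> y \<in> V \<and> U \<inter> V = {}"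
    by simp
qed

lemma compact_t2_separate:
  fixes a b :: "'a::t2_space"
  assumes "compact (UNIV :: 'a set)" "a \<noteq> b"
  obtains f :: "'a \<Rightarrow> real" where "continuous_on UNIV f" "f a = 0" "f b = 1"
proof -
  have "compact_space (euclidean :: 'a topology)" using assms(1) by (simp add: compact_space_def)
  then have "normal_space (euclidean :: 'a topology)"
    using Hausdorff_space_t2 compact_Hausdorff_or_regular_imp_normal_space by blast
  moreover have "closedin euclidean {a}" "closedin euclidean {b}" "disjnt {a} {b}" using assms(2) by auto
  ultimately obtain f where f: "continuous_map euclidean (top_of_set {0..1}) f" "f ` {a} \<subseteq> {0}" "f ` {b} \<subseteq> {1 :: real}"
    using Urysohn_lemma[of euclidean "{a}" "{b}" 0 1] by auto
  from f(1) have "continuous_on UNIV f" by (simp add: continuous_map_in_subtopology)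
  with f(2,3) show ?thesis by (intro that[of f]) auto
qed

text \<open>A compact Hausdorff space is normal, so Urysohn provides a continuous function that
  takes different values at h and 0; \<open>characters_separate\<close> then excludes that all
  normalised characters are 1 at h.\<close>

lemma dual_separates_points:
  fixes h :: "'a::{topological_group_add, t2_space}"
  assumes compact: "compact (UNIV :: 'a set)" and h: "h \<noteq> 0"
  shows "\<exists>p\<in>unitary_dual. norm_char p h \<noteq> 1"
proof (rule ccontr)
  interpret compact_group "TYPE('a)" by unfold_locales (rule compact)
  assume "\<not> ?thesis"
  then have 1: "norm_char p h = 1" if "p \<in> unitary_dual" for p using that by blast
  obtain f :: "'a \<Rightarrow> real" where f: "continuous_on UNIV f" "f h = 0" "f 0 = 1"
    by (rule compact_t2_separate[OF compact h])
  have "continuous_on UNIV (\<lambda>x. complex_of_real (f x))" by (intro continuous_intros f(1))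
  from characters_separate[OF 1 this] show False using f(2,3) by simp
qed

text \<open>Translating an open singleton {0} would make every set open; so the open set U, which
  contains 0, contains another point.\<close>

lemma near_identity:
  fixes F :: "('a::{topological_group_add, t2_space} \<Rightarrow> complex mat) set set"
  assumes nd: "\<not> (\<forall>S :: 'a set. open S)" and F: "finite F" "F \<subseteq> unitary_dual" and e: "e > 0"
  obtains h where "h \<noteq> 0" "\<forall>q\<in>F. cmod (norm_char q h - 1) < e"
proof -
  have "\<not> open {0 :: 'a}"
  proof
    assume op: "open {0 :: 'a}"
    have "open S" for S :: "'a set"
    proof -
      have "open {x}" for x :: 'a
      proof -
        have "open ((\<lambda>y. - x + y) -` {0})" by (intro open_vimage op continuous_intros)
        moreover have "(\<lambda>y. - x + y) -` {0} = {x}" by (auto simp: neg_eq_iff_add_eq_0[symmetric] minus_equation_iff)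
        ultimately show ?thesis by simp
      qed
      then have "open (\<Union>x\<in>S. {x})" by blast
      then show ?thesis by simp
    qed
    with nd show False by blast
  qed
  moreover define U where "U = (\<Inter>q\<in>F. {h. cmod (norm_char q h - 1) < e})"
  have "open U" unfolding U_def using F
    by (intro open_INT ballI open_Collect_less continuous_intros) (auto intro: norm_char_continuous)
  moreover have "0 \<in> U" using F(2) e by (auto simp: U_def norm_char_zero subset_iff)
  ultimately have "U \<noteq> {0}" by auto
  then obtain h where "h \<in> U" "h \<noteq> 0" using \<open>0 \<in> U\<close> by blast
  then show ?thesis by (intro that[of h]) (auto simp: U_def)
qed

section \<open>A non-inner derivation\<close>

text \<open>Convergence to 0 along this filter is vanishing at infinity on the discrete set K; the
  explicit form is \<open>tendsto_zero_cofinite_on\<close>.\<close>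

definition cofinite_on :: "'i set \<Rightarrow> 'i filter" where
  "cofinite_on K = inf cofinite (principal K)"

lemma eventually_cofinite_on: "eventually P (cofinite_on K) \<longleftrightarrow> finite {x \<in> K. \<not> P x}"
proof -
  have "{x. \<not> (x \<in> K \<longrightarrow> P x)} = {x \<in> K. \<not> P x}" by auto
  then show ?thesis by (simp add: cofinite_on_def eventually_inf_principal eventually_cofinite)
qed

lemma tendsto_zero_cofinite_on:
  fixes f :: "'i \<Rightarrow> complex"
  shows "(f \<longlongrightarrow> 0) (cofinite_on K) \<longleftrightarrow> (\<forall>e>0. finite {x \<in> K. e \<le> cmod (f x)})"
  by (simp add: tendsto_iff eventually_cofinite_on not_less dist_norm)

lemma tendsto_cofinite_on_cong:
  assumes "\<And>x. x \<in> K \<Longrightarrow> f x = h x"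
  shows "(f \<longlongrightarrow> l) (cofinite_on K) \<longleftrightarrow> (h \<longlongrightarrow> l) (cofinite_on K)"
proof (rule tendsto_cong)
  have "{x \<in> K. f x \<noteq> h x} = {}" using assms by auto
  then show "\<forall>\<^sub>F x in cofinite_on K. f x = h x" unfolding eventually_cofinite_on by (metis finite.emptyI)
qed

text \<open>Vanishing at infinity is stable under uniform limits.\<close>

lemma tendsto_zero_approx:
  fixes f :: "'i \<Rightarrow> complex"
  assumes "\<And>e. e > 0 \<Longrightarrow> \<exists>g. (g \<longlongrightarrow> 0) (cofinite_on K) \<and> (\<forall>x\<in>K. cmod (f x - g x) \<le> e)"
  shows "(f \<longlongrightarrow> 0) (cofinite_on K)"
  unfolding tendsto_zero_cofinite_on
proof (intro allI impI)
  fix e :: real assume e: "e > 0"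
  then obtain g where g: "(g \<longlongrightarrow> 0) (cofinite_on K)" "\<And>x. x \<in> K \<Longrightarrow> cmod (f x - g x) \<le> e / 2"
    using assms[of "e / 2"] by auto
  have "finite {x \<in> K. e / 2 \<le> cmod (g x)}" using g(1) half_gt_zero[OF e] unfolding tendsto_zero_cofinite_on by blast
  moreover have "e / 2 \<le> cmod (g x)" if "x \<in> K" "e \<le> cmod (f x)" for x
    using g(2)[OF that(1)] that(2) norm_triangle_ineq2[of "f x" "g x"] by linarith
  ultimately show "finite {x \<in> K. e \<le> cmod (f x)}" by (elim finite_subset[rotated]) auto
qed

text \<open>Outside a finite rectangle one of the factors is small, and the other is
  bounded.\<close>

lemma tendsto_zero_product:
  fixes f g :: "'i \<Rightarrow> complex"
  assumes f: "(f \<longlongrightarrow> 0) (cofinite_on K)" "\<And>x. x \<in> K \<Longrightarrow> cmod (f x) \<le> M"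
    and g: "(g \<longlongrightarrow> 0) (cofinite_on K)" "\<And>x. x \<in> K \<Longrightarrow> cmod (g x) \<le> M"
  shows "((\<lambda>z. f (fst z) * g (snd z)) \<longlongrightarrow> 0) (cofinite_on (K \<times> K))"
  unfolding tendsto_zero_cofinite_on
proof (intro allI impI)
  fix e :: real assume e: "e > 0"
  define N where "N = \<bar>M\<bar> + 1"
  have N: "N > 0" by (simp add: N_def)
  have le: "cmod (f x) \<le> N" "cmod (g x) \<le> N" if "x \<in> K" for x
    using f(2)[OF that] g(2)[OF that] by (auto simp: N_def)
  have "{z \<in> K \<times> K. e \<le> cmod (f (fst z) * g (snd z))}
      \<subseteq> {x \<in> K. e / N \<le> cmod (f x)} \<times> {x \<in> K. e / N \<le> cmod (g x)}"
  proof clarsimp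
    fix x y assume xy: "x \<in> K" "y \<in> K" "e \<le> cmod (f x * g y)"
    have "e \<le> cmod (f x) * N" "e \<le> N * cmod (g y)"
      using xy mult_left_mono[OF le(2)[OF xy(2)], of "cmod (f x)"] mult_right_mono[OF le(1)[OF xy(1)], of "cmod (g y)"]
      by (auto simp: norm_mult)
    then show "e / N \<le> cmod (f x) \<and> e / N \<le> cmod (g y)" using N by (simp add: divide_le_eq mult.commute)
  qed
  moreover have "e / N > 0" using e N by simp
  ultimately show "finite {z \<in> K \<times> K. e \<le> cmod (f (fst z) * g (snd z))}"
    using f(1) g(1) unfolding tendsto_zero_cofinite_on by (meson finite_SigmaI finite_subset)
qed

text \<open>The properties of ZA(G) on which the argument rests: an \<ell>1 algebra of functions
  with basis \<psi>, coefficient functionals \<open>w\<close>, unit \<psi> \<epsilon>, and a base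
  point g at which all \<psi> are 1, namely the identity of the group. Finiteness of each degree is
  carried by \<open>product_vanishes\<close>; non-discreteness and separation of points are carried
  by \<open>near_g\<close>.\<close>

locale character_algebra =
  fixes A :: "('a \<Rightarrow> complex) normed" and K :: "'i set" and \<psi> :: "'i \<Rightarrow> 'a \<Rightarrow> complex"
    and w :: "'i \<Rightarrow> ('a \<Rightarrow> complex) \<Rightarrow> complex" and \<epsilon> :: 'i and g :: 'a
  assumes A_ops: "add A = (\<lambda>f h x. f x + h x)" "mult A = (\<lambda>f h x. f x * h x)" "smult A = (\<lambda>c f x. c * f x)"
    and A_add: "\<And>f h. f \<in> carrier A \<Longrightarrow> h \<in> carrier A \<Longrightarrow> (\<lambda>x. f x + h x) \<in> carrier A"
    and A_mult: "\<And>f h. f \<in> carrier A \<Longrightarrow> h \<in> carrier A \<Longrightarrow> (\<lambda>x. f x * h x) \<in> carrier A"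
    and A_smult: "\<And>c f. f \<in> carrier A \<Longrightarrow> (\<lambda>x. c * f x) \<in> carrier A"
    and norm_nonneg: "\<And>f. f \<in> carrier A \<Longrightarrow> 0 \<le> vnorm A f"
    and norm_mult_le: "\<And>f h. f \<in> carrier A \<Longrightarrow> h \<in> carrier A \<Longrightarrow> vnorm A (\<lambda>x. f x * h x) \<le> vnorm A f * vnorm A h"
    and \<psi>_in: "\<And>p. p \<in> K \<Longrightarrow> \<psi> p \<in> carrier A" and norm_\<psi>: "\<And>p. p \<in> K \<Longrightarrow> vnorm A (\<psi> p) = 1"
    and w_add: "\<And>p f h. p \<in> K \<Longrightarrow> f \<in> carrier A \<Longrightarrow> h \<in> carrier A \<Longrightarrow> w p (\<lambda>x. f x + h x) = w p f + w p h"
    and w_smult: "\<And>p c f. p \<in> K \<Longrightarrow> f \<in> carrier A \<Longrightarrow> w p (\<lambda>x. c * f x) = c * w p f"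
    and w_\<psi>: "\<And>p q. p \<in> K \<Longrightarrow> q \<in> K \<Longrightarrow> w p (\<psi> q) = (if q = p then 1 else 0)"
    and w_sum_le: "\<And>Q f. finite Q \<Longrightarrow> Q \<subseteq> K \<Longrightarrow> f \<in> carrier A \<Longrightarrow> (\<Sum>p\<in>Q. cmod (w p f)) \<le> vnorm A f"
    and dense: "\<And>f. f \<in> carrier A \<Longrightarrow>
      ((\<lambda>Q. vnorm A (\<lambda>x. f x - (\<Sum>q\<in>Q. w q f * \<psi> q x))) \<longlongrightarrow> 0) (finite_subsets_at_top K)"
    and eval_le: "\<And>f x. f \<in> carrier A \<Longrightarrow> cmod (f x) \<le> vnorm A f"
    and product_vanishes: "\<And>s. s \<in> K \<Longrightarrow>
      ((\<lambda>z. w s (\<lambda>x. \<psi> (fst z) x * \<psi> (snd z) x)) \<longlongrightarrow> 0) (cofinite_on (K \<times> K))"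
    and unit: "\<epsilon> \<in> K" "\<psi> \<epsilon> = (\<lambda>x. 1)"
    and \<psi>_g: "\<And>p. p \<in> K \<Longrightarrow> \<psi> p g = 1"
    and near_g: "\<And>F e. finite F \<Longrightarrow> F \<subseteq> K \<Longrightarrow> e > 0 \<Longrightarrow>
      \<exists>h. (\<exists>p\<in>K. \<psi> p h \<noteq> 1) \<and> (\<forall>q\<in>F. cmod (\<psi> q h - 1) < e)"
begin

definition partial :: "'i set \<Rightarrow> ('a \<Rightarrow> complex) \<Rightarrow> 'a \<Rightarrow> complex" where
  "partial Q f x = (\<Sum>q\<in>Q. w q f * \<psi> q x)"

lemma A_diff: "f \<in> carrier A \<Longrightarrow> h \<in> carrier A \<Longrightarrow> (\<lambda>x. f x - h x) \<in> carrier A"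
  using A_add[of f "\<lambda>x. (-1) * h x"] A_smult[of h "-1"] by simp

lemma zero_in: "(\<lambda>x. 0) \<in> carrier A"
  using A_smult[OF \<psi>_in[OF unit(1)], of 0] by simp

lemma one_in: "(\<lambda>x. 1) \<in> carrier A"
  using \<psi>_in[OF unit(1)] by (simp add: unit(2))

lemma norm_one: "vnorm A (\<lambda>x. 1) = 1"
  using norm_\<psi>[OF unit(1)] by (simp add: unit(2))

lemma A_lincomb: "Q \<subseteq> K \<Longrightarrow> (\<lambda>x. \<Sum>q\<in>Q. c q * \<psi> q x) \<in> carrier A"
proof (induction Q rule: infinite_finite_induct)
  case (insert q Q)
  then show ?case using A_add[OF A_smult[OF \<psi>_in[of q], of "c q"]] by auto
qed (simp_all add: zero_in)

lemma partial_in: "Q \<subseteq> K \<Longrightarrow> partial Q f \<in> carrier A"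
  unfolding partial_def[abs_def] by (rule A_lincomb)

lemma w_le: "p \<in> K \<Longrightarrow> f \<in> carrier A \<Longrightarrow> cmod (w p f) \<le> vnorm A f"
  using w_sum_le[of "{p}" f] by simp

text \<open>Bounded bilinear forms, that is, functionals on the projective tensor square; they
  vanish off the carrier so that equality of forms is equality of functions.\<close>

definition form :: "(('a \<Rightarrow> complex) \<Rightarrow> ('a \<Rightarrow> complex) \<Rightarrow> complex) \<Rightarrow> bool" where
  "form \<Phi> \<longleftrightarrow>
     (\<forall>a b. a \<notin> carrier A \<or> b \<notin> carrier A \<longrightarrow> \<Phi> a b = 0) \<and>
     (\<forall>a\<in>carrier A. \<forall>a'\<in>carrier A. \<forall>b\<in>carrier A.
        \<Phi> (\<lambda>x. a x + a' x) b = \<Phi> a b + \<Phi> a' b \<and> \<Phi> b (\<lambda>x. a x + a' x) = \<Phi> b a + \<Phi> b a') \<and>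
     (\<forall>c. \<forall>a\<in>carrier A. \<forall>b\<in>carrier A. \<Phi> (\<lambda>x. c * a x) b = c * \<Phi> a b \<and> \<Phi> a (\<lambda>x. c * b x) = c * \<Phi> a b) \<and>
     (\<exists>M. \<forall>a\<in>carrier A. \<forall>b\<in>carrier A. cmod (\<Phi> a b) \<le> M * vnorm A a * vnorm A b)"

context
  fixes \<Phi> assumes \<Phi>: "form \<Phi>"
begin

lemma form_outside: "a \<notin> carrier A \<Longrightarrow> \<Phi> a b = 0" "b \<notin> carrier A \<Longrightarrow> \<Phi> a b = 0"
  using \<Phi> unfolding form_def by blast+

lemma form_add:
  assumes "a \<in> carrier A" "a' \<in> carrier A" "b \<in> carrier A"
  shows "\<Phi> (\<lambda>x. a x + a' x) b = \<Phi> a b + \<Phi> a' b" "\<Phi> b (\<lambda>x. a x + a' x) = \<Phi> b a + \<Phi> b a'"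
  using \<Phi> assms unfolding form_def by blast+

lemma form_smult:
  assumes "a \<in> carrier A" "b \<in> carrier A"
  shows "\<Phi> (\<lambda>x. c * a x) b = c * \<Phi> a b" "\<Phi> a (\<lambda>x. c * b x) = c * \<Phi> a b"
  using \<Phi> assms unfolding form_def by blast+

lemma form_bounded:
  "\<exists>M\<ge>0. \<forall>a\<in>carrier A. \<forall>b\<in>carrier A. cmod (\<Phi> a b) \<le> M * vnorm A a * vnorm A b"
proof -
  obtain M where M: "\<And>a b. a \<in> carrier A \<Longrightarrow> b \<in> carrier A \<Longrightarrow> cmod (\<Phi> a b) \<le> M * vnorm A a * vnorm A b"
    using \<Phi> unfolding form_def by blast
  have "cmod (\<Phi> a b) \<le> \<bar>M\<bar> * vnorm A a * vnorm A b" if "a \<in> carrier A" "b \<in> carrier A" for a b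
    using M[OF that] by (rule order_trans) (intro mult_right_mono norm_nonneg that; simp)
  then show ?thesis by (intro exI[of _ "\<bar>M\<bar>"]) simp
qed

lemma form_diff:
  assumes "a \<in> carrier A" "a' \<in> carrier A" "b \<in> carrier A"
  shows "\<Phi> (\<lambda>x. a x - a' x) b = \<Phi> a b - \<Phi> a' b" "\<Phi> b (\<lambda>x. a x - a' x) = \<Phi> b a - \<Phi> b a'"
  using form_add[OF assms(1) A_smult[where c = "-1", OF assms(2)] assms(3)]
    form_smult(1)[OF assms(2,3), where c = "-1"] form_smult(2)[OF assms(3,2), where c = "-1"]
  by simp_all

lemma form_zero: "b \<in> carrier A \<Longrightarrow> \<Phi> (\<lambda>x. 0) b = 0" "b \<in> carrier A \<Longrightarrow> \<Phi> b (\<lambda>x. 0) = 0"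
  using form_smult(1)[OF zero_in, where c = 0] form_smult(2)[OF _ zero_in, where c = 0] by simp_all

lemma form_partial:
  assumes Q: "finite Q" "Q \<subseteq> K"
  shows "\<Phi> (partial Q a) (partial Q b) = (\<Sum>p\<in>Q. \<Sum>q\<in>Q. w p a * w q b * \<Phi> (\<psi> p) (\<psi> q))"
proof -
  have left: "\<Phi> (\<lambda>x. \<Sum>p\<in>P. c p * \<psi> p x) b = (\<Sum>p\<in>P. c p * \<Phi> (\<psi> p) b)"
    if "finite P" "P \<subseteq> K" "b \<in> carrier A" for P c b
    using that by (induction P) (auto simp: form_zero form_add form_smult A_smult \<psi>_in A_lincomb)
  have right: "\<Phi> b (\<lambda>x. \<Sum>p\<in>P. c p * \<psi> p x) = (\<Sum>p\<in>P. c p * \<Phi> b (\<psi> p))"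
    if "finite P" "P \<subseteq> K" "b \<in> carrier A" for P c b
    using that by (induction P) (auto simp: form_zero form_add form_smult A_smult \<psi>_in A_lincomb)
  have pe: "partial Q f = (\<lambda>x. \<Sum>q\<in>Q. w q f * \<psi> q x)" for f by (simp add: partial_def fun_eq_iff)
  have "\<Phi> (partial Q a) (partial Q b) = (\<Sum>p\<in>Q. w p a * \<Phi> (\<psi> p) (partial Q b))"
    unfolding pe[of a] by (rule left[OF Q partial_in[OF Q(2)]])
  also have "\<dots> = (\<Sum>p\<in>Q. w p a * (\<Sum>q\<in>Q. w q b * \<Phi> (\<psi> p) (\<psi> q)))"
    unfolding pe[of b] using Q by (intro sum.cong refl) (subst right, auto simp: \<psi>_in)
  finally show ?thesis by (simp add: sum_distrib_left mult.assoc)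
qed

lemma form_partial_tendsto:
  assumes a: "a \<in> carrier A" and b: "b \<in> carrier A"
  shows "((\<lambda>Q. \<Phi> (partial Q a) (partial Q b)) \<longlongrightarrow> \<Phi> a b) (finite_subsets_at_top K)"
proof -
  obtain M where M: "M \<ge> 0" "\<And>a b. a \<in> carrier A \<Longrightarrow> b \<in> carrier A \<Longrightarrow> cmod (\<Phi> a b) \<le> M * vnorm A a * vnorm A b"
    using form_bounded by blast
  let ?r = "\<lambda>Q f x. f x - partial Q f x"
  let ?n = "\<lambda>Q f. vnorm A (?r Q f)"
  note ta = dense[OF a, folded partial_def] and tb = dense[OF b, folded partial_def]
  have "((\<lambda>Q. M * ?n Q a * vnorm A b + M * vnorm A a * ?n Q b + M * ?n Q a * ?n Q b) \<longlongrightarrow>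
     M * 0 * vnorm A b + M * vnorm A a * 0 + M * 0 * 0) (finite_subsets_at_top K)"
    by (intro tendsto_intros ta tb)
  then have lim: "((\<lambda>Q. M * ?n Q a * vnorm A b + M * vnorm A a * ?n Q b + M * ?n Q a * ?n Q b) \<longlongrightarrow> 0) (finite_subsets_at_top K)"
    by simp
  have "\<forall>\<^sub>F Q in finite_subsets_at_top K. norm (\<Phi> (partial Q a) (partial Q b) - \<Phi> a b)
      \<le> M * ?n Q a * vnorm A b + M * vnorm A a * ?n Q b + M * ?n Q a * ?n Q b"
    unfolding eventually_finite_subsets_at_top
  proof (intro exI[of _ "{}"] conjI allI impI)
    fix Q assume Q: "finite Q \<and> {} \<subseteq> Q \<and> Q \<subseteq> K"
    have pa: "partial Q a \<in> carrier A" and pb: "partial Q b \<in> carrier A" using Q by (auto intro: partial_in)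
    have ra: "?r Q a \<in> carrier A" and rb: "?r Q b \<in> carrier A" by (intro A_diff a b pa pb)+
    \<comment> \<open>Each partial sum is written as the element minus its remainder; after
      expansion every term contains a remainder.\<close>
    have eq: "\<Phi> (partial Q a) (partial Q b) - \<Phi> a b = \<Phi> (?r Q a) (?r Q b) - \<Phi> (?r Q a) b - \<Phi> a (?r Q b)"
      using form_diff(1)[OF a pa b] form_diff(2)[OF b pb a] form_diff(1)[OF a pa rb] form_diff(2)[OF b pb pa]
      by simp
    have "norm (\<Phi> (partial Q a) (partial Q b) - \<Phi> a b) \<le> norm (\<Phi> (?r Q a) (?r Q b)) + norm (\<Phi> (?r Q a) b) + norm (\<Phi> a (?r Q b))"
      unfolding eq by (smt (verit) norm_triangle_ineq4)
    then show "norm (\<Phi> (partial Q a) (partial Q b) - \<Phi> a b)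
      \<le> M * ?n Q a * vnorm A b + M * vnorm A a * ?n Q b + M * ?n Q a * ?n Q b"
      using M(2)[OF ra rb] M(2)[OF ra b] M(2)[OF a rb] by linarith
  qed auto
  from Lim_null_comparison[OF this lim] show ?thesis by (simp add: LIM_zero_iff)
qed

text \<open>The norm of A is an \<ell>1 norm in the coefficients, so a bilinear form is bounded by
  its values on pairs of basis elements. Hence the supremum in \<open>form_norm\<close> is the norm
  of the form as a functional on the tensor square.\<close>

lemma form_le:
  assumes N: "\<And>p q. p \<in> K \<Longrightarrow> q \<in> K \<Longrightarrow> cmod (\<Phi> (\<psi> p) (\<psi> q)) \<le> N"
    and a: "a \<in> carrier A" and b: "b \<in> carrier A"
  shows "cmod (\<Phi> a b) \<le> N * vnorm A a * vnorm A b"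
proof (rule tendsto_upperbound[OF tendsto_norm[OF form_partial_tendsto[OF a b]]])
  have N0: "0 \<le> N" using N[OF unit(1,1)] norm_ge_zero order_trans by blast
  show "\<forall>\<^sub>F Q in finite_subsets_at_top K. norm (\<Phi> (partial Q a) (partial Q b)) \<le> N * vnorm A a * vnorm A b"
    unfolding eventually_finite_subsets_at_top
  proof (intro exI[of _ "{}"] conjI allI impI)
    fix Q assume "finite Q \<and> {} \<subseteq> Q \<and> Q \<subseteq> K"
    then have Q: "finite Q" "Q \<subseteq> K" by auto
    have "norm (\<Phi> (partial Q a) (partial Q b)) \<le> (\<Sum>p\<in>Q. \<Sum>q\<in>Q. norm (w p a * w q b * \<Phi> (\<psi> p) (\<psi> q)))"
      unfolding form_partial[OF Q] by (intro order_trans[OF norm_sum] sum_mono) simp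
    also have "\<dots> \<le> (\<Sum>p\<in>Q. \<Sum>q\<in>Q. cmod (w p a) * cmod (w q b) * N)"
      using Q by (intro sum_mono) (auto simp: norm_mult intro!: mult_left_mono N)
    also have "\<dots> = (\<Sum>p\<in>Q. cmod (w p a)) * (\<Sum>q\<in>Q. cmod (w q b)) * N"
      by (simp only: sum_product sum_distrib_right[symmetric])
    also have "\<dots> \<le> vnorm A a * vnorm A b * N"
      using w_sum_le[OF Q a] w_sum_le[OF Q b] N0 norm_nonneg[OF a]
      by (intro mult_mono mult_nonneg_nonneg) (auto intro: sum_nonneg norm_nonneg a b)
    finally show "norm (\<Phi> (partial Q a) (partial Q b)) \<le> N * vnorm A a * vnorm A b" by (simp add: mult_ac)
  qed auto
qed simp

end

text \<open>Modulo \<open>A \<otimes> 1\<close> the tensor square is isomorphic to the kernel of the product map, by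
  \<open>b \<otimes> c \<mapsto> b \<otimes> c - bc \<otimes> 1\<close>; hence the condition \<open>\<Phi>(a, 1) = 0\<close>, and the second term in \<open>left_act\<close>, which
  comes from \<open>(b \<otimes> c - bc \<otimes> 1) \<cdot> a = b \<otimes> ca - bc \<otimes> a\<close>.\<close>

definition form_space :: "(('a \<Rightarrow> complex) \<Rightarrow> ('a \<Rightarrow> complex) \<Rightarrow> complex) set" where
  "form_space = {\<Phi>. form \<Phi> \<and> (\<forall>a\<in>carrier A. \<Phi> a (\<lambda>x. 1) = 0) \<and>
     ((\<lambda>z. \<Phi> (\<psi> (fst z)) (\<psi> (snd z))) \<longlongrightarrow> 0) (cofinite_on (K \<times> K))}"

definition form_norm :: "(('a \<Rightarrow> complex) \<Rightarrow> ('a \<Rightarrow> complex) \<Rightarrow> complex) \<Rightarrow> real" where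
  "form_norm \<Phi> = (SUP (p, q)\<in>K \<times> K. cmod (\<Phi> (\<psi> p) (\<psi> q)))"

definition forms :: "(('a \<Rightarrow> complex) \<Rightarrow> ('a \<Rightarrow> complex) \<Rightarrow> complex) normed" where
  "forms = \<lparr> carrier = form_space, mult = undefined, one = undefined,
     zero = (\<lambda>a b. 0), add = (\<lambda>\<Phi> \<Psi> a b. \<Phi> a b + \<Psi> a b), smult = (\<lambda>c \<Phi> a b. c * \<Phi> a b),
     vnorm = form_norm \<rparr>"

definition left_act :: "('a \<Rightarrow> complex) \<Rightarrow> (('a \<Rightarrow> complex) \<Rightarrow> ('a \<Rightarrow> complex) \<Rightarrow> complex) \<Rightarrow>
    ('a \<Rightarrow> complex) \<Rightarrow> ('a \<Rightarrow> complex) \<Rightarrow> complex" where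
  "left_act a \<Phi> = (\<lambda>b c. if b \<in> carrier A \<and> c \<in> carrier A
     then \<Phi> b (\<lambda>x. c x * a x) - \<Phi> (\<lambda>x. b x * c x) a else 0)"

definition right_act :: "(('a \<Rightarrow> complex) \<Rightarrow> ('a \<Rightarrow> complex) \<Rightarrow> complex) \<Rightarrow> ('a \<Rightarrow> complex) \<Rightarrow>
    ('a \<Rightarrow> complex) \<Rightarrow> ('a \<Rightarrow> complex) \<Rightarrow> complex" where
  "right_act \<Phi> a = (\<lambda>b c. if b \<in> carrier A \<and> c \<in> carrier A then \<Phi> (\<lambda>x. b x * a x) c else 0)"

lemma form_norm_bdd:
  assumes \<Phi>: "form \<Phi>"
  shows "bdd_above ((\<lambda>(p, q). cmod (\<Phi> (\<psi> p) (\<psi> q))) ` (K \<times> K))"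
proof -
  obtain M where M: "M \<ge> 0" "\<And>a b. a \<in> carrier A \<Longrightarrow> b \<in> carrier A \<Longrightarrow> cmod (\<Phi> a b) \<le> M * vnorm A a * vnorm A b"
    using form_bounded[OF \<Phi>] by blast
  show ?thesis
  proof (rule bdd_aboveI2)
    fix z assume "z \<in> K \<times> K"
    then show "(case z of (p, q) \<Rightarrow> cmod (\<Phi> (\<psi> p) (\<psi> q))) \<le> M"
      using M(2)[OF \<psi>_in \<psi>_in] by (auto simp: norm_\<psi>)
  qed
qed

lemma form_norm_ge: "form \<Phi> \<Longrightarrow> p \<in> K \<Longrightarrow> q \<in> K \<Longrightarrow> cmod (\<Phi> (\<psi> p) (\<psi> q)) \<le> form_norm \<Phi>"
  unfolding form_norm_def using cSUP_upper[OF _ form_norm_bdd, of "(p, q)" \<Phi>] by simp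

lemma form_norm_least: "(\<And>p q. p \<in> K \<Longrightarrow> q \<in> K \<Longrightarrow> cmod (\<Phi> (\<psi> p) (\<psi> q)) \<le> N) \<Longrightarrow> form_norm \<Phi> \<le> N"
  unfolding form_norm_def using unit(1) by (intro cSUP_least) auto

lemma form_norm_bound:
  "form \<Phi> \<Longrightarrow> a \<in> carrier A \<Longrightarrow> b \<in> carrier A \<Longrightarrow> cmod (\<Phi> a b) \<le> form_norm \<Phi> * vnorm A a * vnorm A b"
  using form_le form_norm_ge by blast

lemma form_norm_nonneg: "form \<Phi> \<Longrightarrow> 0 \<le> form_norm \<Phi>"
  using form_norm_ge[OF _ unit(1,1)] norm_ge_zero order_trans by blast

lemma form_spaceD:
  assumes "\<Phi> \<in> form_space"
  shows "form \<Phi>" "\<And>a. a \<in> carrier A \<Longrightarrow> \<Phi> a (\<lambda>x. 1) = 0"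
    "((\<lambda>z. \<Phi> (\<psi> (fst z)) (\<psi> (snd z))) \<longlongrightarrow> 0) (cofinite_on (K \<times> K))"
  using assms by (auto simp: form_space_def)

lemma formI:
  assumes "\<And>a b. a \<notin> carrier A \<or> b \<notin> carrier A \<Longrightarrow> \<Phi> a b = 0"
    and "\<And>a a' b. a \<in> carrier A \<Longrightarrow> a' \<in> carrier A \<Longrightarrow> b \<in> carrier A \<Longrightarrow> \<Phi> (\<lambda>x. a x + a' x) b = \<Phi> a b + \<Phi> a' b"
    and "\<And>a a' b. a \<in> carrier A \<Longrightarrow> a' \<in> carrier A \<Longrightarrow> b \<in> carrier A \<Longrightarrow> \<Phi> b (\<lambda>x. a x + a' x) = \<Phi> b a + \<Phi> b a'"
    and "\<And>c a b. a \<in> carrier A \<Longrightarrow> b \<in> carrier A \<Longrightarrow> \<Phi> (\<lambda>x. c * a x) b = c * \<Phi> a b"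
    and "\<And>c a b. a \<in> carrier A \<Longrightarrow> b \<in> carrier A \<Longrightarrow> \<Phi> a (\<lambda>x. c * b x) = c * \<Phi> a b"
    and "\<And>a b. a \<in> carrier A \<Longrightarrow> b \<in> carrier A \<Longrightarrow> cmod (\<Phi> a b) \<le> M * vnorm A a * vnorm A b"
  shows "form \<Phi>"
  unfolding form_def by (intro conjI allI ballI impI exI[of _ M]; rule assms; assumption)

lemma form_plus:
  assumes \<Phi>: "form \<Phi>" and \<Psi>: "form \<Psi>"
  shows "form (\<lambda>a b. \<Phi> a b + \<Psi> a b)"
proof (rule formI[where M = "form_norm \<Phi> + form_norm \<Psi>"])
  fix a b assume ab: "a \<in> carrier A" "b \<in> carrier A"
  show "cmod (\<Phi> a b + \<Psi> a b) \<le> (form_norm \<Phi> + form_norm \<Psi>) * vnorm A a * vnorm A b"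
    using norm_triangle_ineq[of "\<Phi> a b" "\<Psi> a b"] form_norm_bound[OF \<Phi> ab] form_norm_bound[OF \<Psi> ab]
    by (simp add: distrib_right)
qed (auto simp: form_outside[OF \<Phi>] form_outside[OF \<Psi>] form_add[OF \<Phi>] form_add[OF \<Psi>]
    form_smult[OF \<Phi>] form_smult[OF \<Psi>] distrib_left)

lemma form_scale:
  assumes \<Phi>: "form \<Phi>"
  shows "form (\<lambda>a b. c * \<Phi> a b)"
proof (rule formI[where M = "cmod c * form_norm \<Phi>"])
  fix a b assume ab: "a \<in> carrier A" "b \<in> carrier A"
  show "cmod (c * \<Phi> a b) \<le> cmod c * form_norm \<Phi> * vnorm A a * vnorm A b"
    using mult_left_mono[OF form_norm_bound[OF \<Phi> ab], of "cmod c"] by (simp add: norm_mult mult.assoc)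
qed (auto simp: form_outside[OF \<Phi>] form_add[OF \<Phi>] form_smult[OF \<Phi>] distrib_left)

lemma form_space_add: "\<Phi> \<in> form_space \<Longrightarrow> \<Psi> \<in> form_space \<Longrightarrow> (\<lambda>a b. \<Phi> a b + \<Psi> a b) \<in> form_space"
  unfolding form_space_def
  using tendsto_add[of "\<lambda>z. \<Phi> (\<psi> (fst z)) (\<psi> (snd z))" 0 "cofinite_on (K \<times> K)" "\<lambda>z. \<Psi> (\<psi> (fst z)) (\<psi> (snd z))" 0]
  by (auto simp: form_plus)

lemma form_space_smult: "\<Phi> \<in> form_space \<Longrightarrow> (\<lambda>a b. c * \<Phi> a b) \<in> form_space"
  unfolding form_space_def
  using tendsto_mult_left[of "\<lambda>z. \<Phi> (\<psi> (fst z)) (\<psi> (snd z))" 0 "cofinite_on (K \<times> K)" c]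
  by (auto simp: form_scale)

lemma form_space_zero: "(\<lambda>a b. 0) \<in> form_space"
  unfolding form_space_def by (auto intro!: formI[where M = 0])

lemma form_space_diff: "\<Phi> \<in> form_space \<Longrightarrow> \<Psi> \<in> form_space \<Longrightarrow> (\<lambda>a b. \<Phi> a b - \<Psi> a b) \<in> form_space"
  using form_space_add[OF _ form_space_smult[of \<Psi> "-1"], of \<Phi>] by simp

lemma form_space_sum:
  "(\<And>i. i \<in> F \<Longrightarrow> \<Phi> i \<in> form_space) \<Longrightarrow> (\<lambda>a b. \<Sum>i\<in>F. c i * \<Phi> i a b) \<in> form_space"
  by (induction F rule: infinite_finite_induct) (auto simp: form_space_zero form_space_add form_space_smult)

text \<open>The matrix units among the forms. For indices in K the condition \<Phi>(a, 1) = 0 holds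
  exactly when t differs from \<epsilon>, the index of the unit; so the relevant index set is K
  \<times> (K - {\<epsilon>}).\<close>

definition coord :: "'i \<Rightarrow> 'i \<Rightarrow> ('a \<Rightarrow> complex) \<Rightarrow> ('a \<Rightarrow> complex) \<Rightarrow> complex" where
  "coord s t a b = (if a \<in> carrier A \<and> b \<in> carrier A then w s a * w t b else 0)"

lemma delta_vanishes: "s \<in> K \<Longrightarrow> ((\<lambda>p. w s (\<psi> p)) \<longlongrightarrow> 0) (cofinite_on K)"
  unfolding tendsto_zero_cofinite_on
proof (intro allI impI)
  fix e :: real assume s: "s \<in> K" and e: "e > 0"
  have "{x \<in> K. e \<le> cmod (w s (\<psi> x))} \<subseteq> {s}" using s e by (auto simp: w_\<psi> split: if_splits)
  then show "finite {x \<in> K. e \<le> cmod (w s (\<psi> x))}" by (rule finite_subset) simp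
qed

lemma coord_form:
  assumes s: "s \<in> K" and t: "t \<in> K"
  shows "form (coord s t)"
proof (rule formI[where M = 1])
  fix a b assume ab: "a \<in> carrier A" "b \<in> carrier A"
  show "cmod (coord s t a b) \<le> 1 * vnorm A a * vnorm A b"
    using w_le[OF s ab(1)] w_le[OF t ab(2)] norm_nonneg[OF ab(1)] by (simp add: coord_def ab norm_mult mult_mono)
qed (auto simp: coord_def A_add A_smult w_add[OF s] w_add[OF t] w_smult[OF s] w_smult[OF t] algebra_simps)

lemma coord_in_form_space:
  assumes s: "s \<in> K" and t: "t \<in> K" "t \<noteq> \<epsilon>"
  shows "coord s t \<in> form_space"
proof -
  have "w t (\<lambda>x. 1) = 0" using w_\<psi>[OF t(1) unit(1)] t(2) by (simp add: unit(2))
  moreover have "((\<lambda>z. w s (\<psi> (fst z)) * w t (\<psi> (snd z))) \<longlongrightarrow> 0) (cofinite_on (K \<times> K))"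
    by (rule tendsto_zero_product[where M = 1]) (auto simp: delta_vanishes s t w_\<psi>)
  then have "((\<lambda>z. coord s t (\<psi> (fst z)) (\<psi> (snd z))) \<longlongrightarrow> 0) (cofinite_on (K \<times> K))"
    by (rule tendsto_cofinite_on_cong[THEN iffD1, rotated]) (auto simp: coord_def \<psi>_in)
  ultimately show ?thesis using coord_form[OF s t(1)] by (auto simp: form_space_def coord_def)
qed

text \<open>A form vanishing at infinity is, up to e, the combination of matrix units over the
  finitely many pairs where it is at least e. These pairs avoid \<epsilon> in the second place
  because \<Phi>(a, 1) = 0.\<close>

lemma form_approx:
  assumes \<Phi>: "\<Phi> \<in> form_space" and e: "e > 0"
  obtains F where "finite F" "F \<subseteq> K \<times> (K - {\<epsilon>})"
    "form_norm (\<lambda>a b. \<Phi> a b - (\<Sum>(s, t)\<in>F. \<Phi> (\<psi> s) (\<psi> t) * coord s t a b)) \<le> e"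
    "(\<lambda>a b. \<Sum>(s, t)\<in>F. \<Phi> (\<psi> s) (\<psi> t) * coord s t a b) \<in> form_space"
proof -
  define F where "F = {z \<in> K \<times> K. e \<le> cmod (\<Phi> (\<psi> (fst z)) (\<psi> (snd z)))}"
  have fin: "finite F" using form_spaceD(3)[OF \<Phi>] e unfolding F_def tendsto_zero_cofinite_on by blast
  have sub: "F \<subseteq> K \<times> (K - {\<epsilon>})"
    using form_spaceD(2)[OF \<Phi> \<psi>_in] e by (auto simp: F_def unit(2))
  have "cmod (\<Phi> (\<psi> p) (\<psi> q) - (\<Sum>(s, t)\<in>F. \<Phi> (\<psi> s) (\<psi> t) * coord s t (\<psi> p) (\<psi> q))) \<le> e"
    if pq: "p \<in> K" "q \<in> K" for p q
  proof -
    have "(\<Sum>(s, t)\<in>F. \<Phi> (\<psi> s) (\<psi> t) * coord s t (\<psi> p) (\<psi> q)) = (\<Sum>z\<in>F. if z = (p, q) then \<Phi> (\<psi> p) (\<psi> q) else 0)"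
      using pq sub by (intro sum.cong refl) (auto simp: coord_def \<psi>_in w_\<psi> split: if_splits)
    then show ?thesis using fin pq e by (auto simp: F_def)
  qed
  then have small: "form_norm (\<lambda>a b. \<Phi> a b - (\<Sum>(s, t)\<in>F. \<Phi> (\<psi> s) (\<psi> t) * coord s t a b)) \<le> e"
    by (rule form_norm_least)
  have "(\<lambda>a b. \<Sum>z\<in>F. (case z of (s, t) \<Rightarrow> \<Phi> (\<psi> s) (\<psi> t)) * (case z of (s, t) \<Rightarrow> coord s t) a b) \<in> form_space"
    using sub by (intro form_space_sum) (auto intro: coord_in_form_space)
  then have "(\<lambda>a b. \<Sum>(s, t)\<in>F. \<Phi> (\<psi> s) (\<psi> t) * coord s t a b) \<in> form_space"
    by (simp add: case_prod_beta)
  with fin sub small show ?thesis by (rule that)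
qed

text \<open>For a basis element in place of a, this is \<open>product_vanishes\<close> on a slice of
  K \<times> K. A general a is approximated in norm, and the error is uniform in p because all
  \<psi> p have norm 1.\<close>

lemma coeff_product_vanishes:
  assumes s: "s \<in> K" and a: "a \<in> carrier A"
  shows "((\<lambda>p. w s (\<lambda>x. \<psi> p x * a x)) \<longlongrightarrow> 0) (cofinite_on K)"
proof (rule tendsto_zero_approx)
  fix e :: real assume e: "e > 0"
  have "\<forall>\<^sub>F Q in finite_subsets_at_top K. dist (vnorm A (\<lambda>x. a x - partial Q a x)) 0 < e"
    using dense[OF a, folded partial_def] e by (rule tendstoD)
  then obtain Q where Q: "finite Q" "Q \<subseteq> K" "dist (vnorm A (\<lambda>x. a x - partial Q a x)) 0 < e"
    unfolding eventually_finite_subsets_at_top by blast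
  then have small: "vnorm A (\<lambda>x. a x - partial Q a x) \<le> e" by (simp add: dist_real_def)
  have pa: "partial Q a \<in> carrier A" using Q(2) by (rule partial_in)
  have basis: "((\<lambda>p. w s (\<lambda>x. \<psi> p x * \<psi> q x)) \<longlongrightarrow> 0) (cofinite_on K)" if q: "q \<in> K" for q
    unfolding tendsto_zero_cofinite_on
  proof (intro allI impI)
    fix e :: real assume "e > 0"
    then have "finite {z \<in> K \<times> K. e \<le> cmod (w s (\<lambda>x. \<psi> (fst z) x * \<psi> (snd z) x))}"
      using product_vanishes[OF s] unfolding tendsto_zero_cofinite_on by blast
    then have "finite (fst ` {z \<in> K \<times> K. e \<le> cmod (w s (\<lambda>x. \<psi> (fst z) x * \<psi> (snd z) x))})" by simp
    then show "finite {p \<in> K. e \<le> cmod (w s (\<lambda>x. \<psi> p x * \<psi> q x))}"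
      by (rule finite_subset[rotated]) (use q in force)
  qed
  have wsum: "w s (\<lambda>x. \<psi> p x * partial P a x) = (\<Sum>q\<in>P. w q a * w s (\<lambda>x. \<psi> p x * \<psi> q x))"
    if "finite P" "P \<subseteq> K" "p \<in> K" for p P
    using that
  proof (induction P)
    case empty
    then show ?case using w_smult[OF s zero_in, of 0] by (simp add: partial_def)
  next
    case (insert q P)
    have 1: "(\<lambda>x. \<psi> p x * \<psi> q x) \<in> carrier A" using insert by (auto intro: A_mult \<psi>_in)
    have 2: "(\<lambda>x. \<psi> p x * partial P a x) \<in> carrier A" using insert by (auto intro: A_mult \<psi>_in partial_in)
    have "(\<lambda>x. \<psi> p x * partial (insert q P) a x) = (\<lambda>x. w q a * (\<psi> p x * \<psi> q x) + \<psi> p x * partial P a x)"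
      using insert by (simp add: partial_def distrib_left mult_ac)
    then show ?case using insert by (simp add: w_add[OF s A_smult[OF 1] 2] w_smult[OF s 1])
  qed
  have "((\<lambda>p. \<Sum>q\<in>Q. w q a * w s (\<lambda>x. \<psi> p x * \<psi> q x)) \<longlongrightarrow> (\<Sum>q\<in>Q. w q a * 0)) (cofinite_on K)"
    using Q(2) by (intro tendsto_sum tendsto_mult_left basis) auto
  then have lim: "((\<lambda>p. \<Sum>q\<in>Q. w q a * w s (\<lambda>x. \<psi> p x * \<psi> q x)) \<longlongrightarrow> 0) (cofinite_on K)" by simp
  show "\<exists>g. (g \<longlongrightarrow> 0) (cofinite_on K) \<and> (\<forall>p\<in>K. cmod (w s (\<lambda>x. \<psi> p x * a x) - g p) \<le> e)"
  proof (intro exI conjI ballI, rule lim)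
    fix p assume p: "p \<in> K"
    have d: "(\<lambda>x. a x - partial Q a x) \<in> carrier A" by (rule A_diff[OF a pa])
    have pd: "(\<lambda>x. \<psi> p x * (a x - partial Q a x)) \<in> carrier A" by (rule A_mult[OF \<psi>_in[OF p] d])
    have pq: "(\<lambda>x. \<psi> p x * partial Q a x) \<in> carrier A" by (rule A_mult[OF \<psi>_in[OF p] pa])
    have "w s (\<lambda>x. \<psi> p x * a x) = w s (\<lambda>x. \<psi> p x * (a x - partial Q a x)) + w s (\<lambda>x. \<psi> p x * partial Q a x)"
      using w_add[OF s pd pq] by (simp add: right_diff_distrib)
    then have "cmod (w s (\<lambda>x. \<psi> p x * a x) - (\<Sum>q\<in>Q. w q a * w s (\<lambda>x. \<psi> p x * \<psi> q x)))
        = cmod (w s (\<lambda>x. \<psi> p x * (a x - partial Q a x)))" by (simp add: wsum[OF Q(1,2) p])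
    also have "\<dots> \<le> vnorm A (\<lambda>x. \<psi> p x * (a x - partial Q a x))" by (rule w_le[OF s pd])
    also have "\<dots> \<le> vnorm A (\<psi> p) * vnorm A (\<lambda>x. a x - partial Q a x)" by (rule norm_mult_le[OF \<psi>_in[OF p] d])
    also have "\<dots> \<le> e" using small by (simp add: norm_\<psi>[OF p])
    finally show "cmod (w s (\<lambda>x. \<psi> p x * a x) - (\<Sum>q\<in>Q. w q a * w s (\<lambda>x. \<psi> p x * \<psi> q x))) \<le> e" .
  qed
qed

end

section \<open>The module actions on the forms\<close>

context character_algebra
begin

lemma left_act_form:
  assumes a: "a \<in> carrier A" and \<Phi>: "form \<Phi>"
  shows "form (left_act a \<Phi>)"
    and "\<And>b c. b \<in> carrier A \<Longrightarrow> c \<in> carrier A \<Longrightarrow>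
      cmod (left_act a \<Phi> b c) \<le> 2 * form_norm \<Phi> * vnorm A a * vnorm A b * vnorm A c"
proof -
  show bd: "cmod (left_act a \<Phi> b c) \<le> 2 * form_norm \<Phi> * vnorm A a * vnorm A b * vnorm A c"
    if b: "b \<in> carrier A" and c: "c \<in> carrier A" for b c
  proof -
    note N = form_norm_nonneg[OF \<Phi>]
    have 1: "cmod (\<Phi> b (\<lambda>x. c x * a x)) \<le> form_norm \<Phi> * vnorm A b * (vnorm A c * vnorm A a)"
      by (rule order_trans[OF form_norm_bound[OF \<Phi> b A_mult[OF c a]]])
        (intro mult_left_mono norm_mult_le c a mult_nonneg_nonneg N norm_nonneg b)
    have 2: "cmod (\<Phi> (\<lambda>x. b x * c x) a) \<le> form_norm \<Phi> * (vnorm A b * vnorm A c) * vnorm A a"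
      by (rule order_trans[OF form_norm_bound[OF \<Phi> A_mult[OF b c] a]])
        (intro mult_left_mono mult_right_mono norm_mult_le c a mult_nonneg_nonneg N norm_nonneg b)
    have "cmod (left_act a \<Phi> b c) \<le> cmod (\<Phi> b (\<lambda>x. c x * a x)) + cmod (\<Phi> (\<lambda>x. b x * c x) a)"
      using b c by (simp add: left_act_def norm_triangle_ineq4)
    with 1 2 show ?thesis by (simp add: mult_ac)
  qed
  show "form (left_act a \<Phi>)"
  proof (rule formI[where M = "2 * form_norm \<Phi> * vnorm A a"])
    show "cmod (left_act a \<Phi> b c) \<le> 2 * form_norm \<Phi> * vnorm A a * vnorm A b * vnorm A c"
      if "b \<in> carrier A" "c \<in> carrier A" for b c by (rule bd[OF that])
  next
    fix b b' c assume bc: "b \<in> carrier A" "b' \<in> carrier A" "c \<in> carrier A"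
    show "left_act a \<Phi> (\<lambda>x. b x + b' x) c = left_act a \<Phi> b c + left_act a \<Phi> b' c"
      using bc form_add(1)[OF \<Phi> A_mult[OF bc(1,3)] A_mult[OF bc(2,3)] a]
      by (simp add: left_act_def A_add form_add[OF \<Phi>] A_mult a distrib_right)
    show "left_act a \<Phi> c (\<lambda>x. b x + b' x) = left_act a \<Phi> c b + left_act a \<Phi> c b'"
      using bc form_add(2)[OF \<Phi> A_mult[OF bc(1) a] A_mult[OF bc(2) a] bc(3)]
        form_add(1)[OF \<Phi> A_mult[OF bc(3,1)] A_mult[OF bc(3,2)] a]
      by (simp add: left_act_def A_add distrib_right distrib_left)
  next
    fix k b c assume bc: "b \<in> carrier A" "c \<in> carrier A"
    show "left_act a \<Phi> (\<lambda>x. k * b x) c = k * left_act a \<Phi> b c"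
      using bc form_smult(1)[OF \<Phi> A_mult[OF bc] a, of k] form_smult(1)[OF \<Phi> bc(1) A_mult[OF bc(2) a], of k]
      by (simp add: left_act_def A_smult mult.assoc right_diff_distrib)
    show "left_act a \<Phi> b (\<lambda>x. k * c x) = k * left_act a \<Phi> b c"
      using bc form_smult(1)[OF \<Phi> A_mult[OF bc] a, of k] form_smult(2)[OF \<Phi> bc(1) A_mult[OF bc(2) a], of k]
      by (simp add: left_act_def A_smult mult.assoc mult.left_commute[of _ k] right_diff_distrib)
  qed (auto simp: left_act_def)
qed

lemma right_act_form:
  assumes a: "a \<in> carrier A" and \<Phi>: "form \<Phi>"
  shows "form (right_act \<Phi> a)"
    and "\<And>b c. b \<in> carrier A \<Longrightarrow> c \<in> carrier A \<Longrightarrow>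
      cmod (right_act \<Phi> a b c) \<le> form_norm \<Phi> * vnorm A a * vnorm A b * vnorm A c"
proof -
  show bd: "cmod (right_act \<Phi> a b c) \<le> form_norm \<Phi> * vnorm A a * vnorm A b * vnorm A c"
    if b: "b \<in> carrier A" and c: "c \<in> carrier A" for b c
  proof -
    have "cmod (\<Phi> (\<lambda>x. b x * a x) c) \<le> form_norm \<Phi> * (vnorm A b * vnorm A a) * vnorm A c"
      by (rule order_trans[OF form_norm_bound[OF \<Phi> A_mult[OF b a] c]])
        (intro mult_left_mono mult_right_mono norm_mult_le c a mult_nonneg_nonneg form_norm_nonneg[OF \<Phi>] norm_nonneg b)
    then show ?thesis using b c by (simp add: right_act_def mult_ac)
  qed
  show "form (right_act \<Phi> a)"
  proof (rule formI[where M = "form_norm \<Phi> * vnorm A a"])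
    show "cmod (right_act \<Phi> a b c) \<le> form_norm \<Phi> * vnorm A a * vnorm A b * vnorm A c"
      if "b \<in> carrier A" "c \<in> carrier A" for b c by (rule bd[OF that])
  next
    fix b b' c assume bc: "b \<in> carrier A" "b' \<in> carrier A" "c \<in> carrier A"
    show "right_act \<Phi> a (\<lambda>x. b x + b' x) c = right_act \<Phi> a b c + right_act \<Phi> a b' c"
      using bc form_add(1)[OF \<Phi> A_mult[OF bc(1) a] A_mult[OF bc(2) a] bc(3)]
      by (simp add: right_act_def A_add distrib_right)
    show "right_act \<Phi> a c (\<lambda>x. b x + b' x) = right_act \<Phi> a c b + right_act \<Phi> a c b'"
      using bc form_add(2)[OF \<Phi> bc(1,2) A_mult[OF bc(3) a]] by (simp add: right_act_def A_add)
  next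
    fix k b c assume bc: "b \<in> carrier A" "c \<in> carrier A"
    show "right_act \<Phi> a (\<lambda>x. k * b x) c = k * right_act \<Phi> a b c"
      using bc form_smult(1)[OF \<Phi> A_mult[OF bc(1) a] bc(2), of k]
      by (simp add: right_act_def A_smult mult.assoc)
    show "right_act \<Phi> a b (\<lambda>x. k * c x) = k * right_act \<Phi> a b c"
      using bc form_smult(2)[OF \<Phi> A_mult[OF bc(1) a] bc(2), of k]
      by (simp add: right_act_def A_smult)
  qed (auto simp: right_act_def)
qed

text \<open>The actions preserve vanishing at infinity because the coordinate forms are mapped to products
  of coefficient functionals, which vanish at infinity by \<open>product_vanishes\<close>.\<close>

lemma act_in_form_space:
  assumes a: "a \<in> carrier A" and \<Phi>: "\<Phi> \<in> form_space"
  shows "left_act a \<Phi> \<in> form_space" "right_act \<Phi> a \<in> form_space"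
proof -
  let ?n = "vnorm A a"
  note na = norm_nonneg[OF a] and f\<Phi> = form_spaceD(1)[OF \<Phi>]
  define G where "G F = (\<lambda>a b. \<Sum>(s, t)\<in>F. \<Phi> (\<psi> s) (\<psi> t) * coord s t a b)" for F
  \<comment> \<open>The factor 2 (n + 1), with n the norm of a, absorbs the two terms of
    \<open>left_act\<close> and the factor n in each of them; the 1 keeps it positive when n =
    0.\<close>
  have approx: "\<exists>F. finite F \<and> F \<subseteq> K \<times> K \<and> (\<forall>b\<in>carrier A. \<forall>c\<in>carrier A.
      cmod (\<Phi> b c - G F b c) * (2 * (?n + 1)) \<le> e * vnorm A b * vnorm A c)" if e: "e > 0" for e
  proof -
    have "e / (2 * (?n + 1)) > 0" using e na by simp
    then obtain F where F: "finite F" "F \<subseteq> K \<times> (K - {\<epsilon>})" 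
      "form_norm (\<lambda>a b. \<Phi> a b - G F a b) \<le> e / (2 * (?n + 1))" "G F \<in> form_space"
      unfolding G_def by (rule form_approx[OF \<Phi>])
    have fd: "form (\<lambda>a b. \<Phi> a b - G F a b)" using form_spaceD(1)[OF form_space_diff[OF \<Phi> F(4)]] .
    have "cmod (\<Phi> b c - G F b c) * (2 * (?n + 1)) \<le> e * vnorm A b * vnorm A c"
      if b: "b \<in> carrier A" and c: "c \<in> carrier A" for b c
    proof -
      have "cmod (\<Phi> b c - G F b c) \<le> form_norm (\<lambda>a b. \<Phi> a b - G F a b) * vnorm A b * vnorm A c"
        by (rule form_norm_bound[OF fd b c])
      also have "\<dots> \<le> e / (2 * (?n + 1)) * vnorm A b * vnorm A c"
        by (intro mult_right_mono F(3) norm_nonneg b c)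
      finally have "cmod (\<Phi> b c - G F b c) * (2 * (?n + 1)) \<le> e / (2 * (?n + 1)) * vnorm A b * vnorm A c * (2 * (?n + 1))"
        using na by (intro mult_right_mono) auto
      moreover have "e / (2 * (?n + 1)) * vnorm A b * vnorm A c * (2 * (?n + 1)) = e * vnorm A b * vnorm A c"
      proof -
        have "?n + 1 \<noteq> 0" using na by linarith
        then show ?thesis by (simp add: divide_simps)
      qed
      ultimately show ?thesis by simp
    qed
    then show ?thesis using F(1,2) by blast
  qed
  have G_eq: "G F b c = (\<Sum>z\<in>F. \<Phi> (\<psi> (fst z)) (\<psi> (snd z)) * (w (fst z) b * w (snd z) c))"
    if "b \<in> carrier A" "c \<in> carrier A" for F b c
    using that by (simp add: G_def coord_def case_prod_beta)
  have wb: "cmod (w s (\<lambda>x. \<psi> p x * a x)) \<le> ?n + 1" if "s \<in> K" "p \<in> K" for s p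
    using order_trans[OF w_le[OF that(1) A_mult[OF \<psi>_in[OF that(2)] a]] norm_mult_le[OF \<psi>_in[OF that(2)] a]]
    by (simp add: norm_\<psi>[OF that(2)])
  have wd: "cmod (w s (\<psi> p)) \<le> ?n + 1" if "s \<in> K" "p \<in> K" for s p
    using na by (simp add: w_\<psi> that)
  have R: "((\<lambda>z. right_act \<Phi> a (\<psi> (fst z)) (\<psi> (snd z))) \<longlongrightarrow> 0) (cofinite_on (K \<times> K))"
  proof (rule tendsto_zero_approx)
    fix e :: real assume "e > 0"
    then obtain F where F: "finite F" "F \<subseteq> K \<times> K"
      "\<And>b c. b \<in> carrier A \<Longrightarrow> c \<in> carrier A \<Longrightarrow> cmod (\<Phi> b c - G F b c) * (2 * (?n + 1)) \<le> e * vnorm A b * vnorm A c"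
      using approx by meson
    let ?g = "\<lambda>z. \<Sum>y\<in>F. \<Phi> (\<psi> (fst y)) (\<psi> (snd y)) * (w (fst y) (\<lambda>x. \<psi> (fst z) x * a x) * w (snd y) (\<psi> (snd z)))"
    have "(?g \<longlongrightarrow> (\<Sum>y\<in>F. \<Phi> (\<psi> (fst y)) (\<psi> (snd y)) * 0)) (cofinite_on (K \<times> K))"
      using F(2) by (intro tendsto_sum tendsto_mult_left tendsto_zero_product[where M = "?n + 1"]
          coeff_product_vanishes delta_vanishes wb wd a) auto
    then have lim: "(?g \<longlongrightarrow> 0) (cofinite_on (K \<times> K))" by simp
    show "\<exists>g. (g \<longlongrightarrow> 0) (cofinite_on (K \<times> K)) \<and>
        (\<forall>z\<in>K \<times> K. cmod (right_act \<Phi> a (\<psi> (fst z)) (\<psi> (snd z)) - g z) \<le> e)"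
    proof (intro exI conjI ballI, rule lim)
      fix z assume "z \<in> K \<times> K"
      then have z: "\<psi> (fst z) \<in> carrier A" "\<psi> (snd z) \<in> carrier A" "vnorm A (\<psi> (fst z)) = 1" "vnorm A (\<psi> (snd z)) = 1"
        by (auto simp: \<psi>_in norm_\<psi>)
      note za = A_mult[OF z(1) a]
      have "vnorm A (\<lambda>x. \<psi> (fst z) x * a x) \<le> ?n" using norm_mult_le[OF z(1) a] z(3) by simp
      from mult_left_mono[OF this less_imp_le[OF \<open>e > 0\<close>]] F(3)[OF za z(2)] z(4)
      have "cmod (\<Phi> (\<lambda>x. \<psi> (fst z) x * a x) (\<psi> (snd z)) - G F (\<lambda>x. \<psi> (fst z) x * a x) (\<psi> (snd z))) * (2 * (?n + 1)) \<le> e * ?n"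
        by simp
      also have "\<dots> \<le> e * (2 * (?n + 1))" using na \<open>e > 0\<close> by simp
      finally have "cmod (\<Phi> (\<lambda>x. \<psi> (fst z) x * a x) (\<psi> (snd z)) - G F (\<lambda>x. \<psi> (fst z) x * a x) (\<psi> (snd z))) \<le> e"
        using na by (simp add: mult_le_cancel_right)
      then show "cmod (right_act \<Phi> a (\<psi> (fst z)) (\<psi> (snd z)) - ?g z) \<le> e"
        using z by (simp add: right_act_def G_eq[OF za z(2)])
    qed
  qed
  have L: "((\<lambda>z. left_act a \<Phi> (\<psi> (fst z)) (\<psi> (snd z))) \<longlongrightarrow> 0) (cofinite_on (K \<times> K))"
  proof (rule tendsto_zero_approx)
    fix e :: real assume "e > 0"
    then obtain F where F: "finite F" "F \<subseteq> K \<times> K"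
      "\<And>b c. b \<in> carrier A \<Longrightarrow> c \<in> carrier A \<Longrightarrow> cmod (\<Phi> b c - G F b c) * (2 * (?n + 1)) \<le> e * vnorm A b * vnorm A c"
      using approx by meson
    let ?g1 = "\<lambda>z. \<Sum>y\<in>F. \<Phi> (\<psi> (fst y)) (\<psi> (snd y)) * (w (fst y) (\<psi> (fst z)) * w (snd y) (\<lambda>x. \<psi> (snd z) x * a x))"
    \<comment> \<open>The correction term of \<open>left_act\<close> multiplies the two basis
      elements with each other, so it needs \<open>product_vanishes\<close> on pairs and not just on
      slices.\<close>
    let ?g2 = "\<lambda>z. \<Sum>y\<in>F. \<Phi> (\<psi> (fst y)) (\<psi> (snd y)) * (w (fst y) (\<lambda>x. \<psi> (fst z) x * \<psi> (snd z) x) * w (snd y) a)"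
    have "(?g1 \<longlongrightarrow> (\<Sum>y\<in>F. \<Phi> (\<psi> (fst y)) (\<psi> (snd y)) * 0)) (cofinite_on (K \<times> K))"
      using F(2) by (intro tendsto_sum tendsto_mult_left tendsto_zero_product[where M = "?n + 1"]
          coeff_product_vanishes delta_vanishes wb wd a) auto
    moreover have "(?g2 \<longlongrightarrow> (\<Sum>y\<in>F. \<Phi> (\<psi> (fst y)) (\<psi> (snd y)) * (0 * w (snd y) a))) (cofinite_on (K \<times> K))"
      using F(2) by (intro tendsto_sum tendsto_mult_left tendsto_mult_right product_vanishes) auto
    ultimately have "((\<lambda>z. ?g1 z - ?g2 z) \<longlongrightarrow> 0 - 0) (cofinite_on (K \<times> K))"
      by (intro tendsto_diff) simp_all
    then have lim: "((\<lambda>z. ?g1 z - ?g2 z) \<longlongrightarrow> 0) (cofinite_on (K \<times> K))" by simp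
    show "\<exists>g. (g \<longlongrightarrow> 0) (cofinite_on (K \<times> K)) \<and>
        (\<forall>z\<in>K \<times> K. cmod (left_act a \<Phi> (\<psi> (fst z)) (\<psi> (snd z)) - g z) \<le> e)"
    proof (intro exI conjI ballI, rule lim)
      fix z assume "z \<in> K \<times> K"
      then have z: "\<psi> (fst z) \<in> carrier A" "\<psi> (snd z) \<in> carrier A" "vnorm A (\<psi> (fst z)) = 1" "vnorm A (\<psi> (snd z)) = 1"
        by (auto simp: \<psi>_in norm_\<psi>)
      note za = A_mult[OF z(2) a] and zz = A_mult[OF z(1,2)]
      let ?u = "\<Phi> (\<psi> (fst z)) (\<lambda>x. \<psi> (snd z) x * a x) - G F (\<psi> (fst z)) (\<lambda>x. \<psi> (snd z) x * a x)"
      let ?v = "\<Phi> (\<lambda>x. \<psi> (fst z) x * \<psi> (snd z) x) a - G F (\<lambda>x. \<psi> (fst z) x * \<psi> (snd z) x) a"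
      have "vnorm A (\<lambda>x. \<psi> (snd z) x * a x) \<le> ?n" using norm_mult_le[OF z(2) a] z(4) by simp
      from mult_left_mono[OF this less_imp_le[OF \<open>e > 0\<close>]] F(3)[OF z(1) za] z(3)
      have u: "cmod ?u * (2 * (?n + 1)) \<le> e * ?n" by simp
      have "vnorm A (\<lambda>x. \<psi> (fst z) x * \<psi> (snd z) x) \<le> 1" using norm_mult_le[OF z(1,2)] z(3,4) by simp
      then have "e * vnorm A (\<lambda>x. \<psi> (fst z) x * \<psi> (snd z) x) * ?n \<le> e * 1 * ?n"
        using na \<open>e > 0\<close> by (intro mult_right_mono mult_left_mono) auto
      then have v: "cmod ?v * (2 * (?n + 1)) \<le> e * ?n" using F(3)[OF zz a] by simp
      have "cmod (?u - ?v) * (2 * (?n + 1)) \<le> (cmod ?u + cmod ?v) * (2 * (?n + 1))"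
        using na by (intro mult_right_mono norm_triangle_ineq4) auto
      also have "\<dots> \<le> e * (2 * ?n)" using u v by (simp add: distrib_right)
      also have "\<dots> \<le> e * (2 * (?n + 1))" using \<open>e > 0\<close> by simp
      finally have "cmod (?u - ?v) \<le> e" using na by (simp add: mult_le_cancel_right)
      moreover have "left_act a \<Phi> (\<psi> (fst z)) (\<psi> (snd z)) - (?g1 z - ?g2 z) = ?u - ?v"
        using z by (simp add: left_act_def G_eq[OF z(1) za] G_eq[OF zz a])
      ultimately show "cmod (left_act a \<Phi> (\<psi> (fst z)) (\<psi> (snd z)) - (?g1 z - ?g2 z)) \<le> e" by simp
    qed
  qed
  have one_L: "left_act a \<Phi> b (\<lambda>x. 1) = 0" and one_R: "right_act \<Phi> a b (\<lambda>x. 1) = 0" if "b \<in> carrier A" for b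
    using that by (simp_all add: left_act_def right_act_def one_in form_spaceD(2)[OF \<Phi>] A_mult a)
  show "left_act a \<Phi> \<in> form_space" using left_act_form(1)[OF a f\<Phi>] L one_L by (simp add: form_space_def)
  show "right_act \<Phi> a \<in> form_space" using right_act_form(1)[OF a f\<Phi>] R one_R by (simp add: form_space_def)
qed

section \<open>The forms as a Banach bimodule\<close>

lemma forms_simps [simp]:
  "carrier forms = form_space" "\<zero>\<^bsub>forms\<^esub> = (\<lambda>a b. 0)" "\<Phi> \<oplus>\<^bsub>forms\<^esub> \<Psi> = (\<lambda>a b. \<Phi> a b + \<Psi> a b)"
  "c \<odot>\<^bsub>forms\<^esub> \<Phi> = (\<lambda>a b. c * \<Phi> a b)" "vnorm forms = form_norm"
  by (simp_all add: forms_def)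

lemma forms_abelian_group: "abelian_group forms"
proof (rule abelian_groupI)
  fix \<Phi> assume "\<Phi> \<in> carrier forms"
  then show "\<exists>\<Psi>\<in>carrier forms. \<Psi> \<oplus>\<^bsub>forms\<^esub> \<Phi> = \<zero>\<^bsub>forms\<^esub>"
    using form_space_smult[of \<Phi> "-1"] by (intro bexI[of _ "\<lambda>a b. (-1) * \<Phi> a b"]) auto
qed (auto simp: form_space_add form_space_zero ac_simps)

lemma forms_module: "Module.module (class_ring :: complex ring) forms"
proof (rule Module.moduleI)
  show "cring (class_ring :: complex ring)" using class_field by (auto simp: field_def domain_def)
qed (auto simp: forms_abelian_group form_space_smult class_ring_simps algebra_simps)

lemma forms_minus:
  assumes "\<Phi> \<in> form_space" "\<Psi> \<in> form_space"
  shows "\<Phi> \<ominus>\<^bsub>forms\<^esub> \<Psi> = (\<lambda>a b. \<Phi> a b - \<Psi> a b)"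
proof -
  have "\<ominus>\<^bsub>forms\<^esub> \<Psi> = (\<lambda>a b. - \<Psi> a b)"
    using form_space_smult[OF assms(2), of "-1"] assms(2)
    by (intro abelian_group.minus_equality[OF forms_abelian_group]) auto
  then show ?thesis by (simp add: a_minus_def)
qed

lemma form_norm_add:
  assumes "form \<Phi>" "form \<Psi>"
  shows "form_norm (\<lambda>a b. \<Phi> a b + \<Psi> a b) \<le> form_norm \<Phi> + form_norm \<Psi>"
proof (rule form_norm_least)
  fix p q assume "p \<in> K" "q \<in> K"
  then show "cmod (\<Phi> (\<psi> p) (\<psi> q) + \<Psi> (\<psi> p) (\<psi> q)) \<le> form_norm \<Phi> + form_norm \<Psi>"
    using norm_triangle_ineq[of "\<Phi> (\<psi> p) (\<psi> q)" "\<Psi> (\<psi> p) (\<psi> q)"] form_norm_ge[OF assms(1), of p q] form_norm_ge[OF assms(2), of p q]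
    by linarith
qed

lemma form_norm_smult:
  assumes \<Phi>: "form \<Phi>"
  shows "form_norm (\<lambda>a b. c * \<Phi> a b) = cmod c * form_norm \<Phi>"
proof (rule antisym)
  have le: "form_norm (\<lambda>a b. c * \<Psi> a b) \<le> cmod c * form_norm \<Psi>" if "form \<Psi>" for c \<Psi>
    by (rule form_norm_least) (simp add: norm_mult mult_left_mono form_norm_ge that)
  show "form_norm (\<lambda>a b. c * \<Phi> a b) \<le> cmod c * form_norm \<Phi>" by (rule le[OF \<Phi>])
  show "cmod c * form_norm \<Phi> \<le> form_norm (\<lambda>a b. c * \<Phi> a b)"
  proof (cases "c = 0")
    case True
    then show ?thesis using form_norm_nonneg[OF form_scale[OF \<Phi>, of 0]] by simp
  next
    case False
    then have "form_norm \<Phi> = form_norm (\<lambda>a b. inverse c * (c * \<Phi> a b))" by (simp add: mult.assoc[symmetric])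
    also have "\<dots> \<le> cmod (inverse c) * form_norm (\<lambda>a b. c * \<Phi> a b)" by (rule le[OF form_scale[OF \<Phi>]])
    finally show ?thesis using False by (simp add: norm_inverse divide_inverse[symmetric] mult.commute[of "inverse _"] le_divide_eq) (simp add: mult.commute)
  qed
qed

lemma form_norm_eq_zero:
  assumes \<Phi>: "form \<Phi>" and z: "form_norm \<Phi> = 0"
  shows "\<Phi> = (\<lambda>a b. 0)"
proof (intro ext)
  fix a b
  show "\<Phi> a b = 0"
  proof (cases "a \<in> carrier A \<and> b \<in> carrier A")
    case True
    then show ?thesis using form_norm_bound[OF \<Phi>, of a b] z by simp
  next
    case False
    then show ?thesis using form_outside[OF \<Phi>] by blast
  qed
qed

text \<open>A Cauchy sequence of forms converges pointwise, with an error proportional to the norms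
  of the arguments. Bilinearity, the condition \<Phi>(a, 1) = 0 and vanishing at infinity pass to
  the limit.\<close>

lemma forms_complete:
  fixes s :: "nat \<Rightarrow> _"
  assumes s: "\<And>n. s n \<in> form_space"
    and cauchy: "\<And>e. e > 0 \<Longrightarrow> \<exists>N. \<forall>m\<ge>N. \<forall>n\<ge>N. form_norm (\<lambda>a b. s m a b - s n a b) < e"
  shows "\<exists>\<Phi>\<in>form_space. (\<lambda>n. form_norm (\<lambda>a b. s n a b - \<Phi> a b)) \<longlonglongrightarrow> 0"
proof -
  note f = form_spaceD(1)[OF s]
  have fd: "form (\<lambda>a b. s m a b - s n a b)" for m n by (rule form_spaceD(1)[OF form_space_diff[OF s s]])
  have bd: "cmod (s m a b - s n a b) \<le> form_norm (\<lambda>a b. s m a b - s n a b) * vnorm A a * vnorm A b"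
    if "a \<in> carrier A" "b \<in> carrier A" for a b m n by (rule form_norm_bound[OF fd that])
  have conv: "convergent (\<lambda>n. s n a b)" for a b
  proof (cases "a \<in> carrier A \<and> b \<in> carrier A")
    case True
    then have ab: "a \<in> carrier A" "b \<in> carrier A" by auto
    have "Cauchy (\<lambda>n. s n a b)"
    proof (rule CauchyI)
      fix e :: real assume e: "e > 0"
      let ?k = "vnorm A a * vnorm A b + 1"
      have k: "?k > 0" using norm_nonneg[OF ab(1)] norm_nonneg[OF ab(2)] by (simp add: add_nonneg_pos)
      then obtain N where N: "\<And>m n. m \<ge> N \<Longrightarrow> n \<ge> N \<Longrightarrow> form_norm (\<lambda>a b. s m a b - s n a b) < e / ?k"
        using cauchy[of "e / ?k"] e by auto
      have "cmod (s m a b - s n a b) < e" if mn: "m \<ge> N" "n \<ge> N" for m n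
      proof -
        let ?f = "form_norm (\<lambda>a b. s m a b - s n a b)"
        have "cmod (s m a b - s n a b) \<le> ?f * (vnorm A a * vnorm A b)" using bd[OF ab] by (simp add: mult.assoc)
        also have "\<dots> \<le> ?f * ?k" using form_norm_nonneg[OF fd] by (intro mult_left_mono) auto
        also have "\<dots> < e / ?k * ?k" using N[OF mn] k by (intro mult_strict_right_mono)
        finally show ?thesis using k by simp
      qed
      then show "\<exists>M. \<forall>m\<ge>M. \<forall>n\<ge>M. norm (s m a b - s n a b) < e" by blast
    qed
    then show ?thesis by (simp add: Cauchy_convergent_iff)
  next
    case False
    then have "s n a b = 0" for n using form_outside[OF f] by blast
    then show ?thesis by (simp add: convergent_const)
  qed
  define \<Phi> where "\<Phi> a b = lim (\<lambda>n. s n a b)" for a b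
  have lim: "(\<lambda>n. s n a b) \<longlonglongrightarrow> \<Phi> a b" for a b
    using conv[of a b] by (simp add: \<Phi>_def convergent_LIMSEQ_iff)
  have close: "cmod (s n a b - \<Phi> a b) \<le> e * vnorm A a * vnorm A b"
    if N: "\<And>m n. m \<ge> N \<Longrightarrow> n \<ge> N \<Longrightarrow> form_norm (\<lambda>a b. s m a b - s n a b) < e"
      and n: "n \<ge> N" and ab: "a \<in> carrier A" "b \<in> carrier A" for N e n a b
  proof (rule LIMSEQ_le_const2)
    show "(\<lambda>m. cmod (s n a b - s m a b)) \<longlonglongrightarrow> cmod (s n a b - \<Phi> a b)" by (intro tendsto_intros lim)
    have "cmod (s n a b - s m a b) \<le> e * vnorm A a * vnorm A b" if m: "m \<ge> N" for m
      using bd[OF ab, of n m] N[OF n m]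
      by (meson less_imp_le mult_right_mono norm_nonneg ab order_trans)
    then show "\<exists>N. \<forall>m\<ge>N. cmod (s n a b - s m a b) \<le> e * vnorm A a * vnorm A b" by blast
  qed
  have small: "\<exists>N. \<forall>n\<ge>N. \<forall>a\<in>carrier A. \<forall>b\<in>carrier A. cmod (s n a b - \<Phi> a b) \<le> e * vnorm A a * vnorm A b" if "e > 0" for e
    using cauchy[OF that] close by meson
  obtain N1 where N1: "\<And>a b. a \<in> carrier A \<Longrightarrow> b \<in> carrier A \<Longrightarrow> cmod (s N1 a b - \<Phi> a b) \<le> 1 * vnorm A a * vnorm A b"
    using small[of 1] by auto
  have "form \<Phi>"
  proof (rule formI[where M = "form_norm (s N1) + 1"])
    fix a b assume "a \<notin> carrier A \<or> b \<notin> carrier A"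
    then have "s n a b = 0" for n using form_outside[OF f] by blast
    then show "\<Phi> a b = 0" by (simp add: \<Phi>_def)
  next
    fix a a' b assume "a \<in> carrier A" "a' \<in> carrier A" "b \<in> carrier A"
    then have "s n (\<lambda>x. a x + a' x) b = s n a b + s n a' b" "s n b (\<lambda>x. a x + a' x) = s n b a + s n b a'" for n
      by (simp_all add: form_add[OF f])
    then show "\<Phi> (\<lambda>x. a x + a' x) b = \<Phi> a b + \<Phi> a' b" "\<Phi> b (\<lambda>x. a x + a' x) = \<Phi> b a + \<Phi> b a'"
      using lim[of "\<lambda>x. a x + a' x" b] lim[of b "\<lambda>x. a x + a' x"]
        tendsto_add[OF lim[of a b] lim[of a' b]] tendsto_add[OF lim[of b a] lim[of b a']]
      by (simp_all add: LIMSEQ_unique)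
  next
    fix c a b assume "a \<in> carrier A" "b \<in> carrier A"
    then have "s n (\<lambda>x. c * a x) b = c * s n a b" "s n a (\<lambda>x. c * b x) = c * s n a b" for n
      by (simp_all add: form_smult[OF f])
    then show "\<Phi> (\<lambda>x. c * a x) b = c * \<Phi> a b" "\<Phi> a (\<lambda>x. c * b x) = c * \<Phi> a b"
      using lim[of "\<lambda>x. c * a x" b] lim[of a "\<lambda>x. c * b x"] tendsto_mult_left[OF lim[of a b], of c]
      by (simp_all add: LIMSEQ_unique)
  next
    fix a b assume ab: "a \<in> carrier A" "b \<in> carrier A"
    have "cmod (\<Phi> a b) \<le> cmod (s N1 a b) + cmod (s N1 a b - \<Phi> a b)"
      using norm_triangle_ineq4[of "s N1 a b" "s N1 a b - \<Phi> a b"] by simp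
    also have "\<dots> \<le> form_norm (s N1) * vnorm A a * vnorm A b + 1 * vnorm A a * vnorm A b"
      by (intro add_mono form_norm_bound[OF f] N1 ab)
    finally show "cmod (\<Phi> a b) \<le> (form_norm (s N1) + 1) * vnorm A a * vnorm A b" by (simp add: distrib_right)
  qed
  moreover have "\<Phi> a (\<lambda>x. 1) = 0" if "a \<in> carrier A" for a
    using form_spaceD(2)[OF s that] by (simp add: \<Phi>_def)
  moreover have "((\<lambda>z. \<Phi> (\<psi> (fst z)) (\<psi> (snd z))) \<longlongrightarrow> 0) (cofinite_on (K \<times> K))"
  proof (rule tendsto_zero_approx)
    fix e :: real assume "e > 0"
    then obtain N where N: "\<And>a b. a \<in> carrier A \<Longrightarrow> b \<in> carrier A \<Longrightarrow> cmod (s N a b - \<Phi> a b) \<le> e * vnorm A a * vnorm A b"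
      using small by blast
    have "cmod (\<Phi> (\<psi> (fst z)) (\<psi> (snd z)) - s N (\<psi> (fst z)) (\<psi> (snd z))) \<le> e" if "z \<in> K \<times> K" for z
    proof -
      have z: "fst z \<in> K" "snd z \<in> K" using that by auto
      show ?thesis using N[OF \<psi>_in[OF z(1)] \<psi>_in[OF z(2)]] by (simp add: norm_\<psi> z norm_minus_commute)
    qed
    then show "\<exists>g. (g \<longlongrightarrow> 0) (cofinite_on (K \<times> K)) \<and> (\<forall>z\<in>K \<times> K. cmod (\<Phi> (\<psi> (fst z)) (\<psi> (snd z)) - g z) \<le> e)"
      using form_spaceD(3)[OF s] by blast
  qed
  ultimately have \<Phi>: "\<Phi> \<in> form_space" by (simp add: form_space_def)
  moreover have "(\<lambda>n. form_norm (\<lambda>a b. s n a b - \<Phi> a b)) \<longlonglongrightarrow> 0"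
  proof (rule LIMSEQ_I)
    fix e :: real assume e: "e > 0"
    then obtain N where N: "\<And>n a b. n \<ge> N \<Longrightarrow> a \<in> carrier A \<Longrightarrow> b \<in> carrier A \<Longrightarrow> cmod (s n a b - \<Phi> a b) \<le> e / 2 * vnorm A a * vnorm A b"
      using small[of "e / 2"] by (meson half_gt_zero)
    have "norm (form_norm (\<lambda>a b. s n a b - \<Phi> a b) - 0) < e" if n: "n \<ge> N" for n
    proof -
      have "form_norm (\<lambda>a b. s n a b - \<Phi> a b) \<le> e / 2"
      proof (rule form_norm_least)
        fix p q assume "p \<in> K" "q \<in> K"
        then show "cmod (s n (\<psi> p) (\<psi> q) - \<Phi> (\<psi> p) (\<psi> q)) \<le> e / 2"
          using N[OF n \<psi>_in \<psi>_in, of p q] by (simp add: norm_\<psi>)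
      qed
      moreover have "0 \<le> form_norm (\<lambda>a b. s n a b - \<Phi> a b)"
        by (rule form_norm_nonneg[OF form_spaceD(1)[OF form_space_diff[OF s \<Phi>]]])
      ultimately show ?thesis using e by simp
    qed
    then show "\<exists>N. \<forall>n\<ge>N. norm (form_norm (\<lambda>a b. s n a b - \<Phi> a b) - 0) < e" by blast
  qed
  ultimately show ?thesis by blast
qed

lemma forms_banach_space: "banach_space forms"
  unfolding banach_space_def
proof (intro conjI ballI allI impI)
  show "Module.module (class_ring :: complex ring) forms" by (rule forms_module)
next
  fix \<Phi> assume "\<Phi> \<in> carrier forms"
  then have \<Phi>: "form \<Phi>" using form_spaceD by simp
  show "0 \<le> vnorm forms \<Phi>" using form_norm_nonneg[OF \<Phi>] by simp
  have "form_norm (\<lambda>a b. 0) \<le> 0" by (rule form_norm_least) simp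
  then have "form_norm (\<lambda>a b. 0) = 0"
    using form_norm_nonneg[OF form_spaceD(1)[OF form_space_zero]] by simp
  then show "vnorm forms \<Phi> = 0 \<longleftrightarrow> \<Phi> = \<zero>\<^bsub>forms\<^esub>" using form_norm_eq_zero[OF \<Phi>] by auto
  show "vnorm forms (c \<odot>\<^bsub>forms\<^esub> \<Phi>) = cmod c * vnorm forms \<Phi>" for c using form_norm_smult[OF \<Phi>] by simp
next
  fix \<Phi> \<Psi> assume "\<Phi> \<in> carrier forms" "\<Psi> \<in> carrier forms"
  then show "vnorm forms (\<Phi> \<oplus>\<^bsub>forms\<^esub> \<Psi>) \<le> vnorm forms \<Phi> + vnorm forms \<Psi>"
    using form_norm_add form_spaceD by simp
next
  fix s :: "nat \<Rightarrow> _"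
  assume "range s \<subseteq> carrier forms \<and> (\<forall>e>0. \<exists>N. \<forall>m\<ge>N. \<forall>n\<ge>N. vnorm forms (s m \<ominus>\<^bsub>forms\<^esub> s n) < e)"
  then have s: "\<And>n. s n \<in> form_space" and c: "\<forall>e>0. \<exists>N. \<forall>m\<ge>N. \<forall>n\<ge>N. vnorm forms (s m \<ominus>\<^bsub>forms\<^esub> s n) < e"
    by auto
  have "\<exists>\<Phi>\<in>form_space. (\<lambda>n. form_norm (\<lambda>a b. s n a b - \<Phi> a b)) \<longlonglongrightarrow> 0"
    by (rule forms_complete[OF s]) (use c in \<open>simp add: forms_minus[OF s s]\<close>)
  then show "\<exists>\<Phi>\<in>carrier forms. (\<lambda>n. vnorm forms (s n \<ominus>\<^bsub>forms\<^esub> \<Phi>)) \<longlonglongrightarrow> 0"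
    by (auto simp: forms_minus[OF s])
qed

text \<open>In the product law for \<open>left_act\<close>, the two mixed terms \<Phi>(bca, a') from
  the outer and the inner action cancel. That the left and right actions commute uses the
  commutativity of pointwise multiplication.\<close>

lemma forms_bimodule: "banach_bimodule A forms left_act right_act"
proof -
  have outL: "left_act a \<Phi> b c = 0" and outR: "right_act \<Phi> a b c = 0"
    if "b \<notin> carrier A \<or> c \<notin> carrier A" for a \<Phi> b c
    using that by (auto simp: left_act_def right_act_def)
  have ext': "\<Phi> = \<Psi>" if "\<And>b c. b \<in> carrier A \<Longrightarrow> c \<in> carrier A \<Longrightarrow> \<Phi> b c = \<Psi> b c"
    "\<And>b c. b \<notin> carrier A \<or> c \<notin> carrier A \<Longrightarrow> \<Phi> b c = \<Psi> b c" for \<Phi> \<Psi> :: "('a \<Rightarrow> complex) \<Rightarrow> ('a \<Rightarrow> complex) \<Rightarrow> complex"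
    using that by (intro ext) metis
  show ?thesis
    unfolding banach_bimodule_def
  proof (intro conjI ballI allI)
    show "banach_space forms" by (rule forms_banach_space)
  next
    fix a \<Phi> assume "a \<in> carrier A" "\<Phi> \<in> carrier forms"
    then show "left_act a \<Phi> \<in> carrier forms" "right_act \<Phi> a \<in> carrier forms" using act_in_form_space by simp_all
  next
    fix a \<Phi> \<Psi>
    show "left_act a (\<Phi> \<oplus>\<^bsub>forms\<^esub> \<Psi>) = left_act a \<Phi> \<oplus>\<^bsub>forms\<^esub> left_act a \<Psi>"
      "right_act (\<Phi> \<oplus>\<^bsub>forms\<^esub> \<Psi>) a = right_act \<Phi> a \<oplus>\<^bsub>forms\<^esub> right_act \<Psi> a"
      by (auto simp: left_act_def right_act_def fun_eq_iff)
  next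
    fix a a' \<Phi> assume a: "a \<in> carrier A" "a' \<in> carrier A" and "\<Phi> \<in> carrier forms"
    then have \<Phi>: "form \<Phi>" using form_spaceD by simp
    show "left_act (a \<oplus>\<^bsub>A\<^esub> a') \<Phi> = left_act a \<Phi> \<oplus>\<^bsub>forms\<^esub> left_act a' \<Phi>"
    proof (rule ext')
      fix b c assume bc: "b \<in> carrier A" "c \<in> carrier A"
      show "left_act (a \<oplus>\<^bsub>A\<^esub> a') \<Phi> b c = (left_act a \<Phi> \<oplus>\<^bsub>forms\<^esub> left_act a' \<Phi>) b c"
        using bc form_add(2)[OF \<Phi> A_mult[OF bc(2) a(1)] A_mult[OF bc(2) a(2)] bc(1)]
          form_add(2)[OF \<Phi> a A_mult[OF bc]]
        by (simp add: left_act_def A_ops distrib_left)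
    qed (simp add: outL)
    show "right_act \<Phi> (a \<oplus>\<^bsub>A\<^esub> a') = right_act \<Phi> a \<oplus>\<^bsub>forms\<^esub> right_act \<Phi> a'"
    proof (rule ext')
      fix b c assume bc: "b \<in> carrier A" "c \<in> carrier A"
      show "right_act \<Phi> (a \<oplus>\<^bsub>A\<^esub> a') b c = (right_act \<Phi> a \<oplus>\<^bsub>forms\<^esub> right_act \<Phi> a') b c"
        using bc form_add(1)[OF \<Phi> A_mult[OF bc(1) a(1)] A_mult[OF bc(1) a(2)] bc(2)]
        by (simp add: right_act_def A_ops distrib_left)
    qed (simp add: outR)
  next
    fix k a \<Phi> assume a: "a \<in> carrier A" and "\<Phi> \<in> carrier forms"
    then have \<Phi>: "form \<Phi>" using form_spaceD by simp
    show "left_act (k \<odot>\<^bsub>A\<^esub> a) \<Phi> = k \<odot>\<^bsub>forms\<^esub> left_act a \<Phi>"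
    proof (rule ext')
      fix b c assume bc: "b \<in> carrier A" "c \<in> carrier A"
      show "left_act (k \<odot>\<^bsub>A\<^esub> a) \<Phi> b c = (k \<odot>\<^bsub>forms\<^esub> left_act a \<Phi>) b c"
        using bc form_smult(2)[OF \<Phi> bc(1) A_mult[OF bc(2) a], of k] form_smult(2)[OF \<Phi> A_mult[OF bc] a, of k]
        by (simp add: left_act_def A_ops mult.left_commute[of _ k] right_diff_distrib)
    qed (simp add: outL)
    show "right_act \<Phi> (k \<odot>\<^bsub>A\<^esub> a) = k \<odot>\<^bsub>forms\<^esub> right_act \<Phi> a"
    proof (rule ext')
      fix b c assume bc: "b \<in> carrier A" "c \<in> carrier A"
      show "right_act \<Phi> (k \<odot>\<^bsub>A\<^esub> a) b c = (k \<odot>\<^bsub>forms\<^esub> right_act \<Phi> a) b c"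
        using bc form_smult(1)[OF \<Phi> A_mult[OF bc(1) a] bc(2), of k]
        by (simp add: right_act_def A_ops mult.left_commute[of _ k])
    qed (simp add: outR)
    show "left_act a (k \<odot>\<^bsub>forms\<^esub> \<Phi>) = k \<odot>\<^bsub>forms\<^esub> left_act a \<Phi>"
      "right_act (k \<odot>\<^bsub>forms\<^esub> \<Phi>) a = k \<odot>\<^bsub>forms\<^esub> right_act \<Phi> a"
      by (auto simp: left_act_def right_act_def fun_eq_iff right_diff_distrib)
  next
    fix a a' \<Phi> assume a: "a \<in> carrier A" "a' \<in> carrier A"
    show "left_act (a \<otimes>\<^bsub>A\<^esub> a') \<Phi> = left_act a (left_act a' \<Phi>)"
    proof (rule ext')
      fix b c assume bc: "b \<in> carrier A" "c \<in> carrier A"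
      show "(left_act (a \<otimes>\<^bsub>A\<^esub> a') \<Phi>) b c = (left_act a (left_act a' \<Phi>)) b c"
        by (simp add: left_act_def right_act_def A_ops A_mult a bc mult_ac)
    qed (simp add: outL outR)
    show "right_act \<Phi> (a \<otimes>\<^bsub>A\<^esub> a') = right_act (right_act \<Phi> a) a'"
    proof (rule ext')
      fix b c assume bc: "b \<in> carrier A" "c \<in> carrier A"
      show "(right_act \<Phi> (a \<otimes>\<^bsub>A\<^esub> a')) b c = (right_act (right_act \<Phi> a) a') b c"
        by (simp add: left_act_def right_act_def A_ops A_mult a bc mult_ac)
    qed (simp add: outL outR)
    show "left_act a (right_act \<Phi> a') = right_act (left_act a \<Phi>) a'"
    proof (rule ext')
      fix b c assume bc: "b \<in> carrier A" "c \<in> carrier A"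
      show "(left_act a (right_act \<Phi> a')) b c = (right_act (left_act a \<Phi>) a') b c"
        by (simp add: left_act_def right_act_def A_ops A_mult a bc mult_ac)
    qed (simp add: outL outR)
  next
    show "\<exists>M. \<forall>a\<in>carrier A. \<forall>\<Phi>\<in>carrier forms.
       vnorm forms (left_act a \<Phi>) \<le> M * vnorm A a * vnorm forms \<Phi> \<and>
       vnorm forms (right_act \<Phi> a) \<le> M * vnorm A a * vnorm forms \<Phi>"
    proof (intro exI[of _ 2] ballI conjI)
      fix a \<Phi> assume a: "a \<in> carrier A" and "\<Phi> \<in> carrier forms"
      then have \<Phi>: "form \<Phi>" using form_spaceD by simp
      have "form_norm (left_act a \<Phi>) \<le> 2 * vnorm A a * form_norm \<Phi>"
        by (rule form_norm_least) (use left_act_form(2)[OF a \<Phi> \<psi>_in \<psi>_in] in \<open>simp add: norm_\<psi> mult_ac\<close>)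
      then show "vnorm forms (left_act a \<Phi>) \<le> 2 * vnorm A a * vnorm forms \<Phi>" by simp
      have "form_norm (right_act \<Phi> a) \<le> 1 * vnorm A a * form_norm \<Phi>"
        by (rule form_norm_least) (use right_act_form(2)[OF a \<Phi> \<psi>_in \<psi>_in] in \<open>simp add: norm_\<psi> mult_ac\<close>)
      also have "\<dots> \<le> 2 * vnorm A a * form_norm \<Phi>"
        by (intro mult_right_mono norm_nonneg a form_norm_nonneg \<Phi>) simp
      finally show "vnorm forms (right_act \<Phi> a) \<le> 2 * vnorm A a * vnorm forms \<Phi>" by simp
    qed
  qed
qed

end

section \<open>The dual bimodule and its derivation\<close>

context character_algebra
begin

lemma dual_forms_iff:
  "y \<in> carrier (dual_space forms) \<longleftrightarrow>
     (\<forall>\<Phi>\<in>form_space. \<forall>\<Psi>\<in>form_space. y (\<lambda>a b. \<Phi> a b + \<Psi> a b) = y \<Phi> + y \<Psi>) \<and>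
     (\<forall>c. \<forall>\<Phi>\<in>form_space. y (\<lambda>a b. c * \<Phi> a b) = c * y \<Phi>) \<and>
     (\<exists>M. \<forall>\<Phi>\<in>form_space. cmod (y \<Phi>) \<le> M * form_norm \<Phi>) \<and>
     (\<forall>\<Phi>. \<Phi> \<notin> form_space \<longrightarrow> y \<Phi> = 0)"
  by (simp add: dual_space_def)

text \<open>Subtraction in a module record goes through a chosen additive inverse; it has to be
  identified with the pointwise one before inner derivations can be evaluated.\<close>

lemma dual_forms_minus:
  assumes z: "z \<in> carrier (dual_space forms)"
  shows "y \<ominus>\<^bsub>dual_space forms\<^esub> z = (\<lambda>\<Phi>. y \<Phi> - z \<Phi>)"
proof -
  have add: "u \<oplus>\<^bsub>dual_space forms\<^esub> v = (\<lambda>\<Phi>. u \<Phi> + v \<Phi>)" for u v by (simp add: dual_space_def)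
  have zero: "\<zero>\<^bsub>dual_space forms\<^esub> = (\<lambda>\<Phi>. 0)" by (simp add: dual_space_def)
  have neg: "(\<lambda>\<Phi>. - z \<Phi>) \<in> carrier (dual_space forms)" using z unfolding dual_forms_iff by simp
  have "\<ominus>\<^bsub>dual_space forms\<^esub> z = (\<lambda>\<Phi>. - z \<Phi>)"
    unfolding a_inv_def m_inv_def
  proof (rule the_equality)
    show "(\<lambda>\<Phi>. - z \<Phi>) \<in> carrier (add_monoid (dual_space forms)) \<and>
      z \<otimes>\<^bsub>add_monoid (dual_space forms)\<^esub> (\<lambda>\<Phi>. - z \<Phi>) = \<one>\<^bsub>add_monoid (dual_space forms)\<^esub> \<and>
      (\<lambda>\<Phi>. - z \<Phi>) \<otimes>\<^bsub>add_monoid (dual_space forms)\<^esub> z = \<one>\<^bsub>add_monoid (dual_space forms)\<^esub>"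
      using neg by (simp add: add zero)
  next
    fix u assume "u \<in> carrier (add_monoid (dual_space forms)) \<and>
      z \<otimes>\<^bsub>add_monoid (dual_space forms)\<^esub> u = \<one>\<^bsub>add_monoid (dual_space forms)\<^esub> \<and>
      u \<otimes>\<^bsub>add_monoid (dual_space forms)\<^esub> z = \<one>\<^bsub>add_monoid (dual_space forms)\<^esub>"
    then have "(\<lambda>\<Phi>. u \<Phi> + z \<Phi>) = (\<lambda>\<Phi>. 0)" by (simp add: add zero)
    then show "u = (\<lambda>\<Phi>. - z \<Phi>)" by (simp add: fun_eq_iff eq_neg_iff_add_eq_0)
  qed
  then show ?thesis by (simp add: a_minus_def add)
qed

lemma left_act_linear:
  "left_act a (\<lambda>b c. \<Phi> b c + \<Psi> b c) = (\<lambda>b c. left_act a \<Phi> b c + left_act a \<Psi> b c)"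
  "left_act a (\<lambda>b c. k * \<Phi> b c) = (\<lambda>b c. k * left_act a \<Phi> b c)"
  by (auto simp: left_act_def fun_eq_iff right_diff_distrib)

lemma dual_right_in:
  assumes y: "y \<in> carrier (dual_space forms)" and a: "a \<in> carrier A"
  shows "dual_right forms left_act y a \<in> carrier (dual_space forms)"
proof -
  obtain M where M: "\<And>\<Phi>. \<Phi> \<in> form_space \<Longrightarrow> cmod (y \<Phi>) \<le> M * form_norm \<Phi>"
    using y unfolding dual_forms_iff by blast
  have "cmod (y (left_act a \<Phi>)) \<le> \<bar>M\<bar> * (2 * vnorm A a) * form_norm \<Phi>" if \<Phi>: "\<Phi> \<in> form_space" for \<Phi>
  proof -
    note f = form_spaceD(1)[OF \<Phi>] and L = act_in_form_space(1)[OF a \<Phi>]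
    have "form_norm (left_act a \<Phi>) \<le> 2 * vnorm A a * form_norm \<Phi>"
      by (rule form_norm_least) (use left_act_form(2)[OF a f \<psi>_in \<psi>_in] in \<open>simp add: norm_\<psi> mult_ac\<close>)
    then have "\<bar>M\<bar> * form_norm (left_act a \<Phi>) \<le> \<bar>M\<bar> * (2 * vnorm A a * form_norm \<Phi>)" by (rule mult_left_mono) simp
    moreover have "M * form_norm (left_act a \<Phi>) \<le> \<bar>M\<bar> * form_norm (left_act a \<Phi>)"
      using form_norm_nonneg[OF form_spaceD(1)[OF L]] by (intro mult_right_mono) auto
    ultimately show ?thesis using M[OF L] by (simp add: mult.assoc)
  qed
  then show ?thesis
    using y a unfolding dual_forms_iff
    by (auto simp: dual_right_def left_act_linear act_in_form_space(1) form_space_add form_space_smult)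
qed

text \<open>The pairing of \<Phi> with the kernel element 1 \<otimes> a - a \<otimes> 1, which is b
  \<otimes> c - bc \<otimes> 1 for b = 1 and c = a.\<close>

definition eval_derivation :: "('a \<Rightarrow> complex) \<Rightarrow> (('a \<Rightarrow> complex) \<Rightarrow> ('a \<Rightarrow> complex) \<Rightarrow> complex) \<Rightarrow> complex" where
  "eval_derivation a = (\<lambda>\<Phi>. if \<Phi> \<in> form_space then \<Phi> (\<lambda>x. 1) a else 0)"

lemma eval_derivation_le:
  assumes a: "a \<in> carrier A" and \<Phi>: "\<Phi> \<in> form_space"
  shows "cmod (eval_derivation a \<Phi>) \<le> vnorm A a * form_norm \<Phi>"
  using form_norm_bound[OF form_spaceD(1)[OF \<Phi>] one_in a] \<Phi>
  by (simp add: eval_derivation_def norm_one mult.commute)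

lemma eval_derivation_bounded:
  "bounded_derivation A (dual_space forms) (dual_left forms right_act) (dual_right forms left_act) eval_derivation"
  unfolding bounded_derivation_def
proof (intro conjI ballI allI exI[of _ 1])
  fix a assume a: "a \<in> carrier A"
  show "eval_derivation a \<in> carrier (dual_space forms)"
    unfolding dual_forms_iff
  proof (intro conjI exI[of _ "vnorm A a"] ballI)
    show "cmod (eval_derivation a \<Phi>) \<le> vnorm A a * form_norm \<Phi>" if "\<Phi> \<in> form_space" for \<Phi>
      by (rule eval_derivation_le[OF a that])
  qed (auto simp: eval_derivation_def form_space_add form_space_smult)
  have "vnorm (dual_space forms) (eval_derivation a) =
      Sup {cmod (eval_derivation a \<Phi>) | \<Phi>. \<Phi> \<in> form_space \<and> form_norm \<Phi> \<le> 1}"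
    by (simp add: dual_space_def)
  also have "\<dots> \<le> 1 * vnorm A a"
  proof (rule cSup_least)
    have "form_norm (\<lambda>a b. 0) \<le> 1" by (rule form_norm_least) simp
    then show "{cmod (eval_derivation a \<Phi>) | \<Phi>. \<Phi> \<in> form_space \<and> form_norm \<Phi> \<le> 1} \<noteq> {}"
      using form_space_zero by blast
  next
    fix r assume "r \<in> {cmod (eval_derivation a \<Phi>) | \<Phi>. \<Phi> \<in> form_space \<and> form_norm \<Phi> \<le> 1}"
    then obtain \<Phi> where \<Phi>: "r = cmod (eval_derivation a \<Phi>)" "\<Phi> \<in> form_space" "form_norm \<Phi> \<le> 1" by blast
    then show "r \<le> 1 * vnorm A a"
      using eval_derivation_le[OF a \<Phi>(2)] mult_left_mono[OF \<Phi>(3) norm_nonneg[OF a]] by simp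
  qed
  finally show "vnorm (dual_space forms) (eval_derivation a) \<le> 1 * vnorm A a" .
  show "eval_derivation (c \<odot>\<^bsub>A\<^esub> a) = c \<odot>\<^bsub>dual_space forms\<^esub> eval_derivation a" for c
    using form_smult(2)[OF form_spaceD(1) one_in a]
    by (simp add: dual_space_def A_ops fun_eq_iff eval_derivation_def)
next
  fix a b assume a: "a \<in> carrier A" and b: "b \<in> carrier A"
  show "eval_derivation (a \<oplus>\<^bsub>A\<^esub> b) = eval_derivation a \<oplus>\<^bsub>dual_space forms\<^esub> eval_derivation b"
    using form_add(2)[OF form_spaceD(1) a b one_in]
    by (simp add: dual_space_def A_ops fun_eq_iff eval_derivation_def)
  \<comment> \<open>The first summand is \<Phi>(a, b), and the correction term in
    \<open>left_act\<close> removes it again, leaving \<Phi>(1, ab).\<close>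
  have "eval_derivation (a \<otimes>\<^bsub>A\<^esub> b) \<Phi> = eval_derivation b (right_act \<Phi> a) + eval_derivation a (left_act b \<Phi>)"
    if \<Phi>: "\<Phi> \<in> form_space" for \<Phi>
    using act_in_form_space[OF a \<Phi>] act_in_form_space[OF b \<Phi>] \<Phi> a b one_in
    by (simp add: eval_derivation_def left_act_def right_act_def A_ops)
  then show "eval_derivation (a \<otimes>\<^bsub>A\<^esub> b) = dual_left forms right_act a (eval_derivation b)
      \<oplus>\<^bsub>dual_space forms\<^esub> dual_right forms left_act (eval_derivation a) b"
    by (auto simp: dual_space_def dual_left_def dual_right_def fun_eq_iff) (simp add: eval_derivation_def)
qed

lemma partial_tendsto:
  assumes f: "f \<in> carrier A"
  shows "((\<lambda>P. partial P f x) \<longlongrightarrow> f x) (finite_subsets_at_top K)"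
proof -
  have "\<forall>\<^sub>F P in finite_subsets_at_top K. norm (partial P f x - f x) \<le> vnorm A (\<lambda>x. f x - partial P f x)"
    unfolding eventually_finite_subsets_at_top
  proof (intro exI[of _ "{}"] conjI allI impI)
    fix P assume "finite P \<and> {} \<subseteq> P \<and> P \<subseteq> K"
    then show "norm (partial P f x - f x) \<le> vnorm A (\<lambda>x. f x - partial P f x)"
      using eval_le[OF A_diff[OF f partial_in], of P x] by (simp add: norm_minus_commute)
  qed auto
  from Lim_null_comparison[OF this dense[OF f, folded partial_def]] show ?thesis by (simp add: LIM_zero_iff)
qed

lemma partial_le:
  assumes P: "finite P" "P \<subseteq> K" and f: "f \<in> carrier A"
  shows "cmod (partial P f x) \<le> vnorm A f"
proof -
  have "cmod (partial P f x) \<le> (\<Sum>p\<in>P. cmod (w p f * \<psi> p x))" unfolding partial_def by (rule norm_sum)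
  also have "\<dots> \<le> (\<Sum>p\<in>P. cmod (w p f))"
  proof (rule sum_mono)
    fix p assume "p \<in> P"
    then have "cmod (\<psi> p x) \<le> 1" using eval_le[OF \<psi>_in, of p x] norm_\<psi>[of p] P(2) by auto
    then show "cmod (w p f * \<psi> p x) \<le> cmod (w p f)" by (simp add: norm_mult mult_left_le)
  qed
  also have "\<dots> \<le> vnorm A f" by (rule w_sum_le[OF P f])
  finally show ?thesis .
qed

text \<open>A truncation of \<open>b(g) (c(h) - c(g))\<close>, which does not itself vanish at infinity.\<close>

definition eval_form :: "'a \<Rightarrow> 'i set \<Rightarrow> ('a \<Rightarrow> complex) \<Rightarrow> ('a \<Rightarrow> complex) \<Rightarrow> complex" where
  "eval_form h P b c = (if b \<in> carrier A \<and> c \<in> carrier A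
     then partial P b g * (partial P c h - partial P c g) else 0)"

text \<open>In matrix units the coefficient at (s, t) is \<psi> t h - 1, which is 0 for t =
  \<epsilon>. Subtracting the value at g is what gives the condition \<Phi>(a, 1) = 0.\<close>

lemma eval_form_in:
  assumes P: "finite P" "P \<subseteq> K"
  shows "eval_form h P \<in> form_space"
proof -
  have "eval_form h P = (\<lambda>b c. \<Sum>z\<in>P \<times> (P - {\<epsilon>}). (\<psi> (snd z) h - 1) * coord (fst z) (snd z) b c)"
  proof (intro ext)
    fix b c
    show "eval_form h P b c = (\<Sum>z\<in>P \<times> (P - {\<epsilon>}). (\<psi> (snd z) h - 1) * coord (fst z) (snd z) b c)"
    proof (cases "b \<in> carrier A \<and> c \<in> carrier A")
      case True
      have "partial P b g = (\<Sum>s\<in>P. w s b)"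
        unfolding partial_def using P(2) by (intro sum.cong refl) (auto simp: \<psi>_g)
      moreover have "partial P c h - partial P c g = (\<Sum>t\<in>P. (\<psi> t h - 1) * w t c)"
        unfolding partial_def sum_subtractf[symmetric] using P(2)
        by (intro sum.cong refl) (auto simp: \<psi>_g algebra_simps)
      moreover have "\<dots> = (\<Sum>t\<in>P - {\<epsilon>}. (\<psi> t h - 1) * w t c)"
        using P(1) by (intro sum.mono_neutral_right) (auto simp: unit(2))
      ultimately have "eval_form h P b c = (\<Sum>s\<in>P. \<Sum>t\<in>P - {\<epsilon>}. w s b * ((\<psi> t h - 1) * w t c))"
        using True by (simp add: eval_form_def sum_product)
      also have "\<dots> = (\<Sum>z\<in>P \<times> (P - {\<epsilon>}). w (fst z) b * ((\<psi> (snd z) h - 1) * w (snd z) c))"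
        by (simp add: sum.cartesian_product case_prod_beta)
      finally show ?thesis using True by (simp add: coord_def mult_ac)
    qed (auto simp: eval_form_def coord_def)
  qed
  moreover have "(\<lambda>b c. \<Sum>z\<in>P \<times> (P - {\<epsilon>}). (\<psi> (snd z) h - 1) * coord (fst z) (snd z) b c) \<in> form_space"
    using P(2) by (intro form_space_sum coord_in_form_space) auto
  ultimately show ?thesis by simp
qed

text \<open>The bound is uniform in P and h; it is the majorant for the limit over P.\<close>

lemma eval_form_norm_le:
  assumes P: "finite P" "P \<subseteq> K"
  shows "form_norm (eval_form h P) \<le> 2"
proof (rule form_norm_least)
  fix p q assume pq: "p \<in> K" "q \<in> K"
  have "cmod (partial P (\<psi> p) g * (partial P (\<psi> q) h - partial P (\<psi> q) g)) \<le> 1 * (1 + 1)"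
    unfolding norm_mult
    by (intro mult_mono order_trans[OF norm_triangle_ineq4] add_mono)
      (use partial_le[OF P \<psi>_in] norm_\<psi> pq in force)+
  then show "cmod (eval_form h P (\<psi> p) (\<psi> q)) \<le> 2" by (simp add: eval_form_def \<psi>_in pq)
qed

section \<open>Functionals on the forms as absolutely summable families\<close>

context
  fixes y M
  assumes y: "y \<in> carrier (dual_space forms)"
    and M: "0 \<le> M" "\<And>\<Phi>. \<Phi> \<in> form_space \<Longrightarrow> cmod (y \<Phi>) \<le> M * form_norm \<Phi>"
begin

private lemma y_add: "\<Phi> \<in> form_space \<Longrightarrow> \<Psi> \<in> form_space \<Longrightarrow> y (\<lambda>a b. \<Phi> a b + \<Psi> a b) = y \<Phi> + y \<Psi>"
  and y_smult: "\<Phi> \<in> form_space \<Longrightarrow> y (\<lambda>a b. c * \<Phi> a b) = c * y \<Phi>"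
  using y unfolding dual_forms_iff by blast+

private lemma y_diff:
  assumes "\<Phi> \<in> form_space" "\<Psi> \<in> form_space"
  shows "y (\<lambda>a b. \<Phi> a b - \<Psi> a b) = y \<Phi> - y \<Psi>"
  using y_add[OF assms(1) form_space_smult[OF assms(2), of "-1"]] y_smult[OF assms(2), of "-1"] by simp

private lemma y_coord_sum:
  assumes "finite F" "F \<subseteq> K \<times> (K - {\<epsilon>})"
  shows "y (\<lambda>a b. \<Sum>z\<in>F. c z * coord (fst z) (snd z) a b) = (\<Sum>z\<in>F. c z * y (coord (fst z) (snd z)))"
  using assms
proof (induction F)
  case empty
  then show ?case using y_smult[OF form_space_zero, of 0] by simp
next
  case (insert z F)
  have 1: "coord (fst z) (snd z) \<in> form_space" using insert.prems by (intro coord_in_form_space) auto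
  have 2: "(\<lambda>a b. \<Sum>z\<in>F. c z * coord (fst z) (snd z) a b) \<in> form_space"
    using insert.prems by (intro form_space_sum coord_in_form_space) auto
  show ?case
    using insert y_add[OF form_space_smult[OF 1, of "c z"] 2] y_smult[OF 1, of "c z"] by simp
qed

private lemma coord_sum_basis:
  assumes "finite F" "F \<subseteq> K \<times> K" "p \<in> K" "q \<in> K"
  shows "(\<Sum>z\<in>F. c z * coord (fst z) (snd z) (\<psi> p) (\<psi> q)) = (if (p, q) \<in> F then c (p, q) else 0)"
proof -
  have "(\<Sum>z\<in>F. c z * coord (fst z) (snd z) (\<psi> p) (\<psi> q)) = (\<Sum>z\<in>F. if z = (p, q) then c z else 0)"
  proof (intro sum.cong refl)
    fix z assume "z \<in> F"
    then have "fst z \<in> K" "snd z \<in> K" using assms(2) by auto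
    then show "c z * coord (fst z) (snd z) (\<psi> p) (\<psi> q) = (if z = (p, q) then c z else 0)"
      using assms(3,4) by (auto simp: coord_def \<psi>_in w_\<psi> prod_eq_iff)
  qed
  then show ?thesis using assms(1) by simp
qed

text \<open>Duality between forms vanishing at infinity and \<ell>1: y is tested on a combination of
  matrix units whose coefficients, of modulus at most 1, are the conjugate phases of its
  values.\<close>

private lemma y_coord_abs_sum:
  assumes F: "finite F" "F \<subseteq> K \<times> (K - {\<epsilon>})"
  shows "(\<Sum>z\<in>F. cmod (y (coord (fst z) (snd z)))) \<le> M"
proof -
  define c where "c z = cnj (sgn (y (coord (fst z) (snd z))))" for z
  let ?\<Phi> = "\<lambda>a b. \<Sum>z\<in>F. c z * coord (fst z) (snd z) a b"
  have in_space: "?\<Phi> \<in> form_space"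
    using F(2) by (intro form_space_sum coord_in_form_space) auto
  have "cmod (?\<Phi> (\<psi> p) (\<psi> q)) \<le> 1" if "p \<in> K" "q \<in> K" for p q
    using F that by (subst coord_sum_basis) (auto simp: c_def norm_sgn)
  then have N: "form_norm ?\<Phi> \<le> 1" by (rule form_norm_least)
  have sgn: "cnj (sgn u) * u = of_real (cmod u)" for u :: complex
  proof -
    have "cnj (sgn u) * u = (u * cnj u) / of_real (cmod u)" by (simp add: sgn_eq mult.commute)
    also have "\<dots> = of_real (cmod u)" by (simp add: complex_norm_square[symmetric] power2_eq_square)
    finally show ?thesis .
  qed
  have "y ?\<Phi> = of_real (\<Sum>z\<in>F. cmod (y (coord (fst z) (snd z))))"
    unfolding y_coord_sum[OF F] by (simp add: c_def sgn)
  then have "(\<Sum>z\<in>F. cmod (y (coord (fst z) (snd z)))) = cmod (y ?\<Phi>)"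
    by (simp only: norm_of_real) (simp add: sum_nonneg)
  also have "\<dots> \<le> M * form_norm ?\<Phi>" by (rule M(2)[OF in_space])
  also have "\<dots> \<le> M" using mult_left_mono[OF N M(1)] by simp
  finally show ?thesis .
qed

text \<open>A finite set whose sum comes within \<eta> of the supremum leaves at most \<eta> for any
  finite set disjoint from it.\<close>

private lemma y_coord_tail:
  assumes \<eta>: "\<eta> > 0"
  obtains F0 where "finite F0" "F0 \<subseteq> K \<times> (K - {\<epsilon>})"
    "\<forall>F. finite F \<and> F \<subseteq> K \<times> (K - {\<epsilon>}) - F0 \<longrightarrow> (\<Sum>z\<in>F. cmod (y (coord (fst z) (snd z)))) \<le> \<eta>"
proof -
  let ?c = "\<lambda>z. cmod (y (coord (fst z) (snd z)))"
  define T where "T = sum ?c ` {F. finite F \<and> F \<subseteq> K \<times> (K - {\<epsilon>})}"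
  have "bdd_above T" unfolding T_def by (rule bdd_aboveI2[where M = M]) (use y_coord_abs_sum in auto)
  moreover have "T \<noteq> {}" by (auto simp: T_def)
  ultimately obtain r where r: "Sup T - \<eta> < r" "r \<in> T"
    using \<eta> by (metis diff_less_eq less_add_same_cancel1 less_cSup_iff)
  then obtain F0 where F0: "finite F0" "F0 \<subseteq> K \<times> (K - {\<epsilon>})" "Sup T - \<eta> < sum ?c F0"
    unfolding T_def by blast
  have "sum ?c F \<le> \<eta>" if F: "finite F" "F \<subseteq> K \<times> (K - {\<epsilon>}) - F0" for F
  proof -
    have "sum ?c (F0 \<union> F) \<le> Sup T" using F F0 \<open>bdd_above T\<close> by (intro cSup_upper) (auto simp: T_def)
    moreover have "sum ?c (F0 \<union> F) = sum ?c F0 + sum ?c F" using F F0 by (intro sum.union_disjoint) auto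
    ultimately show ?thesis using F0(3) by simp
  qed
  with F0(1,2) show ?thesis by (intro that) auto
qed

text \<open>The coordinates are split at F0: on F0 the form is at most \<delta> against a total mass
  M, and elsewhere at most N against a mass \<eta>. An additional error e accounts for replacing the
  form by a finite combination of matrix units.\<close>

private lemma y_le:
  assumes F0: "finite F0" "F0 \<subseteq> K \<times> (K - {\<epsilon>})"
      "\<forall>F. finite F \<and> F \<subseteq> K \<times> (K - {\<epsilon>}) - F0 \<longrightarrow> (\<Sum>z\<in>F. cmod (y (coord (fst z) (snd z)))) \<le> \<eta>"
    and \<Theta>: "\<Theta> \<in> form_space" "form_norm \<Theta> \<le> N" 
    and \<delta>: "0 \<le> \<delta>" "\<And>z. z \<in> F0 \<Longrightarrow> cmod (\<Theta> (\<psi> (fst z)) (\<psi> (snd z))) \<le> \<delta>"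
  shows "cmod (y \<Theta>) \<le> M * \<delta> + N * \<eta>"
proof (rule field_le_epsilon)
  fix e :: real assume e: "e > 0"
  let ?c = "\<lambda>z. cmod (y (coord (fst z) (snd z)))"
  let ?v = "\<lambda>z. \<Theta> (\<psi> (fst z)) (\<psi> (snd z))"
  have N: "0 \<le> N" using form_norm_nonneg[OF form_spaceD(1)[OF \<Theta>(1)]] \<Theta>(2) by linarith
  have "e / (M + 1) > 0" using e M(1) by simp
  then obtain F where F: "finite F" "F \<subseteq> K \<times> (K - {\<epsilon>})"
    "form_norm (\<lambda>a b. \<Theta> a b - (\<Sum>(s, t)\<in>F. \<Theta> (\<psi> s) (\<psi> t) * coord s t a b)) \<le> e / (M + 1)"
    "(\<lambda>a b. \<Sum>(s, t)\<in>F. \<Theta> (\<psi> s) (\<psi> t) * coord s t a b) \<in> form_space"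
    by (rule form_approx[OF \<Theta>(1)])
  define G where "G = (\<lambda>a b. \<Sum>z\<in>F. ?v z * coord (fst z) (snd z) a b)"
  have G: "form_norm (\<lambda>a b. \<Theta> a b - G a b) \<le> e / (M + 1)" "G \<in> form_space"
    using F(3,4) by (simp_all add: G_def case_prod_beta)
  have "cmod (y \<Theta> - y G) \<le> M * form_norm (\<lambda>a b. \<Theta> a b - G a b)"
    using M(2)[OF form_space_diff[OF \<Theta>(1) G(2)]] y_diff[OF \<Theta>(1) G(2)] by simp
  also have "\<dots> \<le> M * (e / (M + 1))" by (rule mult_left_mono[OF G(1) M(1)])
  also have "\<dots> \<le> e" using e M(1) by (simp add: divide_simps)
  finally have 1: "cmod (y \<Theta> - y G) \<le> e" .
  have "cmod (y G) \<le> (\<Sum>z\<in>F. cmod (?v z * y (coord (fst z) (snd z))))"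
    unfolding G_def y_coord_sum[OF F(1,2)] by (rule norm_sum)
  also have "\<dots> = (\<Sum>z\<in>F. cmod (?v z) * ?c z)" by (simp add: norm_mult)
  also have "\<dots> = (\<Sum>z\<in>F \<inter> F0. cmod (?v z) * ?c z) + (\<Sum>z\<in>F - F0. cmod (?v z) * ?c z)"
    by (rule sum.Int_Diff[OF F(1)])
  also have "\<dots> \<le> (\<Sum>z\<in>F \<inter> F0. \<delta> * ?c z) + (\<Sum>z\<in>F - F0. N * ?c z)"
  proof (intro add_mono sum_mono mult_right_mono norm_ge_zero)
    show "cmod (?v z) \<le> \<delta>" if "z \<in> F \<inter> F0" for z using \<delta>(2) that by blast
    show "cmod (?v z) \<le> N" if "z \<in> F - F0" for z
    proof -
      have "fst z \<in> K" "snd z \<in> K" using that F(2) by auto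
      from form_norm_ge[OF form_spaceD(1)[OF \<Theta>(1)] this] show ?thesis using \<Theta>(2) by linarith
    qed
  qed
  also have "\<dots> = \<delta> * (\<Sum>z\<in>F \<inter> F0. ?c z) + N * (\<Sum>z\<in>F - F0. ?c z)" by (simp add: sum_distrib_left)
  also have "\<dots> \<le> \<delta> * M + N * \<eta>"
    using F(1,2) \<delta>(1) N by (intro add_mono mult_left_mono y_coord_abs_sum F0(3)[rule_format]) auto
  finally have 2: "cmod (y G) \<le> M * \<delta> + N * \<eta>" by (simp add: mult.commute)
  show "cmod (y \<Theta>) \<le> M * \<delta> + N * \<eta> + e"
    using 1 2 norm_triangle_sub[of "y \<Theta>" "y G"] by linarith
qed

text \<open>Dominated convergence for the summable family of coordinates of y: the forms are
  uniformly bounded and tend to 0 in each coordinate.\<close>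

private lemma y_tendsto_zero:
  assumes \<Theta>: "\<And>P. finite P \<Longrightarrow> P \<subseteq> K \<Longrightarrow> \<Theta> P \<in> form_space \<and> form_norm (\<Theta> P) \<le> N"
    and lim: "\<And>s t. s \<in> K \<Longrightarrow> t \<in> K \<Longrightarrow> ((\<lambda>P. \<Theta> P (\<psi> s) (\<psi> t)) \<longlongrightarrow> 0) (finite_subsets_at_top K)"
  shows "((\<lambda>P. y (\<Theta> P)) \<longlongrightarrow> 0) (finite_subsets_at_top K)"
proof (rule tendstoI)
  fix e :: real assume e: "e > 0"
  have N: "0 \<le> N" using \<Theta>[of "{}"] form_norm_nonneg[OF form_spaceD(1), of "\<Theta> {}"] by simp
  \<comment> \<open>With these constants each of the two terms in \<open>y_le\<close> is at most e /
    4; the summands 1 avoid a division by 0.\<close>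
  define \<eta> where "\<eta> = e / (4 * (N + 1))"
  define \<delta> where "\<delta> = e / (4 * (M + 1))"
  have pos: "\<eta> > 0" "\<delta> > 0" using e N M(1) by (simp_all add: \<eta>_def \<delta>_def)
  have small: "M * \<delta> \<le> e / 4" "N * \<eta> \<le> e / 4" using e N M(1) by (simp_all add: \<eta>_def \<delta>_def divide_simps)
  obtain F0 where F0: "finite F0" "F0 \<subseteq> K \<times> (K - {\<epsilon>})"
    "\<forall>F. finite F \<and> F \<subseteq> K \<times> (K - {\<epsilon>}) - F0 \<longrightarrow> (\<Sum>z\<in>F. cmod (y (coord (fst z) (snd z)))) \<le> \<eta>"
    by (rule y_coord_tail[OF pos(1)])
  have "\<forall>\<^sub>F P in finite_subsets_at_top K. \<forall>z\<in>F0. dist (\<Theta> P (\<psi> (fst z)) (\<psi> (snd z))) 0 < \<delta>"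
    using F0(1,2) by (intro eventually_ball_finite ballI tendstoD[OF lim pos(2)]) auto
  moreover have "\<forall>\<^sub>F P in finite_subsets_at_top K. finite P \<and> P \<subseteq> K"
    unfolding eventually_finite_subsets_at_top by blast
  ultimately show "\<forall>\<^sub>F P in finite_subsets_at_top K. dist (y (\<Theta> P)) 0 < e"
  proof eventually_elim
    case (elim P)
    then have "cmod (y (\<Theta> P)) \<le> M * \<delta> + N * \<eta>"
      using \<Theta>[of P] pos(2) by (intro y_le[OF F0]) (auto simp: less_imp_le)
    then show ?case using small e by simp
  qed
qed

text \<open>The truncations satisfy the eigenvector identity up to a defect
  \<open>\<Theta> P\<close>, which is bounded and tends to 0 in each coordinate, so
  y(\<open>\<Theta> P\<close>) tends to 0. The values of y on the truncations must therefore tend to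
  -1, whereas the choice of h keeps them at most 1 / 2 in modulus.\<close>

lemma eval_derivation_not_inner:
  assumes inner: "\<And>a \<Phi>. a \<in> carrier A \<Longrightarrow> \<Phi> \<in> form_space \<Longrightarrow> \<Phi> (\<lambda>x. 1) a = y (right_act \<Phi> a) - y (left_act a \<Phi>)"
  shows False
proof -
  obtain F0 where F0: "finite F0" "F0 \<subseteq> K \<times> (K - {\<epsilon>})"
    "\<forall>F. finite F \<and> F \<subseteq> K \<times> (K - {\<epsilon>}) - F0 \<longrightarrow> (\<Sum>z\<in>F. cmod (y (coord (fst z) (snd z)))) \<le> 1 / 8"
    by (rule y_coord_tail[of "1 / 8"]) simp
  \<comment> \<open>Together with the tail 1 / 8 and the bound 2 on the truncations,
    \<open>y_le\<close> will give M \<delta> + 2 / 8 <= 1 / 2, which is strictly below 1.\<close>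
  define \<delta> where "\<delta> = 1 / (4 * (M + 1))"
  have \<delta>: "\<delta> > 0" "M * \<delta> \<le> 1 / 4" using M(1) by (simp_all add: \<delta>_def divide_simps)
  \<comment> \<open>The values on F0 depend on h through the second indices, so h needs to be close
    to g for these finitely many characters.\<close>
  have "finite (snd ` F0)" "snd ` F0 \<subseteq> K" using F0(1,2) by auto
  then have "\<exists>h. (\<exists>p\<in>K. \<psi> p h \<noteq> 1) \<and> (\<forall>q\<in>snd ` F0. cmod (\<psi> q h - 1) < \<delta>)"
    by (rule near_g[OF _ _ \<delta>(1)])
  then obtain h p where p: "p \<in> K" "\<psi> p h \<noteq> 1" and h: "\<forall>t\<in>snd ` F0. cmod (\<psi> t h - 1) < \<delta>"
    by blast
  \<comment> \<open>The eigenvalue a(g) - a(h) for a = \<psi> p, nonzero by the choice of p and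
    h.\<close>
  define \<kappa> where "\<kappa> = 1 - \<psi> p h"
  note pA = \<psi>_in[OF p(1)]
  have \<kappa>: "\<kappa> \<noteq> 0" "cmod \<kappa> \<le> 2"
    using p(2) eval_le[OF pA, of h] norm_\<psi>[OF p(1)] norm_triangle_ineq4[of 1 "\<psi> p h"] by (auto simp: \<kappa>_def)
  let ?\<phi> = "eval_form h"
  define \<Theta> where "\<Theta> P = (\<lambda>b c. (right_act (?\<phi> P) (\<psi> p) b c - left_act (\<psi> p) (?\<phi> P) b c) - \<kappa> * ?\<phi> P b c)" for P
  have \<phi>_lim: "((\<lambda>P. ?\<phi> P b c) \<longlongrightarrow> b g * (c h - c g)) (finite_subsets_at_top K)"
    if "b \<in> carrier A" "c \<in> carrier A" for b c
    using that by (simp add: eval_form_def) (intro tendsto_intros partial_tendsto)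
  have \<Theta>_lim: "((\<lambda>P. \<Theta> P (\<psi> s) (\<psi> t)) \<longlongrightarrow> 0) (finite_subsets_at_top K)" if st: "s \<in> K" "t \<in> K" for s t
  proof -
    note sA = \<psi>_in[OF st(1)] and tA = \<psi>_in[OF st(2)]
    \<comment> \<open>The first two lines of the limit are the right action minus the left action;
      as every \<psi> is 1 at g, they reduce to \<kappa> (\<psi> t h - 1), which the last line
      subtracts.\<close>
    have "((\<lambda>P. \<Theta> P (\<psi> s) (\<psi> t)) \<longlongrightarrow>
        (\<psi> s g * \<psi> p g * (\<psi> t h - \<psi> t g) -
          (\<psi> s g * (\<psi> t h * \<psi> p h - \<psi> t g * \<psi> p g) - \<psi> s g * \<psi> t g * (\<psi> p h - \<psi> p g)))
        - \<kappa> * (\<psi> s g * (\<psi> t h - \<psi> t g))) (finite_subsets_at_top K)"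
      unfolding \<Theta>_def right_act_def left_act_def
      using \<phi>_lim[OF A_mult[OF sA pA] tA] \<phi>_lim[OF sA A_mult[OF tA pA]] \<phi>_lim[OF A_mult[OF sA tA] pA] \<phi>_lim[OF sA tA]
      by (simp add: sA tA) (intro tendsto_intros)
    then show ?thesis by (simp add: \<psi>_g st p \<kappa>_def algebra_simps)
  qed
  have \<Theta>_in: "\<Theta> P \<in> form_space \<and> form_norm (\<Theta> P) \<le> 10" if P: "finite P" "P \<subseteq> K" for P
  proof
    note \<phi> = eval_form_in[OF P, of h]
    note R = act_in_form_space(2)[OF pA \<phi>] and L = act_in_form_space(1)[OF pA \<phi>] and f = form_spaceD(1)[OF \<phi>]
    show "\<Theta> P \<in> form_space" unfolding \<Theta>_def by (intro form_space_diff form_space_smult R L \<phi>)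
    \<comment> \<open>The number 10 is 2 for the right action, 4 for the two terms of the left
      action, and 4 for \<kappa> times the truncation.\<close>
    show "form_norm (\<Theta> P) \<le> 10"
    proof (rule form_norm_least)
      fix s t assume st: "s \<in> K" "t \<in> K"
      note sA = \<psi>_in[OF st(1)] and tA = \<psi>_in[OF st(2)]
      note n = norm_\<psi>[OF st(1)] norm_\<psi>[OF st(2)] norm_\<psi>[OF p(1)] and N = eval_form_norm_le[OF P, of h]
      have 1: "cmod (right_act (?\<phi> P) (\<psi> p) (\<psi> s) (\<psi> t)) \<le> 2" using right_act_form(2)[OF pA f sA tA] N by (simp add: n)
      have 2: "cmod (left_act (\<psi> p) (?\<phi> P) (\<psi> s) (\<psi> t)) \<le> 4" using left_act_form(2)[OF pA f sA tA] N by (simp add: n)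
      have "cmod (\<kappa> * ?\<phi> P (\<psi> s) (\<psi> t)) \<le> 2 * 2"
        unfolding norm_mult using order_trans[OF form_norm_ge[OF f st] N] \<kappa>(2) by (intro mult_mono) auto
      then have 3: "cmod (\<kappa> * ?\<phi> P (\<psi> s) (\<psi> t)) \<le> 4" by simp
      show "cmod (\<Theta> P (\<psi> s) (\<psi> t)) \<le> 10"
        unfolding \<Theta>_def using 1 2 3 norm_triangle_ineq4 by (smt (verit))
    qed
  qed
  \<comment> \<open>On a pair (s, t) in F0 a truncation takes the value 0 or \<psi> t h - 1, so the
    closeness of h to g bounds it uniformly in P.\<close>
  have \<phi>_small: "cmod (y (?\<phi> P)) \<le> 1 / 2" if P: "finite P" "P \<subseteq> K" for P
  proof -
    have "cmod (?\<phi> P (\<psi> (fst z)) (\<psi> (snd z))) \<le> \<delta>" if z: "z \<in> F0" for z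
    proof -
      have st: "fst z \<in> K" "snd z \<in> K" using z F0(2) by auto
      have part: "partial P (\<psi> q) x = (if q \<in> P then \<psi> q x else 0)" if "q \<in> K" for q x
      proof -
        have "partial P (\<psi> q) x = (\<Sum>r\<in>P. if r = q then \<psi> r x else 0)"
          unfolding partial_def using P(2) that by (intro sum.cong refl) (auto simp: w_\<psi>)
        then show ?thesis using P(1) by simp
      qed
      show ?thesis
        using bspec[OF h, of "snd z"] z \<delta>(1) by (auto simp: eval_form_def \<psi>_in st part \<psi>_g less_imp_le)
    qed
    from y_le[OF F0 eval_form_in[OF P] eval_form_norm_le[OF P] less_imp_le[OF \<delta>(1)] this]
    have "cmod (y (?\<phi> P)) \<le> M * \<delta> + 2 * (1 / 8)" by simp
    then show ?thesis using \<delta>(2) by simp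
  qed
  have eq: "?\<phi> P (\<lambda>x. 1) (\<psi> p) - y (\<Theta> P) = \<kappa> * y (?\<phi> P)" if P: "finite P" "P \<subseteq> K" for P
  proof -
    note \<phi> = eval_form_in[OF P, of h]
    note R = act_in_form_space(2)[OF pA \<phi>] and L = act_in_form_space(1)[OF pA \<phi>]
    have "y (\<Theta> P) = y (right_act (?\<phi> P) (\<psi> p)) - y (left_act (\<psi> p) (?\<phi> P)) - \<kappa> * y (?\<phi> P)"
      unfolding \<Theta>_def by (simp add: y_diff form_space_diff form_space_smult R L \<phi> y_smult)
    then show ?thesis using inner[OF pA \<phi>] by simp
  qed
  have "((\<lambda>P. ?\<phi> P (\<lambda>x. 1) (\<psi> p) - y (\<Theta> P)) \<longlongrightarrow> 1 * (\<psi> p h - \<psi> p g) - 0) (finite_subsets_at_top K)"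
    by (intro tendsto_diff \<phi>_lim[OF one_in pA] y_tendsto_zero[OF \<Theta>_in \<Theta>_lim])
  then have lim: "((\<lambda>P. ?\<phi> P (\<lambda>x. 1) (\<psi> p) - y (\<Theta> P)) \<longlongrightarrow> - \<kappa>) (finite_subsets_at_top K)"
    by (simp add: \<psi>_g p \<kappa>_def)
  \<comment> \<open>Divided by \<kappa>, this confronts the limit -1 of y on the truncations with
    the bound 1 / 2.\<close>
  have "cmod (- \<kappa>) \<le> cmod \<kappa> / 2"
  proof (rule tendsto_upperbound[OF tendsto_norm[OF lim]])
    show "\<forall>\<^sub>F P in finite_subsets_at_top K. norm (?\<phi> P (\<lambda>x. 1) (\<psi> p) - y (\<Theta> P)) \<le> cmod \<kappa> / 2"
      unfolding eventually_finite_subsets_at_top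
    proof (intro exI[of _ "{}"] conjI allI impI)
      fix P assume "finite P \<and> {} \<subseteq> P \<and> P \<subseteq> K"
      then have P: "finite P" "P \<subseteq> K" by auto
      show "norm (?\<phi> P (\<lambda>x. 1) (\<psi> p) - y (\<Theta> P)) \<le> cmod \<kappa> / 2"
        unfolding eq[OF P] norm_mult using mult_left_mono[OF \<phi>_small[OF P], of "cmod \<kappa>"] by simp
    qed auto
  qed simp
  then show False using \<kappa>(1) by simp
qed

end

text \<open>The elements of \<open>forms\<close> have exactly the type tested by
  \<open>amenable\<close>, so amenability applies to this bimodule directly and yields y.\<close>

theorem not_amenable: "\<not> amenable A"
proof
  assume "amenable A"
  then have "inner_derivation A (dual_space forms) (dual_left forms right_act) (dual_right forms left_act) eval_derivation"
    using forms_bimodule eval_derivation_bounded unfolding amenable_def amenable_wrt_def by blast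
  then obtain y where y: "y \<in> carrier (dual_space forms)" and inner: "\<And>a. a \<in> carrier A \<Longrightarrow>
      eval_derivation a = dual_left forms right_act a y \<ominus>\<^bsub>dual_space forms\<^esub> dual_right forms left_act y a"
    unfolding inner_derivation_def by blast
  obtain M where M: "\<And>\<Phi>. \<Phi> \<in> form_space \<Longrightarrow> cmod (y \<Phi>) \<le> M * form_norm \<Phi>"
    using y unfolding dual_forms_iff by blast
  have "cmod (y \<Phi>) \<le> \<bar>M\<bar> * form_norm \<Phi>" if "\<Phi> \<in> form_space" for \<Phi>
    using M[OF that] mult_right_mono[OF abs_ge_self form_norm_nonneg[OF form_spaceD(1)[OF that]], of M] by linarith
  moreover have "\<Phi> (\<lambda>x. 1) a = y (right_act \<Phi> a) - y (left_act a \<Phi>)" if a: "a \<in> carrier A" and \<Phi>: "\<Phi> \<in> form_space" for a \<Phi>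
    using fun_cong[OF inner[OF a, unfolded dual_forms_minus[OF dual_right_in[OF y a]]], of \<Phi>] \<Phi>
    by (simp add: dual_left_def dual_right_def eval_derivation_def)
  ultimately show False using eval_derivation_not_inner[OF y, of "\<bar>M\<bar>"] by simp
qed

end

section \<open>The central Fourier algebra as an instance\<close>

theorem corollary4p2:
  assumes compact: "compact (UNIV :: 'a::{topological_group_add, t2_space} set)"
    and non_discrete: "\<not> (\<forall>S :: 'a set. open S)"
    and finite_dim: "\<forall>n>0. finite {p \<in> (unitary_dual :: ('a \<Rightarrow> complex mat) set set). class_dim p = n}"
  shows "\<not> amenable (central_fourier_algebra :: ('a \<Rightarrow> complex) normed)"
proof -
  let ?A = "central_fourier_algebra :: ('a \<Rightarrow> complex) normed"
  let ?K = "unitary_dual :: ('a \<Rightarrow> complex mat) set set"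
  interpret compact_group "TYPE('a)" by unfold_locales (rule compact)
  obtain \<epsilon> where \<epsilon>: "\<epsilon> \<in> ?K" "norm_char \<epsilon> = (\<lambda>x. 1)" by (rule trivial_class_exists)
  have carrier: "f \<in> carrier ?A \<longleftrightarrow> char_abs_summable f" for f
    using char_abs_summable_in_carrier carrier_char_abs_summable by blast
  have ops: "add ?A = (\<lambda>f h x. f x + h x)" "mult ?A = (\<lambda>f h x. f x * h x)" "smult ?A = (\<lambda>c f x. c * f x)"
    by (simp_all add: central_fourier_algebra_def fourier_algebra_def)
  have norm: "vnorm ?A f = char_norm f" if "char_abs_summable f" for f
    using vnorm_class_function[of f] that by (simp add: central_fourier_algebra_def char_abs_summable_def)
  note summable = char_abs_summable_add char_abs_summable_mult(1) char_abs_summable_cmult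
  \<comment> \<open>The base point is the identity 0 of the group, and \<epsilon> is the class of
    the trivial representation.\<close>
  interpret character_algebra ?A ?K norm_char char_coeff \<epsilon> 0
  proof (unfold_locales, unfold carrier)
    fix f h :: "'a \<Rightarrow> complex" and c
    assume f: "char_abs_summable f"
    show "char_abs_summable (\<lambda>x. c * f x)" by (rule char_abs_summable_cmult[OF f])
    show "0 \<le> vnorm ?A f" by (simp add: norm f char_norm_nonneg)
    show "cmod (f x) \<le> vnorm ?A f" for x by (simp add: norm f char_series(3))
    show "(\<Sum>p\<in>Q. cmod (char_coeff p f)) \<le> vnorm ?A f" if "finite Q" "Q \<subseteq> ?K" for Q
      by (simp add: norm f sum_char_coeff_le_norm that)
    show "char_coeff p (\<lambda>x. c * f x) = c * char_coeff p f" if "p \<in> ?K" for p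
      by (rule char_coeff_cmult[OF that char_abs_summable_continuous[OF f]])
    \<comment> \<open>The equality of \<open>vnorm\<close> and \<open>char_norm\<close> is available
      for remainders over finite subsets of the dual, which is eventually the case along the
      filter.\<close>
    have "\<forall>\<^sub>F Q in finite_subsets_at_top ?K.
        char_norm (\<lambda>x. f x - char_partial_sum Q f x) = vnorm ?A (\<lambda>x. f x - (\<Sum>q\<in>Q. char_coeff q f * norm_char q x))"
      unfolding eventually_finite_subsets_at_top
      using norm[OF char_norm_minus_partial_sum(1)[OF f]]
      by (intro exI[of _ "{}"]) (simp add: char_partial_sum_def)
    from Lim_transform_eventually[OF char_partial_sum_tendsto[OF f] this]
    show "((\<lambda>Q. vnorm ?A (\<lambda>x. f x - (\<Sum>q\<in>Q. char_coeff q f * norm_char q x))) \<longlongrightarrow> 0) (finite_subsets_at_top ?K)" .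
    assume h: "char_abs_summable h"
    show "char_abs_summable (\<lambda>x. f x + h x)" by (rule char_abs_summable_add[OF f h])
    show fh: "char_abs_summable (\<lambda>x. f x * h x)" by (rule char_abs_summable_mult(1)[OF f h])
    show "vnorm ?A (\<lambda>x. f x * h x) \<le> vnorm ?A f * vnorm ?A h"
      using char_abs_summable_mult(2)[OF f h] by (simp add: norm f h fh)
    show "char_coeff p (\<lambda>x. f x + h x) = char_coeff p f + char_coeff p h" if "p \<in> ?K" for p
      by (rule char_coeff_add[OF that]) (intro char_abs_summable_continuous f h)+
  next
    fix p :: "('a \<Rightarrow> complex mat) set" assume p: "p \<in> ?K"
    show n: "char_abs_summable (norm_char p)" by (rule norm_char_abs_summable(1)[OF p])
    show "vnorm ?A (norm_char p) = 1" by (simp add: norm n norm_char_abs_summable(2)[OF p])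
    show "norm_char p 0 = 1" by (rule norm_char_zero[OF p])
    show "char_coeff p (norm_char q) = (if q = p then 1 else 0)" if "q \<in> ?K" for q
      by (rule char_coeff_norm_char[OF that p])
    show "((\<lambda>z. char_coeff p (\<lambda>x. norm_char (fst z) x * norm_char (snd z) x)) \<longlongrightarrow> 0) (cofinite_on (?K \<times> ?K))"
      unfolding tendsto_zero_cofinite_on using product_coeff_finite[OF finite_dim p] by blast
  next
    fix F :: "('a \<Rightarrow> complex mat) set set" and e :: real assume F: "finite F" "F \<subseteq> ?K" "e > 0"
    obtain h where "h \<noteq> 0" "\<forall>q\<in>F. cmod (norm_char q h - 1) < e" by (rule near_identity[OF non_discrete F])
    then show "\<exists>h. (\<exists>p\<in>?K. norm_char p h \<noteq> 1) \<and> (\<forall>q\<in>F. cmod (norm_char q h - 1) < e)"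
      using dual_separates_points[OF compact] by blast
  qed (use \<epsilon> ops in auto)
  show ?thesis by (rule not_amenable)
qed

end
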